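(* Let $M \subset \mathbb{C}^N$ be a connected real analytic generic submanifold of (real) codimension 2 through the origin, which is almost minimal at the origin. Let $H \subset \mathbb{C}^N$ be a connected $C^2$ hypersurface with boundary and $M \subset \partial H$. Then $H$ is not Levi-flat.
   Context: "Submanifold" means embedded submanifold; "hypersurface" means a submanifold of real codimension 1. Let $J$ be the complex structure on $\mathbb{C}^N$. For a real submanifold $M$, $T_p^cM = J(T_pM)\cap T_pM$. $M$ is CR if $\dim T_p^cM$ is constant in $p \in M$. $M$ is generic if $T_pM + J(T_pM) = T_p\mathbb{C}^N$ for all $p \in M$. The local CR orbit of a CR submanifold $M$ at $p$ is the smallest (in dimension) germ at $p$ of a CR submanifold $N \subset M$ through $p$ such that $T_q^cN = T_q^cM$ for $q\in N$. A real analytic generic submanifold $M$ through the origin is almost minimal at the origin if for every neighbourhood $U$ of the origin there exists $p \in U\cap M$ such that the local CR orbit of $M$ at $p$ (a representative of this germ) is not contained in any proper complex analytic subvariety of $U$. $C^k$ hypersurface with boundary: a set $H \subset \mathbb{C}^N$ with a subset $\partial H \subset H$ such that $H^o := H\setminus\partial H$ is a $C^k$ hypersurface and for each $p \in \partial H$ there are a neighbourhood $U \subset \mathbb{C}^N$ of $p$ and a $C^k$ diffeomorphism $\varphi\colon U \to \mathbb{R}^{2N}$ with $\varphi(H\cap U) = \{x \mid x_{2N-1}\ge 0,\ x_{2N}=0\}$ and $\varphi(\partial H\cap U) = \{x \mid x_{2N-1}=0,\ x_{2N}=0\}$. A $C^k$ ($k\geq 2$) hypersurface $H$ is Levi-flat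 if the bundle $T^cH$ is involutive; equivalently, near every point $H$ is foliated by a one-parameter family of complex hypersurfaces. A hypersurface with boundary $H$ is Levi-flat if $H^o$ is Levi-flat. *)

theory Defs
  imports "HOL-Analysis.Analysis"
begin

section \<open>Regularity classes on open subsets of Euclidean spaces\<close>

text \<open>\<open>Ck_on\<close> and \<open>real_analytic_on\<close> below are meant for open sets \<open>U\<close>.\<close>

fun Ck_on :: "nat \<Rightarrow> ('a::euclidean_space \<Rightarrow> 'b::euclidean_space) \<Rightarrow> 'a set \<Rightarrow> bool" where
  "Ck_on 0 f U \<longleftrightarrow> continuous_on U f"
| "Ck_on (Suc k) f U \<longleftrightarrow> (\<forall>x\<in>U. f differentiable (at x)) \<and>
     (\<forall>v. Ck_on k (\<lambda>x. frechet_derivative f (at x) v) U)"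

definition smooth_on :: "('a::euclidean_space \<Rightarrow> 'b::euclidean_space) \<Rightarrow> 'a set \<Rightarrow> bool" where
  "smooth_on f U \<longleftrightarrow> (\<forall>k. Ck_on k f U)"

text \<open>Multi-indices are the (extensional) functions from \<open>Basis\<close> to the naturals.\<close>

definition real_analytic_on :: "('a::euclidean_space \<Rightarrow> 'b::euclidean_space) \<Rightarrow> 'a set \<Rightarrow> bool" where
  "real_analytic_on f U \<longleftrightarrow>
     (\<forall>p\<in>U. \<exists>c :: ('a \<Rightarrow> nat) \<Rightarrow> 'b. \<exists>r>0. \<forall>x\<in>ball p r.
        ((\<lambda>\<alpha>. (\<Prod>b\<in>Basis. ((x - p) \<bullet> b) ^ \<alpha> b) *\<^sub>R c \<alpha>) has_sum f x) (Basis \<rightarrow>\<^sub>E UNIV))"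

text \<open>The parameter \<open>R\<close> is the regularity class: \<open>Ck_on k\<close>, \<open>smooth_on\<close> or \<open>real_analytic_on\<close>.\<close>

definition diffeo ::
  "(('a::euclidean_space \<Rightarrow> 'a) \<Rightarrow> 'a set \<Rightarrow> bool) \<Rightarrow> 'a set \<Rightarrow> 'a set \<Rightarrow> ('a \<Rightarrow> 'a) \<Rightarrow> bool" where
  "diffeo R U V \<phi> \<longleftrightarrow> open U \<and> open V \<and> (\<exists>\<psi>. homeomorphism U V \<phi> \<psi> \<and> R \<phi> U \<and> R \<psi> V)"


section \<open>Embedded submanifolds, tangent spaces, hypersurfaces with boundary\<close>

text \<open>Embedded submanifold of dimension \<open>d\<close>: locally straightened to a linear subspace by an
  ambient diffeomorphism.\<close>

definition submanifold ::
  "(('a::euclidean_space \<Rightarrow> 'a) \<Rightarrow> 'a set \<Rightarrow> bool) \<Rightarrow> nat \<Rightarrow> 'a set \<Rightarrow> bool" where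
  "submanifold R d M \<longleftrightarrow>
     (\<forall>p\<in>M. \<exists>U V \<phi> S. p \<in> U \<and> diffeo R U V \<phi> \<and> subspace S \<and> dim S = d \<and> \<phi> ` (M \<inter> U) = S \<inter> V)"

definition tangent_space :: "'a::euclidean_space set \<Rightarrow> 'a \<Rightarrow> 'a set" where
  "tangent_space M p = {v. \<exists>(\<gamma> :: real \<Rightarrow> 'a) \<epsilon>. \<epsilon> > 0 \<and> Ck_on 1 \<gamma> {-\<epsilon><..<\<epsilon>} \<and>
     \<gamma> ` {-\<epsilon><..<\<epsilon>} \<subseteq> M \<and> \<gamma> 0 = p \<and> (\<gamma> has_vector_derivative v) (at 0)}"

definition Ck_hypersurface :: "nat \<Rightarrow> 'a::euclidean_space set \<Rightarrow> bool" where
  "Ck_hypersurface k H \<longleftrightarrow> submanifold (Ck_on k) (DIM('a) - 1) H"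

text \<open>\<open>B\<close> is the boundary of \<open>H\<close>, which is part of the data. The space \<open>'a\<close> is
  \<open>\<complex>\<^sup>N\<close> below and also serves as the model space \<open>\<real>\<^sup>2\<^sup>N\<close>; the distinguished real
  coordinates \<open>x\<^sub>2\<^sub>N\<^sub>-\<^sub>1\<close> and \<open>x\<^sub>2\<^sub>N\<close> are the components along two
  distinct basis vectors \<open>e\<close> and \<open>f\<close>; which two is immaterial, by permuting coordinates.\<close>

definition Ck_hypersurface_with_boundary ::
  "nat \<Rightarrow> 'a::euclidean_space set \<Rightarrow> 'a set \<Rightarrow> bool" where
  "Ck_hypersurface_with_boundary k H B \<longleftrightarrow> B \<subseteq> H \<and> Ck_hypersurface k (H - B) \<and>
     (\<forall>p\<in>B. \<exists>U \<phi>. \<exists>e\<in>Basis. \<exists>f\<in>Basis. e \<noteq> f \<and> p \<in> U \<and> diffeo (Ck_on k) U UNIV \<phi> \<and>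
        \<phi> ` (H \<inter> U) = {x. x \<bullet> e \<ge> 0 \<and> x \<bullet> f = 0} \<and>
        \<phi> ` (B \<inter> U) = {x. x \<bullet> e = 0 \<and> x \<bullet> f = 0})"


section \<open>CR geometry in \<open>\<complex>\<^sup>N\<close>\<close>

text \<open>In this section \<open>dim\<close>, \<open>DIM\<close> and \<open>subspace\<close> refer to the real structure of
  \<open>complex ^ 'n\<close>, so that \<open>DIM(complex ^ 'n) = 2 * CARD('n)\<close>.\<close>

definition cJ :: "complex ^ 'n \<Rightarrow> complex ^ 'n" where
  "cJ v = \<i> *s v"

definition complex_tangent_space :: "(complex ^ 'n) set \<Rightarrow> complex ^ 'n \<Rightarrow> (complex ^ 'n) set" where
  "complex_tangent_space M p = cJ ` tangent_space M p \<inter> tangent_space M p"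

definition CR :: "(complex ^ 'n) set \<Rightarrow> bool" where
  "CR M \<longleftrightarrow> (\<forall>p\<in>M. \<forall>q\<in>M. dim (complex_tangent_space M p) = dim (complex_tangent_space M q))"

definition generic :: "(complex ^ 'n) set \<Rightarrow> bool" where
  "generic M \<longleftrightarrow> (\<forall>p\<in>M. {v + cJ w | v w. v \<in> tangent_space M p \<and> w \<in> tangent_space M p} = UNIV)"

text \<open>Competitors for the local CR orbit of \<open>M\<close> at \<open>p\<close>. Dimension being a property of the germ, minimality is
  tested on representatives, and \<open>local_CR_orbit M p N\<close> says that \<open>N\<close> represents the
  local CR orbit of \<open>M\<close> at \<open>p\<close>.\<close>

definition CR_orbit_candidate ::
  "(complex ^ 'n) set \<Rightarrow> complex ^ 'n \<Rightarrow> nat \<Rightarrow> (complex ^ 'n) set \<Rightarrow> bool" where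
  "CR_orbit_candidate M p d N \<longleftrightarrow> submanifold smooth_on d N \<and> CR N \<and> N \<subseteq> M \<and> p \<in> N \<and>
     (\<forall>q\<in>N. complex_tangent_space N q = complex_tangent_space M q)"

definition local_CR_orbit ::
  "(complex ^ 'n) set \<Rightarrow> complex ^ 'n \<Rightarrow> (complex ^ 'n) set \<Rightarrow> bool" where
  "local_CR_orbit M p N \<longleftrightarrow> (\<exists>d. CR_orbit_candidate M p d N \<and>
     (\<forall>d' N'. CR_orbit_candidate M p d' N' \<longrightarrow> d \<le> d'))"

text \<open>Holomorphic functions of several variables: real differentiable with complex linear
  derivative.\<close>

definition holomorphic_fun_on :: "(complex ^ 'n \<Rightarrow> complex) \<Rightarrow> (complex ^ 'n) set \<Rightarrow> bool" where
  "holomorphic_fun_on f U \<longleftrightarrow>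
     (\<forall>z\<in>U. \<exists>D. (f has_derivative D) (at z) \<and> (\<forall>c v. D (c *s v) = c * D v))"

text \<open>Quantifying over all \<open>p \<in> U\<close>, not just over \<open>p \<in> V\<close>, makes \<open>V\<close> relatively closed
  in \<open>U\<close>.\<close>

definition analytic_subvariety :: "(complex ^ 'n) set \<Rightarrow> (complex ^ 'n) set \<Rightarrow> bool" where
  "analytic_subvariety U V \<longleftrightarrow> V \<subseteq> U \<and>
     (\<forall>p\<in>U. \<exists>W F. open W \<and> p \<in> W \<and> W \<subseteq> U \<and> finite F \<and>
        (\<forall>f\<in>F. holomorphic_fun_on f W) \<and> V \<inter> W = {z\<in>W. \<forall>f\<in>F. f z = 0})"

text \<open>Neighbourhoods are taken open and connected: otherwise a connected component of \<open>U\<close> would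
  be a proper subvariety of \<open>U\<close>, and no \<open>M\<close> would be almost minimal. Noncontainment is
  required of every representative of the orbit, i.e. it is a property of the germ.\<close>

definition almost_minimal_at_origin :: "(complex ^ 'n) set \<Rightarrow> bool" where
  "almost_minimal_at_origin M \<longleftrightarrow>
     (\<forall>U. open U \<and> connected U \<and> 0 \<in> U \<longrightarrow>
        (\<exists>p\<in>U \<inter> M. \<forall>N. local_CR_orbit M p N \<longrightarrow>
           (\<forall>V. analytic_subvariety U V \<and> V \<noteq> U \<longrightarrow> \<not> N \<subseteq> V)))"

text \<open>For \<open>X\<close>, \<open>Y\<close> tangent to \<open>H\<close>, the restriction of the bracket to \<open>H\<close> depends only on the
  restrictions of \<open>X\<close> and \<open>Y\<close>, and local \<open>C\<^sup>1\<close> sections of \<open>T\<^sup>cH\<close> over a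
  \<open>C\<^sup>2\<close> hypersurface extend locally to \<open>C\<^sup>1\<close> vector fields on open sets of
  \<open>\<complex>\<^sup>N\<close>. So involutivity is tested on ambient fields.\<close>

definition lie_bracket :: "('a::euclidean_space \<Rightarrow> 'a) \<Rightarrow> ('a \<Rightarrow> 'a) \<Rightarrow> 'a \<Rightarrow> 'a" where
  "lie_bracket X Y q = frechet_derivative Y (at q) (X q) - frechet_derivative X (at q) (Y q)"

definition levi_flat :: "(complex ^ 'n) set \<Rightarrow> bool" where
  "levi_flat H \<longleftrightarrow>
     (\<forall>U X Y. open U \<and> Ck_on 1 X U \<and> Ck_on 1 Y U \<and>
        (\<forall>q\<in>H \<inter> U. X q \<in> complex_tangent_space H q \<and> Y q \<in> complex_tangent_space H q) \<longrightarrow>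
        (\<forall>q\<in>H \<inter> U. lie_bracket X Y q \<in> complex_tangent_space H q))"

definition levi_flat_with_boundary :: "(complex ^ 'n) set \<Rightarrow> (complex ^ 'n) set \<Rightarrow> bool" where
  "levi_flat_with_boundary H B \<longleftrightarrow> levi_flat (H - B)"

end

(* Suppose H is Levi-flat. Near 0 write H = {r = 0, \<rho> \<ge> 0} and M \<subseteq> {r = \<rho> = 0}, and choose unit vectors a, b
   tangent to M at 0 such that i a is tangent to H and points inwards while i b is transverse to H. The complex
   tangent spaces of H are the hyperplanes {v. B q v = 0}, normalised by B q b = -1. Levi-flatness is the
   integrability of this field inside H and, by continuity, up to the boundary; so the Frobenius argument, made
   with ordinary differential equations along rays from an interior point, gives leaves through the points of M,
   each the zero set of a C^1 function g that is holomorphic where \<rho> > 0.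
   In the slices q + \<complex> a + \<complex> b, the complexified equations of M can be solved so that they straighten M
   along the leaf to the real axis. Schwarz reflection therefore extends g holomorphically across the boundary
   of H in the direction a, and Hartogs' argument yields a holomorphic function G on a neighbourhood of 0 whose
   size does not depend on the leaf, with G = g on H. Consequently {m \<in> M. G m = 0} = {m \<in> M. Re (G m) = 0} is
   near 0 a submanifold of codimension 1 in M with the same complex tangent spaces, so it competes in the
   definition of the CR orbit. The orbit is either of that dimension, or one less, in which case it is tangent
   to its complex tangent space and the parameter of the leaves is constant along it. Either way the orbit has a
   representative inside the proper analytic subset {G = 0}, and M is not almost minimal. *)

theory Submission
  imports Defs "HOL-Complex_Analysis.Complex_Analysis"
begin

section \<open>Calculus of the classes \<open>C\<^sup>k\<close>\<close>

text \<open>Almost minimality hands over the point \<open>p\<close> only after the neighbourhood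
  \<open>U\<close> has been fixed. Hence all radii are chosen before the leaf, and all estimates are
  uniform in \<open>p\<close>. The second obstacle is one-sidedness: where \<rho> < 0 integrability
  is unknown, and the function \<open>g\<close> of a leaf is merely Lipschitz. The equations of
  \<open>M\<close> along a leaf are therefore solved by contractions, which need Lipschitz bounds
  only; holomorphy is recovered afterwards where \<rho> > 0, and the other side is replaced by the
  reflection. This needs a small Lipschitz constant of \<open>g\<close> in the direction
  \<open>a\<close>: the hyperplane at 0 contains \<open>a\<close>, so near 0 the constant is of
  order \<epsilon>, and \<epsilon> * C1 \<le> 1/100 pays for the error terms. That
  \<open>Re (G m) = 0\<close> forces \<open>G m = 0\<close> on \<open>M\<close> is what lets a
  single real equation cut the zero set of \<open>G\<close> out of \<open>M\<close>. Genericity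
  provides \<open>a\<close> and \<open>b\<close>: the two normal directions of the boundary chart
  are, modulo tangent vectors of \<open>M\<close>, i times tangent vectors of
  \<open>M\<close>.\<close>

lemma linear_eq_sum_Basis:
  fixes L :: "'a::euclidean_space \<Rightarrow> 'b::real_vector"
  assumes "linear L"
  shows "L w = (\<Sum>b\<in>Basis. (w \<bullet> b) *\<^sub>R L b)"
proof -
  have "L w = L (\<Sum>b\<in>Basis. (w \<bullet> b) *\<^sub>R b)" by (simp only: euclidean_representation)
  also have "\<dots> = (\<Sum>b\<in>Basis. L ((w \<bullet> b) *\<^sub>R b))" by (rule linear_sum[OF assms])
  finally show ?thesis by (simp only: linear_cmul[OF assms])
qed

lemma Ck_on_cong:
  assumes "open U" "\<And>x. x \<in> U \<Longrightarrow> f x = g x" "Ck_on k f U"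
  shows "Ck_on k g U"
  using assms(2,3)
proof (induction k arbitrary: f g)
  case 0
  then show ?case by (metis Ck_on.simps(1) continuous_on_cong)
next
  case (Suc k)
  have D: "(g has_derivative frechet_derivative f (at x)) (at x)" if "x \<in> U" for x
  proof (rule has_derivative_transform_within_open[OF _ \<open>open U\<close> that])
    show "(f has_derivative frechet_derivative f (at x)) (at x)"
      using Suc.prems that frechet_derivative_works by auto
  qed (use Suc.prems in auto)
  then have eq: "frechet_derivative g (at x) = frechet_derivative f (at x)" if "x \<in> U" for x
    using that frechet_derivative_at by metis
  have "Ck_on k (\<lambda>x. frechet_derivative g (at x) v) U" for v
    by (rule Suc.IH[of "\<lambda>x. frechet_derivative f (at x) v"]) (use eq Suc.prems in auto)
  moreover have "g differentiable at x" if "x \<in> U" for x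
    using D[OF that] by (auto simp: differentiable_def)
  ultimately show ?case by simp
qed

text \<open>\<open>Ck_on\<close> recurses through \<open>frechet_derivative\<close>. Derivatives are
  unique, so on an open set an explicit formula may take its place; this is how the closure
  properties below pass through the induction on \<open>k\<close>.\<close>

lemma Ck_on_SucI:
  assumes "open U" "\<And>x. x \<in> U \<Longrightarrow> (f has_derivative D x) (at x)"
    and "\<And>v. Ck_on k (\<lambda>x. D x v) U"
  shows "Ck_on (Suc k) f U"
proof -
  have "frechet_derivative f (at x) = D x" if "x \<in> U" for x
    using that assms(2) frechet_derivative_at by metis
  then have "Ck_on k (\<lambda>x. frechet_derivative f (at x) v) U" for v
    by (intro Ck_on_cong[OF \<open>open U\<close> _ assms(3)]) auto
  moreover have "f differentiable at x" if "x \<in> U" for x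
    using assms(2)[OF that] by (auto simp: differentiable_def)
  ultimately show ?thesis by simp
qed

lemma Ck_on_SucD:
  assumes "Ck_on (Suc k) f U" "x \<in> U"
  shows "(f has_derivative frechet_derivative f (at x)) (at x)"
  using assms frechet_derivative_works by auto

lemma Ck_on_imp_continuous_on: "Ck_on k f U \<Longrightarrow> continuous_on U f"
proof (cases k)
  case (Suc m)
  assume "Ck_on k f U"
  then have "f differentiable_on U" using Suc
    by (auto simp: differentiable_on_def intro: differentiable_at_withinI)
  then show ?thesis by (rule differentiable_imp_continuous_on)
qed simp

lemma Ck_on_Suc_imp: "Ck_on (Suc k) f U \<Longrightarrow> Ck_on k f U"
proof (induction k arbitrary: f)
  case 0
  then show ?case using Ck_on_imp_continuous_on by fastforce
next
  case (Suc k)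
  then show ?case by (metis Ck_on.simps(2))
qed

lemma Ck_on_mono: "j \<le> k \<Longrightarrow> Ck_on k f U \<Longrightarrow> Ck_on j f U"
proof (induction k)
  case (Suc k)
  then show ?case using Ck_on_Suc_imp le_Suc_eq by metis
qed simp

lemma Ck_on_subset: "Ck_on k f U \<Longrightarrow> V \<subseteq> U \<Longrightarrow> Ck_on k f V"
proof (induction k arbitrary: f)
  case 0 then show ?case using continuous_on_subset by auto
next
  case (Suc k) then show ?case by (meson Ck_on.simps(2) subset_iff)
qed

lemma Ck_on_local:
  assumes "\<And>x. x \<in> U \<Longrightarrow> \<exists>W. open W \<and> x \<in> W \<and> Ck_on k f W"
  shows "Ck_on k f U"
  using assms
proof (induction k arbitrary: f)
  case 0
  have "isCont f x" if "x \<in> U" for x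
    using 0[OF that] by (auto simp: continuous_on_eq_continuous_at)
  then show ?case by (simp add: continuous_at_imp_continuous_on)
next
  case (Suc k)
  have "f differentiable at x" if "x \<in> U" for x using Suc.prems[OF that] by auto
  moreover have "Ck_on k (\<lambda>x. frechet_derivative f (at x) v) U" for v
    by (rule Suc.IH) (use Suc.prems in fastforce)
  ultimately show ?case by auto
qed

lemma Ck_on_const [simp]: "Ck_on k (\<lambda>x. c) U"
proof (induction k arbitrary: c)
  case (Suc k)
  then show ?case by (simp add: frechet_derivative_const)
qed simp

lemma Ck_on_linear: "bounded_linear L \<Longrightarrow> Ck_on k L U"
proof (cases k)
  case 0
  assume "bounded_linear L"
  then show ?thesis using 0 by (simp add: linear_continuous_on)
next
  case (Suc m)
  assume L: "bounded_linear L"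
  then have "frechet_derivative L (at x) = L" for x
    using bounded_linear_imp_has_derivative frechet_derivative_at by metis
  then show ?thesis using L Suc bounded_linear_imp_differentiable by auto
qed

lemma Ck_on_id: "Ck_on k (\<lambda>x. x) U"
  using Ck_on_linear[OF bounded_linear_ident] .

lemma Ck_on_add:
  assumes "open U" "Ck_on k f U" "Ck_on k g U"
  shows "Ck_on k (\<lambda>x. f x + g x) U"
  using assms(2,3)
proof (induction k arbitrary: f g)
  case 0 then show ?case by (simp add: continuous_on_add)
next
  case (Suc k)
  show ?case
  proof (rule Ck_on_SucI[OF \<open>open U\<close>])
    show "((\<lambda>x. f x + g x) has_derivative
        (\<lambda>v. frechet_derivative f (at x) v + frechet_derivative g (at x) v)) (at x)" if "x \<in> U" for x
      by (intro has_derivative_add Ck_on_SucD[OF Suc.prems(1) that] Ck_on_SucD[OF Suc.prems(2) that])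
  qed (use Suc in auto)
qed

lemma Ck_on_bounded_linear:
  assumes "open U" "bounded_linear L" "Ck_on k f U"
  shows "Ck_on k (\<lambda>x. L (f x)) U"
  using assms(3)
proof (induction k arbitrary: f)
  case 0 then show ?case using assms(2) bounded_linear.continuous_on by auto
next
  case (Suc k)
  show ?case
  proof (rule Ck_on_SucI[OF \<open>open U\<close>])
    show "((\<lambda>x. L (f x)) has_derivative
        (\<lambda>v. L (frechet_derivative f (at x) v))) (at x)" if "x \<in> U" for x
      by (intro bounded_linear.has_derivative[OF assms(2)] Ck_on_SucD[OF Suc.prems that])
  qed (use Suc in auto)
qed

lemma Ck_on_minus: "open U \<Longrightarrow> Ck_on k f U \<Longrightarrow> Ck_on k (\<lambda>x. - f x) U"
  by (rule Ck_on_bounded_linear[where L=uminus]) (auto intro: bounded_linear_minus bounded_linear_ident)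

lemma Ck_on_diff:
  assumes "open U" "Ck_on k f U" "Ck_on k g U"
  shows "Ck_on k (\<lambda>x. f x - g x) U"
  using Ck_on_add[OF assms(1,2) Ck_on_minus[OF assms(1,3)]] by (simp only: add_uminus_conv_diff)

lemma Ck_on_sum:
  assumes "open U" "\<And>i. i \<in> I \<Longrightarrow> Ck_on k (f i) U"
  shows "Ck_on k (\<lambda>x. \<Sum>i\<in>I. f i x) U"
proof (cases "finite I")
  case True
  then show ?thesis using assms(2)
    by (induction I rule: finite_induct) (auto intro: Ck_on_add[OF assms(1)])
qed simp

lemma Ck_on_bilinear:
  assumes "open U" "bounded_bilinear P" "Ck_on k f U" "Ck_on k g U"
  shows "Ck_on k (\<lambda>x. P (f x) (g x)) U"
  using assms(3,4)
proof (induction k arbitrary: f g)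
  case 0 then show ?case using bounded_bilinear.continuous_on[OF assms(2)] by auto
next
  case (Suc k)
  have 1: "Ck_on k f U" "Ck_on k g U" using Suc.prems Ck_on_Suc_imp by auto
  show ?case
  proof (rule Ck_on_SucI[OF \<open>open U\<close>])
    show "((\<lambda>x. P (f x) (g x)) has_derivative
        (\<lambda>v. P (f x) (frechet_derivative g (at x) v) + P (frechet_derivative f (at x) v) (g x))) (at x)"
      if "x \<in> U" for x
      by (intro bounded_bilinear.FDERIV[OF assms(2)] Ck_on_SucD[OF Suc.prems(1) that] Ck_on_SucD[OF Suc.prems(2) that])
  qed (use Suc 1 in \<open>auto intro!: Ck_on_add[OF \<open>open U\<close>]\<close>)
qed

lemma Ck_on_components:
  assumes "open U" "\<And>b. b \<in> Basis \<Longrightarrow> Ck_on k (\<lambda>x. f x \<bullet> b) U"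
  shows "Ck_on k f U"
proof -
  have "Ck_on k (\<lambda>x. \<Sum>b\<in>Basis. (f x \<bullet> b) *\<^sub>R b) U"
    by (rule Ck_on_sum[OF assms(1)],
        rule Ck_on_bounded_linear[OF assms(1) bounded_linear_scaleR_left assms(2)])
  then show ?thesis by (simp add: euclidean_representation)
qed

text \<open>In the chain rule both the base point \<open>g x\<close> and the direction vary with
  \<open>x\<close>. Expanding the direction in \<open>Basis\<close> gives a sum of products:
  components of the derivative of \<open>g\<close>, times partial derivatives of \<open>f\<close> at
  \<open>g x\<close>, to which the induction hypothesis applies.\<close>

lemma Ck_on_compose:
  assumes "open U" "open V" "Ck_on k f V" "Ck_on k g U" "g ` U \<subseteq> V"
  shows "Ck_on k (\<lambda>x. f (g x)) U"
  using assms(3,4)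
proof (induction k arbitrary: f)
  case 0 then show ?case using continuous_on_compose2 assms(5) by auto
next
  case (Suc k)
  have g: "Ck_on k g U" using Suc.prems Ck_on_Suc_imp by auto
  have gd: "Ck_on k (\<lambda>x. frechet_derivative g (at x) v) U" for v using Suc.prems by auto
  show ?case
  proof (rule Ck_on_SucI[OF \<open>open U\<close>])
    show "((\<lambda>x. f (g x)) has_derivative (\<lambda>v. \<Sum>b\<in>Basis.
        (frechet_derivative g (at x) v \<bullet> b) *\<^sub>R frechet_derivative f (at (g x)) b)) (at x)"
      if "x \<in> U" for x
    proof -
      have f: "(f has_derivative frechet_derivative f (at (g x))) (at (g x))"
        using Suc.prems(1) assms(5) that by (auto intro!: Ck_on_SucD)
      then have lin: "linear (frechet_derivative f (at (g x)))"
        using has_derivative_linear by blast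
      have "((\<lambda>x. f (g x)) has_derivative
          (\<lambda>v. frechet_derivative f (at (g x)) (frechet_derivative g (at x) v))) (at x)"
        by (rule has_derivative_compose[OF Ck_on_SucD[OF Suc.prems(2) that] f])
      moreover have "(\<lambda>v. frechet_derivative f (at (g x)) (frechet_derivative g (at x) v)) =
          (\<lambda>v. \<Sum>b\<in>Basis. (frechet_derivative g (at x) v \<bullet> b) *\<^sub>R frechet_derivative f (at (g x)) b)"
        by (rule ext, rule linear_eq_sum_Basis[OF lin])
      ultimately show ?thesis by (simp only:)
    qed
    show "Ck_on k (\<lambda>x. \<Sum>b\<in>Basis. (frechet_derivative g (at x) v \<bullet> b) *\<^sub>R
        frechet_derivative f (at (g x)) b) U" for v
    proof (rule Ck_on_sum[OF \<open>open U\<close>],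
        rule Ck_on_bilinear[OF \<open>open U\<close> bounded_bilinear_scaleR])
      fix b :: 'b
      show "Ck_on k (\<lambda>x. frechet_derivative g (at x) v \<bullet> b) U"
        by (rule Ck_on_bounded_linear[OF \<open>open U\<close> bounded_linear_inner_left gd])
      show "Ck_on k (\<lambda>x. frechet_derivative f (at (g x)) b) U"
        by (rule Suc.IH) (use Suc.prems g in auto)
    qed
  qed
qed

text \<open>The derivative of \<open>inverse\<close> is a product of copies of
  \<open>inverse\<close> and a constant, so the induction on \<open>k\<close> feeds on
  itself.\<close>

lemma Ck_on_inverse:
  "Ck_on k (inverse :: 'a \<Rightarrow> 'a::{euclidean_space,real_normed_field}) (- {0})"
proof (induction k)
  case 0 show ?case by (auto intro!: continuous_intros)
next
  case (Suc k)
  have o: "open (- {0::'a})" by auto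
  show ?case
  proof (rule Ck_on_SucI[OF o])
    show "(inverse has_derivative (\<lambda>h. - (inverse x * h * inverse x))) (at x)" if "x \<in> - {0}" for x :: 'a
      using that by (intro has_derivative_inverse') auto
    show "Ck_on k (\<lambda>x::'a. - (inverse x * v * inverse x)) (- {0})" for v
      by (intro Ck_on_minus o Ck_on_bilinear[OF o bounded_bilinear_mult] Suc Ck_on_const)
  qed
qed

lemma Ck_on_divide:
  fixes f g :: "'b::euclidean_space \<Rightarrow> 'a::{euclidean_space,real_normed_field}"
  assumes "open U" "Ck_on k f U" "Ck_on k g U" "\<And>x. x \<in> U \<Longrightarrow> g x \<noteq> 0"
  shows "Ck_on k (\<lambda>x. f x / g x) U"
proof -
  have "Ck_on k (\<lambda>x. f x * inverse (g x)) U"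
    by (rule Ck_on_bilinear[OF \<open>open U\<close> bounded_bilinear_mult assms(2)],
        rule Ck_on_compose[OF \<open>open U\<close> _ Ck_on_inverse assms(3)]) (use assms in auto)
  then show ?thesis by (simp add: divide_inverse)
qed

text \<open>Compactness gives a modulus of continuity of the derivative on the closed ball. It is
  taken on the finitely many basis vectors with tolerance e / n, which adds up to an operator bound.
  The second estimate is the mean value inequality for y \<mapsto> f y - D x y.\<close>

lemma Ck_1_uniform:
  fixes f :: "'a::euclidean_space \<Rightarrow> 'b::euclidean_space"
  assumes "open U" "cball c R \<subseteq> U" "Ck_on 1 f U" "e > 0"
  obtains d where "d > 0"
    "\<And>x y h. x \<in> cball c R \<Longrightarrow> y \<in> cball c R \<Longrightarrow> dist x y < d \<Longrightarrow>
       norm (frechet_derivative f (at x) h - frechet_derivative f (at y) h) \<le> e * norm h"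
    "\<And>x y. x \<in> cball c R \<Longrightarrow> y \<in> cball c R \<Longrightarrow> dist x y < d \<Longrightarrow>
       norm (f y - f x - frechet_derivative f (at x) (y - x)) \<le> e * norm (y - x)"
proof -
  define D where "D x = frechet_derivative f (at x)" for x
  define n where "n = real (DIM('a))"
  have n: "n \<ge> 1" unfolding n_def by (simp add: Suc_leI)
  have D: "(f has_derivative D x) (at x)" if "x \<in> cball c R" for x
    unfolding D_def by (rule Ck_on_SucD[of 0]) (use assms that in auto)
  have linD: "linear (D x)" if "x \<in> cball c R" for x using D[OF that] has_derivative_linear by blast
  have "\<exists>d>0. \<forall>x\<in>cball c R. \<forall>y\<in>cball c R. dist x y < d \<longrightarrow> norm (D x b - D y b) < e / n" for b
  proof -
    have "continuous_on U (\<lambda>x. D x b)" using assms(3) unfolding D_def by simp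
    then have "uniformly_continuous_on (cball c R) (\<lambda>x. D x b)"
      using assms(2) by (meson compact_uniformly_continuous continuous_on_subset compact_cball)
    moreover have "e / n > 0" using \<open>e > 0\<close> n by simp
    ultimately obtain d where "d > 0"
      "\<forall>x\<in>cball c R. \<forall>y\<in>cball c R. dist y x < d \<longrightarrow> dist (D y b) (D x b) < e / n"
      unfolding uniformly_continuous_on_def by blast
    then show ?thesis by (intro exI[of _ d]) (simp add: dist_norm norm_minus_commute)
  qed
  then obtain d where d: "\<And>b. d b > 0"
     "\<And>b x y. x \<in> cball c R \<Longrightarrow> y \<in> cball c R \<Longrightarrow> dist x y < d b \<Longrightarrow> norm (D x b - D y b) < e / n"
    by metis
  define d0 where "d0 = Min (d ` Basis)"
  have d0: "d0 > 0" "\<And>b. b \<in> Basis \<Longrightarrow> d0 \<le> d b" using d(1) by (auto simp: d0_def)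
  have 1: "norm (D x h - D y h) \<le> e * norm h"
    if "x \<in> cball c R" "y \<in> cball c R" "dist x y < d0" for x y h
  proof -
    have "D x h - D y h = (\<Sum>b\<in>Basis. (h \<bullet> b) *\<^sub>R (D x b - D y b))"
      using linear_eq_sum_Basis[OF linD[OF that(1)], of h] linear_eq_sum_Basis[OF linD[OF that(2)], of h]
      by (simp add: sum_subtractf scaleR_diff_right)
    also have "norm \<dots> \<le> (\<Sum>b\<in>(Basis::'a set). norm h * (e / n))"
    proof (rule sum_norm_le)
      fix b :: 'a assume b: "b \<in> Basis"
      have "norm (D x b - D y b) \<le> e / n" using d(2)[of x y b] d0(2)[OF b] that by auto
      then show "norm ((h \<bullet> b) *\<^sub>R (D x b - D y b)) \<le> norm h * (e / n)"
        using mult_mono[OF Basis_le_norm[OF b, of h] \<open>norm (D x b - D y b) \<le> e / n\<close> norm_ge_zero norm_ge_zero]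
        by (simp only: norm_scaleR)
    qed
    also have "\<dots> = e * norm h" using n by (simp add: n_def)
    finally show ?thesis .
  qed
  have 2: "norm (f y - f x - D x (y - x)) \<le> e * norm (y - x)"
    if "x \<in> cball c R" "y \<in> cball c R" "dist x y < d0" for x y
  proof -
    \<comment> \<open>A convex set; intersecting with the ball keeps every point so close to
      \<open>x\<close> that the first estimate bounds the derivative of the difference by
      \<open>e\<close>.\<close>
    let ?S = "cball c R \<inter> ball x d0"
    have "norm ((f y - D x y) - (f x - D x x)) \<le> e * norm (y - x)"
    proof (rule differentiable_bound[where S="?S" and f'="\<lambda>z h. D z h - D x h"])
      show "convex ?S" by (intro convex_Int convex_cball convex_ball)
      fix z assume z: "z \<in> ?S"
      have "bounded_linear (D x)" using D[OF that(1)] has_derivative_bounded_linear by blast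
      then show "((\<lambda>y. f y - D x y) has_derivative (\<lambda>h. D z h - D x h)) (at z within ?S)"
        using z by (intro has_derivative_diff has_derivative_at_withinI[OF D]
            bounded_linear_imp_has_derivative) auto
      show "onorm (\<lambda>h. D z h - D x h) \<le> e"
        by (rule onorm_le) (use 1[of z x] z that in \<open>auto simp: dist_commute\<close>)
    qed (use that d0 in \<open>auto simp: dist_commute\<close>)
    then show ?thesis using linD[OF that(1)] by (simp add: linear_diff algebra_simps)
  qed
  show ?thesis using that[OF d0(1)] 1 2 unfolding D_def by auto
qed

text \<open>Strict differentiability at the centre: one and the same linear map approximates the
  increments between all pairs of nearby points. It is used wherever two varying points are
  compared.\<close>

lemma Ck_1_strict:
  fixes f :: "'a::euclidean_space \<Rightarrow> 'b::euclidean_space"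
  assumes "open U" "c \<in> U" "Ck_on 1 f U" "e > 0"
  obtains d where "d > 0" "ball c d \<subseteq> U"
    "\<And>x y. x \<in> ball c d \<Longrightarrow> y \<in> ball c d \<Longrightarrow>
       norm (f y - f x - frechet_derivative f (at c) (y - x)) \<le> e * norm (y - x)"
proof -
  obtain R where R: "R > 0" "cball c R \<subseteq> U" using assms open_contains_cball by blast
  have "e / 2 > 0" using assms by auto
  obtain d where d: "d > 0"
    "\<And>x y h. x \<in> cball c R \<Longrightarrow> y \<in> cball c R \<Longrightarrow> dist x y < d \<Longrightarrow>
       norm (frechet_derivative f (at x) h - frechet_derivative f (at y) h) \<le> e/2 * norm h"
    "\<And>x y. x \<in> cball c R \<Longrightarrow> y \<in> cball c R \<Longrightarrow> dist x y < d \<Longrightarrow>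
       norm (f y - f x - frechet_derivative f (at x) (y - x)) \<le> e/2 * norm (y - x)"
    using Ck_1_uniform[OF assms(1) R(2) assms(3) \<open>e / 2 > 0\<close>] by blast
  \<comment> \<open>Half of \<open>d\<close>, so that any two points of the ball are closer than
    \<open>d\<close>.\<close>
  let ?d = "min R (d/2)"
  show ?thesis
  proof (rule that[of ?d])
    fix x y assume xy: "x \<in> ball c ?d" "y \<in> ball c ?d"
    then have "dist x y < d" using dist_triangle_half_r[of c x d y] by auto
    then have 1: "norm (f y - f x - frechet_derivative f (at x) (y - x)) \<le> e/2 * norm (y - x)"
      using d(3)[of x y] xy by auto
    have 2: "norm (frechet_derivative f (at x) (y - x) - frechet_derivative f (at c) (y - x)) \<le> e/2 * norm (y - x)"
      using d(2)[of x c "y - x"] xy R d(1) by (auto simp: dist_commute)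
    have "f y - f x - frechet_derivative f (at c) (y - x) = (f y - f x - frechet_derivative f (at x) (y - x))
       + (frechet_derivative f (at x) (y - x) - frechet_derivative f (at c) (y - x))" by simp
    then show "norm (f y - f x - frechet_derivative f (at c) (y - x)) \<le> e * norm (y - x)"
      using norm_triangle_ineq[of "f y - f x - frechet_derivative f (at x) (y - x)"
          "frechet_derivative f (at x) (y - x) - frechet_derivative f (at c) (y - x)"] 1 2 by auto
  qed (use R d in auto)
qed

lemma Ck_1_Lipschitz:
  fixes f :: "'a::euclidean_space \<Rightarrow> 'b::euclidean_space"
  assumes "open U" "cball c R \<subseteq> U" "Ck_on 1 f U"
  obtains K where "K \<ge> 0"
    "\<And>x h. x \<in> cball c R \<Longrightarrow> norm (frechet_derivative f (at x) h) \<le> K * norm h"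
    "\<And>x y. x \<in> cball c R \<Longrightarrow> y \<in> cball c R \<Longrightarrow> norm (f x - f y) \<le> K * norm (x - y)"
proof -
  define D where "D x = frechet_derivative f (at x)" for x
  have D: "(f has_derivative D x) (at x)" if "x \<in> cball c R" for x
    unfolding D_def by (rule Ck_on_SucD[of 0]) (use assms that in auto)
  have linD: "linear (D x)" if "x \<in> cball c R" for x using D[OF that] has_derivative_linear by blast
  have "\<exists>k. \<forall>x\<in>cball c R. norm (D x b) \<le> k" for b
  proof -
    have "continuous_on U (\<lambda>x. D x b)" using assms(3) unfolding D_def by simp
    then have "compact ((\<lambda>x. D x b) ` cball c R)"
      using assms(2) by (meson compact_continuous_image continuous_on_subset compact_cball)
    from compact_imp_bounded[OF this] show ?thesis unfolding bounded_iff by simp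
  qed
  then obtain k where k: "\<And>b x. x \<in> cball c R \<Longrightarrow> norm (D x b) \<le> k b" by metis
  define K where "K = \<bar>\<Sum>b\<in>Basis. k b\<bar>"
  have 1: "norm (D x h) \<le> K * norm h" if "x \<in> cball c R" for x h
  proof -
    have "D x h = (\<Sum>b\<in>Basis. (h \<bullet> b) *\<^sub>R D x b)"
      by (rule linear_eq_sum_Basis[OF linD[OF that]])
    also have "norm \<dots> \<le> (\<Sum>b\<in>Basis. norm h * k b)"
    proof (rule sum_norm_le)
      fix b :: 'a assume b: "b \<in> Basis"
      show "norm ((h \<bullet> b) *\<^sub>R D x b) \<le> norm h * k b"
        using mult_mono[OF Basis_le_norm[OF b, of h] k[OF that, of b] norm_ge_zero norm_ge_zero] by simp
    qed
    also have "\<dots> = sum k Basis * norm h" by (simp add: sum_distrib_left mult.commute)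
    also have "\<dots> \<le> K * norm h" by (simp add: K_def mult_right_mono)
    finally show ?thesis .
  qed
  have 2: "norm (f x - f y) \<le> K * norm (x - y)" if "x \<in> cball c R" "y \<in> cball c R" for x y
  proof (rule differentiable_bound[where S="cball c R" and f'=D])
    fix z assume z: "z \<in> cball c R"
    show "(f has_derivative D z) (at z within cball c R)"
      by (rule has_derivative_at_withinI[OF D[OF z]])
    show "onorm (D z) \<le> K" by (rule onorm_le) (use 1[OF z] in auto)
  qed (use that in auto)
  show ?thesis by (rule that[of K]) (use 1 2 in \<open>auto simp: D_def K_def\<close>)
qed

section \<open>Complex vectors and holomorphic functions of several variables\<close>

lemma norm_cvec_smult: "norm (c *s (v::complex^'n)) = cmod c * norm v"
proof -
  have "(\<Sum>i\<in>UNIV. (cmod c * cmod (v $ i))\<^sup>2) = (cmod c)\<^sup>2 * (\<Sum>i\<in>UNIV. (cmod (v $ i))\<^sup>2)"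
    by (simp add: power_mult_distrib sum_distrib_left)
  then show ?thesis
    by (simp add: norm_vec_def L2_set_def norm_mult real_sqrt_mult)
qed

lemma bounded_bilinear_cvec_smult: "bounded_bilinear (\<lambda>c (v::complex^'n). c *s v)"
proof
  show "\<exists>K. \<forall>a (b::complex^'n). norm (a *s b) \<le> norm a * norm b * K"
    by (rule exI[of _ 1]) (simp add: norm_cvec_smult)
qed (simp_all add: vec_eq_iff algebra_simps)

lemmas bounded_linear_cvec_smult_left = bounded_bilinear.bounded_linear_left[OF bounded_bilinear_cvec_smult]
lemmas bounded_linear_cvec_smult_right = bounded_bilinear.bounded_linear_right[OF bounded_bilinear_cvec_smult]

lemma of_real_cvec_smult: "of_real r *s (v::complex^'n) = r *\<^sub>R v"
  by (simp add: vec_eq_iff scaleR_conv_of_real[symmetric])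

lemma has_derivative_line: "((\<lambda>\<xi>. z + \<xi> *s v) has_derivative (\<lambda>h. h *s (v::complex^'n))) (at \<xi>)"
  by (rule has_derivative_eq_rhs, rule has_derivative_add[OF has_derivative_const
      bounded_linear_imp_has_derivative[OF bounded_linear_cvec_smult_left]]) simp

lemma holomorphic_fun_onD:
  assumes "holomorphic_fun_on f U" "z \<in> U"
  shows "(f has_derivative frechet_derivative f (at z)) (at z)"
    and "frechet_derivative f (at z) (c *s v) = c * frechet_derivative f (at z) v"
proof -
  obtain D where D: "(f has_derivative D) (at z)" "\<And>c v. D (c *s v) = c * D v"
    using assms unfolding holomorphic_fun_on_def by blast
  have "D = frechet_derivative f (at z)" using D(1) by (rule frechet_derivative_at)
  then show "(f has_derivative frechet_derivative f (at z)) (at z)"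
    and "frechet_derivative f (at z) (c *s v) = c * frechet_derivative f (at z) v" using D by auto
qed

lemma holomorphic_fun_on_subset: "holomorphic_fun_on f U \<Longrightarrow> V \<subseteq> U \<Longrightarrow> holomorphic_fun_on f V"
  unfolding holomorphic_fun_on_def by blast

lemma holomorphic_fun_on_continuous: "holomorphic_fun_on f U \<Longrightarrow> continuous_on U f"
  by (meson continuous_at_imp_continuous_on has_derivative_continuous holomorphic_fun_onD(1))

lemma holomorphic_fun_on_curve:
  assumes "holomorphic_fun_on f U" "g \<xi> \<in> U" "(g has_derivative (\<lambda>h. h *s w)) (at \<xi>)"
  shows "((\<lambda>\<xi>. f (g \<xi>)) has_field_derivative frechet_derivative f (at (g \<xi>)) w) (at \<xi>)"
proof -
  note D = holomorphic_fun_onD[OF assms(1,2)]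
  have "((\<lambda>\<xi>. f (g \<xi>)) has_derivative (\<lambda>h. frechet_derivative f (at (g \<xi>)) (h *s w))) (at \<xi>)"
    by (rule has_derivative_compose[OF assms(3) D(1)])
  then show ?thesis by (simp add: has_field_derivative_def D(2) mult_commute_abs)
qed

lemma holomorphic_fun_on_line:
  assumes "holomorphic_fun_on f U" "\<And>\<xi>. \<xi> \<in> S \<Longrightarrow> z + \<xi> *s v \<in> U"
  shows "(\<lambda>\<xi>. f (z + \<xi> *s v)) holomorphic_on S"
  unfolding holomorphic_on_def field_differentiable_def
  using holomorphic_fun_on_curve[OF assms(1) _ has_derivative_line] assms(2)
    has_field_derivative_at_within by blast

lemma holomorphic_fun_on_deriv_line:
  assumes "holomorphic_fun_on f U" "z + \<xi> *s v \<in> U"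
  shows "deriv (\<lambda>\<xi>. f (z + \<xi> *s v)) \<xi> = frechet_derivative f (at (z + \<xi> *s v)) v"
  using holomorphic_fun_on_curve[OF assms has_derivative_line] by (rule DERIV_imp_deriv)

lemma holomorphic_fun_on_const: "holomorphic_fun_on (\<lambda>z. c) U"
  unfolding holomorphic_fun_on_def by (intro ballI exI[of _ "\<lambda>h. 0"]) auto

lemma holomorphic_fun_on_linear:
  "bounded_linear f \<Longrightarrow> (\<And>c v. f (c *s v) = c * f v) \<Longrightarrow> holomorphic_fun_on f U"
  unfolding holomorphic_fun_on_def using bounded_linear_imp_has_derivative by blast

lemma holomorphic_fun_on_add:
  assumes "holomorphic_fun_on f U" "holomorphic_fun_on g U"
  shows "holomorphic_fun_on (\<lambda>z. f z + g z) U"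
  unfolding holomorphic_fun_on_def
proof (intro ballI exI conjI allI)
  fix z assume z: "z \<in> U"
  note 1 = holomorphic_fun_onD[OF assms(1) z] and 2 = holomorphic_fun_onD[OF assms(2) z]
  show "((\<lambda>z. f z + g z) has_derivative (\<lambda>v. frechet_derivative f (at z) v + frechet_derivative g (at z) v)) (at z)"
    by (rule has_derivative_add[OF 1(1) 2(1)])
qed (simp add: holomorphic_fun_onD(2)[OF assms(1)] holomorphic_fun_onD(2)[OF assms(2)] algebra_simps)

lemma holomorphic_fun_on_mult:
  assumes "holomorphic_fun_on f U" "holomorphic_fun_on g U"
  shows "holomorphic_fun_on (\<lambda>z. f z * g z) U"
  unfolding holomorphic_fun_on_def
proof (intro ballI exI conjI allI)
  fix z assume z: "z \<in> U"
  note 1 = holomorphic_fun_onD[OF assms(1) z] and 2 = holomorphic_fun_onD[OF assms(2) z]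
  show "((\<lambda>z. f z * g z) has_derivative
      (\<lambda>v. f z * frechet_derivative g (at z) v + frechet_derivative f (at z) v * g z)) (at z)"
    by (rule has_derivative_mult[OF 1(1) 2(1)])
qed (simp add: holomorphic_fun_onD(2)[OF assms(1)] holomorphic_fun_onD(2)[OF assms(2)] algebra_simps)

lemma holomorphic_fun_on_sum:
  "(\<And>i. i \<in> I \<Longrightarrow> holomorphic_fun_on (f i) U) \<Longrightarrow> holomorphic_fun_on (\<lambda>z. \<Sum>i\<in>I. f i z) U"
  by (induction I rule: infinite_finite_induct)
     (auto intro: holomorphic_fun_on_const holomorphic_fun_on_add)

lemma holomorphic_fun_on_prod:
  "(\<And>i. i \<in> I \<Longrightarrow> holomorphic_fun_on (f i) U) \<Longrightarrow> holomorphic_fun_on (\<lambda>z. \<Prod>i\<in>I. f i z) U"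
  by (induction I rule: infinite_finite_induct)
     (auto intro: holomorphic_fun_on_const holomorphic_fun_on_mult)

lemma holomorphic_fun_on_power:
  "holomorphic_fun_on f U \<Longrightarrow> holomorphic_fun_on (\<lambda>z. f z ^ n) U"
  by (induction n) (auto intro: holomorphic_fun_on_const holomorphic_fun_on_mult)

section \<open>Cauchy estimates, uniform limits and derivatives in several variables\<close>

lemma divide_Suc_mult_le: "0 \<le> x \<Longrightarrow> 0 < \<rho> \<Longrightarrow> \<rho> / (x + 1) * x \<le> (\<rho>::real)"
  by (simp add: divide_simps algebra_simps)

lemma Cauchy_derivative_bound:
  assumes "\<phi> holomorphic_on ball 0 \<rho>" "\<rho> > 0" "\<And>\<xi>. \<xi> \<in> ball 0 \<rho> \<Longrightarrow> cmod (\<phi> \<xi>) \<le> A"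
  shows "cmod (deriv \<phi> 0) \<le> 2 * A / \<rho>"
proof -
  have sub: "cball 0 (\<rho>/2) \<subseteq> ball (0::complex) \<rho>" using assms(2) by auto
  have "cmod ((deriv ^^ 1) \<phi> 0) \<le> fact 1 * A / (\<rho>/2)^1"
  proof (rule Cauchy_inequality)
    show "\<phi> holomorphic_on ball 0 (\<rho>/2)"
      using assms(1) by (rule holomorphic_on_subset) (use assms(2) in auto)
    show "continuous_on (cball 0 (\<rho>/2)) \<phi>"
      using holomorphic_on_imp_continuous_on[OF assms(1)] sub continuous_on_subset by blast
  qed (use assms in auto)
  then show ?thesis by (simp add: field_simps)
qed

text \<open>The limit is holomorphic on lines; Cauchy's estimate along lines makes the derivatives
  converge uniformly.\<close>
lemma holomorphic_fun_on_uniform_limit: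
  fixes f :: "nat \<Rightarrow> complex ^ 'n \<Rightarrow> complex"
  assumes "open U" "\<And>n. holomorphic_fun_on (f n) U" "uniform_limit U f g sequentially"
  shows "holomorphic_fun_on g U"
  unfolding holomorphic_fun_on_def
proof
  fix z assume "z \<in> U"
  then obtain r where r: "r > 0" "ball z r \<subseteq> U" using assms(1) open_contains_ball by blast
  \<comment> \<open>Half the radius: complex discs of radius \<rho> about all points of the smaller
    ball stay in \<open>U\<close>.\<close>
  define \<rho> where "\<rho> = r / 2"
  have \<rho>: "\<rho> > 0" using r by (simp add: \<rho>_def)
  have bU: "w + \<xi> *s h \<in> U" if "w \<in> ball z \<rho>" "cmod \<xi> * norm h < \<rho>" for w \<xi> h
  proof -
    have "dist z (w + \<xi> *s h) \<le> dist z w + cmod \<xi> * norm h"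
      using dist_triangle[of z "w + \<xi> *s h" w] by (simp add: dist_norm norm_cvec_smult)
    then show ?thesis using that r unfolding \<rho>_def by (intro subsetD[OF r(2)]) simp
  qed
  have lim: "\<forall>\<^sub>F n in sequentially. \<forall>x\<in>U. cmod (f n x - g x) < e" if "e > 0" for e
    using uniform_limitD[OF assms(3) that] by (simp add: dist_norm)
  have gline: "(\<lambda>\<xi>. g (w + \<xi> *s h)) holomorphic_on ball 0 s"
    if "w \<in> ball z \<rho>" "s * norm h \<le> \<rho>" for w h s
  proof (rule holomorphic_uniform_sequence[OF open_ball, where f="\<lambda>n \<xi>. f n (w + \<xi> *s h)"])
    have sub: "w + \<xi> *s h \<in> U" if "\<xi> \<in> ball 0 s" for \<xi>
    proof (rule bU[OF \<open>w \<in> ball z \<rho>\<close>])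
      show "cmod \<xi> * norm h < \<rho>"
      proof (cases "h = 0")
        case False
        then have "cmod \<xi> * norm h < s * norm h" using \<open>\<xi> \<in> ball 0 s\<close> by simp
        then show ?thesis using \<open>s * norm h \<le> \<rho>\<close> by simp
      qed (use \<rho> in simp)
    qed
    show "(\<lambda>\<xi>. f n (w + \<xi> *s h)) holomorphic_on ball 0 s" for n
      by (rule holomorphic_fun_on_line[OF assms(2) sub])
    fix x :: complex assume "x \<in> ball 0 s"
    then obtain d where d: "d > 0" "cball x d \<subseteq> ball 0 s" using open_contains_cball open_ball by metis
    have "uniform_limit (cball x d) (\<lambda>n \<xi>. f n (w + \<xi> *s h)) (\<lambda>\<xi>. g (w + \<xi> *s h)) sequentially"
    proof (rule uniform_limitI)
      fix e :: real assume "e > 0"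
      from lim[OF this] show "\<forall>\<^sub>F n in sequentially. \<forall>\<xi>\<in>cball x d. dist (f n (w + \<xi> *s h)) (g (w + \<xi> *s h)) < e"
        by eventually_elim (use sub d in \<open>auto simp: dist_norm\<close>)
    qed
    with d show "\<exists>d>0. cball x d \<subseteq> ball 0 s \<and>
      uniform_limit (cball x d) (\<lambda>n \<xi>. f n (w + \<xi> *s h)) (\<lambda>\<xi>. g (w + \<xi> *s h)) sequentially" by blast
  qed
  \<comment> \<open>The candidate for the derivative, taken line by line. Only complex homogeneity
    in \<open>h\<close> is proved by hand; additivity comes out of
    \<open>has_derivative_sequence\<close>.\<close>
  define D where "D w h = deriv (\<lambda>\<xi>. g (w + \<xi> *s h)) 0" for w h
  have gdiff: "(\<lambda>\<xi>. g (w + \<xi> *s h)) field_differentiable at 0" if "w \<in> ball z \<rho>" for w h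
  proof -
    \<comment> \<open>Dividing by \<open>norm h + 1\<close> gives a positive radius for h = 0 as
      well.\<close>
    have "(\<lambda>\<xi>. g (w + \<xi> *s h)) holomorphic_on ball 0 (\<rho> / (norm h + 1))"
      by (rule gline[OF that divide_Suc_mult_le[OF norm_ge_zero \<rho>]])
    then show ?thesis
      by (rule holomorphic_on_imp_differentiable_at) (use \<rho> in \<open>auto intro!: divide_pos_pos add_nonneg_pos\<close>)
  qed
  have Dc: "D w (c *s h) = c * D w h" if "w \<in> ball z \<rho>" for w c h
  proof -
    have "deriv ((\<lambda>\<xi>. g (w + \<xi> *s h)) \<circ> (\<lambda>\<xi>. \<xi> * c)) 0 = deriv (\<lambda>\<xi>. g (w + \<xi> *s h)) (0 * c) * deriv (\<lambda>\<xi>. \<xi> * c) 0"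
      by (rule deriv_chain)
         (use gdiff[OF that] in \<open>auto intro: field_differentiable_mult field_differentiable_ident field_differentiable_const\<close>)
    then show ?thesis by (simp add: D_def o_def vector_smult_assoc mult.commute)
  qed
  have close: "cmod (frechet_derivative (f n) (at w) h - D w h) \<le> 2 * e / \<rho> * norm h"
    if w: "w \<in> ball z \<rho>" and e: "\<forall>x\<in>U. cmod (f n x - g x) < e" for n w h e
  proof (cases "h = 0")
    case True
    have "w \<in> U" using bU[OF w, of 0 0] \<rho> by simp
    from holomorphic_fun_onD(2)[OF assms(2) this, of n 0 0] True show ?thesis
      using Dc[OF w, of 0 0] by simp
  next
    case False
    \<comment> \<open>For a unit direction Cauchy's estimate can use the full radius \<rho>; scaling
      back makes the bound linear in \<open>norm h\<close>.\<close>
    define u where "u = of_real (1 / norm h) *s h"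
    have u: "norm u = 1" using False by (simp add: u_def norm_cvec_smult norm_divide)
    have h: "h = of_real (norm h) *s u" using False by (simp add: u_def vector_smult_assoc)
    have wU: "w + 0 *s u \<in> U" using bU[OF w, of 0 0] \<rho> by simp
    have 1: "(\<lambda>\<xi>. f n (w + \<xi> *s u)) holomorphic_on ball 0 \<rho>"
      by (rule holomorphic_fun_on_line[OF assms(2)]) (use bU[OF w] u in auto)
    have 2: "(\<lambda>\<xi>. g (w + \<xi> *s u)) holomorphic_on ball 0 \<rho>" by (rule gline[OF w]) (simp add: u)
    have "cmod (deriv (\<lambda>\<xi>. f n (w + \<xi> *s u) - g (w + \<xi> *s u)) 0) \<le> 2 * e / \<rho>"
    proof (rule Cauchy_derivative_bound)
      show "cmod (f n (w + \<xi> *s u) - g (w + \<xi> *s u)) \<le> e" if "\<xi> \<in> ball 0 \<rho>" for \<xi>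
        using e bU[OF w, of \<xi> u] u that by (auto intro: less_imp_le)
    qed (use 1 2 \<rho> in \<open>auto intro: holomorphic_intros\<close>)
    moreover have "deriv (\<lambda>\<xi>. f n (w + \<xi> *s u) - g (w + \<xi> *s u)) 0
        = frechet_derivative (f n) (at w) u - D w u"
    proof -
      have "(\<lambda>\<xi>. f n (w + \<xi> *s u)) field_differentiable at 0"
        using 1 \<rho> by (auto intro: holomorphic_on_imp_differentiable_at)
      then show ?thesis
        using gdiff[OF w, of u] holomorphic_fun_on_deriv_line[OF assms(2) wU] by (simp add: D_def)
    qed
    moreover have "frechet_derivative (f n) (at w) h = of_real (norm h) * frechet_derivative (f n) (at w) u"
      using holomorphic_fun_onD(2)[OF assms(2), of w n "of_real (norm h)" u] wU h by simp
    moreover have "D w h = of_real (norm h) * D w u" using Dc[OF w, of "of_real (norm h)" u] h by simp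
    ultimately have "cmod (frechet_derivative (f n) (at w) h - D w h) \<le> norm h * (2 * e / \<rho>)"
      using mult_left_mono[OF _ norm_ge_zero, of _ "2 * e / \<rho>" h]
      by (simp only: right_diff_distrib[symmetric] norm_mult norm_of_real abs_norm_cancel)
    then show ?thesis by (simp only: mult.commute)
  qed
  have "\<exists>g0. \<forall>x\<in>ball z \<rho>. (\<lambda>n. f n x) \<longlonglongrightarrow> g0 x \<and> (g0 has_derivative D x) (at x within ball z \<rho>)"
  proof (rule has_derivative_sequence[where f'="\<lambda>n w. frechet_derivative (f n) (at w)"])
    show "convex (ball z \<rho>)" by simp
    show "z \<in> ball z \<rho>" using \<rho> by simp
    show "(\<lambda>n. f n z) \<longlonglongrightarrow> g z" using tendsto_uniform_limitI[OF assms(3) \<open>z \<in> U\<close>] .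
    fix n x assume "x \<in> ball z \<rho>"
    then have "x \<in> U" using r by (auto simp: \<rho>_def)
    show "(f n has_derivative frechet_derivative (f n) (at x)) (at x within ball z \<rho>)"
      by (rule has_derivative_at_withinI[OF holomorphic_fun_onD(1)[OF assms(2) \<open>x \<in> U\<close>]])
  next
    fix e :: real assume "e > 0"
    then have "e * \<rho> / 2 > 0" using \<rho> by simp
    from lim[OF this] show "\<forall>\<^sub>F n in sequentially. \<forall>x\<in>ball z \<rho>. \<forall>h.
        cmod (frechet_derivative (f n) (at x) h - D x h) \<le> e * norm h"
    proof eventually_elim
      case (elim n)
      then show ?case using close[of _ n "e * \<rho> / 2"] \<rho> by simp
    qed
  qed
  then obtain g0 where g0: "\<And>x. x \<in> ball z \<rho> \<Longrightarrow> (\<lambda>n. f n x) \<longlonglongrightarrow> g0 x"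
     "\<And>x. x \<in> ball z \<rho> \<Longrightarrow> (g0 has_derivative D x) (at x within ball z \<rho>)" by blast
  have eq: "g0 x = g x" if "x \<in> ball z \<rho>" for x
  proof -
    have "x \<in> U" using r that by (auto simp: \<rho>_def)
    from LIMSEQ_unique[OF g0(1)[OF that] tendsto_uniform_limitI[OF assms(3) this]] show ?thesis .
  qed
  have z: "z \<in> ball z \<rho>" using \<rho> by simp
  have "(g has_derivative D z) (at z)"
    using g0(2)[OF z] at_within_open[OF z open_ball] eq
    by (metis (no_types, lifting) has_derivative_transform_within_open open_ball z)
  then show "\<exists>D. (g has_derivative D) (at z) \<and> (\<forall>c v. D (c *s v) = c * D v)"
    using Dc[OF z] by blast
qed

text \<open>The constant is 2 * A / (r/2)^2, Cauchy's bound for the second derivative on discs of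
  radius r/2 about points of the half disc.\<close>

lemma holomorphic_Taylor2:
  assumes "\<phi> holomorphic_on ball 0 r" "r > 0" "\<And>\<xi>. \<xi> \<in> ball 0 r \<Longrightarrow> cmod (\<phi> \<xi>) \<le> A" "cmod s < r / 2"
  shows "cmod (\<phi> s - \<phi> 0 - deriv \<phi> 0 * s) \<le> 8 * A / r\<^sup>2 * (cmod s)\<^sup>2"
proof -
  have "cmod ((deriv ^^ 0) \<phi> s - (\<Sum>i\<le>1. (deriv ^^ i) \<phi> 0 * (s - 0) ^ i / fact i))
      \<le> (8 * A / r\<^sup>2) * cmod (s - 0) ^ Suc 1 / fact 1"
  proof (rule complex_Taylor[where S="ball 0 (r/2)"])
    fix i :: nat and x :: complex assume x: "x \<in> ball 0 (r/2)"
    then have xr: "x \<in> ball 0 r" using assms(2) by auto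
    have "((deriv ^^ i) \<phi> has_field_derivative deriv ((deriv ^^ i) \<phi>) x) (at x)"
      by (rule holomorphic_derivI[OF holomorphic_higher_deriv[OF assms(1) open_ball] open_ball xr])
    then show "((deriv ^^ i) \<phi> has_field_derivative (deriv ^^ Suc i) \<phi> x) (at x within ball 0 (r/2))"
      by (simp add: has_field_derivative_at_within)
  next
    fix x :: complex assume x: "x \<in> ball 0 (r/2)"
    have sub: "cball x (r/2) \<subseteq> ball 0 r"
    proof
      fix y assume "y \<in> cball x (r/2)"
      then show "y \<in> ball 0 r" using x dist_triangle[of 0 y x] by simp
    qed
    have "cmod ((deriv ^^ 2) \<phi> x) \<le> fact 2 * A / (r/2)^2"
    proof (rule Cauchy_inequality)
      show "\<phi> holomorphic_on ball x (r/2)"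
        using assms(1) by (rule holomorphic_on_subset) (use sub in auto)
      show "continuous_on (cball x (r/2)) \<phi>"
        using holomorphic_on_imp_continuous_on[OF assms(1)] sub continuous_on_subset by blast
      show "cmod (\<phi> y) \<le> A" if "cmod (x - y) = r/2" for y
        using that sub by (intro assms(3)) (auto simp: dist_norm)
    qed (use assms in auto)
    then show "cmod ((deriv ^^ Suc 1) \<phi> x) \<le> 8 * A / r\<^sup>2"
      by (simp add: numeral_2_eq_2 power2_eq_square field_simps)
  qed (use assms in auto)
  then show ?thesis by (simp add: power2_eq_square algebra_simps)
qed

text \<open>The derivative in the direction \<open>v\<close> is a locally uniform limit of
  difference quotients, which are holomorphic. The second order Taylor estimate along lines makes
  the convergence uniform.\<close>

lemma holomorphic_fun_on_derivative:
  assumes "open U" "holomorphic_fun_on f U"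
  shows "holomorphic_fun_on (\<lambda>z. frechet_derivative f (at z) v) U"
proof -
  have "\<exists>\<rho>>0. holomorphic_fun_on (\<lambda>z. frechet_derivative f (at z) v) (ball z0 \<rho>)" if z0: "z0 \<in> U" for z0
  proof -
    obtain R where R: "R > 0" "cball z0 R \<subseteq> U" using open_contains_cball_eq[OF assms(1)] z0 by metis
    have "compact (f ` cball z0 R)"
      by (rule compact_continuous_image[OF continuous_on_subset[OF holomorphic_fun_on_continuous[OF assms(2)] R(2)] compact_cball])
    from compact_imp_bounded[OF this] obtain A where "\<forall>y \<in> f ` cball z0 R. cmod y \<le> A"
      unfolding bounded_iff by blast
    then have A: "cmod (f x) \<le> A" if "x \<in> cball z0 R" for x using that by blast
    define \<rho> where "\<rho> = R / 2"
    define r where "r = \<rho> / (norm v + 1)"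
    have \<rho>: "\<rho> > 0" and r: "r > 0" "r * norm v \<le> \<rho>"
      using R divide_Suc_mult_le[OF norm_ge_zero, of \<rho> v]
      by (auto simp: \<rho>_def r_def intro!: divide_pos_pos add_nonneg_pos)
    have inR: "w + \<xi> *s v \<in> cball z0 R" if "w \<in> ball z0 \<rho>" "\<xi> \<in> ball 0 r" for w \<xi>
    proof -
      have "dist z0 (w + \<xi> *s v) \<le> dist z0 w + cmod \<xi> * norm v"
        using dist_triangle[of z0 "w + \<xi> *s v" w] by (simp add: dist_norm norm_cvec_smult)
      moreover have "cmod \<xi> * norm v \<le> r * norm v" using that by (intro mult_right_mono) auto
      ultimately show ?thesis using that r unfolding \<rho>_def by simp
    qed
    \<comment> \<open>Steps of the difference quotients: nonzero, tending to 0, and inside the disc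
      of radius r / 2 in which the Taylor estimate holds.\<close>
    define s :: "nat \<Rightarrow> complex" where "s n = of_real (r / (2 * (real n + 2)))" for n
    have cs: "cmod (s n) = r / (2 * (real n + 2))" for n
      unfolding s_def norm_of_real using r by simp
    have s: "s n \<noteq> 0" "cmod (s n) < r / 2" for n
    proof -
      have "r / (2 * (real n + 2)) < r / 2" using r by (simp add: divide_simps)
      then show "cmod (s n) < r / 2" using cs by simp
      have "cmod (s n) \<noteq> 0" using r cs[of n] by simp
      then show "s n \<noteq> 0" by auto
    qed
    have "cmod (s n) \<le> r / 2 / real (Suc n)" for n using r by (simp add: cs frac_le)
    moreover have "(\<lambda>n. r / 2 / real (Suc n)) \<longlonglongrightarrow> 0" by (rule LIMSEQ_Suc[OF lim_const_over_n])
    ultimately have s0: "(\<lambda>n. cmod (s n)) \<longlonglongrightarrow> 0"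
      using tendsto_sandwich[of "\<lambda>n. 0" "\<lambda>n. cmod (s n)" sequentially "\<lambda>n. r / 2 / real (Suc n)" 0] by simp
    define F where "F n w = (1 / s n) * (f (w + s n *s v) + (-1) * f w)" for n w
    have "holomorphic_fun_on (\<lambda>z. frechet_derivative f (at z) v) (ball z0 \<rho>)"
    proof (rule holomorphic_fun_on_uniform_limit[of _ F])
      show "holomorphic_fun_on (F n) (ball z0 \<rho>)" for n
      proof -
        have "holomorphic_fun_on (\<lambda>w. f (w + s n *s v)) (ball z0 \<rho>)"
          unfolding holomorphic_fun_on_def
        proof (intro ballI exI conjI allI)
          fix w assume "w \<in> ball z0 \<rho>"
          then have U: "w + s n *s v \<in> U" using inR[of w "s n"] s[of n] R r by auto
          have "((\<lambda>w. w + s n *s v) has_derivative (\<lambda>h. h)) (at w)"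
            by (auto intro!: derivative_eq_intros)
          from has_derivative_compose[OF this holomorphic_fun_onD(1)[OF assms(2) U]]
          show "((\<lambda>w. f (w + s n *s v)) has_derivative (\<lambda>h. frechet_derivative f (at (w + s n *s v)) h)) (at w)" .
          show "frechet_derivative f (at (w + s n *s v)) (c *s h) = c * frechet_derivative f (at (w + s n *s v)) h" for c h
            by (rule holomorphic_fun_onD(2)[OF assms(2) U])
        qed
        moreover have "holomorphic_fun_on f (ball z0 \<rho>)"
          by (rule holomorphic_fun_on_subset[OF assms(2)]) (use R in \<open>auto simp: \<rho>_def\<close>)
        ultimately show ?thesis unfolding F_def
          by (intro holomorphic_fun_on_mult holomorphic_fun_on_add holomorphic_fun_on_const)
      qed
      have est: "cmod (F n w - frechet_derivative f (at w) v) \<le> 8 * A / r\<^sup>2 * cmod (s n)"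
        if w: "w \<in> ball z0 \<rho>" for n w
      proof -
        have wU: "w + 0 *s v \<in> U" using inR[OF w, of 0] r R by auto
        have "cmod (f (w + s n *s v) - f (w + 0 *s v) - deriv (\<lambda>\<xi>. f (w + \<xi> *s v)) 0 * s n) \<le> 8 * A / r\<^sup>2 * (cmod (s n))\<^sup>2"
          by (rule holomorphic_Taylor2)
             (use inR[OF w] R A r s in \<open>auto intro!: holomorphic_fun_on_line[OF assms(2)]\<close>)
        then have *: "cmod (f (w + s n *s v) - f w - frechet_derivative f (at w) v * s n) \<le> 8 * A / r\<^sup>2 * (cmod (s n))\<^sup>2"
          using holomorphic_fun_on_deriv_line[OF assms(2) wU] by simp
        have "F n w - frechet_derivative f (at w) v = (f (w + s n *s v) - f w - frechet_derivative f (at w) v * s n) / s n"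
          using s(1)[of n] by (simp add: F_def field_simps)
        then have "cmod (F n w - frechet_derivative f (at w) v) \<le> 8 * A / r\<^sup>2 * (cmod (s n))\<^sup>2 / cmod (s n)"
          using divide_right_mono[OF * norm_ge_zero[of "s n"]] by (simp only: norm_divide)
        also have "\<dots> = 8 * A / r\<^sup>2 * cmod (s n)" using s(1)[of n] by (simp add: power2_eq_square)
        finally show ?thesis .
      qed
      show "uniform_limit (ball z0 \<rho>) F (\<lambda>z. frechet_derivative f (at z) v) sequentially"
      proof (rule uniform_limitI)
        fix e :: real assume "e > 0"
        have "(\<lambda>n. 8 * A / r\<^sup>2 * cmod (s n)) \<longlonglongrightarrow> 8 * A / r\<^sup>2 * 0" by (intro tendsto_mult s0 tendsto_const)
        then have "\<forall>\<^sub>F n in sequentially. 8 * A / r\<^sup>2 * cmod (s n) < e"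
          using \<open>e > 0\<close> by (intro order_tendstoD(2)) auto
        then show "\<forall>\<^sub>F n in sequentially. \<forall>x\<in>ball z0 \<rho>. dist (F n x) (frechet_derivative f (at x) v) < e"
          by eventually_elim (auto simp: dist_norm intro: le_less_trans[OF est])
      qed
    qed auto
    then show ?thesis using \<rho> by blast
  qed
  then show ?thesis unfolding holomorphic_fun_on_def by (metis centre_in_ball)
qed

lemma holomorphic_fun_on_imp_Ck:
  assumes "open U" "holomorphic_fun_on f U"
  shows "Ck_on k f U"
  using assms(2)
proof (induction k arbitrary: f)
  case 0 then show ?case by (simp add: holomorphic_fun_on_continuous)
next
  case (Suc k)
  then show ?case
    by (intro Ck_on_SucI[OF assms(1) holomorphic_fun_onD(1)] Suc.IH holomorphic_fun_on_derivative[OF assms(1)])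
qed

section \<open>Complexification of real analytic functions\<close>

text \<open>Vectors are placed as real points in a complex space of twice the dimension, where real
  analytic functions of the real coordinates have holomorphic extensions.\<close>

definition cplx_embed :: "complex ^ 'n \<Rightarrow> complex ^ ('n + 'n)" where
  "cplx_embed v = (\<chi> i. case i of Inl j \<Rightarrow> of_real (Re (v $ j)) | Inr j \<Rightarrow> of_real (Im (v $ j)))"

text \<open>The complex linear extension of v \<mapsto> v \<bullet> e from the real points. Power
  series are complexified by substituting it for the coordinates.\<close>

definition cplx_coord :: "complex ^ 'n \<Rightarrow> complex ^ ('n + 'n) \<Rightarrow> complex" where
  "cplx_coord e z = (\<Sum>j\<in>UNIV. z $ Inl j * of_real (Re (e $ j)) + z $ Inr j * of_real (Im (e $ j)))"

lemma cplx_coord_embed: "cplx_coord e (cplx_embed v) = of_real (v \<bullet> e)"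
  by (simp add: cplx_coord_def cplx_embed_def inner_vec_def inner_complex_def)

lemma sum_UNIV_Plus:
  fixes f :: "'a::finite + 'b::finite \<Rightarrow> 'c::comm_monoid_add"
  shows "(\<Sum>i\<in>UNIV. f i) = (\<Sum>i\<in>UNIV. f (Inl i)) + (\<Sum>i\<in>UNIV. f (Inr i))"
  by (simp add: UNIV_Plus_UNIV[symmetric] sum.Plus del: UNIV_Plus_UNIV)

lemma norm_cplx_embed: "norm (cplx_embed v) = norm v"
proof -
  have "(\<Sum>i\<in>UNIV. (cmod (cplx_embed v $ i))\<^sup>2) = (\<Sum>j\<in>UNIV. (cmod (v $ j))\<^sup>2)"
    by (simp add: sum_UNIV_Plus cplx_embed_def cmod_power2 sum.distrib)
  then show ?thesis by (simp add: norm_vec_def L2_set_def)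
qed

lemma bounded_linear_cplx_embed: "bounded_linear (cplx_embed :: complex ^ 'n \<Rightarrow> _)"
proof (rule bounded_linear_intro[of _ 1])
  show "cplx_embed (x + y) = cplx_embed x + cplx_embed y" for x y :: "complex ^ 'n"
    by (simp add: vec_eq_iff cplx_embed_def split: sum.split)
  show "cplx_embed (r *\<^sub>R x) = r *\<^sub>R cplx_embed x" for x :: "complex ^ 'n" and r
    by (simp add: vec_eq_iff cplx_embed_def scaleR_conv_of_real[where 'a=complex] split: sum.split)
qed (simp add: norm_cplx_embed)

lemma cplx_coord_smult: "cplx_coord e (c *s z) = c * cplx_coord e z"
  by (simp add: cplx_coord_def sum_distrib_left algebra_simps)

lemma bounded_linear_cplx_coord: "bounded_linear (cplx_coord e)"
  unfolding cplx_coord_def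
  by (intro bounded_linear_sum bounded_linear_add bounded_linear_mult_const bounded_linear_vec_nth)

lemma norm_cplx_coord:
  fixes z :: "complex ^ ('n::finite + 'n)"
  shows "cmod (cplx_coord e z) \<le> 2 * real CARD('n) * norm e * norm z"
proof -
  have "cmod (cplx_coord e z) \<le> (\<Sum>j\<in>(UNIV::'n set). 2 * norm e * norm z)"
    unfolding cplx_coord_def
  proof (rule sum_norm_le)
    fix j :: 'n
    have 1: "\<bar>Re (e $ j)\<bar> \<le> norm e" "\<bar>Im (e $ j)\<bar> \<le> norm e"
      using abs_Re_le_cmod[of "e $ j"] abs_Im_le_cmod[of "e $ j"] Finite_Cartesian_Product.norm_nth_le[of e j] by auto
    have "cmod (z $ Inl j * of_real (Re (e $ j)) + z $ Inr j * of_real (Im (e $ j)))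
       \<le> cmod (z $ Inl j) * \<bar>Re (e $ j)\<bar> + cmod (z $ Inr j) * \<bar>Im (e $ j)\<bar>"
      by (rule order_trans[OF norm_triangle_ineq]) (simp add: norm_mult)
    also have "\<dots> \<le> norm z * norm e + norm z * norm e"
      by (intro add_mono mult_mono 1 Finite_Cartesian_Product.norm_nth_le) auto
    finally show "cmod (z $ Inl j * of_real (Re (e $ j)) + z $ Inr j * of_real (Im (e $ j))) \<le> 2 * norm e * norm z"
      by (simp add: algebra_simps)
  qed
  then show ?thesis by (simp add: algebra_simps)
qed

text \<open>Convergence of the real series at a point with all coordinates equal to \<rho> is
  absolute, and its terms majorise the complexified series wherever all complex coordinates are at
  most \<rho> in modulus. Weierstrass' test then gives a holomorphic sum.\<close>

lemma power_series_complexify: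
  fixes c :: "(complex ^ 'n \<Rightarrow> nat) \<Rightarrow> real"
  assumes "r > 0" and sums: "\<And>y. y \<in> ball 0 r \<Longrightarrow>
     ((\<lambda>\<alpha>. (\<Prod>b\<in>Basis. (y \<bullet> b) ^ \<alpha> b) * c \<alpha>) has_sum f y) (Basis \<rightarrow>\<^sub>E UNIV)"
  obtains R F where "R > 0" "holomorphic_fun_on F (ball 0 R)"
    "\<And>y. norm y < R \<Longrightarrow> F (cplx_embed y) = of_real (f y)"
proof -
  define I :: "(complex ^ 'n \<Rightarrow> nat) set" where "I = Basis \<rightarrow>\<^sub>E UNIV"
  \<comment> \<open>All coordinates of \<open>y0\<close> are 1, so \<rho> times it is the test point
    of the majorant.\<close>
  define y0 :: "complex ^ 'n" where "y0 = (\<Sum>b\<in>Basis. b)"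
  have y0b: "y0 \<bullet> b = 1" if "b \<in> Basis" for b
    using that by (simp add: y0_def inner_sum_left inner_Basis)
  define \<rho> where "\<rho> = r / (2 * (norm y0 + 1))"
  have "\<rho> > 0" using assms(1) by (auto simp: \<rho>_def intro!: divide_pos_pos add_nonneg_pos)
  have "\<rho> = r / 2 / (norm y0 + 1)" by (simp add: \<rho>_def)
  then have "\<rho> * norm y0 \<le> r / 2" using divide_Suc_mult_le[OF norm_ge_zero, of "r/2" y0] assms(1) by simp
  then have "\<rho> * norm y0 < r" using assms(1) by simp
  then have "\<rho> *\<^sub>R y0 \<in> ball 0 r" using \<open>\<rho> > 0\<close> by simp
  from sums[OF this] have "(\<lambda>\<alpha>. (\<Prod>b\<in>Basis. \<rho> ^ \<alpha> b) * c \<alpha>) summable_on I"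
    unfolding I_def summable_on_def by (auto simp: y0b)
  from iffD1[OF summable_on_iff_abs_summable_on_real this]
  have absum: "(\<lambda>\<alpha>. (\<Prod>b\<in>Basis. \<rho> ^ \<alpha> b) * \<bar>c \<alpha>\<bar>) summable_on I"
    using \<open>\<rho> > 0\<close> by (simp add: abs_mult abs_prod)
  \<comment> \<open>Infinite and countable: the sum over multi-indices can be rearranged into a
    series over the naturals.\<close>
  have "infinite I"
  proof -
    obtain b0 :: "complex ^ 'n" where b0: "b0 \<in> Basis" using nonempty_Basis by blast
    have "inj (\<lambda>n::nat. \<lambda>b\<in>(Basis :: (complex ^ 'n) set). n)"
    proof (rule injI)
      fix n m :: nat assume "(\<lambda>b\<in>(Basis :: (complex ^ 'n) set). n) = (\<lambda>b\<in>Basis. m)"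
      from fun_cong[OF this, of b0] b0 show "n = m" by simp
    qed
    moreover have "range (\<lambda>n::nat. \<lambda>b\<in>(Basis :: (complex ^ 'n) set). n) \<subseteq> I" by (auto simp: I_def)
    ultimately show ?thesis using infinite_super range_inj_infinite by blast
  qed
  moreover have "countable I" unfolding I_def by (intro countable_PiE) auto
  ultimately have bij: "bij_betw (from_nat_into I) UNIV I" using bij_betw_from_nat_into by blast
  define e where "e = from_nat_into I"
  have bij: "bij_betw e UNIV I" using bij by (simp add: e_def)
  define T where "T k z = (\<Prod>b\<in>Basis. cplx_coord b z ^ e k b) * of_real (c (e k))" for k z
  define M where "M k = (\<Prod>b\<in>(Basis::(complex ^ 'n) set). \<rho> ^ e k b) * \<bar>c (e k)\<bar>" for k
  have "M summable_on UNIV"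
    unfolding M_def using absum summable_on_reindex_bij_betw[OF bij] by fastforce
  then have "summable M" by (rule summable_on_imp_summable)
  \<comment> \<open>The divisor is the bound of \<open>norm_cplx_coord\<close> for unit vectors, so
    that every complex coordinate is at most \<rho> on this ball.\<close>
  define R where "R = min r (\<rho> / (2 * real CARD('n)))"
  have R: "R > 0" "R \<le> r" using assms(1) \<open>\<rho> > 0\<close> by (auto simp: R_def)
  have bound: "cmod (T k z) \<le> M k" if "z \<in> ball 0 R" for k z
  proof -
    have "cmod (cplx_coord b z) \<le> \<rho>" if b: "b \<in> Basis" for b
    proof -
      have "norm z \<le> \<rho> / (2 * real CARD('n))" using \<open>z \<in> ball 0 R\<close> by (simp add: R_def)
      then have "2 * real CARD('n) * norm z \<le> \<rho>" by (simp add: field_simps)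
      then show ?thesis using norm_cplx_coord[of b z] b by simp
    qed
    then have "(\<Prod>b\<in>Basis. cmod (cplx_coord b z) ^ e k b) \<le> (\<Prod>b\<in>Basis. \<rho> ^ e k b)"
      by (intro prod_mono conjI power_mono) auto
    then show ?thesis
      by (simp add: T_def M_def norm_mult prod_norm[symmetric] norm_power mult_right_mono)
  qed
  define F where "F z = (\<Sum>k. T k z)" for z
  have "holomorphic_fun_on F (ball 0 R)"
  proof (rule holomorphic_fun_on_uniform_limit)
    show "uniform_limit (ball 0 R) (\<lambda>n z. \<Sum>i<n. T i z) F sequentially"
      unfolding F_def by (rule Weierstrass_m_test[OF bound \<open>summable M\<close>])
    show "holomorphic_fun_on (\<lambda>z. \<Sum>i<n. T i z) (ball 0 R)" for n
      unfolding T_def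
      by (intro holomorphic_fun_on_sum holomorphic_fun_on_mult holomorphic_fun_on_prod
          holomorphic_fun_on_power holomorphic_fun_on_const holomorphic_fun_on_linear
          bounded_linear_cplx_coord cplx_coord_smult)
  qed auto
  moreover have "F (cplx_embed y) = of_real (f y)" if "norm y < R" for y
  proof -
    have "y \<in> ball 0 r" using that R by simp
    from sums[OF this] have "((\<lambda>k. (\<Prod>b\<in>Basis. (y \<bullet> b) ^ e k b) * c (e k)) has_sum f y) UNIV"
      using has_sum_reindex_bij_betw[OF bij, of "\<lambda>\<alpha>. (\<Prod>b\<in>Basis. (y \<bullet> b) ^ \<alpha> b) * c \<alpha>"] by (simp add: I_def)
    from sums_of_real[where 'a=complex, OF has_sum_imp_sums[OF this]]
    have "(\<lambda>k. T k (cplx_embed y)) sums (of_real (f y))"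
      by (simp add: T_def cplx_coord_embed)
    then show ?thesis by (simp add: F_def sums_iff)
  qed
  ultimately show ?thesis using that R by blast
qed

lemma real_analytic_complexify:
  fixes f :: "complex ^ 'n \<Rightarrow> 'b::euclidean_space"
  assumes "real_analytic_on f U" "p \<in> U"
  obtains R F where "R > 0" "holomorphic_fun_on F (ball 0 R)"
    "\<And>y. norm y < R \<Longrightarrow> F (cplx_embed y) = of_real (f (p + y) \<bullet> u)"
proof -
  obtain c r where r: "r > 0" and s: "\<And>x. x \<in> ball p r \<Longrightarrow>
     ((\<lambda>\<alpha>. (\<Prod>b\<in>Basis. ((x - p) \<bullet> b) ^ \<alpha> b) *\<^sub>R c \<alpha>) has_sum f x) (Basis \<rightarrow>\<^sub>E UNIV)"
    using assms unfolding real_analytic_on_def by blast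
  have "((\<lambda>\<alpha>. (\<Prod>b\<in>Basis. (y \<bullet> b) ^ \<alpha> b) * (c \<alpha> \<bullet> u)) has_sum f (p + y) \<bullet> u) (Basis \<rightarrow>\<^sub>E UNIV)"
    if "y \<in> ball 0 r" for y
  proof -
    have "((\<lambda>\<alpha>. (\<Prod>b\<in>Basis. ((p + y - p) \<bullet> b) ^ \<alpha> b) *\<^sub>R c \<alpha>) has_sum f (p + y)) (Basis \<rightarrow>\<^sub>E UNIV)"
      by (rule s) (use that in \<open>simp add: dist_norm\<close>)
    from has_sum_bounded_linear[OF bounded_linear_inner_left[of u] this] show ?thesis
      by (simp add: o_def)
  qed
  from power_series_complexify[OF r this] that show ?thesis by metis
qed

text \<open>Locally each component is the real part of a holomorphic function composed with an
  affine map, and holomorphic functions have all derivatives.\<close>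

lemma real_analytic_imp_smooth:
  fixes f :: "complex ^ 'n \<Rightarrow> 'b::euclidean_space"
  assumes "open U" "real_analytic_on f U"
  shows "smooth_on f U"
  unfolding smooth_on_def
proof (rule allI, rule Ck_on_components[OF assms(1)], rule Ck_on_local)
  fix k p and u :: 'b assume p: "p \<in> U"
  obtain R F where R: "R > 0" "holomorphic_fun_on F (ball 0 R)"
    "\<And>y. norm y < R \<Longrightarrow> F (cplx_embed y) = of_real (f (p + y) \<bullet> u)"
    using real_analytic_complexify[OF assms(2) p, of u] by blast
  have emb: "Ck_on k (\<lambda>x. cplx_embed (x - p)) (ball p R)"
    by (rule Ck_on_bounded_linear[OF open_ball bounded_linear_cplx_embed Ck_on_diff[OF open_ball Ck_on_id Ck_on_const]])
  have "Ck_on k (\<lambda>x. F (cplx_embed (x - p))) (ball p R)"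
    by (rule Ck_on_compose[OF open_ball open_ball holomorphic_fun_on_imp_Ck[OF open_ball R(2)] emb])
       (auto simp: norm_cplx_embed dist_norm norm_minus_commute)
  from Ck_on_bounded_linear[OF open_ball bounded_linear_Re this]
  have "Ck_on k (\<lambda>x. f x \<bullet> u) (ball p R)"
    by (rule Ck_on_cong[OF open_ball, rotated]) (use R(3) in \<open>auto simp: dist_norm norm_minus_commute\<close>)
  then show "\<exists>W. open W \<and> p \<in> W \<and> Ck_on k (\<lambda>x. f x \<bullet> u) W" using R(1) by (metis centre_in_ball open_ball)
qed

section \<open>A scalar initial value problem\<close>

text \<open>On a time interval of length 1, the Lipschitz constant 1/2 makes the integral operator a
  contraction in the supremum norm, and the bound \<rho> on the field keeps paths in the ball. So
  the solution exists on the whole interval at once.\<close>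

lemma picard_unit_interval:
  fixes f :: "real \<Rightarrow> complex \<Rightarrow> complex"
  assumes cont: "continuous_on ({0..1} \<times> cball t \<rho>) (\<lambda>(\<tau>, w). f \<tau> w)"
    and bound: "\<And>\<tau> w. \<tau> \<in> {0..1} \<Longrightarrow> w \<in> cball t \<rho> \<Longrightarrow> cmod (f \<tau> w) \<le> \<rho>"
    and lip: "\<And>\<tau> w w'. \<tau> \<in> {0..1} \<Longrightarrow> w \<in> cball t \<rho> \<Longrightarrow> w' \<in> cball t \<rho> \<Longrightarrow>
        cmod (f \<tau> w - f \<tau> w') \<le> cmod (w - w') / 2"
    and "\<rho> \<ge> 0"
  obtains w where "w 0 = t" "\<And>\<tau>. \<tau> \<in> {0..1} \<Longrightarrow> w \<tau> \<in> cball t \<rho>"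
    "\<And>\<tau>. \<tau> \<in> {0..1} \<Longrightarrow> (w has_vector_derivative f \<tau> (w \<tau>)) (at \<tau> within {0..1})"
proof -
  define T where "T w = (\<lambda>\<tau>. t + integral {0..\<tau>} (\<lambda>\<sigma>. f \<sigma> (w \<sigma>)))" for w :: "real \<Rightarrow> complex"
  define ok where "ok w \<longleftrightarrow> continuous_on {0..1} w \<and> (\<forall>\<tau>\<in>{0..1}. w \<tau> \<in> cball t \<rho>)" for w :: "real \<Rightarrow> complex"
  have contf: "continuous_on {0..1} (\<lambda>\<sigma>. f \<sigma> (w \<sigma>))" if "ok w" for w
  proof -
    have "continuous_on {0..1} (\<lambda>\<sigma>. (\<sigma>, w \<sigma>))"
      using that by (auto simp: ok_def intro!: continuous_intros)
    from continuous_on_compose2[OF cont this] have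
      "(\<lambda>\<sigma>. (\<sigma>, w \<sigma>)) ` {0..1} \<subseteq> {0..1} \<times> cball t \<rho> \<Longrightarrow> continuous_on {0..1} (\<lambda>\<sigma>. f \<sigma> (w \<sigma>))" by simp
    moreover have "(\<lambda>\<sigma>. (\<sigma>, w \<sigma>)) ` {0..1} \<subseteq> {0..1} \<times> cball t \<rho>" using that by (auto simp: ok_def)
    ultimately show ?thesis by blast
  qed
  have intf: "(\<lambda>\<sigma>. f \<sigma> (w \<sigma>)) integrable_on {0..\<tau>}" if "ok w" "\<tau> \<in> {0..1}" for w \<tau>
    using continuous_on_subset[OF contf[OF that(1)], of "{0..\<tau>}"] that(2)
    by (intro integrable_continuous_interval) auto
  have derivT: "(T w has_vector_derivative f \<tau> (w \<tau>)) (at \<tau> within {0..1})" if "ok w" "\<tau> \<in> {0..1}" for w \<tau>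
  proof -
    have "(T w has_vector_derivative 0 + f \<tau> (w \<tau>)) (at \<tau> within {0..1})" unfolding T_def
      by (rule has_vector_derivative_add[OF has_vector_derivative_const
            integral_has_vector_derivative[OF contf[OF that(1)] that(2)]])
    then show ?thesis by simp
  qed
  have intbd: "cmod (integral {0..\<tau>} g) \<le> A" if "continuous_on {0..1} g" "\<tau> \<in> {0..1}"
      "\<And>\<sigma>. \<sigma> \<in> {0..1} \<Longrightarrow> cmod (g \<sigma>) \<le> A" for g :: "real \<Rightarrow> complex" and \<tau> A
  proof -
    have "A \<ge> 0" using order_trans[OF norm_ge_zero that(3)[of 0]] by simp
    have "norm (integral {0..\<tau>} g) \<le> A * (\<tau> - 0)"
      by (rule integral_bound) (use that continuous_on_subset[OF that(1), of "{0..\<tau>}"] in auto)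
    also have "\<dots> \<le> A * 1" using \<open>A \<ge> 0\<close> that(2) by (intro mult_left_mono) auto
    finally show ?thesis by simp
  qed
  have okT: "ok (T w)" if "ok w" for w
    unfolding ok_def
  proof (intro conjI ballI)
    show "continuous_on {0..1} (T w)"
      using derivT[OF that] by (meson continuous_on_eq_continuous_within has_vector_derivative_continuous)
    fix \<tau> :: real assume "\<tau> \<in> {0..1}"
    have "cmod (integral {0..\<tau>} (\<lambda>\<sigma>. f \<sigma> (w \<sigma>))) \<le> \<rho>"
      by (rule intbd[OF contf[OF that] \<open>\<tau> \<in> {0..1}\<close>]) (use bound that in \<open>auto simp: ok_def\<close>)
    then show "T w \<tau> \<in> cball t \<rho>" by (simp add: T_def dist_norm)
  qed
  have lipT: "cmod (T w \<tau> - T w' \<tau>) \<le> A / 2"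
    if "ok w" "ok w'" "\<tau> \<in> {0..1}" "\<And>\<sigma>. \<sigma> \<in> {0..1} \<Longrightarrow> cmod (w \<sigma> - w' \<sigma>) \<le> A" for w w' \<tau> A
  proof -
    have "T w \<tau> - T w' \<tau> = integral {0..\<tau>} (\<lambda>\<sigma>. f \<sigma> (w \<sigma>) - f \<sigma> (w' \<sigma>))"
      using intf[OF that(1,3)] intf[OF that(2,3)] by (simp add: T_def integral_diff)
    also have "cmod \<dots> \<le> A / 2"
    proof (rule intbd[OF _ that(3)])
      show "continuous_on {0..1} (\<lambda>\<sigma>. f \<sigma> (w \<sigma>) - f \<sigma> (w' \<sigma>))"
        by (intro continuous_on_diff contf that)
      fix \<sigma> :: real assume s: "\<sigma> \<in> {0..1}"
      have "cmod (f \<sigma> (w \<sigma>) - f \<sigma> (w' \<sigma>)) \<le> cmod (w \<sigma> - w' \<sigma>) / 2"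
        by (rule lip[OF s]) (use s that in \<open>auto simp: ok_def\<close>)
      then show "cmod (f \<sigma> (w \<sigma>) - f \<sigma> (w' \<sigma>)) \<le> A / 2" using that(4)[OF s] by simp
    qed
    finally show ?thesis .
  qed
  \<comment> \<open>Picard iteration from the constant path. Consecutive iterates differ by at most
    \<rho> * (1/2)^n, so they converge uniformly as a telescoping series.\<close>
  define w where "w n = (T ^^ n) (\<lambda>\<tau>. t)" for n
  have okw: "ok (w n)" for n
    by (induction n) (use okT \<open>\<rho> \<ge> 0\<close> in \<open>auto simp: w_def ok_def\<close>)
  have step: "cmod (w (Suc n) \<tau> - w n \<tau>) \<le> \<rho> * (1/2) ^ n" if "\<tau> \<in> {0..1}" for n \<tau>
    using that
  proof (induction n arbitrary: \<tau>)
    case 0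
    then show ?case using okw[of 1] by (auto simp: ok_def w_def dist_norm norm_minus_commute)
  next
    case (Suc n)
    have "cmod (T (w (Suc n)) \<tau> - T (w n) \<tau>) \<le> (\<rho> * (1/2) ^ n) / 2"
      by (rule lipT[OF okw okw Suc.prems Suc.IH])
    then show ?case by (simp add: w_def)
  qed
  have "summable (\<lambda>n. \<rho> * (1/2) ^ n)" by (intro summable_mult) simp
  then have "uniform_limit {0..1} (\<lambda>n \<tau>. \<Sum>i<n. w (Suc i) \<tau> - w i \<tau>) (\<lambda>\<tau>. \<Sum>i. w (Suc i) \<tau> - w i \<tau>) sequentially"
    by (rule Weierstrass_m_test[rotated]) (rule step)
  moreover have "(\<lambda>n \<tau>. \<Sum>i<n. w (Suc i) \<tau> - w i \<tau>) = (\<lambda>n \<tau>. w n \<tau> - t)"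
  proof (intro ext)
    fix n \<tau> show "(\<Sum>i<n. w (Suc i) \<tau> - w i \<tau>) = w n \<tau> - t"
      using sum_lessThan_telescope[of "\<lambda>i. w i \<tau>" n] by (simp add: w_def)
  qed
  ultimately have ul0: "uniform_limit {0..1} (\<lambda>n \<tau>. w n \<tau> - t) (\<lambda>\<tau>. \<Sum>i. w (Suc i) \<tau> - w i \<tau>) sequentially"
    by (simp only:)
  define W where "W \<tau> = t + (\<Sum>i. w (Suc i) \<tau> - w i \<tau>)" for \<tau>
  have ul: "uniform_limit {0..1} w W sequentially"
  proof (rule uniform_limitI)
    fix e :: real assume "e > 0"
    from uniform_limitD[OF ul0 this] show "\<forall>\<^sub>F n in sequentially. \<forall>x\<in>{0..1}. dist (w n x) (W x) < e"
      by eventually_elim (simp add: W_def dist_norm algebra_simps)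
  qed
  have okW: "ok W" unfolding ok_def
  proof (intro conjI ballI)
    show "continuous_on {0..1} W"
      by (rule uniform_limit_theorem[OF _ ul]) (use okw in \<open>auto simp: ok_def\<close>)
    fix \<tau> :: real assume t: "\<tau> \<in> {0..1}"
    show "W \<tau> \<in> cball t \<rho>"
      by (rule Lim_in_closed_set[OF closed_cball _ _ tendsto_uniform_limitI[OF ul t]])
         (use okw t in \<open>auto simp: ok_def\<close>)
  qed
  have fix_pt: "T W \<tau> = W \<tau>" if t: "\<tau> \<in> {0..1}" for \<tau>
  proof -
    \<comment> \<open>Both terms are compared with a late iterate, which \<open>T\<close> moves to
      the next one.\<close>
    have "cmod (T W \<tau> - W \<tau>) \<le> e" if "e > 0" for e
    proof -
      have "e / 2 > 0" using \<open>e > 0\<close> by simp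
      from uniform_limitD[OF ul this] obtain N where "\<forall>n\<ge>N. \<forall>x\<in>{0..1}. cmod (w n x - W x) < e / 2"
        unfolding eventually_sequentially dist_norm by blast
      then have N: "cmod (w n x - W x) < e / 2" if "n \<ge> N" "x \<in> {0..1}" for n x using that by blast
      have "cmod (T (w N) \<tau> - T W \<tau>) \<le> (e / 2) / 2"
        by (rule lipT[OF okw okW t]) (use N in \<open>auto intro: less_imp_le\<close>)
      moreover have "T (w N) \<tau> = w (Suc N) \<tau>" by (simp add: w_def)
      ultimately show ?thesis
        using N[of "Suc N" \<tau>] t norm_triangle_ineq4[of "w (Suc N) \<tau> - W \<tau>" "T (w N) \<tau> - T W \<tau>"] \<open>e > 0\<close>
        by simp
    qed
    then show ?thesis by (metis dense_ge eq_iff_diff_eq_0 norm_le_zero_iff)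
  qed
  show ?thesis
  proof (rule that[of W])
    show "W 0 = t" using fix_pt[of 0] by (simp add: T_def)
    show "W \<tau> \<in> cball t \<rho>" if "\<tau> \<in> {0..1}" for \<tau> using okW that by (simp add: ok_def)
    show "(W has_vector_derivative f \<tau> (W \<tau>)) (at \<tau> within {0..1})" if "\<tau> \<in> {0..1}" for \<tau>
      by (rule has_vector_derivative_transform[OF that _ derivT[OF okW that]]) (simp add: fix_pt)
  qed
qed

section \<open>Mean value and Gronwall estimates on the unit interval\<close>

lemma has_vector_derivative_bound_unit:
  fixes u :: "real \<Rightarrow> 'a::real_normed_vector"
  assumes "\<And>\<tau>. \<tau> \<in> {0..1} \<Longrightarrow> (u has_vector_derivative u' \<tau>) (at \<tau> within {0..1})"
    and "\<And>\<tau>. \<tau> \<in> {0..1} \<Longrightarrow> norm (u' \<tau>) \<le> A"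
    and "s \<in> {0..1}" "\<tau> \<in> {0..1}"
  shows "norm (u \<tau> - u s) \<le> A * \<bar>\<tau> - s\<bar>"
proof -
  have "norm (u \<tau> - u s) \<le> A * norm (\<tau> - s)"
  proof (rule differentiable_bound[where S="{0..1}" and f'="\<lambda>x h. h *\<^sub>R u' x"])
    fix x :: real assume x: "x \<in> {0..1}"
    show "(u has_derivative (\<lambda>h. h *\<^sub>R u' x)) (at x within {0..1})"
      using assms(1)[OF x] by (simp add: has_vector_derivative_def)
    show "onorm (\<lambda>h. h *\<^sub>R u' x) \<le> A"
      by (rule onorm_le) (use mult_right_mono[OF assms(2)[OF x] abs_ge_zero] in \<open>simp add: mult.commute\<close>)
  qed (use assms in auto)
  then show ?thesis by simp
qed

text \<open>At a time \<open>m\<close> where \<open>norm u\<close> is largest, the change since time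
  \<open>s\<close> is at most norm (u m) / 2 + e, and the half is absorbed on the left. As
  \<open>s\<close> is arbitrary, the estimate also runs backwards in time.\<close>

lemma gronwall_half:
  fixes u :: "real \<Rightarrow> 'a::real_normed_vector"
  assumes "\<And>\<tau>. \<tau> \<in> {0..1} \<Longrightarrow> (u has_vector_derivative u' \<tau>) (at \<tau> within {0..1})"
    and "\<And>\<tau>. \<tau> \<in> {0..1} \<Longrightarrow> norm (u' \<tau>) \<le> norm (u \<tau>) / 2 + e"
    and "s \<in> {0..1}" "\<tau> \<in> {0..1}"
  shows "norm (u \<tau>) \<le> 2 * (norm (u s) + e)"
proof -
  have "continuous_on {0..1} (\<lambda>\<tau>. norm (u \<tau>))"
    using assms(1) by (intro continuous_on_norm)
      (meson continuous_on_eq_continuous_within has_vector_derivative_continuous)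
  then obtain m where m: "m \<in> {0..1}" "\<And>\<tau>. \<tau> \<in> {0..1} \<Longrightarrow> norm (u \<tau>) \<le> norm (u m)"
    using continuous_attains_sup[of "{0..1::real}" "\<lambda>\<tau>. norm (u \<tau>)"] by auto
  have A: "norm (u m - u s) \<le> (norm (u m) / 2 + e) * \<bar>m - s\<bar>"
  proof (rule has_vector_derivative_bound_unit[OF assms(1) _ assms(3) m(1)])
    fix \<tau> :: real assume "\<tau> \<in> {0..1}"
    then show "norm (u' \<tau>) \<le> norm (u m) / 2 + e" using assms(2)[of \<tau>] m(2)[of \<tau>] by simp
  qed
  have "0 \<le> norm (u m) / 2 + e" using order_trans[OF norm_ge_zero assms(2)[OF m(1)]] .
  moreover have "\<bar>m - s\<bar> \<le> 1" using m(1) assms(3) by (auto simp: abs_le_iff)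
  ultimately have "norm (u m - u s) \<le> norm (u m) / 2 + e"
    using A mult_left_mono[of "\<bar>m - s\<bar>" 1 "norm (u m) / 2 + e"] by simp
  then have "norm (u m) \<le> 2 * (norm (u s) + e)"
    using norm_triangle_ineq2[of "u m" "u s"] by simp
  then show ?thesis using m(2)[OF assms(4)] by simp
qed

section \<open>Integral leaves of a field of complex hyperplanes\<close>

text \<open>The hyperplane at \<open>q\<close> is \<open>{v. B q v = 0}\<close>; it is transverse to \<open>b\<close>, and
  \<open>v + B q v *s b\<close> is the projection of \<open>v\<close> to it along \<open>b\<close>. Integrability is only
  available on the part \<open>r = 0\<close>, \<open>\<rho> \<ge> 0\<close>.\<close>

locale hyperplane_field =
  fixes b :: "complex ^ 'n" and B :: "complex ^ 'n \<Rightarrow> complex ^ 'n \<Rightarrow> complex"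
    and DB :: "complex ^ 'n \<Rightarrow> complex ^ 'n \<Rightarrow> complex ^ 'n \<Rightarrow> complex"
    and r \<rho> :: "complex ^ 'n \<Rightarrow> real" and Dr :: "complex ^ 'n \<Rightarrow> complex ^ 'n \<Rightarrow> real" and R C K :: real
  assumes R: "R > 0" and C: "C \<ge> 1" and K: "K \<ge> 0" and b: "norm b = 1"
    and B_add: "\<And>q u v. q \<in> ball 0 R \<Longrightarrow> B q (u + v) = B q u + B q v"
    and B_smult: "\<And>q c v. q \<in> ball 0 R \<Longrightarrow> B q (c *s v) = c * B q v"
    and B_b: "\<And>q. q \<in> ball 0 R \<Longrightarrow> B q b = -1"
    and B_bound: "\<And>q v. q \<in> ball 0 R \<Longrightarrow> cmod (B q v) \<le> C * norm v"
    and B_lip: "\<And>q q' v. q \<in> ball 0 R \<Longrightarrow> q' \<in> ball 0 R \<Longrightarrow>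
        cmod (B q v - B q' v) \<le> K * norm (q - q') * norm v"
    and B_deriv: "\<And>q v. q \<in> ball 0 R \<Longrightarrow> ((\<lambda>q. B q v) has_derivative (\<lambda>u. DB q u v)) (at q)"
    and B_unif: "\<And>v e. e > 0 \<Longrightarrow> \<exists>d>0. \<forall>q\<in>ball 0 R. \<forall>q'\<in>ball 0 R. dist q q' < d \<longrightarrow>
        cmod (B q' v - B q v - DB q (q' - q) v) \<le> e * norm (q' - q)"
    and r_deriv: "\<And>q. q \<in> ball 0 R \<Longrightarrow> (r has_derivative Dr q) (at q)"
    and r_B: "\<And>q v. q \<in> ball 0 R \<Longrightarrow> Dr q (v + B q v *s b) = 0"
    and integrable: "\<And>q u v. q \<in> ball 0 R \<Longrightarrow> r q = 0 \<Longrightarrow> \<rho> q \<ge> 0 \<Longrightarrow>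
        DB q (u + B q u *s b) v = DB q (v + B q v *s b) u"
begin

text \<open>A lift along \<open>b\<close> of the segment from \<open>z\<close> to
  \<open>z + v\<close>. The lifted curve has velocity v + B v *s b and is therefore tangent to the
  hyperplanes; \<open>w\<close> is its displacement along \<open>b\<close>.\<close>

definition lpath :: "complex ^ 'n \<Rightarrow> complex ^ 'n \<Rightarrow> (real \<Rightarrow> complex) \<Rightarrow> bool" where
  "lpath z v w \<longleftrightarrow> (\<forall>\<tau>\<in>{0..1}. z + \<tau> *\<^sub>R v + w \<tau> *s b \<in> ball 0 R \<and>
     (w has_vector_derivative B (z + \<tau> *\<^sub>R v + w \<tau> *s b) v) (at \<tau> within {0..1}))"

lemma B_scaleR: "q \<in> ball 0 R \<Longrightarrow> B q (c *\<^sub>R v) = of_real c * B q v"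
  using B_smult[of q "of_real c" v] by (simp add: of_real_cvec_smult)

lemma B_minus: "q \<in> ball 0 R \<Longrightarrow> B q (- v) = - B q v"
  using B_scaleR[of q "-1" v] by simp

lemma B_diff: "q \<in> ball 0 R \<Longrightarrow> B q (u - v) = B q u - B q v"
  using B_add[of q u "- v"] B_minus[of q v] by simp

text \<open>The first hypothesis keeps every candidate curve in the ball, the second is the
  contraction condition of the Picard iteration.\<close>

lemma lpath_exists:
  assumes "norm z + norm v + cmod t + C * norm v < R" "K * norm v \<le> 1 / 2"
  obtains w where "lpath z v w" "w 0 = t" "\<And>\<tau>. \<tau> \<in> {0..1} \<Longrightarrow> cmod (w \<tau> - t) \<le> C * norm v"
proof -
  have inR: "z + \<tau> *\<^sub>R v + w *s b \<in> ball 0 R" if "\<tau> \<in> {0..1}" "w \<in> cball t (C * norm v)" for \<tau> w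
  proof -
    have "norm (z + \<tau> *\<^sub>R v + w *s b) \<le> norm z + \<bar>\<tau>\<bar> * norm v + cmod w"
      using norm_triangle_ineq[of "z + \<tau> *\<^sub>R v" "w *s b"] norm_triangle_ineq[of z "\<tau> *\<^sub>R v"]
      by (simp add: norm_cvec_smult b)
    moreover have "\<bar>\<tau>\<bar> * norm v \<le> norm v" using that by (simp add: mult_left_le_one_le)
    moreover have "cmod w \<le> cmod t + C * norm v"
      using that norm_triangle_ineq2[of w t] by (simp add: dist_norm norm_minus_commute)
    ultimately show ?thesis using assms by simp
  qed
  have contB: "continuous_on (ball 0 R) (\<lambda>q. B q v)"
    by (intro continuous_at_imp_continuous_on ballI has_derivative_continuous[OF B_deriv])
  obtain w where w: "w 0 = t" "\<And>\<tau>. \<tau> \<in> {0..1} \<Longrightarrow> w \<tau> \<in> cball t (C * norm v)"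
    "\<And>\<tau>. \<tau> \<in> {0..1} \<Longrightarrow> (w has_vector_derivative B (z + \<tau> *\<^sub>R v + w \<tau> *s b) v) (at \<tau> within {0..1})"
  proof (rule picard_unit_interval[of t "C * norm v" "\<lambda>\<tau> w. B (z + \<tau> *\<^sub>R v + w *s b) v"])
    have "continuous_on ({0..1} \<times> cball t (C * norm v)) (\<lambda>p. z + fst p *\<^sub>R v + snd p *s b)"
      by (intro continuous_intros bounded_linear.continuous_on[OF bounded_linear_cvec_smult_left])
    then show "continuous_on ({0..1} \<times> cball t (C * norm v)) (\<lambda>(\<tau>, w). B (z + \<tau> *\<^sub>R v + w *s b) v)"
      unfolding case_prod_unfold by (rule continuous_on_compose2[OF contB]) (use inR in auto)
    show "cmod (B (z + \<tau> *\<^sub>R v + w *s b) v) \<le> C * norm v" if "\<tau> \<in> {0..1}" "w \<in> cball t (C * norm v)" for \<tau> w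
      by (rule B_bound[OF inR[OF that]])
    show "cmod (B (z + \<tau> *\<^sub>R v + w *s b) v - B (z + \<tau> *\<^sub>R v + w' *s b) v) \<le> cmod (w - w') / 2"
      if "\<tau> \<in> {0..1}" "w \<in> cball t (C * norm v)" "w' \<in> cball t (C * norm v)" for \<tau> w w'
    proof -
      have eq: "(z + \<tau> *\<^sub>R v + w *s b) - (z + \<tau> *\<^sub>R v + w' *s b) = (w - w') *s b"
        by (simp add: vector_sub_rdistrib)
      have "cmod (B (z + \<tau> *\<^sub>R v + w *s b) v - B (z + \<tau> *\<^sub>R v + w' *s b) v) \<le> K * cmod (w - w') * norm v"
        using B_lip[OF inR[OF that(1,2)] inR[OF that(1,3)], of v] unfolding eq by (simp only: norm_cvec_smult b mult_1_right)
      also have "\<dots> \<le> (1/2) * cmod (w - w')"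
        using mult_right_mono[OF assms(2) norm_ge_zero, of "w - w'"] by (simp add: mult.commute mult.left_commute)
      finally show ?thesis by simp
    qed
    show "0 \<le> C * norm v" using C by simp
  qed blast
  show ?thesis
    by (rule that[of w]) (use w inR in \<open>auto simp: lpath_def dist_norm norm_minus_commute\<close>)
qed

lemma lpath_in: "lpath z v w \<Longrightarrow> \<tau> \<in> {0..1} \<Longrightarrow> z + \<tau> *\<^sub>R v + w \<tau> *s b \<in> ball 0 R"
  and lpath_deriv: "lpath z v w \<Longrightarrow> \<tau> \<in> {0..1} \<Longrightarrow>
     (w has_vector_derivative B (z + \<tau> *\<^sub>R v + w \<tau> *s b) v) (at \<tau> within {0..1})"
  by (auto simp: lpath_def)

text \<open>Gronwall's estimate for the difference of two lifts. The change of direction enters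
  mainly through \<beta>, because in the direction \<open>a\<close> the field will be of size
  \<epsilon> and not \<open>C\<close>; its norm only appears with the small factor
  \<open>K * norm v\<close>.\<close>

lemma lpath_compare:
  assumes "lpath z v w" "lpath z' v' w'" "K * norm v \<le> 1 / 2" "s \<in> {0..1}" "\<tau> \<in> {0..1}"
    and \<beta>: "\<And>q. q \<in> ball 0 R \<Longrightarrow> cmod (B q (v' - v)) \<le> \<beta>"
  shows "cmod (w' \<tau> - w \<tau>) \<le> 2 * (cmod (w' s - w s) + (\<beta> + K * norm v * (norm (z' - z) + norm (v' - v))))"
proof (rule gronwall_half[OF _ _ assms(4,5), where u="\<lambda>\<tau>. w' \<tau> - w \<tau>"])
  fix \<tau> :: real assume t: "\<tau> \<in> {0..1}"
  let ?p = "z + \<tau> *\<^sub>R v + w \<tau> *s b" and ?p' = "z' + \<tau> *\<^sub>R v' + w' \<tau> *s b"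
  note p = lpath_in[OF assms(1) t] and p' = lpath_in[OF assms(2) t]
  show "((\<lambda>\<tau>. w' \<tau> - w \<tau>) has_vector_derivative B ?p' v' - B ?p v) (at \<tau> within {0..1})"
    by (intro has_vector_derivative_diff lpath_deriv assms t)
  have eq: "?p' - ?p = (z' - z) + \<tau> *\<^sub>R (v' - v) + (w' \<tau> - w \<tau>) *s b"
    by (simp add: algebra_simps vector_sub_rdistrib)
  have "norm ((w' \<tau> - w \<tau>) *s b) = cmod (w' \<tau> - w \<tau>)"
    by (simp only: norm_cvec_smult b mult_1_right)
  then have "norm (?p' - ?p) \<le> norm (z' - z) + \<bar>\<tau>\<bar> * norm (v' - v) + cmod (w' \<tau> - w \<tau>)"
    unfolding eq
    using norm_triangle_ineq[of "(z' - z) + \<tau> *\<^sub>R (v' - v)" "(w' \<tau> - w \<tau>) *s b"]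
      norm_triangle_ineq[of "z' - z" "\<tau> *\<^sub>R (v' - v)"] unfolding norm_scaleR by linarith
  moreover have "\<bar>\<tau>\<bar> * norm (v' - v) \<le> norm (v' - v)" using t by (simp add: mult_left_le_one_le)
  ultimately have d: "norm (?p' - ?p) \<le> norm (z' - z) + norm (v' - v) + cmod (w' \<tau> - w \<tau>)" by simp
  have "cmod (B ?p' v - B ?p v) \<le> K * norm v * norm (?p' - ?p)"
    using B_lip[OF p' p, of v] by (simp add: mult.commute mult.left_commute)
  also have "\<dots> \<le> K * norm v * (norm (z' - z) + norm (v' - v) + cmod (w' \<tau> - w \<tau>))"
    using d K by (intro mult_left_mono) auto
  also have "\<dots> \<le> K * norm v * (norm (z' - z) + norm (v' - v)) + cmod (w' \<tau> - w \<tau>) / 2"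
    using mult_right_mono[OF assms(3) norm_ge_zero, of "w' \<tau> - w \<tau>"] by (simp add: distrib_left)
  finally have 1: "cmod (B ?p' v - B ?p v) \<le> K * norm v * (norm (z' - z) + norm (v' - v)) + cmod (w' \<tau> - w \<tau>) / 2" .
  have eq: "B ?p' v' - B ?p v = B ?p' (v' - v) + (B ?p' v - B ?p v)" using B_diff[OF p'] by simp
  show "cmod (B ?p' v' - B ?p v) \<le> cmod (w' \<tau> - w \<tau>) / 2 + (\<beta> + K * norm v * (norm (z' - z) + norm (v' - v)))"
    unfolding eq using norm_triangle_ineq[of "B ?p' (v' - v)" "B ?p' v - B ?p v"] 1 \<beta>[OF p'] by linarith
qed

lemma lpath_unique:
  assumes "lpath z v w" "lpath z v w'" "K * norm v \<le> 1 / 2" "w' 0 = w 0" "\<tau> \<in> {0..1}"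
  shows "w' \<tau> = w \<tau>"
proof -
  have "B q 0 = 0" if "q \<in> ball 0 R" for q using B_smult[OF that, of 0 0] by simp
  then have "cmod (w' \<tau> - w \<tau>) \<le> 2 * (cmod (w' 0 - w 0) + (0 + K * norm v * (norm (z - z) + norm (v - v))))"
    by (intro lpath_compare[OF assms(1,2,3) _ assms(5)]) auto
  then show ?thesis using assms(4) by simp
qed

text \<open>Serves to follow a leaf from a given point back to the base point and to read off its
  parameter there.\<close>

lemma lpath_reverse:
  assumes "lpath z v w"
  shows "lpath (z + v) (- v) (\<lambda>\<tau>. w (1 - \<tau>))"
  unfolding lpath_def
proof (intro ballI conjI)
  fix \<tau> :: real assume "\<tau> \<in> {0..1}"
  then have t': "1 - \<tau> \<in> {0..1}" by auto
  have eq: "z + v + \<tau> *\<^sub>R (- v) + w (1 - \<tau>) *s b = z + (1 - \<tau>) *\<^sub>R v + w (1 - \<tau>) *s b"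
    by (simp add: algebra_simps)
  show in_R: "z + v + \<tau> *\<^sub>R (- v) + w (1 - \<tau>) *s b \<in> ball 0 R"
    unfolding eq by (rule lpath_in[OF assms t'])
  have "((w \<circ> (\<lambda>\<tau>. 1 - \<tau>)) has_vector_derivative ((-1) *\<^sub>R B (z + (1 - \<tau>) *\<^sub>R v + w (1 - \<tau>) *s b) v)) (at \<tau> within {0..1})"
  proof (rule vector_diff_chain_within)
    show "((\<lambda>\<tau>. 1 - \<tau>) has_vector_derivative -1) (at \<tau> within {0..1})"
      by (auto intro!: derivative_eq_intros)
    show "(w has_vector_derivative B (z + (1 - \<tau>) *\<^sub>R v + w (1 - \<tau>) *s b) v) (at (1 - \<tau>) within (\<lambda>\<tau>. 1 - \<tau>) ` {0..1})"
      by (rule has_vector_derivative_within_subset[OF lpath_deriv[OF assms t']]) auto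
  qed
  then show "((\<lambda>\<tau>. w (1 - \<tau>)) has_vector_derivative B (z + v + \<tau> *\<^sub>R (- v) + w (1 - \<tau>) *s b) (- v)) (at \<tau> within {0..1})"
    using B_minus[OF in_R, of v] unfolding eq by (simp add: o_def)
qed

text \<open>The lifted curve stays the same; because of \<open>B q b = -1\<close> only its splitting
  into segment and displacement changes. This yields the behaviour of the leaf functions under
  translation along \<open>b\<close>.\<close>

lemma lpath_shift:
  assumes "lpath z v w"
  shows "lpath z (v + c *s b) (\<lambda>\<tau>. w \<tau> - of_real \<tau> * c)"
  unfolding lpath_def
proof (intro ballI conjI)
  fix \<tau> :: real assume t: "\<tau> \<in> {0..1}"
  have eq: "z + \<tau> *\<^sub>R (v + c *s b) + (w \<tau> - of_real \<tau> * c) *s b = z + \<tau> *\<^sub>R v + w \<tau> *s b"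
    by (simp add: vec_eq_iff algebra_simps scaleR_conv_of_real[where 'a=complex])
  show "z + \<tau> *\<^sub>R (v + c *s b) + (w \<tau> - of_real \<tau> * c) *s b \<in> ball 0 R"
    unfolding eq by (rule lpath_in[OF assms t])
  have "((\<lambda>\<tau>. w \<tau> - of_real \<tau> * c) has_vector_derivative B (z + \<tau> *\<^sub>R v + w \<tau> *s b) v - c) (at \<tau> within {0..1})"
  proof (intro has_vector_derivative_diff lpath_deriv[OF assms t])
    have "((\<lambda>\<tau>. \<tau> *\<^sub>R c) has_vector_derivative c) (at \<tau> within {0..1})"
      by (auto intro!: derivative_eq_intros)
    then show "((\<lambda>\<tau>. of_real \<tau> * c) has_vector_derivative c) (at \<tau> within {0..1})"
      by (simp add: scaleR_conv_of_real)
  qed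
  then show "((\<lambda>\<tau>. w \<tau> - of_real \<tau> * c) has_vector_derivative
      B (z + \<tau> *\<^sub>R (v + c *s b) + (w \<tau> - of_real \<tau> * c) *s b) (v + c *s b)) (at \<tau> within {0..1})"
    unfolding eq using lpath_in[OF assms t] by (simp add: B_add B_smult B_b)
qed

lemma lpath_point_deriv:
  assumes "lpath z v w" "\<tau> \<in> {0..1}"
  shows "((\<lambda>\<tau>. z + \<tau> *\<^sub>R v + w \<tau> *s b) has_vector_derivative
     v + B (z + \<tau> *\<^sub>R v + w \<tau> *s b) v *s b) (at \<tau> within {0..1})"
proof -
  have 1: "((\<lambda>\<tau>. w \<tau> *s b) has_vector_derivative B (z + \<tau> *\<^sub>R v + w \<tau> *s b) v *s b) (at \<tau> within {0..1})"
    by (rule bounded_linear.has_vector_derivative[OF bounded_linear_cvec_smult_left lpath_deriv[OF assms]])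
  have 2: "((\<lambda>\<tau>. z + \<tau> *\<^sub>R v) has_vector_derivative v) (at \<tau> within {0..1})"
    by (auto intro!: derivative_eq_intros)
  show ?thesis by (rule has_vector_derivative_add[OF 2 1])
qed

text \<open>By \<open>r_B\<close> lifts are tangent to the level sets of \<open>r\<close>, so a lift
  that starts on the hypersurface r = 0 never leaves it.\<close>

lemma lpath_r:
  assumes "lpath z v w" "\<tau> \<in> {0..1}"
  shows "r (z + \<tau> *\<^sub>R v + w \<tau> *s b) = r (z + w 0 *s b)"
proof -
  have "norm (r (z + \<tau> *\<^sub>R v + w \<tau> *s b) - r (z + 0 *\<^sub>R v + w 0 *s b)) \<le> 0 * \<bar>\<tau> - 0\<bar>"
  proof (rule has_vector_derivative_bound_unit[where u="\<lambda>\<tau>. r (z + \<tau> *\<^sub>R v + w \<tau> *s b)" and u'="\<lambda>\<tau>. 0"])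
    fix \<tau> :: real assume t: "\<tau> \<in> {0..1}"
    let ?p = "z + \<tau> *\<^sub>R v + w \<tau> *s b"
    note p = lpath_in[OF assms(1) t]
    have "((\<lambda>\<tau>. r (z + \<tau> *\<^sub>R v + w \<tau> *s b)) has_derivative (\<lambda>h. Dr ?p (h *\<^sub>R (v + B ?p v *s b)))) (at \<tau> within {0..1})"
      by (rule has_derivative_compose[OF lpath_point_deriv[OF assms(1) t, unfolded has_vector_derivative_def] r_deriv[OF p]])
    moreover have "Dr ?p (h *\<^sub>R (v + B ?p v *s b)) = 0" for h
      using r_B[OF p, of v] has_derivative_linear[OF r_deriv[OF p]] by (simp add: linear_cmul)
    ultimately show "((\<lambda>\<tau>. r (z + \<tau> *\<^sub>R v + w \<tau> *s b)) has_vector_derivative 0) (at \<tau> within {0..1})"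
      by (simp add: has_vector_derivative_def)
  qed (use assms in auto)
  then show ?thesis by simp
qed

text \<open>The Frobenius argument: to first order in \<open>h\<close>, the curve \<open>w \<tau> + \<tau> * B (p \<tau>) h\<close> solves the
  initial value problem of the neighbouring ray, exactly because of integrability.\<close>
lemma lpath_tangent:
  assumes w: "lpath z v w" and v: "K * norm v \<le> 1 / 4"
    and flat: "\<And>\<tau>. \<tau> \<in> {0..1} \<Longrightarrow> r (z + \<tau> *\<^sub>R v + w \<tau> *s b) = 0 \<and> \<rho> (z + \<tau> *\<^sub>R v + w \<tau> *s b) \<ge> 0"
    and "e > 0"
  obtains d where "d > 0" "\<And>h w'. norm h < d \<Longrightarrow> lpath z (v + h) w' \<Longrightarrow> w' 0 = w 0 \<Longrightarrow>
      cmod (w' 1 - w 1 - B (z + v + w 1 *s b) h) \<le> e * norm h"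
proof -
  define p where "p \<tau> = z + \<tau> *\<^sub>R v + w \<tau> *s b" for \<tau>
  note p = lpath_in[OF w, folded p_def]
  have "continuous_on {0..1} (\<lambda>\<tau>. norm (p \<tau>))"
    using lpath_point_deriv[OF w, folded p_def]
    by (intro continuous_on_norm) (meson continuous_on_eq_continuous_within has_vector_derivative_continuous)
  then obtain s where s: "s \<in> {0..1}" "\<And>\<tau>. \<tau> \<in> {0..1} \<Longrightarrow> norm (p \<tau>) \<le> norm (p s)"
    using continuous_attains_sup[of "{0..1::real}" "\<lambda>\<tau>. norm (p \<tau>)"] by auto
  define m where "m = R - norm (p s)"
  have "m > 0" using p[OF s(1)] by (simp add: m_def)
  \<comment> \<open>Chosen from the end: the final error is at most 4 * (1 + C) * e' * norm h, where
    \<open>1 + C\<close> bounds how far \<open>h\<close> displaces the curve.\<close>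
  define e' where "e' = e / 4 / (1 + C)"
  have "e' > 0" using \<open>e > 0\<close> C by (simp add: e'_def)
  from B_unif[OF this, of v] obtain d0 where d0: "d0 > 0"
    "\<And>q q'. q \<in> ball 0 R \<Longrightarrow> q' \<in> ball 0 R \<Longrightarrow> dist q q' < d0 \<Longrightarrow>
        cmod (B q' v - B q v - DB q (q' - q) v) \<le> e' * norm (q' - q)" by blast
  \<comment> \<open>The first part keeps the displaced curve in the ball and within
    \<open>d0\<close> of the old one; the second bounds \<open>K * norm h\<close> by
    \<open>e'\<close> and by 1/4.\<close>
  define d where "d = min (min m d0 / (1 + C)) (min e' (1/4) / (K + 1))"
  have "d > 0" using \<open>m > 0\<close> d0(1) \<open>e' > 0\<close> C K by (simp add: d_def)
  have "cmod (w' 1 - w 1 - B (z + v + w 1 *s b) h) \<le> e * norm h"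
    if h: "norm h < d" and w': "lpath z (v + h) w'" and w0: "w' 0 = w 0" for h w'
  proof -
    have "norm h * (1 + C) < min m d0" and "norm h * (K + 1) < min e' (1/4)"
      using h C K by (auto simp: d_def pos_less_divide_eq)
    then have h1: "(1 + C) * norm h < m" "(1 + C) * norm h < d0" and h2: "(K + 1) * norm h < e'" "(K + 1) * norm h < 1/4"
      by (auto simp: mult.commute)
    have "K * norm h \<le> (K + 1) * norm h" by (simp add: distrib_right)
    then have h3: "K * norm h \<le> e'" "K * norm h \<le> 1/4" using h2 by linarith+
    have vh: "K * norm (v + h) \<le> 1/2"
      using v h3(2) mult_left_mono[OF norm_triangle_ineq[of v h] K] by (simp add: distrib_left)
    define c where "c \<tau> = w \<tau> + of_real \<tau> * B (p \<tau>) h" for \<tau>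
    define X where "X u \<tau> = u + B (p \<tau>) u *s b" for u \<tau>
    have cder: "(c has_vector_derivative B (p \<tau>) v + (B (p \<tau>) h + of_real \<tau> * DB (p \<tau>) (X v \<tau>) h)) (at \<tau> within {0..1})"
      if t: "\<tau> \<in> {0..1}" for \<tau>
    proof -
      have "((\<lambda>\<tau>. B (p \<tau>) h) has_derivative (\<lambda>s. DB (p \<tau>) (s *\<^sub>R X v \<tau>) h)) (at \<tau> within {0..1})"
        unfolding X_def p_def
        by (rule has_derivative_compose[OF lpath_point_deriv[OF w t, unfolded has_vector_derivative_def] B_deriv[OF lpath_in[OF w t]]])
      moreover have "DB (p \<tau>) (s *\<^sub>R X v \<tau>) h = s *\<^sub>R DB (p \<tau>) (X v \<tau>) h" for s
        by (rule linear_cmul[OF has_derivative_linear[OF B_deriv[OF p[OF t]]]])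
      ultimately have 1: "((\<lambda>\<tau>. B (p \<tau>) h) has_vector_derivative DB (p \<tau>) (X v \<tau>) h) (at \<tau> within {0..1})"
        by (simp add: has_vector_derivative_def)
      have 2: "((\<lambda>\<tau>. complex_of_real \<tau>) has_vector_derivative 1) (at \<tau> within {0..1})"
        by (auto intro!: derivative_eq_intros)
      have "((\<lambda>\<tau>. of_real \<tau> * B (p \<tau>) h) has_vector_derivative
           (of_real \<tau> * DB (p \<tau>) (X v \<tau>) h + 1 * B (p \<tau>) h)) (at \<tau> within {0..1})"
        by (rule has_vector_derivative_mult[OF 2 1])
      from has_vector_derivative_add[OF lpath_deriv[OF w t] this] show ?thesis
        unfolding c_def p_def by (simp add: add.commute)
    qed
    define E where "E = (1 + C) * norm h * (e' + K * norm h)"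
    have "cmod (w' 1 - c 1) \<le> 2 * (cmod (w' 0 - c 0) + E)"
    proof (rule gronwall_half[where u="\<lambda>\<tau>. w' \<tau> - c \<tau>"])
      fix \<tau> :: real assume t: "\<tau> \<in> {0..1}"
      let ?p' = "z + \<tau> *\<^sub>R (v + h) + w' \<tau> *s b"
      define q where "q = z + \<tau> *\<^sub>R (v + h) + c \<tau> *s b"
      note p' = lpath_in[OF w' t]
      show "((\<lambda>\<tau>. w' \<tau> - c \<tau>) has_vector_derivative B ?p' (v + h) -
          (B (p \<tau>) v + (B (p \<tau>) h + of_real \<tau> * DB (p \<tau>) (X v \<tau>) h))) (at \<tau> within {0..1})"
        by (intro has_vector_derivative_diff lpath_deriv w' t cder)
      have qp: "q - p \<tau> = \<tau> *\<^sub>R X h \<tau>"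
        by (simp add: q_def p_def c_def X_def vec_eq_iff algebra_simps scaleR_conv_of_real[where 'a=complex])
      have "norm (X h \<tau>) \<le> norm h + C * norm h"
        unfolding X_def using norm_triangle_ineq[of h "B (p \<tau>) h *s b"] B_bound[OF p[OF t], of h]
        by (simp add: norm_cvec_smult b)
      then have nX: "norm (X h \<tau>) \<le> (1 + C) * norm h" by (simp add: distrib_right)
      have nq: "norm (q - p \<tau>) \<le> (1 + C) * norm h"
      proof -
        have "\<bar>\<tau>\<bar> * norm (X h \<tau>) \<le> 1 * norm (X h \<tau>)" using t by (intro mult_right_mono) auto
        then show ?thesis using nX by (simp add: qp)
      qed
      have q: "q \<in> ball 0 R"
        using norm_triangle_ineq[of "p \<tau>" "q - p \<tau>"] nq h1(1) s(2)[OF t] by (simp add: m_def)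
      have pq: "dist (p \<tau>) q < d0" using nq h1(2) by (simp add: dist_norm norm_minus_commute)
      have I1: "cmod (B ?p' (v + h) - B q (v + h)) \<le> cmod (w' \<tau> - c \<tau>) / 2"
      proof -
        have "?p' - q = (w' \<tau> - c \<tau>) *s b" by (simp add: q_def vector_sub_rdistrib)
        then have "cmod (B ?p' (v + h) - B q (v + h)) \<le> K * norm (v + h) * cmod (w' \<tau> - c \<tau>)"
          using B_lip[OF p' q, of "v + h"] by (simp only: norm_cvec_smult b mult_1_right mult.commute mult.left_commute)
        also have "\<dots> \<le> 1/2 * cmod (w' \<tau> - c \<tau>)" using vh by (intro mult_right_mono) auto
        finally show ?thesis by simp
      qed
      have I2: "cmod (B q v - B (p \<tau>) v - DB (p \<tau>) (q - p \<tau>) v) \<le> e' * ((1 + C) * norm h)"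
        using d0(2)[OF p[OF t] q pq] nq \<open>e' > 0\<close> by (meson mult_left_mono less_imp_le order_trans)
      have I3: "cmod (B q h - B (p \<tau>) h) \<le> K * ((1 + C) * norm h) * norm h"
        using B_lip[OF q p[OF t], of h] mult_right_mono[OF mult_left_mono[OF nq K] norm_ge_zero[of h]] by simp
      \<comment> \<open>Here integrability enters: the change of the field under the displacement by
        \<open>h\<close> is exchanged for the change of \<open>B (p \<tau>) h\<close> along the
        curve, which is what differentiating \<open>c\<close> produced.\<close>
      have I4: "DB (p \<tau>) (q - p \<tau>) v = of_real \<tau> * DB (p \<tau>) (X v \<tau>) h"
      proof -
        have "DB (p \<tau>) (q - p \<tau>) v = \<tau> *\<^sub>R DB (p \<tau>) (X h \<tau>) v"
          unfolding qp by (rule linear_cmul[OF has_derivative_linear[OF B_deriv[OF p[OF t]]]])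
        also have "DB (p \<tau>) (X h \<tau>) v = DB (p \<tau>) (X v \<tau>) h"
          unfolding X_def using integrable[OF p[OF t]] flat[OF t] by (simp add: p_def)
        finally show ?thesis by (simp add: scaleR_conv_of_real)
      qed
      have eq: "B ?p' (v + h) - (B (p \<tau>) v + (B (p \<tau>) h + of_real \<tau> * DB (p \<tau>) (X v \<tau>) h)) =
        (B ?p' (v + h) - B q (v + h)) + (B q v - B (p \<tau>) v - DB (p \<tau>) (q - p \<tau>) v) + (B q h - B (p \<tau>) h)"
        using B_add[OF q, of v h] by (simp add: I4)
      have "cmod (B ?p' (v + h) - (B (p \<tau>) v + (B (p \<tau>) h + of_real \<tau> * DB (p \<tau>) (X v \<tau>) h)))
         \<le> cmod (w' \<tau> - c \<tau>) / 2 + e' * ((1 + C) * norm h) + K * ((1 + C) * norm h) * norm h"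
        unfolding eq using norm_triangle_ineq[of "(B ?p' (v + h) - B q (v + h)) + (B q v - B (p \<tau>) v - DB (p \<tau>) (q - p \<tau>) v)" "B q h - B (p \<tau>) h"]
          norm_triangle_ineq[of "B ?p' (v + h) - B q (v + h)" "B q v - B (p \<tau>) v - DB (p \<tau>) (q - p \<tau>) v"] I1 I2 I3
        by linarith
      also have "\<dots> = cmod (w' \<tau> - c \<tau>) / 2 + E" by (simp add: E_def algebra_simps)
      finally show "cmod (B ?p' (v + h) - (B (p \<tau>) v + (B (p \<tau>) h + of_real \<tau> * DB (p \<tau>) (X v \<tau>) h)))
         \<le> cmod (w' \<tau> - c \<tau>) / 2 + E" .
    qed auto
    also have "\<dots> = 2 * E" by (simp add: c_def w0)
    finally have fin: "cmod (w' 1 - c 1) \<le> 2 * E" .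
    have "E \<le> (1 + C) * norm h * (2 * e')"
      unfolding E_def using h3(1) C by (intro mult_left_mono) auto
    then have "2 * E \<le> 4 * ((1 + C) * e') * norm h" by (simp add: algebra_simps)
    also have "(1 + C) * e' = e / 4" using C unfolding e'_def by (intro nonzero_mult_div_cancel_left[of "1 + C", folded times_divide_eq_right]) simp
    also have "4 * (e / 4) * norm h = e * norm h" by simp
    finally show ?thesis using fin by (simp add: c_def p_def diff_diff_add)
  qed
  then show ?thesis using that \<open>d > 0\<close> by blast
qed

end

text \<open>\<open>a\<close> lies almost in the hyperplanes, \<rho> is almost its linear part
  \<open>l\<close>, and i a points towards \<rho> > 0. The condition on
  \<open>\<epsilon> * C1\<close> makes errors of order \<epsilon> remain small after applying
  \<open>l\<close>. By \<open>r_ib\<close> the hypersurface r = 0 is met at most once in the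
  direction i b.\<close>

locale leaf_chart = hyperplane_field b B DB r \<rho> Dr R C K
  for b :: "complex ^ 'n" and B DB r \<rho> Dr R C K +
  fixes a :: "complex ^ 'n" and l :: "complex ^ 'n \<Rightarrow> real" and C1 \<epsilon> :: real
  assumes a: "norm a = 1" and \<epsilon>: "0 < \<epsilon>" "\<epsilon> * C1 \<le> 1 / 100" and C1: "C1 \<ge> 1"
    and B_a: "\<And>q. q \<in> ball 0 R \<Longrightarrow> cmod (B q a) \<le> \<epsilon>"
    and l_lin: "linear l" and l_bound: "\<And>v. \<bar>l v\<bar> \<le> C1 * norm v" and l_ia: "l (\<i> *s a) = 1"
    and \<rho>_approx: "\<And>q q'. q \<in> ball 0 R \<Longrightarrow> q' \<in> ball 0 R \<Longrightarrow>
        \<bar>\<rho> q - \<rho> q' - l (q - q')\<bar> \<le> \<epsilon> * norm (q - q')"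
    and r_ib: "\<And>q y. q \<in> ball 0 R \<Longrightarrow> q + (\<i> * of_real y) *s b \<in> ball 0 R \<Longrightarrow>
        r q = 0 \<Longrightarrow> r (q + (\<i> * of_real y) *s b) = 0 \<Longrightarrow> y = 0"
begin

lemma \<epsilon>_small: "\<epsilon> \<le> 1 / 100"
proof -
  have "\<epsilon> * 1 \<le> \<epsilon> * C1" by (rule mult_left_mono[OF C1]) (use \<epsilon> in simp)
  then show ?thesis using \<epsilon>(2) by linarith
qed

text \<open>The leaf with parameter \<open>t\<close> passes through \<open>z0 + t *s b\<close>, over
  a base point \<open>z0\<close> in the direction i a; \<open>G t z\<close> is its displacement
  along \<open>b\<close> over \<open>z\<close>, found by lifting the segment from \<open>z0\<close>
  to \<open>z\<close>. Translation along \<open>b\<close> then shows the leaf to be the zero set of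
  \<open>G t\<close>. The parameter \<open>t m\<close> of the leaf through \<open>m\<close> is found
  by lifting the segment from \<open>m\<close> back to \<open>z0\<close>.\<close>

lemma leaf_family:
  obtains \<delta> :: real and t :: "complex ^ 'n \<Rightarrow> complex" and G :: "complex \<Rightarrow> complex ^ 'n \<Rightarrow> complex"
  where "\<delta> > 0"
    and "\<And>m. m \<in> ball 0 \<delta> \<Longrightarrow> G (t m) m = 0"
    and "\<And>m z z'. m \<in> ball 0 \<delta> \<Longrightarrow> z \<in> ball 0 \<delta> \<Longrightarrow> z' \<in> ball 0 \<delta> \<Longrightarrow>
        cmod (G (t m) z - G (t m) z') \<le> 4 * C * norm (z - z')"
    and "\<And>m z \<xi>. m \<in> ball 0 \<delta> \<Longrightarrow> z \<in> ball 0 \<delta> \<Longrightarrow> z + \<xi> *s a \<in> ball 0 \<delta> \<Longrightarrow>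
        cmod (G (t m) (z + \<xi> *s a) - G (t m) z) \<le> 4 * \<epsilon> * cmod \<xi>"
    and "\<And>m z c. m \<in> ball 0 \<delta> \<Longrightarrow> z \<in> ball 0 \<delta> \<Longrightarrow> z + c *s b \<in> ball 0 \<delta> \<Longrightarrow>
        G (t m) (z + c *s b) = G (t m) z - c"
    and "\<And>m z. m \<in> ball 0 \<delta> \<Longrightarrow> z \<in> ball 0 \<delta> \<Longrightarrow> z + G (t m) z *s b \<in> ball 0 R"
    and "\<And>m z. m \<in> ball 0 \<delta> \<Longrightarrow> z \<in> ball 0 \<delta> \<Longrightarrow> r (z + G (t m) z *s b) = r m"
    and "\<And>m z. m \<in> ball 0 \<delta> \<Longrightarrow> z \<in> ball 0 \<delta> \<Longrightarrow> r m = 0 \<Longrightarrow> \<rho> (z + G (t m) z *s b) \<ge> 0 \<Longrightarrow>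
        (G (t m) has_derivative B (z + G (t m) z *s b)) (at z)"
    and "\<And>m m'. m \<in> ball 0 \<delta> \<Longrightarrow> m' \<in> ball 0 \<delta> \<Longrightarrow> cmod (t m - t m') \<le> 2 * cmod (G (t m) m')"
proof -
  \<comment> \<open>The distance of the base point from the origin: small against \<open>R\<close>,
    so that lifts stay in the ball, and against \<epsilon> / K, so that the field hardly varies
    along a segment.\<close>
  define \<delta>1 where "\<delta>1 = min (R / (8 * C)) (\<epsilon> / (8 * (K + 1)))"
  \<comment> \<open>With this radius the endpoint \<open>z\<close> contributes at most C * \<delta>
    = \<epsilon> * \<delta>1 to the speed of the lift, no more than the bound for
    \<open>z0\<close>.\<close>
  define \<delta> where "\<delta> = \<epsilon> * \<delta>1 / C"
  have \<delta>1: "\<delta>1 > 0" "8 * C * \<delta>1 \<le> R" "8 * K * \<delta>1 \<le> \<epsilon>"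
  proof -
    show "\<delta>1 > 0" using R C K \<epsilon> by (simp add: \<delta>1_def)
    then have p: "0 \<le> \<delta>1" by simp
    have "\<delta>1 \<le> R / (8 * C)" by (simp add: \<delta>1_def)
    then show "8 * C * \<delta>1 \<le> R" using C by (simp add: field_simps)
    have "\<delta>1 \<le> \<epsilon> / (8 * (K + 1))" by (simp add: \<delta>1_def)
    then have "8 * (K + 1) * \<delta>1 \<le> \<epsilon>" using K by (simp add: field_simps)
    then show "8 * K * \<delta>1 \<le> \<epsilon>" using p by (simp add: algebra_simps)
  qed
  have C\<delta>: "C * \<delta> = \<epsilon> * \<delta>1" using C by (simp add: \<delta>_def)
  have \<delta>: "\<delta> > 0" "\<delta> \<le> \<delta>1" "\<delta> \<le> \<epsilon> * \<delta>1"
  proof -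
    show "\<delta> > 0" using \<delta>1 \<epsilon> C by (simp add: \<delta>_def)
    then show "\<delta> \<le> \<epsilon> * \<delta>1" using mult_right_mono[OF C, of \<delta>] C\<delta> by simp
    also have "\<dots> \<le> 1 * \<delta>1" using \<epsilon>_small \<delta>1 by (intro mult_right_mono) auto
    finally show "\<delta> \<le> \<delta>1" by simp
  qed
  define z0 where "z0 = (\<i> * of_real \<delta>1) *s a"
  have nz0: "norm z0 = \<delta>1" using \<delta>1 by (simp add: z0_def norm_cvec_smult a norm_mult)
  have nv: "norm (z - z0) \<le> 2 * \<delta>1" if "z \<in> ball 0 \<delta>" for z
    using norm_triangle_ineq4[of z z0] that nz0 \<delta> by simp
  have Kv: "K * norm (z - z0) \<le> \<epsilon> / 4" if "z \<in> ball 0 \<delta>" for z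
    using mult_left_mono[OF nv[OF that] K] \<delta>1(3) by simp
  have Kv2: "K * norm (z - z0) \<le> 1 / 4" if "z \<in> ball 0 \<delta>" for z
    using Kv[OF that] \<epsilon>_small by simp
  define T where "T = 2 * C * \<delta>1"
  have Cv: "C * norm (z - z0) \<le> T" if "z \<in> ball 0 \<delta>" for z
    using mult_left_mono[OF nv[OF that], of C] C by (simp add: T_def)
  have \<delta>1T: "\<delta>1 \<le> T / 2" using C \<delta>1 by (simp add: T_def)
  have TR: "4 * T \<le> R" using \<delta>1 by (simp add: T_def)
  have T0: "T > 0" using \<delta>1T \<delta>1 by simp
  define W where "W t z = (SOME w. lpath z0 (z - z0) w \<and> w 0 = t)" for t z
  define G where "G t z = W t z 1" for t z
  have W: "lpath z0 (z - z0) (W t z) \<and> W t z 0 = t" if "z \<in> ball 0 \<delta>" "cmod t \<le> T" for t z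
  proof -
    have "norm z0 + norm (z - z0) + cmod t + C * norm (z - z0) < R"
      using nz0 nv[OF that(1)] that(2) Cv[OF that(1)] \<delta>1T TR T0 by linarith
    moreover have "K * norm (z - z0) \<le> 1 / 2" using Kv2[OF that(1)] by simp
    ultimately have "\<exists>w. lpath z0 (z - z0) w \<and> w 0 = t" using lpath_exists by metis
    then show ?thesis unfolding W_def by (rule someI_ex)
  qed
  have "\<exists>w. lpath m (z0 - m) w \<and> w 0 = 0 \<and> cmod (w 1) \<le> T" if m: "m \<in> ball 0 \<delta>" for m
  proof -
    have "norm m + norm (z0 - m) + cmod 0 + C * norm (z0 - m) < R"
      using m \<delta>(2) nv[OF m] Cv[OF m] \<delta>1T TR T0 by (simp add: norm_minus_commute)
    moreover have "K * norm (z0 - m) \<le> 1 / 2" using Kv2[OF m] by (simp add: norm_minus_commute)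
    ultimately obtain w where w: "lpath m (z0 - m) w" "w 0 = 0"
      "\<And>\<tau>. \<tau> \<in> {0..1} \<Longrightarrow> cmod (w \<tau> - 0) \<le> C * norm (z0 - m)" using lpath_exists by metis
    have "cmod (w 1 - 0) \<le> C * norm (z0 - m)" by (rule w(3)) simp
    then have "cmod (w 1) \<le> T" using Cv[OF m] by (simp add: norm_minus_commute)
    with w(1,2) show ?thesis by blast
  qed
  then obtain w0 where w0: "\<And>m. m \<in> ball 0 \<delta> \<Longrightarrow> lpath m (z0 - m) (w0 m) \<and> w0 m 0 = 0 \<and> cmod (w0 m 1) \<le> T"
    by metis
  define t where "t m = w0 m 1" for m
  have tT: "cmod (t m) \<le> T" if "m \<in> ball 0 \<delta>" for m using w0[OF that] by (simp add: t_def)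
  note Wm = W[OF _ tT]
  \<comment> \<open>By uniqueness the lift chosen in \<open>W\<close> is the reverse of the one that
    defined \<open>t m\<close>; its endpoint gives \<open>G (t m) m = 0\<close>.\<close>
  have rev: "W (t m) m \<tau> = w0 m (1 - \<tau>)" if m: "m \<in> ball 0 \<delta>" "\<tau> \<in> {0..1}" for m \<tau>
  proof -
    have "lpath z0 (m - z0) (\<lambda>\<tau>. w0 m (1 - \<tau>))"
      using lpath_reverse[of m "z0 - m" "w0 m"] w0[OF m(1)] by simp
    from lpath_unique[OF this _ _ _ m(2), of "W (t m) m"] Wm[OF m(1) m(1)] Kv2[OF m(1)]
    show ?thesis by (simp add: t_def)
  qed
  have G0: "G (t m) m = 0" if "m \<in> ball 0 \<delta>" for m
    using rev[OF that, of 1] w0[OF that] by (simp add: G_def)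
  have Gdiff: "cmod (G (t m) z' - G (t m) z) \<le> 2 * (\<beta> + \<epsilon> / 4 * norm (z' - z))"
    if "m \<in> ball 0 \<delta>" "z \<in> ball 0 \<delta>" "z' \<in> ball 0 \<delta>" "\<And>q. q \<in> ball 0 R \<Longrightarrow> cmod (B q (z' - z)) \<le> \<beta>" for m z z' \<beta>
  proof -
    have "cmod (W (t m) z' 1 - W (t m) z 1) \<le> 2 * (cmod (W (t m) z' 0 - W (t m) z 0) +
        (\<beta> + K * norm (z - z0) * (norm (z0 - z0) + norm ((z' - z0) - (z - z0)))))"
      by (rule lpath_compare) (use Wm[OF that(2,1)] Wm[OF that(3,1)] Kv2[OF that(2)] that(4) in auto)
    also have "\<dots> \<le> 2 * (\<beta> + \<epsilon> / 4 * norm (z' - z))"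
      using Wm[OF that(2,1)] Wm[OF that(3,1)] mult_right_mono[OF Kv[OF that(2)] norm_ge_zero, of "z' - z"] by simp
    finally show ?thesis by (simp add: G_def)
  qed
  have inR: "z + G (t m) z *s b \<in> ball 0 R" if "m \<in> ball 0 \<delta>" "z \<in> ball 0 \<delta>" for m z
    using lpath_in[of z0 "z - z0" "W (t m) z" 1] Wm[OF that(2,1)] by (simp add: G_def)
  have rG: "r (z + G (t m) z *s b) = r (z0 + t m *s b)" if "m \<in> ball 0 \<delta>" "z \<in> ball 0 \<delta>" for m z
    using lpath_r[of z0 "z - z0" "W (t m) z" 1] Wm[OF that(2,1)] by (simp add: G_def)
  have rm: "r (z0 + t m *s b) = r m" if "m \<in> ball 0 \<delta>" for m
    using rG[OF that that] G0[OF that] by simp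
  show ?thesis
  proof (rule that[of \<delta> G t])
    show "\<delta> > 0" by fact
    show "G (t m) m = 0" if "m \<in> ball 0 \<delta>" for m by (rule G0[OF that])
    show "z + G (t m) z *s b \<in> ball 0 R" if "m \<in> ball 0 \<delta>" "z \<in> ball 0 \<delta>" for m z by (rule inR[OF that])
    show "r (z + G (t m) z *s b) = r m" if "m \<in> ball 0 \<delta>" "z \<in> ball 0 \<delta>" for m z
      using rG[OF that] rm[OF that(1)] by simp
    show "cmod (G (t m) z - G (t m) z') \<le> 4 * C * norm (z - z')"
      if "m \<in> ball 0 \<delta>" "z \<in> ball 0 \<delta>" "z' \<in> ball 0 \<delta>" for m z z'
    proof -
      have "cmod (G (t m) z - G (t m) z') \<le> 2 * (C * norm (z - z') + \<epsilon> / 4 * norm (z - z'))"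
        by (rule Gdiff) (use that B_bound in auto)
      also have "\<epsilon> / 4 * norm (z - z') \<le> C * norm (z - z')"
        using \<epsilon>_small C by (intro mult_right_mono) auto
      finally show ?thesis by simp
    qed
    show "cmod (G (t m) (z + \<xi> *s a) - G (t m) z) \<le> 4 * \<epsilon> * cmod \<xi>"
      if "m \<in> ball 0 \<delta>" "z \<in> ball 0 \<delta>" "z + \<xi> *s a \<in> ball 0 \<delta>" for m z \<xi>
    proof -
      have "cmod (G (t m) (z + \<xi> *s a) - G (t m) z) \<le> 2 * (\<epsilon> * cmod \<xi> + \<epsilon> / 4 * norm (z + \<xi> *s a - z))"
      proof (rule Gdiff[OF that])
        fix q :: "complex ^ 'n" assume q: "q \<in> ball 0 R"
        show "cmod (B q (z + \<xi> *s a - z)) \<le> \<epsilon> * cmod \<xi>"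
          using mult_right_mono[OF B_a[OF q] norm_ge_zero[of \<xi>]]
          by (simp only: add_diff_cancel_left' B_smult[OF q] norm_mult mult.commute)
      qed
      also have "norm (z + \<xi> *s a - z) = cmod \<xi>" by (simp add: norm_cvec_smult a)
      finally have "cmod (G (t m) (z + \<xi> *s a) - G (t m) z) \<le> 5 / 2 * (\<epsilon> * cmod \<xi>)" by simp
      moreover have "0 \<le> \<epsilon> * cmod \<xi>" using \<epsilon> by simp
      ultimately show ?thesis by simp
    qed
    show "G (t m) (z + c *s b) = G (t m) z - c"
      if "m \<in> ball 0 \<delta>" "z \<in> ball 0 \<delta>" "z + c *s b \<in> ball 0 \<delta>" for m z c
    proof -
      have "lpath z0 (z - z0 + c *s b) (\<lambda>\<tau>. W (t m) z \<tau> - of_real \<tau> * c)"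
        using lpath_shift Wm[OF that(2,1)] by blast
      then have 1: "lpath z0 (z + c *s b - z0) (\<lambda>\<tau>. W (t m) z \<tau> - of_real \<tau> * c)" by (simp add: algebra_simps)
      have "W (t m) (z + c *s b) 1 = W (t m) z 1 - of_real 1 * c"
        by (rule lpath_unique[OF 1]) (use Wm[OF that(3,1)] Wm[OF that(2,1)] Kv2[OF that(3)] in auto)
      then show ?thesis by (simp add: G_def)
    qed
    \<comment> \<open>Gronwall backwards: over the same segment the two lifts end at
      \<open>G (t m) m'\<close> and at 0, and start at the two parameters.\<close>
    show "cmod (t m - t m') \<le> 2 * cmod (G (t m) m')" if "m \<in> ball 0 \<delta>" "m' \<in> ball 0 \<delta>" for m m'
    proof -
      have B0: "B q (m' - z0 - (m' - z0)) = 0" if "q \<in> ball 0 R" for q using B_smult[OF that, of 0 0] by simp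
      have "cmod (W (t m) m' 0 - W (t m') m' 0) \<le> 2 * (cmod (W (t m) m' 1 - W (t m') m' 1) +
          (0 + K * norm (m' - z0) * (norm (z0 - z0) + norm ((m' - z0) - (m' - z0)))))"
        by (rule lpath_compare) (use Wm[OF that(2,1)] Wm[OF that(2,2)] Kv2[OF that(2)] B0 in auto)
      then show ?thesis using Wm[OF that(2,1)] Wm[OF that(2,2)] G0[OF that(2)] by (simp add: G_def)
    qed
    show "(G (t m) has_derivative B (z + G (t m) z *s b)) (at z)"
      if m: "m \<in> ball 0 \<delta>" and z: "z \<in> ball 0 \<delta>" and "r m = 0" and pos: "\<rho> (z + G (t m) z *s b) \<ge> 0" for m z
    proof -
      have nz: "norm z \<le> \<delta>" "0 \<le> C" "0 \<le> C1" using z C C1 by auto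
      define w where "w = W (t m) z"
      have w: "lpath z0 (z - z0) w" "w 0 = t m" using Wm[OF z m] by (auto simp: w_def)
      define p where "p \<tau> = z0 + \<tau> *\<^sub>R (z - z0) + w \<tau> *s b" for \<tau>
      have p1: "p 1 = z + G (t m) z *s b" by (simp add: p_def w_def G_def)
      note pR = lpath_in[OF w(1), folded p_def]
      \<comment> \<open>Going back from the endpoint towards \<open>z0\<close>, \<rho> grows at a
        rate close to \<delta>1, because the direction is almost that of i a. So the whole lift
        stays in the region where the field is integrable.\<close>
      have flat: "r (p \<tau>) = 0 \<and> \<rho> (p \<tau>) \<ge> 0" if t: "\<tau> \<in> {0..1}" for \<tau>
      proof
        show "r (p \<tau>) = 0" using lpath_r[OF w(1) t] w(2) rm[OF m] \<open>r m = 0\<close> by (simp add: p_def)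
        define s where "s = 1 - \<tau>"
        have s: "s \<ge> 0" using t by (simp add: s_def)
        have "norm (w \<tau> - w 1) \<le> (2 * \<epsilon> * \<delta>1) * \<bar>\<tau> - 1\<bar>"
        proof (rule has_vector_derivative_bound_unit[OF lpath_deriv[OF w(1)]])
          fix x :: real assume x: "x \<in> {0..1}"
          have q: "p x \<in> ball 0 R" by (rule pR[OF x])
          have "cmod (B (p x) (z - z0)) \<le> cmod (B (p x) z) + cmod (B (p x) z0)"
            by (simp add: B_diff[OF q] norm_triangle_ineq4)
          moreover have "cmod (B (p x) z) \<le> C * \<delta>"
            using B_bound[OF q, of z] mult_left_mono[OF nz(1,2)] by linarith
          moreover have "cmod (B (p x) z0) \<le> \<epsilon> * \<delta>1"
          proof -
            have "cmod (B (p x) z0) = cmod (B (p x) a) * \<delta>1" using \<delta>1(1) by (simp add: z0_def B_smult[OF q] norm_mult)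
            then show ?thesis using mult_right_mono[OF B_a[OF q], of \<delta>1] \<delta>1(1) by linarith
          qed
          ultimately show "cmod (B (z0 + x *\<^sub>R (z - z0) + w x *s b) (z - z0)) \<le> 2 * \<epsilon> * \<delta>1"
            by (simp add: p_def C\<delta>)
        qed (use t in auto)
        then have wd: "cmod (w \<tau> - w 1) \<le> 2 * \<epsilon> * \<delta>1 * s" using t by (simp add: s_def)
        define e where "e = (w \<tau> - w 1) *s b"
        have ne: "norm e \<le> 2 * \<epsilon> * \<delta>1 * s" using wd by (simp only: e_def norm_cvec_smult b mult_1_right)
        have pd: "p \<tau> - p 1 = s *\<^sub>R (z0 - z) + e"
          by (simp add: p_def e_def s_def algebra_simps vector_sub_rdistrib)
        have "l z0 = \<delta>1"
        proof -
          have "z0 = \<delta>1 *\<^sub>R (\<i> *s a)" by (simp add: z0_def vec_eq_iff scaleR_conv_of_real[where 'a=complex])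
          then show ?thesis by (simp add: linear_cmul[OF l_lin] l_ia)
        qed
        then have "l (p \<tau> - p 1) = s * (\<delta>1 - l z) + l e"
          unfolding pd by (simp add: linear_add[OF l_lin] linear_cmul[OF l_lin] linear_diff[OF l_lin])
        moreover have "\<bar>l z\<bar> \<le> \<delta>1 / 100"
        proof -
          have "\<bar>l z\<bar> \<le> C1 * \<delta>" using l_bound[of z] mult_left_mono[OF nz(1,3)] by linarith
          also have "\<dots> \<le> C1 * (\<epsilon> * \<delta>1)" using \<delta>(3) C1 by (intro mult_left_mono) auto
          also have "\<dots> = (\<epsilon> * C1) * \<delta>1" by simp
          also have "\<dots> \<le> 1 / 100 * \<delta>1" using \<epsilon>(2) \<delta>1 by (intro mult_right_mono) auto
          finally show ?thesis by simp
        qed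
        moreover have "\<bar>l e\<bar> \<le> s * (\<delta>1 / 50)"
        proof -
          have "\<bar>l e\<bar> \<le> C1 * (2 * \<epsilon> * \<delta>1 * s)" using l_bound[of e] mult_left_mono[OF ne nz(3)] by linarith
          also have "\<dots> = (\<epsilon> * C1) * (2 * \<delta>1 * s)" by simp
          also have "\<dots> \<le> 1 / 100 * (2 * \<delta>1 * s)" using \<epsilon>(2) \<delta>1 s by (intro mult_right_mono) auto
          finally show ?thesis by (simp add: mult.commute)
        qed
        moreover have "\<epsilon> * norm (p \<tau> - p 1) \<le> s * (\<delta>1 / 20)"
        proof -
          have "norm (p \<tau> - p 1) \<le> s * norm (z0 - z) + norm e"
            unfolding pd using norm_triangle_ineq[of "s *\<^sub>R (z0 - z)" e] s by simp
          also have "\<dots> \<le> s * (2 * \<delta>1) + 2 * \<epsilon> * \<delta>1 * s"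
            using ne mult_left_mono[OF nv[OF z] s] by (simp add: norm_minus_commute)
          also have "\<dots> = (2 + 2 * \<epsilon>) * (\<delta>1 * s)" by (simp add: algebra_simps)
          also have "\<dots> \<le> 3 * (\<delta>1 * s)" using \<epsilon>_small \<delta>1 s by (intro mult_right_mono) auto
          finally have "\<epsilon> * norm (p \<tau> - p 1) \<le> 1/100 * (3 * (\<delta>1 * s))"
            using \<epsilon>_small \<epsilon> by (intro mult_mono) auto
          also have "\<dots> \<le> s * (\<delta>1 / 20)" using \<delta>1 s by simp
          finally show ?thesis .
        qed
        moreover have "\<bar>\<rho> (p \<tau>) - \<rho> (p 1) - l (p \<tau> - p 1)\<bar> \<le> \<epsilon> * norm (p \<tau> - p 1)"
          by (rule \<rho>_approx[OF pR[OF t] pR]) simp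
        moreover have "s * (\<delta>1 / 100) \<ge> s * l z" using \<open>\<bar>l z\<bar> \<le> \<delta>1 / 100\<close> s by (intro mult_left_mono) auto
        moreover have "\<rho> (p 1) \<ge> 0" using pos p1 by simp
        moreover have "s * \<delta>1 \<ge> 0" using s \<delta>1 by simp
        ultimately show "\<rho> (p \<tau>) \<ge> 0" by (simp add: right_diff_distrib)
      qed
      have blin: "bounded_linear (B (p 1))"
      proof (rule bounded_linear_intro[of _ C])
        have q: "p 1 \<in> ball 0 R" by (rule pR) simp
        show "B (p 1) (x + y) = B (p 1) x + B (p 1) y" for x y by (rule B_add[OF q])
        show "B (p 1) (c *\<^sub>R x) = c *\<^sub>R B (p 1) x" for c x by (simp add: B_scaleR[OF q] scaleR_conv_of_real[where 'a=complex])
        show "norm (B (p 1) x) \<le> norm x * C" for x using B_bound[OF q, of x] by (simp add: mult.commute)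
      qed
      have "(G (t m) has_derivative B (p 1)) (at z)"
        unfolding has_derivative_at_alt
      proof (intro conjI blin allI impI)
        fix e :: real assume "e > 0"
        obtain d where d: "d > 0" "\<And>h w'. norm h < d \<Longrightarrow> lpath z0 (z - z0 + h) w' \<Longrightarrow> w' 0 = w 0 \<Longrightarrow>
            cmod (w' 1 - w 1 - B (z0 + (z - z0) + w 1 *s b) h) \<le> e * norm h"
          using lpath_tangent[OF w(1) Kv2[OF z] flat[unfolded p_def] \<open>e > 0\<close>] by blast
        have "cmod (G (t m) y - G (t m) z - B (p 1) (y - z)) \<le> e * norm (y - z)"
          if y: "norm (y - z) < min d (\<delta> - norm z)" for y
        proof -
          have yb: "y \<in> ball 0 \<delta>" using y norm_triangle_ineq[of z "y - z"] by simp
          have "lpath z0 (z - z0 + (y - z)) (W (t m) y)" "W (t m) y 0 = w 0" using Wm[OF yb m] w(2) by auto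
          from d(2)[OF _ this] y show ?thesis by (simp add: G_def w_def p_def)
        qed
        then show "\<exists>d>0. \<forall>y. norm (y - z) < d \<longrightarrow> norm (G (t m) y - G (t m) z - B (p 1) (y - z)) \<le> e * norm (y - z)"
          using d(1) z by (intro exI[of _ "min d (\<delta> - norm z)"]) auto
      qed
      then show ?thesis by (simp only: p1)
    qed
  qed
qed

end

section \<open>Extension of a leaf across the boundary\<close>

text \<open>Iterating \<Psi> from the constant \<open>c\<close> gives maps that are holomorphic by
  \<open>hol\<close> and converge uniformly to the fixed point. Since \<open>c\<close> is within
  \<sigma> / 4 of all the fixed points, the iterates stay in the region of contraction.\<close>

lemma holomorphic_fixpoint:
  fixes \<eta> :: "complex \<Rightarrow> complex \<times> complex"
  assumes fp: "\<And>\<zeta>. \<zeta> \<in> ball \<zeta>0 \<tau> \<Longrightarrow> \<Psi> \<zeta> (\<eta> \<zeta>) = \<eta> \<zeta>"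
    and near: "\<And>\<zeta>. \<zeta> \<in> ball \<zeta>0 \<tau> \<Longrightarrow> norm (\<eta> \<zeta> - c) \<le> \<sigma> / 4" and "\<sigma> > 0"
    and contr: "\<And>\<zeta> u u'. \<zeta> \<in> ball \<zeta>0 \<tau> \<Longrightarrow> norm (u - c) \<le> \<sigma> \<Longrightarrow> norm (u' - c) \<le> \<sigma> \<Longrightarrow>
        norm (\<Psi> \<zeta> u - \<Psi> \<zeta> u') \<le> norm (u - u') / 2"
    and hol: "\<And>f. (\<lambda>\<zeta>. fst (f \<zeta>)) holomorphic_on ball \<zeta>0 \<tau> \<Longrightarrow> (\<lambda>\<zeta>. snd (f \<zeta>)) holomorphic_on ball \<zeta>0 \<tau> \<Longrightarrow>
        (\<And>\<zeta>. \<zeta> \<in> ball \<zeta>0 \<tau> \<Longrightarrow> norm (f \<zeta> - c) \<le> \<sigma>) \<Longrightarrow>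
        (\<lambda>\<zeta>. fst (\<Psi> \<zeta> (f \<zeta>))) holomorphic_on ball \<zeta>0 \<tau> \<and> (\<lambda>\<zeta>. snd (\<Psi> \<zeta> (f \<zeta>))) holomorphic_on ball \<zeta>0 \<tau>"
  shows "(\<lambda>\<zeta>. fst (\<eta> \<zeta>)) holomorphic_on ball \<zeta>0 \<tau>" "(\<lambda>\<zeta>. snd (\<eta> \<zeta>)) holomorphic_on ball \<zeta>0 \<tau>"
proof -
  define f where "f n = ((\<lambda>g \<zeta>. \<Psi> \<zeta> (g \<zeta>)) ^^ n) (\<lambda>\<zeta>. c)" for n
  have f: "(\<lambda>\<zeta>. fst (f n \<zeta>)) holomorphic_on ball \<zeta>0 \<tau> \<and> (\<lambda>\<zeta>. snd (f n \<zeta>)) holomorphic_on ball \<zeta>0 \<tau> \<and>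
     (\<forall>\<zeta>\<in>ball \<zeta>0 \<tau>. norm (f n \<zeta> - \<eta> \<zeta>) \<le> \<sigma> / 4 * (1/2) ^ n \<and> norm (f n \<zeta> - c) \<le> \<sigma>)" for n
  proof (induction n)
    case 0
    then show ?case using near \<open>\<sigma> > 0\<close> by (auto simp: f_def norm_minus_commute)
  next
    case (Suc n)
    have S: "f (Suc n) = (\<lambda>\<zeta>. \<Psi> \<zeta> (f n \<zeta>))" by (simp add: f_def)
    have "norm (f (Suc n) \<zeta> - \<eta> \<zeta>) \<le> \<sigma> / 4 * (1/2) ^ Suc n \<and> norm (f (Suc n) \<zeta> - c) \<le> \<sigma>"
      if z: "\<zeta> \<in> ball \<zeta>0 \<tau>" for \<zeta>
    proof -
      have "norm (\<Psi> \<zeta> (f n \<zeta>) - \<Psi> \<zeta> (\<eta> \<zeta>)) \<le> norm (f n \<zeta> - \<eta> \<zeta>) / 2"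
        by (rule contr[OF z]) (use Suc z near[OF z] \<open>\<sigma> > 0\<close> in auto)
      also have "\<dots> \<le> (\<sigma> / 4 * (1/2) ^ n) / 2" by (rule divide_right_mono) (use Suc z in blast, simp)
      also have "\<dots> = \<sigma> / 4 * (1/2) ^ Suc n" by simp
      finally have 1: "norm (f (Suc n) \<zeta> - \<eta> \<zeta>) \<le> \<sigma> / 4 * (1/2) ^ Suc n" by (simp add: S fp[OF z])
      have "(1/2::real) ^ Suc n \<le> 1" by (rule power_le_one) auto
      then have "\<sigma> / 4 * (1/2) ^ Suc n \<le> \<sigma> / 4 * 1" using \<open>\<sigma> > 0\<close> by (intro mult_left_mono) auto
      then have "norm (f (Suc n) \<zeta> - \<eta> \<zeta>) \<le> \<sigma> / 4" using 1 by simp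
      then have "norm (f (Suc n) \<zeta> - c) \<le> \<sigma>"
        using norm_triangle_ineq[of "f (Suc n) \<zeta> - \<eta> \<zeta>" "\<eta> \<zeta> - c"] near[OF z] \<open>\<sigma> > 0\<close> by simp
      with 1 show ?thesis by blast
    qed
    moreover have "(\<lambda>\<zeta>. fst (f (Suc n) \<zeta>)) holomorphic_on ball \<zeta>0 \<tau> \<and> (\<lambda>\<zeta>. snd (f (Suc n) \<zeta>)) holomorphic_on ball \<zeta>0 \<tau>"
      unfolding S by (rule hol) (use Suc in auto)
    ultimately show ?case by blast
  qed
  have lim: "\<forall>\<^sub>F n in sequentially. \<forall>\<zeta>\<in>ball \<zeta>0 \<tau>. norm (f n \<zeta> - \<eta> \<zeta>) < e" if "e > 0" for e
  proof -
    have "(\<lambda>n. \<sigma> / 4 * (1/2) ^ n) \<longlonglongrightarrow> \<sigma> / 4 * 0" by (intro tendsto_mult tendsto_const LIMSEQ_power_zero) auto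
    then have "\<forall>\<^sub>F n in sequentially. \<sigma> / 4 * (1/2) ^ n < e" using \<open>e > 0\<close> by (intro order_tendstoD(2)) auto
    then show ?thesis by eventually_elim (use f in \<open>blast intro: le_less_trans\<close>)
  qed
  have gen: "(\<lambda>\<zeta>. P (\<eta> \<zeta>)) holomorphic_on ball \<zeta>0 \<tau>"
    if "\<And>n. (\<lambda>\<zeta>. P (f n \<zeta>)) holomorphic_on ball \<zeta>0 \<tau>" "\<And>x y. dist (P x) (P y) \<le> dist x y" for P :: "complex \<times> complex \<Rightarrow> complex"
  proof (rule holomorphic_uniform_sequence[OF open_ball that(1)])
    fix x assume "x \<in> ball \<zeta>0 \<tau>"
    then obtain d where d: "d > 0" "cball x d \<subseteq> ball \<zeta>0 \<tau>" using open_contains_cball open_ball by metis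
    have "uniform_limit (cball x d) (\<lambda>n \<zeta>. P (f n \<zeta>)) (\<lambda>\<zeta>. P (\<eta> \<zeta>)) sequentially"
    proof (rule uniform_limitI)
      fix e :: real assume "e > 0"
      from lim[OF this] show "\<forall>\<^sub>F n in sequentially. \<forall>\<zeta>\<in>cball x d. dist (P (f n \<zeta>)) (P (\<eta> \<zeta>)) < e"
      proof eventually_elim
        case (elim n)
        then show ?case using d that(2) le_less_trans by (metis dist_norm subsetD)
      qed
    qed
    with d show "\<exists>d>0. cball x d \<subseteq> ball \<zeta>0 \<tau> \<and>
      uniform_limit (cball x d) (\<lambda>n \<zeta>. P (f n \<zeta>)) (\<lambda>\<zeta>. P (\<eta> \<zeta>)) sequentially" by blast
  qed
  show "(\<lambda>\<zeta>. fst (\<eta> \<zeta>)) holomorphic_on ball \<zeta>0 \<tau>" by (rule gen) (use f dist_fst_le in auto)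
  show "(\<lambda>\<zeta>. snd (\<eta> \<zeta>)) holomorphic_on ball \<zeta>0 \<tau>" by (rule gen) (use f dist_snd_le in auto)
qed

section \<open>Schwarz reflection of Lipschitz functions\<close>

definition schwarz_refl :: "(complex \<Rightarrow> complex) \<Rightarrow> complex \<Rightarrow> complex" where
  "schwarz_refl f \<zeta> = (if 0 \<le> Im \<zeta> then f \<zeta> else cnj (f (cnj \<zeta>)))"

text \<open>Points on opposite sides are compared through the real point x = Re \<zeta>'. With d =
  cmod (\<zeta> - \<zeta>') its distances to them are at most d and 2 * d, which gives the factor 3.
  Reality on the axis makes both halves agree at \<open>x\<close>.\<close>

lemma schwarz_refl_Lipschitz:
  assumes lip: "\<And>\<zeta> \<zeta>'. \<zeta> \<in> ball 0 s \<Longrightarrow> \<zeta>' \<in> ball 0 s \<Longrightarrow> cmod (f \<zeta> - f \<zeta>') \<le> c * cmod (\<zeta> - \<zeta>')"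
    and real: "\<And>x. complex_of_real x \<in> ball 0 s \<Longrightarrow> f (of_real x) \<in> \<real>" and "c \<ge> 0"
    and "\<zeta> \<in> ball 0 s" "\<zeta>' \<in> ball 0 s"
  shows "cmod (schwarz_refl f \<zeta> - schwarz_refl f \<zeta>') \<le> 3 * c * cmod (\<zeta> - \<zeta>')"
proof -
  have mixed: "cmod (f \<zeta> - cnj (f (cnj \<zeta>'))) \<le> 3 * c * cmod (\<zeta> - \<zeta>')"
    if "Im \<zeta> \<ge> 0" "Im \<zeta>' < 0" "\<zeta> \<in> ball 0 s" "\<zeta>' \<in> ball 0 s" for \<zeta> \<zeta>'
  proof -
    define x where "x = complex_of_real (Re \<zeta>')"
    have x: "x \<in> ball 0 s" using that(4) abs_Re_le_cmod[of \<zeta>'] by (simp add: x_def)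
    have "cmod (\<zeta>' - x) = \<bar>Im \<zeta>'\<bar>" by (simp add: x_def cmod_def)
    also have "\<dots> \<le> \<bar>Im (\<zeta> - \<zeta>')\<bar>" using that by simp
    also have "\<dots> \<le> cmod (\<zeta> - \<zeta>')" by (rule abs_Im_le_cmod)
    finally have 1: "cmod (\<zeta>' - x) \<le> cmod (\<zeta> - \<zeta>')" .
    then have 2: "cmod (\<zeta> - x) \<le> 2 * cmod (\<zeta> - \<zeta>')"
      using norm_triangle_ineq[of "\<zeta> - \<zeta>'" "\<zeta>' - x"] by simp
    have "cnj x = x" by (simp add: x_def)
    have "cnj (f x) = f x" using real[of "Re \<zeta>'"] x by (auto simp: x_def Reals_cnj_iff)
    then have "cmod (f x - cnj (f (cnj \<zeta>'))) = cmod (f x - f (cnj \<zeta>'))"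
      by (metis complex_cnj_diff complex_mod_cnj)
    also have "\<dots> \<le> c * cmod (x - cnj \<zeta>')" by (rule lip) (use x that in auto)
    also have "cmod (x - cnj \<zeta>') = cmod (\<zeta>' - x)"
      using \<open>cnj x = x\<close> by (metis complex_cnj_diff complex_mod_cnj norm_minus_commute)
    finally have "cmod (f x - cnj (f (cnj \<zeta>'))) \<le> c * cmod (\<zeta> - \<zeta>')"
      using mult_left_mono[OF 1 \<open>c \<ge> 0\<close>] by simp
    moreover have "cmod (f \<zeta> - f x) \<le> c * (2 * cmod (\<zeta> - \<zeta>'))"
      using lip[OF that(3) x] mult_left_mono[OF 2 \<open>c \<ge> 0\<close>] by simp
    ultimately show ?thesis using norm_triangle_ineq[of "f \<zeta> - f x" "f x - cnj (f (cnj \<zeta>'))"] by simp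
  qed
  have w: "c * cmod (\<zeta> - \<zeta>') \<le> 3 * c * cmod (\<zeta> - \<zeta>')" using \<open>c \<ge> 0\<close> by (intro mult_right_mono) auto
  consider "Im \<zeta> \<ge> 0" "Im \<zeta>' \<ge> 0" | "Im \<zeta> \<ge> 0" "Im \<zeta>' < 0" | "Im \<zeta> < 0" "Im \<zeta>' \<ge> 0" | "Im \<zeta> < 0" "Im \<zeta>' < 0"
    by linarith
  then show ?thesis
  proof cases
    case 1 then show ?thesis using lip[OF assms(4,5)] w by (simp add: schwarz_refl_def)
  next
    case 2 then show ?thesis using mixed[OF 2 assms(4,5)] by (simp add: schwarz_refl_def)
  next
    case 3 then show ?thesis using mixed[OF 3(2,1) assms(5,4)] by (simp add: schwarz_refl_def norm_minus_commute)
  next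
    case 4
    have "cmod (cnj (f (cnj \<zeta>)) - cnj (f (cnj \<zeta>'))) = cmod (f (cnj \<zeta>) - f (cnj \<zeta>'))"
      by (metis complex_cnj_diff complex_mod_cnj)
    also have "\<dots> \<le> c * cmod (cnj \<zeta> - cnj \<zeta>')" by (rule lip) (use assms in auto)
    also have "cmod (cnj \<zeta> - cnj \<zeta>') = cmod (\<zeta> - \<zeta>')" by (metis complex_cnj_diff complex_mod_cnj)
    finally show ?thesis using 4 w by (simp add: schwarz_refl_def)
  qed
qed

lemma schwarz_refl_holomorphic:
  assumes "f holomorphic_on (ball 0 s \<inter> {z. 0 < Im z})"
    and lip: "\<And>\<zeta> \<zeta>'. \<zeta> \<in> ball 0 s \<Longrightarrow> \<zeta>' \<in> ball 0 s \<Longrightarrow> cmod (f \<zeta> - f \<zeta>') \<le> c * cmod (\<zeta> - \<zeta>')"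
    and real: "\<And>x. complex_of_real x \<in> ball 0 s \<Longrightarrow> f (of_real x) \<in> \<real>" and "c \<ge> 0"
  shows "schwarz_refl f holomorphic_on ball 0 s"
  unfolding schwarz_refl_def
proof (rule Schwarz_reflection[OF open_ball _ assms(1)])
  show "cnj ` ball 0 s \<subseteq> ball 0 s" by auto
  have "c-lipschitz_on (ball 0 s) f"
    by (rule lipschitz_onI) (use lip \<open>c \<ge> 0\<close> in \<open>auto simp: dist_norm\<close>)
  then have "continuous_on (ball 0 s) f" by (rule lipschitz_on_continuous_on)
  then show "continuous_on (ball 0 s \<inter> {z. 0 \<le> Im z}) f" by (rule continuous_on_subset) auto
  show "f z \<in> \<real>" if "z \<in> ball 0 s" "z \<in> \<real>" for z
    using real that by (auto elim!: Reals_cases)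
qed

text \<open>A solution is a fixed point of \<zeta> \<mapsto> \<xi> - \<phi> \<zeta>, which contracts
  the disc into itself.\<close>

lemma near_identity_surj:
  fixes \<phi> :: "complex \<Rightarrow> complex"
  assumes lip: "\<And>\<zeta> \<zeta>'. \<zeta> \<in> cball 0 \<sigma> \<Longrightarrow> \<zeta>' \<in> cball 0 \<sigma> \<Longrightarrow> cmod (\<phi> \<zeta> - \<phi> \<zeta>') \<le> 1/2 * cmod (\<zeta> - \<zeta>')"
    and "\<And>\<zeta>. \<zeta> \<in> cball 0 \<sigma> \<Longrightarrow> cmod (\<phi> \<zeta>) \<le> \<sigma> / 2" "cmod \<xi> \<le> \<sigma> / 2"
  obtains \<zeta> :: complex where "\<zeta> \<in> cball 0 \<sigma>" "\<zeta> + \<phi> \<zeta> = \<xi>"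
proof -
  have "0 \<le> \<sigma>" using norm_ge_zero[of \<xi>] assms(3) by linarith
  have "\<exists>!\<zeta>. \<zeta> \<in> cball 0 \<sigma> \<and> \<xi> - \<phi> \<zeta> = \<zeta>"
  proof (rule Banach_fix[of "cball 0 \<sigma>" "1/2" "\<lambda>\<zeta>. \<xi> - \<phi> \<zeta>"])
    show "complete (cball (0::complex) \<sigma>)" by (simp add: complete_eq_closed)
    show "(\<lambda>\<zeta>. \<xi> - \<phi> \<zeta>) ` cball 0 \<sigma> \<subseteq> cball 0 \<sigma>"
    proof (rule image_subsetI)
      fix \<zeta> :: complex assume "\<zeta> \<in> cball 0 \<sigma>"
      then show "\<xi> - \<phi> \<zeta> \<in> cball 0 \<sigma>"
        using norm_triangle_ineq4[of \<xi> "\<phi> \<zeta>"] assms(2)[of \<zeta>] assms(3) by simp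
    qed
    show "dist (\<xi> - \<phi> x) (\<xi> - \<phi> y) \<le> 1/2 * dist x y" if "x \<in> cball 0 \<sigma>" "y \<in> cball 0 \<sigma>" for x y
      using lip[OF that] by (simp add: dist_norm norm_minus_commute)
  qed (use \<open>0 \<le> \<sigma>\<close> in auto)
  then obtain \<zeta> where "\<zeta> \<in> cball 0 \<sigma>" "\<xi> - \<phi> \<zeta> = \<zeta>" by blast
  then show ?thesis by (intro that[of \<zeta>]) (auto simp: algebra_simps)
qed

text \<open>\<open>F q\<close> is the complexified defining function of \<open>M\<close> in the complex plane \<open>q + \<complex> a + \<complex> b\<close>: in
  terms of complexified real and imaginary parts \<open>(x\<^sub>1, x\<^sub>2)\<close> and \<open>(y\<^sub>1, y\<^sub>2)\<close> of the two
  coordinates.\<close>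

locale leaf_extension = leaf_chart b B DB r \<rho> Dr R C K a l C1 \<epsilon>
  for b :: "complex ^ 'n" and B DB r \<rho> Dr R C K a l C1 \<epsilon> +
  fixes M :: "(complex ^ 'n) set" and R' CF :: real
    and F :: "complex ^ 'n \<Rightarrow> complex \<Rightarrow> complex \<Rightarrow> complex \<times> complex \<Rightarrow> complex \<times> complex"
  assumes R': "R' > 0" and CF: "CF \<ge> 0"
    and F_lip: "\<And>q x1 x2 y x1' x2' y'. q \<in> ball 0 R' \<Longrightarrow> cmod x1 < R' \<Longrightarrow> cmod x2 < R' \<Longrightarrow> norm y < R' \<Longrightarrow>
        cmod x1' < R' \<Longrightarrow> cmod x2' < R' \<Longrightarrow> norm y' < R' \<Longrightarrow>
        norm (F q x1 x2 y - F q x1' x2' y' - (y - y')) \<le> \<epsilon> * (cmod (x1 - x1') + cmod (x2 - x2') + norm (y - y'))"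
    and F_0: "\<And>q. q \<in> ball 0 R' \<Longrightarrow> norm (F q 0 0 0) \<le> CF * norm q"
    and F_real: "\<And>q x1 x2 y1 y2. q \<in> ball 0 R' \<Longrightarrow> \<bar>x1\<bar> < R' \<Longrightarrow> \<bar>x2\<bar> < R' \<Longrightarrow> \<bar>y1\<bar> < R' \<Longrightarrow> \<bar>y2\<bar> < R' \<Longrightarrow>
        fst (F q (of_real x1) (of_real x2) (of_real y1, of_real y2)) \<in> \<real> \<and>
        snd (F q (of_real x1) (of_real x2) (of_real y1, of_real y2)) \<in> \<real> \<and>
        (F q (of_real x1) (of_real x2) (of_real y1, of_real y2) = 0 \<longleftrightarrow> q + Complex x1 y1 *s a + Complex x2 y2 *s b \<in> M)"
    and F_hol: "\<And>q S f1 f2 g. q \<in> ball 0 R' \<Longrightarrow> f1 holomorphic_on S \<Longrightarrow> f2 holomorphic_on S \<Longrightarrow>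
        (\<lambda>\<zeta>. fst (g \<zeta>)) holomorphic_on S \<Longrightarrow> (\<lambda>\<zeta>. snd (g \<zeta>)) holomorphic_on S \<Longrightarrow> open S \<Longrightarrow>
        (\<And>\<zeta>. \<zeta> \<in> S \<Longrightarrow> cmod (f1 \<zeta>) < R' \<and> cmod (f2 \<zeta>) < R' \<and> norm (g \<zeta>) < R') \<Longrightarrow>
        (\<lambda>\<zeta>. fst (F q (f1 \<zeta>) (f2 \<zeta>) (g \<zeta>))) holomorphic_on S \<and> (\<lambda>\<zeta>. snd (F q (f1 \<zeta>) (f2 \<zeta>) (g \<zeta>))) holomorphic_on S"
    and M_sub: "\<And>m. m \<in> M \<Longrightarrow> m \<in> ball 0 R \<Longrightarrow> r m = 0 \<and> \<rho> m = 0"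
begin

text \<open>What \<open>leaf_family\<close> provides for \<open>G (t p)\<close>, detached from the
  family. The point \<open>z + g z *s b\<close> is the projection of \<open>z\<close> to the leaf
  along \<open>b\<close>; where its \<rho> is negative only the Lipschitz bounds remain.\<close>

definition leaf :: "real \<Rightarrow> complex ^ 'n \<Rightarrow> (complex ^ 'n \<Rightarrow> complex) \<Rightarrow> bool" where
  "leaf \<delta> p g \<longleftrightarrow> g p = 0 \<and>
     (\<forall>z\<in>ball 0 \<delta>. \<forall>z'\<in>ball 0 \<delta>. cmod (g z - g z') \<le> 4 * C * norm (z - z')) \<and>
     (\<forall>z\<in>ball 0 \<delta>. \<forall>\<xi>. z + \<xi> *s a \<in> ball 0 \<delta> \<longrightarrow> cmod (g (z + \<xi> *s a) - g z) \<le> 4 * \<epsilon> * cmod \<xi>) \<and>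
     (\<forall>z\<in>ball 0 \<delta>. \<forall>c. z + c *s b \<in> ball 0 \<delta> \<longrightarrow> g (z + c *s b) = g z - c) \<and>
     (\<forall>z\<in>ball 0 \<delta>. z + g z *s b \<in> ball 0 R \<and> r (z + g z *s b) = 0 \<and>
        (\<rho> (z + g z *s b) \<ge> 0 \<longrightarrow> (g has_derivative B (z + g z *s b)) (at z)))"

text \<open>\<open>m\<close> and its projection \<open>m + g m *s b\<close> both lie on r = 0 and
  differ by a real multiple of i b, so \<open>r_ib\<close> identifies them.\<close>

lemma leaf_on_level:
  assumes "leaf \<delta> p g" "m \<in> ball 0 \<delta>" "m \<in> ball 0 R" "r m = 0" "Re (g m) = 0"
  shows "g m = 0"
proof -
  have eq: "g m = \<i> * of_real (Im (g m))" using assms(5) by (simp add: complex_eq_iff)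
  have "m + (\<i> * of_real (Im (g m))) *s b \<in> ball 0 R" "r (m + (\<i> * of_real (Im (g m))) *s b) = 0"
    using assms(1,2) eq by (auto simp: leaf_def)
  from r_ib[OF assms(3) this(1) assms(4) this(2)] eq show ?thesis by simp
qed

text \<open>In slice coordinates (x1 + i y1, x2 + i y2) the leaf is x2 + i y2 = \<gamma> (x1 + i
  y1), and \<open>M\<close> is given by F = 0 at real values. Let x1 = \<zeta> and y = \<eta> become
  complex: the leaf equation yields x2 = \<open>k \<zeta> \<eta>\<close>, and then F = 0 determines
  \<eta>. For real \<zeta> the solution is real and describes the points of \<open>M\<close> on the
  leaf; for Im \<zeta> > 0 the point has \<rho> > 0, where \<gamma> is holomorphic. Reflecting
  \<eta> and x2 in the real axis extends this parametrisation of the leaf, and inverting its first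
  coordinate turns it back into a function \<open>h\<close>.\<close>

lemma slice_extension:
  assumes "\<delta> > 0"
  obtains s \<delta>' where "s > 0" "\<delta>' > 0" "\<delta>' \<le> \<delta>" "4 * s \<le> \<delta>" "4 * s \<le> R" "\<delta>' \<le> R / 2"
    "\<And>q p g. q \<in> ball 0 \<delta>' \<Longrightarrow> p \<in> ball 0 \<delta>' \<Longrightarrow> leaf \<delta> p g \<Longrightarrow>
       \<exists>h. h holomorphic_on ball 0 (s/4) \<and> (\<forall>\<xi>\<in>ball 0 (s/4). cmod (h \<xi>) \<le> 4 * s) \<and>
         (\<forall>\<xi>\<in>ball 0 (s/4). \<rho> (q + \<xi> *s a + g (q + \<xi> *s a) *s b) \<ge> 0 \<longrightarrow> h \<xi> = g (q + \<xi> *s a)) \<and>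
         (q \<in> M \<and> Re (h 0) = 0 \<longrightarrow> h 0 = 0 \<and> g q = 0)"
proof -
  define s where "s = min (\<delta> / 20) (min (R' / 8) (R / 20))"
  have s: "s > 0" "20 * s \<le> \<delta>" "8 * s \<le> R'" "20 * s \<le> R"
    using assms R R' by (auto simp: s_def)
  \<comment> \<open>Makes \<open>F q 0 0 0\<close> and \<open>g q\<close> small against
    \<open>s\<close>, uniformly in \<open>q\<close>, \<open>p\<close> and the leaf.\<close>
  define \<delta>' where "\<delta>' = s / (64 * (CF + 16 * C + 1))"
  have den: "64 * (CF + 16 * C + 1) > 0" using CF C by simp
  have \<delta>'0: "\<delta>' > 0" using s den by (simp add: \<delta>'_def)
  have "64 * (CF + 16 * C + 1) * \<delta>' = s" using den by (simp add: \<delta>'_def)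
  then have e1: "64 * (CF * \<delta>') + 1024 * (C * \<delta>') + 64 * \<delta>' = s" by (simp add: algebra_simps)
  have e2: "CF * \<delta>' \<ge> 0" "C * \<delta>' \<ge> 0" using CF C \<delta>'0 by auto
  have \<delta>': "\<delta>' \<le> s / 64" "CF * \<delta>' \<le> s / 64" "4 * C * (2 * \<delta>') \<le> s / 32"
    using e1 e2 \<delta>'0 by auto
  note \<epsilon>' = \<epsilon>(1) \<epsilon>_small
  show ?thesis
  proof (rule that[of s \<delta>'])
    show "s > 0" by fact
    show "\<delta>' > 0" by fact
    show "\<delta>' \<le> \<delta>" "4 * s \<le> \<delta>" "4 * s \<le> R" "\<delta>' \<le> R / 2" using \<delta>' s by auto
    fix q p :: "complex ^ 'n" and g
    assume q: "q \<in> ball 0 \<delta>'" and p: "p \<in> ball 0 \<delta>'" and L: "leaf \<delta> p g"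
    have qR': "q \<in> ball 0 R'" using q \<delta>' s by auto
    define \<gamma> where "\<gamma> \<xi> = g (q + \<xi> *s a)" for \<xi>
    have dom: "q + \<xi> *s a \<in> ball 0 \<delta>" if "cmod \<xi> \<le> 3 * s" for \<xi>
      using norm_triangle_ineq[of q "\<xi> *s a"] that q \<delta>' s by (simp add: norm_cvec_smult a)
    have \<gamma>_lip: "cmod (\<gamma> \<xi> - \<gamma> \<xi>') \<le> 4 * \<epsilon> * cmod (\<xi> - \<xi>')" if "cmod \<xi> \<le> 3 * s" "cmod \<xi>' \<le> 3 * s" for \<xi> \<xi>'
    proof -
      have eq: "q + \<xi>' *s a + (\<xi> - \<xi>') *s a = q + \<xi> *s a" by (simp add: vector_sub_rdistrib)
      have "cmod (g (q + \<xi>' *s a + (\<xi> - \<xi>') *s a) - g (q + \<xi>' *s a)) \<le> 4 * \<epsilon> * cmod (\<xi> - \<xi>')"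
        using L dom[OF that(2)] dom[OF that(1)] eq unfolding leaf_def by metis
      then show ?thesis unfolding eq by (simp add: \<gamma>_def)
    qed
    have \<gamma>0: "cmod (\<gamma> 0) \<le> s / 32"
    proof -
      have qd: "q \<in> ball 0 \<delta>" and pd: "p \<in> ball 0 \<delta>" using q p \<delta>' s by auto
      have "g p = 0" using L by (simp add: leaf_def)
      then have "cmod (\<gamma> 0) \<le> 4 * C * norm (q - p)" using L qd pd unfolding leaf_def \<gamma>_def by (metis diff_zero vector_smult_lzero add.right_neutral)
      also have "norm (q - p) \<le> 2 * \<delta>'" using norm_triangle_ineq4[of q p] q p by simp
      then have "4 * C * norm (q - p) \<le> 4 * C * (2 * \<delta>')" using C by (intro mult_left_mono) auto
      finally show ?thesis using \<delta>'(3) by linarith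
    qed
    have \<gamma>_bd: "cmod (\<gamma> \<xi>) \<le> s / 4" if "cmod \<xi> \<le> 3 * s" for \<xi>
    proof -
      have "cmod (\<gamma> \<xi> - \<gamma> 0) \<le> 4 * \<epsilon> * cmod \<xi>" using \<gamma>_lip[OF that, of 0] s by simp
      also have "\<dots> \<le> 4 * (1/100) * (3 * s)" using \<epsilon>' that by (intro mult_mono) auto
      finally show ?thesis using norm_triangle_ineq2[of "\<gamma> \<xi>" "\<gamma> 0"] \<gamma>0 s by linarith
    qed
    define k where "k \<zeta> \<eta> = \<gamma> (\<zeta> + \<i> * fst \<eta>) - \<i> * snd \<eta>" for \<zeta> and \<eta> :: "complex \<times> complex"
    \<comment> \<open>By \<open>F_lip\<close> the map \<open>F\<close> is, up to a small Lipschitz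
      error, the identity in its last argument; so this step towards a zero of \<open>F\<close> is a
      contraction.\<close>
    define \<Psi> where "\<Psi> \<zeta> \<eta> = \<eta> - F q \<zeta> (k \<zeta> \<eta>) \<eta>" for \<zeta> \<eta>
    define Dm where "Dm = cball (0 :: complex \<times> complex) s"
    have fs: "cmod (fst \<eta>) \<le> norm \<eta>" "cmod (snd \<eta>) \<le> norm \<eta>" for \<eta> :: "complex \<times> complex"
      using norm_fst_le[of "fst \<eta>" "snd \<eta>"] norm_snd_le[of "snd \<eta>" "fst \<eta>"] by simp_all
    have \<xi>_dom: "cmod (\<zeta> + \<i> * fst \<eta>) \<le> 2 * s" if "\<zeta> \<in> cball 0 s" "\<eta> \<in> Dm" for \<zeta> \<eta>
      using norm_triangle_ineq[of \<zeta> "\<i> * fst \<eta>"] fs(1)[of \<eta>] that by (simp add: Dm_def norm_mult)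
    have \<xi>_dom3: "cmod (\<zeta> + \<i> * fst \<eta>) \<le> 3 * s" if "\<zeta> \<in> cball 0 s" "\<eta> \<in> Dm" for \<zeta> \<eta>
      using \<xi>_dom[OF that] s by simp
    have k_bd: "cmod (k \<zeta> \<eta>) \<le> 2 * s" if "\<zeta> \<in> cball 0 s" "\<eta> \<in> Dm" for \<zeta> \<eta>
    proof -
      have "cmod (k \<zeta> \<eta>) \<le> cmod (\<gamma> (\<zeta> + \<i> * fst \<eta>)) + cmod (snd \<eta>)"
        unfolding k_def using norm_triangle_ineq4[of "\<gamma> (\<zeta> + \<i> * fst \<eta>)" "\<i> * snd \<eta>"] by (simp add: norm_mult)
      also have "cmod (snd \<eta>) \<le> s" using fs(2)[of \<eta>] that by (simp add: Dm_def)
      finally show ?thesis using \<gamma>_bd[OF \<xi>_dom3[OF that]] s by linarith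
    qed
    have \<gamma>_diff: "cmod (\<gamma> (\<zeta> + \<i> * fst \<eta>) - \<gamma> (\<zeta>' + \<i> * fst \<eta>')) \<le> 4 * \<epsilon> * (cmod (\<zeta> - \<zeta>') + norm (\<eta> - \<eta>'))"
      if "\<zeta> \<in> cball 0 s" "\<eta> \<in> Dm" "\<zeta>' \<in> cball 0 s" "\<eta>' \<in> Dm" for \<zeta> \<eta> \<zeta>' \<eta>'
    proof -
      have "cmod (\<zeta> + \<i> * fst \<eta> - (\<zeta>' + \<i> * fst \<eta>')) = cmod ((\<zeta> - \<zeta>') + \<i> * fst (\<eta> - \<eta>'))"
        by (simp add: algebra_simps)
      also have "\<dots> \<le> cmod (\<zeta> - \<zeta>') + norm (\<eta> - \<eta>')"
        using norm_triangle_ineq[of "\<zeta> - \<zeta>'" "\<i> * fst (\<eta> - \<eta>')"] fs(1)[of "\<eta> - \<eta>'"] by (simp add: norm_mult)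
      finally have "4 * \<epsilon> * cmod (\<zeta> + \<i> * fst \<eta> - (\<zeta>' + \<i> * fst \<eta>')) \<le> 4 * \<epsilon> * (cmod (\<zeta> - \<zeta>') + norm (\<eta> - \<eta>'))"
        using \<epsilon>' by (intro mult_left_mono) auto
      then show ?thesis using \<gamma>_lip[OF \<xi>_dom3[OF that(1,2)] \<xi>_dom3[OF that(3,4)]] by linarith
    qed
    have w: "4 * \<epsilon> * x \<le> x / 25" if "x \<ge> 0" for x
      using mult_right_mono[OF \<epsilon>_small that] by linarith
    have k_diff: "cmod (k \<zeta> \<eta> - k \<zeta>' \<eta>') \<le> cmod (\<zeta> - \<zeta>') / 25 + 2 * norm (\<eta> - \<eta>')"
      if "\<zeta> \<in> cball 0 s" "\<eta> \<in> Dm" "\<zeta>' \<in> cball 0 s" "\<eta>' \<in> Dm" for \<zeta> \<eta> \<zeta>' \<eta>'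
    proof -
      have "k \<zeta> \<eta> - k \<zeta>' \<eta>' = (\<gamma> (\<zeta> + \<i> * fst \<eta>) - \<gamma> (\<zeta>' + \<i> * fst \<eta>')) - \<i> * snd (\<eta> - \<eta>')"
        by (simp add: k_def algebra_simps)
      then have "cmod (k \<zeta> \<eta> - k \<zeta>' \<eta>') \<le> cmod (\<gamma> (\<zeta> + \<i> * fst \<eta>) - \<gamma> (\<zeta>' + \<i> * fst \<eta>')) + norm (\<eta> - \<eta>')"
        using norm_triangle_ineq4[of "\<gamma> (\<zeta> + \<i> * fst \<eta>) - \<gamma> (\<zeta>' + \<i> * fst \<eta>')" "\<i> * snd (\<eta> - \<eta>')"] fs(2)[of "\<eta> - \<eta>'"]
        by (simp only: norm_mult norm_ii mult_1_left)
      moreover have "cmod (\<gamma> (\<zeta> + \<i> * fst \<eta>) - \<gamma> (\<zeta>' + \<i> * fst \<eta>')) \<le> (cmod (\<zeta> - \<zeta>') + norm (\<eta> - \<eta>')) / 25"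
        by (rule order_trans[OF \<gamma>_diff[OF that] w]) simp
      moreover have "0 \<le> norm (\<eta> - \<eta>')" by simp
      ultimately show ?thesis by argo
    qed
    have mR: "x \<le> 2 * s \<Longrightarrow> x < R'" for x using s by simp
    have mR1: "x \<le> s \<Longrightarrow> x < R'" for x using s by simp
    have Fd: "norm (F q \<zeta> x \<eta> - F q \<zeta>' x' \<eta>' - (\<eta> - \<eta>')) \<le> \<epsilon> * (cmod (\<zeta> - \<zeta>') + cmod (x - x') + norm (\<eta> - \<eta>'))"
      if "\<zeta> \<in> cball 0 s" "\<eta> \<in> Dm" "\<zeta>' \<in> cball 0 s" "\<eta>' \<in> Dm" "cmod x \<le> 2 * s" "cmod x' \<le> 2 * s" for \<zeta> \<eta> \<zeta>' \<eta>' x x'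
      by (rule F_lip[OF qR']) (use that mR mR1 in \<open>auto simp: Dm_def\<close>)
    have fix_bd: "norm (\<eta> - F q \<zeta> x \<eta>) \<le> s / 8"
      if "\<zeta> \<in> cball 0 s" "\<eta> \<in> Dm" "cmod x \<le> 2 * s" for \<zeta> \<eta> x
    proof -
      have 0: "0 \<in> Dm" using s by (simp add: Dm_def)
      have "norm (F q \<zeta> x \<eta> - F q 0 0 0 - (\<eta> - 0)) \<le> \<epsilon> * (cmod (\<zeta> - 0) + cmod (x - 0) + norm (\<eta> - 0))"
        by (rule Fd) (use that 0 s in auto)
      also have "\<dots> \<le> 1/100 * (s + 2 * s + s)" using \<epsilon>' that by (intro mult_mono) (auto simp: Dm_def)
      finally have 1: "norm (F q \<zeta> x \<eta> - F q 0 0 0 - \<eta>) \<le> s / 25" by simp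
      have "norm (F q 0 0 0) \<le> CF * norm q" by (rule F_0[OF qR'])
      also have "\<dots> \<le> CF * \<delta>'" using q CF by (intro mult_left_mono) auto
      finally have 2: "norm (F q 0 0 0) \<le> s / 64" using \<delta>' by linarith
      have "\<eta> - F q \<zeta> x \<eta> = - (F q \<zeta> x \<eta> - F q 0 0 0 - \<eta>) - F q 0 0 0" by simp
      then have "norm (\<eta> - F q \<zeta> x \<eta>) \<le> norm (F q \<zeta> x \<eta> - F q 0 0 0 - \<eta>) + norm (F q 0 0 0)"
        using norm_triangle_ineq4[of "- (F q \<zeta> x \<eta> - F q 0 0 0 - \<eta>)" "F q 0 0 0"] by (simp only: norm_minus_cancel)
      then show ?thesis using 1 2 s by linarith
    qed
    have \<Psi>_diff: "norm (\<Psi> \<zeta> \<eta> - \<Psi> \<zeta>' \<eta>') \<le> \<epsilon> * (2 * cmod (\<zeta> - \<zeta>') + 3 * norm (\<eta> - \<eta>'))"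
      if "\<zeta> \<in> cball 0 s" "\<eta> \<in> Dm" "\<zeta>' \<in> cball 0 s" "\<eta>' \<in> Dm" for \<zeta> \<eta> \<zeta>' \<eta>'
    proof -
      have eq: "\<Psi> \<zeta> \<eta> - \<Psi> \<zeta>' \<eta>' = - (F q \<zeta> (k \<zeta> \<eta>) \<eta> - F q \<zeta>' (k \<zeta>' \<eta>') \<eta>' - (\<eta> - \<eta>'))" by (simp add: \<Psi>_def)
      have "norm (\<Psi> \<zeta> \<eta> - \<Psi> \<zeta>' \<eta>') \<le> \<epsilon> * (cmod (\<zeta> - \<zeta>') + cmod (k \<zeta> \<eta> - k \<zeta>' \<eta>') + norm (\<eta> - \<eta>'))"
        unfolding eq norm_minus_cancel by (rule Fd[OF that k_bd[OF that(1,2)] k_bd[OF that(3,4)]])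
      also have "\<dots> \<le> \<epsilon> * (2 * cmod (\<zeta> - \<zeta>') + 3 * norm (\<eta> - \<eta>'))"
      proof (rule mult_left_mono)
        show "cmod (\<zeta> - \<zeta>') + cmod (k \<zeta> \<eta> - k \<zeta>' \<eta>') + norm (\<eta> - \<eta>') \<le> 2 * cmod (\<zeta> - \<zeta>') + 3 * norm (\<eta> - \<eta>')"
          using k_diff[OF that] norm_ge_zero[of "\<zeta> - \<zeta>'"] by linarith
      qed (use \<epsilon>' in simp)
      finally show ?thesis .
    qed
    have \<Psi>_contr: "norm (\<Psi> \<zeta> \<eta> - \<Psi> \<zeta> \<eta>') \<le> norm (\<eta> - \<eta>') / 2"
      if "\<zeta> \<in> cball 0 s" "\<eta> \<in> Dm" "\<eta>' \<in> Dm" for \<zeta> \<eta> \<eta>'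
    proof -
      have "norm (\<Psi> \<zeta> \<eta> - \<Psi> \<zeta> \<eta>') \<le> \<epsilon> * (3 * norm (\<eta> - \<eta>'))"
        using \<Psi>_diff[OF that(1,2,1,3)] by simp
      also have "\<dots> \<le> 1/100 * (3 * norm (\<eta> - \<eta>'))" using \<epsilon>' by (intro mult_right_mono) auto
      finally show ?thesis using norm_ge_zero[of "\<eta> - \<eta>'"] by linarith
    qed
    have ex1: "\<exists>!\<eta>. \<eta> \<in> Dm \<and> \<Psi> \<zeta> \<eta> = \<eta>" if z: "\<zeta> \<in> cball 0 s" for \<zeta>
    proof (rule Banach_fix[of Dm "1/2" "\<Psi> \<zeta>"])
      show "complete Dm" by (simp add: Dm_def complete_eq_closed)
      show "Dm \<noteq> {}" using s by (simp add: Dm_def)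
      show "\<Psi> \<zeta> ` Dm \<subseteq> Dm"
      proof (rule image_subsetI)
        fix \<eta> assume e: "\<eta> \<in> Dm"
        have "norm (\<Psi> \<zeta> \<eta>) \<le> s / 8" unfolding \<Psi>_def by (rule fix_bd[OF z e k_bd[OF z e]])
        then show "\<Psi> \<zeta> \<eta> \<in> Dm" using s by (simp add: Dm_def)
      qed
      show "dist (\<Psi> \<zeta> x) (\<Psi> \<zeta> y) \<le> 1/2 * dist x y" if "x \<in> Dm" "y \<in> Dm" for x y
        using \<Psi>_contr[OF z that] by (simp add: dist_norm)
    qed auto
    define \<eta> where "\<eta> \<zeta> = (THE \<eta>. \<eta> \<in> Dm \<and> \<Psi> \<zeta> \<eta> = \<eta>)" for \<zeta>
    have \<eta>: "\<eta> \<zeta> \<in> Dm" "\<Psi> \<zeta> (\<eta> \<zeta>) = \<eta> \<zeta>" if "\<zeta> \<in> cball 0 s" for \<zeta>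
      using theI'[OF ex1[OF that]] by (auto simp: \<eta>_def)
    have \<eta>_uniq: "\<eta> \<zeta> = u" if "\<zeta> \<in> cball 0 s" "u \<in> Dm" "\<Psi> \<zeta> u = u" for \<zeta> u
      using ex1[OF that(1)] \<eta>[OF that(1)] that(2,3) by blast
    have \<eta>_bd: "norm (\<eta> \<zeta>) \<le> s / 8" if z: "\<zeta> \<in> cball 0 s" for \<zeta>
      using fix_bd[OF z \<eta>(1)[OF z] k_bd[OF z \<eta>(1)[OF z]]] \<eta>(2)[OF z] by (simp add: \<Psi>_def)
    have \<eta>_lip: "norm (\<eta> \<zeta> - \<eta> \<zeta>') \<le> 3 * \<epsilon> * cmod (\<zeta> - \<zeta>')" if "\<zeta> \<in> cball 0 s" "\<zeta>' \<in> cball 0 s" for \<zeta> \<zeta>'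
    proof -
      have "norm (\<eta> \<zeta> - \<eta> \<zeta>') \<le> \<epsilon> * (2 * cmod (\<zeta> - \<zeta>') + 3 * norm (\<eta> \<zeta> - \<eta> \<zeta>'))"
        using \<Psi>_diff[OF that(1) \<eta>(1)[OF that(1)] that(2) \<eta>(1)[OF that(2)]] \<eta>(2)[OF that(1)] \<eta>(2)[OF that(2)] by simp
      moreover have "\<epsilon> * norm (\<eta> \<zeta> - \<eta> \<zeta>') \<le> 1/100 * norm (\<eta> \<zeta> - \<eta> \<zeta>')"
        using \<epsilon>' by (intro mult_right_mono) auto
      moreover have "0 \<le> \<epsilon> * cmod (\<zeta> - \<zeta>')" using \<epsilon>' by simp
      ultimately show ?thesis by (simp add: algebra_simps)
    qed
    define \<kappa> where "\<kappa> \<zeta> = k \<zeta> (\<eta> \<zeta>)" for \<zeta>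
    define W where "W \<zeta> = \<zeta> + \<i> * fst (\<eta> \<zeta>)" for \<zeta>
    have W3: "cmod (W \<zeta>) \<le> 2 * s" if "\<zeta> \<in> cball 0 s" for \<zeta>
      unfolding W_def by (rule \<xi>_dom[OF that \<eta>(1)[OF that]])
    have \<gamma>W: "\<gamma> (W \<zeta>) = \<kappa> \<zeta> + \<i> * snd (\<eta> \<zeta>)" for \<zeta> by (simp add: \<kappa>_def k_def W_def)
    have \<gamma>W_lip: "cmod (\<gamma> (W \<zeta>) - \<gamma> (W \<zeta>')) \<le> 8 * \<epsilon> * cmod (\<zeta> - \<zeta>')" if "\<zeta> \<in> cball 0 s" "\<zeta>' \<in> cball 0 s" for \<zeta> \<zeta>'
    proof -
      have "3 * \<epsilon> * cmod (\<zeta> - \<zeta>') \<le> 1 * cmod (\<zeta> - \<zeta>')" using \<epsilon>' by (intro mult_right_mono) auto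
      then have "cmod (\<zeta> - \<zeta>') + norm (\<eta> \<zeta> - \<eta> \<zeta>') \<le> 2 * cmod (\<zeta> - \<zeta>')" using \<eta>_lip[OF that] by linarith
      then have "4 * \<epsilon> * (cmod (\<zeta> - \<zeta>') + norm (\<eta> \<zeta> - \<eta> \<zeta>')) \<le> 4 * \<epsilon> * (2 * cmod (\<zeta> - \<zeta>'))"
        using \<epsilon>' by (intro mult_left_mono) auto
      then show ?thesis
        using \<gamma>_diff[OF that(1) \<eta>(1)[OF that(1)] that(2) \<eta>(1)[OF that(2)]] by (simp add: W_def)
    qed
    have \<eta>1_lip: "cmod (fst (\<eta> \<zeta>) - fst (\<eta> \<zeta>')) \<le> 3 * \<epsilon> * cmod (\<zeta> - \<zeta>')"
     and \<eta>2_lip: "cmod (snd (\<eta> \<zeta>) - snd (\<eta> \<zeta>')) \<le> 3 * \<epsilon> * cmod (\<zeta> - \<zeta>')"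
      if "\<zeta> \<in> cball 0 s" "\<zeta>' \<in> cball 0 s" for \<zeta> \<zeta>'
      using \<eta>_lip[OF that] fs[of "\<eta> \<zeta> - \<eta> \<zeta>'"] by auto
    have \<kappa>_lip: "cmod (\<kappa> \<zeta> - \<kappa> \<zeta>') \<le> 11 * \<epsilon> * cmod (\<zeta> - \<zeta>')" if "\<zeta> \<in> cball 0 s" "\<zeta>' \<in> cball 0 s" for \<zeta> \<zeta>'
    proof -
      have "\<kappa> \<zeta> - \<kappa> \<zeta>' = (\<gamma> (W \<zeta>) - \<gamma> (W \<zeta>')) - \<i> * (snd (\<eta> \<zeta>) - snd (\<eta> \<zeta>'))"
        by (simp add: \<gamma>W algebra_simps)
      then have "cmod (\<kappa> \<zeta> - \<kappa> \<zeta>') \<le> cmod (\<gamma> (W \<zeta>) - \<gamma> (W \<zeta>')) + cmod (snd (\<eta> \<zeta>) - snd (\<eta> \<zeta>'))"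
        using norm_triangle_ineq4[of "\<gamma> (W \<zeta>) - \<gamma> (W \<zeta>')" "\<i> * (snd (\<eta> \<zeta>) - snd (\<eta> \<zeta>'))"]
        by (simp only: norm_mult norm_ii mult_1_left)
      then show ?thesis using \<gamma>W_lip[OF that] \<eta>2_lip[OF that] by (simp add: algebra_simps)
    qed
    define pt where "pt \<zeta> = q + W \<zeta> *s a + \<gamma> (W \<zeta>) *s b" for \<zeta>
    have ptR: "pt \<zeta> \<in> ball 0 R" if "\<zeta> \<in> cball 0 s" for \<zeta>
      using L dom[of "W \<zeta>"] W3[OF that] s unfolding leaf_def pt_def \<gamma>_def by force
    \<comment> \<open>For real \<open>x\<close> the equation is solved afresh among real \<eta>,
      with the real part of \<gamma> in place of x2. The point found lies in \<open>M\<close> and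
      satisfies \<open>Re (g m) = 0\<close>, so it is on the leaf by \<open>leaf_on_level\<close>.
      Hence it also solves the complex equation, and uniqueness identifies the two
      solutions.\<close>
    have real: "fst (\<eta> (of_real x)) \<in> \<real> \<and> snd (\<eta> (of_real x)) \<in> \<real> \<and> \<kappa> (of_real x) \<in> \<real> \<and> pt (of_real x) \<in> M"
      if x: "\<bar>x\<bar> \<le> s" for x
    proof -
      have xs: "of_real x \<in> cball (0::complex) s" using x by simp
      define Dr where "Dr = Dm \<inter> {u. Im (fst u) = 0 \<and> Im (snd u) = 0}"
      define kr where "kr u = Re (\<gamma> (of_real x + \<i> * fst u))" for u :: "complex \<times> complex"
      have kr2: "cmod (of_real (kr u)) \<le> 2 * s" if "u \<in> Dm" for u
        using abs_Re_le_cmod[of "\<gamma> (of_real x + \<i> * fst u)"] \<gamma>_bd[OF \<xi>_dom3[OF xs that]] s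
        by (simp add: kr_def)
      define \<Psi>r where "\<Psi>r u = u - F q (of_real x) (of_real (kr u)) u" for u
      have "\<exists>!u. u \<in> Dr \<and> \<Psi>r u = u"
      proof (rule Banach_fix[of Dr "1/2" \<Psi>r])
        have "closed Dr" unfolding Dr_def Dm_def
          by (intro closed_Int closed_cball closed_Collect_conj closed_Collect_eq continuous_intros)
        then show "complete Dr" by (simp add: complete_eq_closed)
        have "0 \<in> Dr" using s by (simp add: Dr_def Dm_def)
        then show "Dr \<noteq> {}" by blast
        show "\<Psi>r ` Dr \<subseteq> Dr"
        proof (rule image_subsetI)
          fix u assume u: "u \<in> Dr"
          then have uD: "u \<in> Dm" by (simp add: Dr_def)
          have ueq: "u = (of_real (Re (fst u)), of_real (Re (snd u)))"
            using u by (auto simp: Dr_def prod_eq_iff complex_eq_iff)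
          have "norm (\<Psi>r u) \<le> s / 8" unfolding \<Psi>r_def by (rule fix_bd[OF xs uD kr2[OF uD]])
          moreover have "fst (F q (of_real x) (of_real (kr u)) u) \<in> \<real> \<and> snd (F q (of_real x) (of_real (kr u)) u) \<in> \<real>"
          \<comment> \<open>Only the last arguments of \<open>F\<close> are rewritten as pairs of
            reals, not the occurrences of \<open>u\<close> inside \<open>kr\<close>.\<close>
          proof (subst (2 4) ueq, rule F_real[OF qR', THEN conjunct1, THEN conjI, OF _ _ _ _ F_real[OF qR', THEN conjunct2, THEN conjunct1]])
          qed (use x mR1 mR kr2[OF uD] uD fs[of u] abs_Re_le_cmod[of "fst u"] abs_Re_le_cmod[of "snd u"] s in \<open>auto simp: Dm_def\<close>)
          ultimately show "\<Psi>r u \<in> Dr"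
            using u s by (auto simp: Dr_def Dm_def \<Psi>r_def complex_is_Real_iff)
        qed
        show "dist (\<Psi>r u) (\<Psi>r v) \<le> 1/2 * dist u v" if "u \<in> Dr" "v \<in> Dr" for u v
        proof -
          have uv: "u \<in> Dm" "v \<in> Dm" using that by (auto simp: Dr_def)
          have eq: "\<Psi>r u - \<Psi>r v = - (F q (of_real x) (of_real (kr u)) u - F q (of_real x) (of_real (kr v)) v - (u - v))"
            by (simp add: \<Psi>r_def)
          have "norm (\<Psi>r u - \<Psi>r v) \<le> \<epsilon> * (cmod (of_real x - of_real x) + cmod (of_real (kr u) - of_real (kr v)) + norm (u - v))"
            unfolding eq norm_minus_cancel by (rule Fd[OF xs uv(1) xs uv(2) kr2[OF uv(1)] kr2[OF uv(2)]])
          also have "cmod (complex_of_real (kr u) - of_real (kr v)) = \<bar>Re (\<gamma> (of_real x + \<i> * fst u) - \<gamma> (of_real x + \<i> * fst v))\<bar>"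
            unfolding of_real_diff[symmetric] norm_of_real by (simp add: kr_def)
          also have "\<epsilon> * (cmod (of_real x - of_real x) + \<bar>Re (\<gamma> (of_real x + \<i> * fst u) - \<gamma> (of_real x + \<i> * fst v))\<bar> + norm (u - v))
             \<le> 1/100 * (0 + norm (u - v) + norm (u - v))"
          proof (intro mult_mono add_mono)
            have "\<bar>Re (\<gamma> (of_real x + \<i> * fst u) - \<gamma> (of_real x + \<i> * fst v))\<bar> \<le> 4 * \<epsilon> * (cmod (of_real x - of_real x) + norm (u - v))"
              using abs_Re_le_cmod \<gamma>_diff[OF xs uv(1) xs uv(2)] order_trans by blast
            also have "\<dots> \<le> (cmod (complex_of_real x - of_real x) + norm (u - v)) / 25" by (rule w) simp
            finally have small: "\<bar>Re (\<gamma> (of_real x + \<i> * fst u) - \<gamma> (of_real x + \<i> * fst v))\<bar> \<le> norm (u - v) / 25"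
              by simp
            show "\<bar>Re (\<gamma> (of_real x + \<i> * fst u) - \<gamma> (of_real x + \<i> * fst v))\<bar> \<le> norm (u - v)"
              using small norm_ge_zero[of "u - v"] by linarith
          qed (use \<epsilon>' in auto)
          finally have "norm (\<Psi>r u - \<Psi>r v) \<le> norm (u - v) / 50" by simp
          then have "norm (\<Psi>r u - \<Psi>r v) \<le> 1/2 * norm (u - v)" using norm_ge_zero[of "u - v"] by linarith
          then show ?thesis by (simp only: dist_norm)
        qed
      qed auto
      then obtain u where u: "u \<in> Dr" "\<Psi>r u = u" by blast
      then have uD: "u \<in> Dm" by (simp add: Dr_def)
      have ueq: "u = (of_real (Re (fst u)), of_real (Re (snd u)))"
        using u by (auto simp: Dr_def prod_eq_iff complex_eq_iff)
      have F0: "F q (of_real x) (of_real (kr u)) (of_real (Re (fst u)), of_real (Re (snd u))) = 0"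
        using u(2) ueq by (simp add: \<Psi>r_def)
      define m where "m = q + Complex x (Re (fst u)) *s a + Complex (kr u) (Re (snd u)) *s b"
      have mM: "m \<in> M"
        using F_real[OF qR', of x "kr u" "Re (fst u)" "Re (snd u)"] F0 x mR1 mR kr2[OF uD] uD fs[of u]
          abs_Re_le_cmod[of "fst u"] abs_Re_le_cmod[of "snd u"] s by (auto simp: Dm_def m_def)
      have cx: "Complex x (Re (fst u)) = of_real x + \<i> * fst u" "Complex (kr u) (Re (snd u)) = of_real (kr u) + \<i> * snd u"
        using ueq u(1) by (auto simp: complex_eq_iff Dr_def)
      have "norm m < 6 * s"
      proof -
        have "norm m \<le> norm q + cmod (of_real x + \<i> * fst u) + cmod (of_real (kr u) + \<i> * snd u)"
          unfolding m_def cx using norm_triangle_ineq[of "q + (of_real x + \<i> * fst u) *s a" "(of_real (kr u) + \<i> * snd u) *s b"]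
            norm_triangle_ineq[of q "(of_real x + \<i> * fst u) *s a"]
          unfolding norm_cvec_smult a b mult_1_right by linarith
        moreover have "cmod (of_real (kr u) + \<i> * snd u) \<le> 3 * s"
          using norm_triangle_ineq[of "of_real (kr u)" "\<i> * snd u"] kr2[OF uD] fs(2)[of u] uD by (simp add: Dm_def norm_mult)
        ultimately show ?thesis using \<xi>_dom[OF xs uD] q \<delta>'(1) s by simp
      qed
      then have mR: "m \<in> ball 0 R" and m\<delta>: "m \<in> ball 0 \<delta>" using s by auto
      have gm: "g m = \<gamma> (of_real x + \<i> * fst u) - (of_real (kr u) + \<i> * snd u)"
        using L dom[OF \<xi>_dom3[OF xs uD]] m\<delta> unfolding leaf_def m_def cx \<gamma>_def by blast
      have "g m = 0"
        by (rule leaf_on_level[OF L m\<delta> mR])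
           (use M_sub[OF mM mR] gm u(1) in \<open>auto simp: kr_def Dr_def\<close>)
      then have keq: "k (of_real x) u = of_real (kr u)" using gm by (simp add: k_def algebra_simps)
      then have "\<Psi> (of_real x) u = u" using u(2) by (simp add: \<Psi>_def \<Psi>r_def)
      then have eu: "\<eta> (of_real x) = u" by (rule \<eta>_uniq[OF xs uD])
      have "pt (of_real x) = m"
        using \<open>g m = 0\<close> gm by (simp add: pt_def W_def eu m_def cx)
      then show ?thesis using mM eu keq u(1) by (auto simp: \<kappa>_def Dr_def complex_is_Real_iff)
    qed
    \<comment> \<open>\<rho> vanishes at the point of \<open>M\<close> over Re \<zeta>, and from
      there to \<open>pt \<zeta>\<close> the displacement is Im \<zeta> times i a up to order
      \<epsilon>. So \<rho> has the sign of Im \<zeta>.\<close>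
    have pt_\<rho>: "\<bar>\<rho> (pt \<zeta>) - Im \<zeta>\<bar> \<le> \<bar>Im \<zeta>\<bar> / 2" if z: "\<zeta> \<in> cball 0 s" for \<zeta>
    proof -
      define x where "x = complex_of_real (Re \<zeta>)"
      have xr: "\<bar>Re \<zeta>\<bar> \<le> s" using z abs_Re_le_cmod[of \<zeta>] by simp
      then have xs: "x \<in> cball 0 s" by (simp add: x_def)
      have \<rho>x: "\<rho> (pt x) = 0" using real[OF xr] M_sub ptR[OF xs] by (simp add: x_def)
      have zx: "\<zeta> - x = \<i> * of_real (Im \<zeta>)" by (simp add: x_def complex_eq_iff)
      then have nzx: "cmod (\<zeta> - x) = \<bar>Im \<zeta>\<bar>" by (simp add: norm_mult)
      define e where "e = (\<i> * (fst (\<eta> \<zeta>) - fst (\<eta> x))) *s a + (\<gamma> (W \<zeta>) - \<gamma> (W x)) *s b"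
      have d: "pt \<zeta> - pt x = Im \<zeta> *\<^sub>R (\<i> *s a) + e"
      proof -
        have "pt \<zeta> - pt x = (\<zeta> - x) *s a + e"
          by (simp add: pt_def W_def e_def vec_eq_iff algebra_simps)
        then show ?thesis by (simp add: zx of_real_cvec_smult[symmetric] vector_smult_assoc mult.commute)
      qed
      have "norm e \<le> cmod (fst (\<eta> \<zeta>) - fst (\<eta> x)) + cmod (\<gamma> (W \<zeta>) - \<gamma> (W x))"
        unfolding e_def using norm_triangle_ineq[of "(\<i> * (fst (\<eta> \<zeta>) - fst (\<eta> x))) *s a" "(\<gamma> (W \<zeta>) - \<gamma> (W x)) *s b"]
        by (simp only: norm_cvec_smult a b norm_mult norm_ii mult_1_left mult_1_right)
      then have ne: "norm e \<le> 11 * \<epsilon> * \<bar>Im \<zeta>\<bar>"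
        using \<eta>1_lip[OF z xs] \<gamma>W_lip[OF z xs] unfolding nzx by (simp add: algebra_simps)
      have "\<bar>l e\<bar> \<le> C1 * (11 * \<epsilon> * \<bar>Im \<zeta>\<bar>)"
        using l_bound[of e] mult_left_mono[OF ne, of C1] C1 by linarith
      also have "\<dots> = (\<epsilon> * C1) * (11 * \<bar>Im \<zeta>\<bar>)" by simp
      also have "\<dots> \<le> 1/100 * (11 * \<bar>Im \<zeta>\<bar>)" using \<epsilon>(2) by (intro mult_right_mono) auto
      finally have le: "\<bar>l e\<bar> \<le> 11/100 * \<bar>Im \<zeta>\<bar>" by simp
      have ll: "l (pt \<zeta> - pt x) = Im \<zeta> + l e"
        unfolding d by (simp add: linear_add[OF l_lin] linear_cmul[OF l_lin] l_ia)
      have "11 * \<epsilon> * \<bar>Im \<zeta>\<bar> \<le> 1 * \<bar>Im \<zeta>\<bar>" using \<epsilon>' by (intro mult_right_mono) auto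
      then have "norm (pt \<zeta> - pt x) \<le> 2 * \<bar>Im \<zeta>\<bar>"
        unfolding d using norm_triangle_ineq[of "Im \<zeta> *\<^sub>R (\<i> *s a)" e] ne by (simp add: norm_cvec_smult a)
      then have "\<epsilon> * norm (pt \<zeta> - pt x) \<le> 1/100 * (2 * \<bar>Im \<zeta>\<bar>)" using \<epsilon>' by (intro mult_mono) auto
      moreover have "\<bar>\<rho> (pt \<zeta>) - \<rho> (pt x) - l (pt \<zeta> - pt x)\<bar> \<le> \<epsilon> * norm (pt \<zeta> - pt x)"
        by (rule \<rho>_approx[OF ptR[OF z] ptR[OF xs]])
      ultimately show ?thesis using le ll \<rho>x by linarith
    qed
    \<comment> \<open>Around \<open>pt \<zeta>0\<close> the leaf stays in \<rho> > 0, so \<gamma> is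
      holomorphic on a disc about \<open>W \<zeta>0\<close>; there the fixed point equation is
      holomorphic and \<open>holomorphic_fixpoint\<close> applies.\<close>
    have hol_\<eta>: "(\<lambda>\<zeta>. fst (\<eta> \<zeta>)) holomorphic_on (ball 0 s \<inter> {z. 0 < Im z}) \<and>
         (\<lambda>\<zeta>. snd (\<eta> \<zeta>)) holomorphic_on (ball 0 s \<inter> {z. 0 < Im z}) \<and>
         \<kappa> holomorphic_on (ball 0 s \<inter> {z. 0 < Im z})"
    proof -
      have loc: "\<exists>\<tau>>0. (\<lambda>\<zeta>. fst (\<eta> \<zeta>)) holomorphic_on ball \<zeta>0 \<tau> \<and> (\<lambda>\<zeta>. snd (\<eta> \<zeta>)) holomorphic_on ball \<zeta>0 \<tau>
          \<and> \<kappa> holomorphic_on ball \<zeta>0 \<tau>" if z0: "\<zeta>0 \<in> ball 0 s" "0 < Im \<zeta>0" for \<zeta>0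
      proof -
        have z0c: "\<zeta>0 \<in> cball 0 s" using z0 by simp
        define \<xi>0 where "\<xi>0 = W \<zeta>0"
        define \<rho>0 where "\<rho>0 = \<rho> (pt \<zeta>0)"
        have \<rho>0: "\<rho>0 > 0" using pt_\<rho>[OF z0c] z0(2) unfolding \<rho>0_def by linarith
        \<comment> \<open>Over a disc of this radius the point of the leaf moves by at most 2 *
          \<sigma>, which changes \<rho> by at most \<rho>0 / 2.\<close>
        define \<sigma> where "\<sigma> = min (\<rho>0 / (4 * (C1 + 1))) s"
        have \<sigma>: "\<sigma> > 0" "\<sigma> \<le> s" using \<rho>0 C1 s by (auto simp: \<sigma>_def)
        have "\<sigma> \<le> \<rho>0 / (4 * (C1 + 1))" by (simp add: \<sigma>_def)
        then have \<sigma>2: "(C1 + 1) * (2 * \<sigma>) \<le> \<rho>0 / 2" using C1 by (simp add: field_simps)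
        have \<xi>3: "cmod \<xi> \<le> 3 * s" if "\<xi> \<in> ball \<xi>0 \<sigma>" for \<xi>
          using that W3[OF z0c] \<sigma>(2) norm_triangle_ineq2[of \<xi> \<xi>0] by (simp add: \<xi>0_def dist_norm norm_minus_commute)
        have \<gamma>hol: "\<gamma> holomorphic_on ball \<xi>0 \<sigma>"
          unfolding holomorphic_on_def
        proof
          fix \<xi> assume \<xi>: "\<xi> \<in> ball \<xi>0 \<sigma>"
          define z where "z = q + \<xi> *s a"
          have z: "z \<in> ball 0 \<delta>" unfolding z_def by (rule dom[OF \<xi>3[OF \<xi>]])
          have zR: "z + g z *s b \<in> ball 0 R" using L z by (auto simp: leaf_def)
          have "\<rho> (z + g z *s b) > 0"
          proof -
            define e where "e = z + g z *s b - pt \<zeta>0"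
            have e: "e = (\<xi> - \<xi>0) *s a + (\<gamma> \<xi> - \<gamma> \<xi>0) *s b"
              by (simp add: e_def z_def pt_def \<xi>0_def \<gamma>_def vec_eq_iff algebra_simps)
            have "cmod (\<gamma> \<xi> - \<gamma> \<xi>0) \<le> 4 * \<epsilon> * cmod (\<xi> - \<xi>0)"
              by (rule \<gamma>_lip[OF \<xi>3[OF \<xi>] \<xi>3]) (use \<sigma> in simp)
            also have "\<dots> \<le> cmod (\<xi> - \<xi>0) / 25" by (rule w) simp
            finally have "cmod (\<gamma> \<xi> - \<gamma> \<xi>0) \<le> cmod (\<xi> - \<xi>0)" using norm_ge_zero[of "\<xi> - \<xi>0"] by linarith
            then have "norm e \<le> 2 * cmod (\<xi> - \<xi>0)"
              unfolding e using norm_triangle_ineq[of "(\<xi> - \<xi>0) *s a" "(\<gamma> \<xi> - \<gamma> \<xi>0) *s b"]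
              by (simp only: norm_cvec_smult a b mult_1_right)
            then have ne: "norm e \<le> 2 * \<sigma>" using \<xi> by (simp add: dist_norm norm_minus_commute)
            have "\<bar>\<rho> (z + g z *s b) - \<rho> (pt \<zeta>0) - l e\<bar> \<le> \<epsilon> * norm e"
              unfolding e_def by (rule \<rho>_approx[OF zR ptR[OF z0c]])
            moreover have "\<epsilon> * norm e \<le> 1 * norm e" using \<epsilon>' by (intro mult_right_mono) auto
            moreover have "\<bar>l e\<bar> \<le> C1 * norm e" by (rule l_bound)
            moreover have "(C1 + 1) * norm e \<le> (C1 + 1) * (2 * \<sigma>)" using ne C1 by (intro mult_left_mono) auto
            moreover have "(C1 + 1) * norm e = C1 * norm e + norm e" by (simp add: distrib_right)
            ultimately show ?thesis using \<sigma>2 \<rho>0 unfolding \<rho>0_def by linarith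
          qed
          then have gd: "(g has_derivative B (z + g z *s b)) (at z)" using L z by (auto simp: leaf_def)
          have "((\<lambda>\<xi>. g (q + \<xi> *s a)) has_derivative (\<lambda>h. B (z + g z *s b) (h *s a))) (at \<xi>)"
            by (rule has_derivative_compose[OF has_derivative_line gd[unfolded z_def], folded z_def])
          then have "(\<gamma> has_field_derivative B (z + g z *s b) a) (at \<xi>)"
            unfolding has_field_derivative_def \<gamma>_def by (simp add: B_smult[OF zR] mult_commute_abs)
          then show "\<gamma> field_differentiable at \<xi> within ball \<xi>0 \<sigma>"
            using field_differentiable_def has_field_derivative_at_within by blast
        qed
        define \<sigma>' where "\<sigma>' = min (\<sigma> / 2) (s / 2)"
        have \<sigma>': "\<sigma>' > 0" "\<sigma>' \<le> \<sigma> / 2" "\<sigma>' \<le> s / 2" using \<sigma> s by (auto simp: \<sigma>'_def)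
        define \<tau> where "\<tau> = min (s - cmod \<zeta>0) (\<sigma>' / 4)"
        have \<tau>: "\<tau> > 0" "\<tau> \<le> s - cmod \<zeta>0" "\<tau> \<le> \<sigma>' / 4" 
          using z0 \<sigma>' min.cobounded2[of "s - cmod \<zeta>0" "\<sigma>' / 4"] by (simp_all only: \<tau>_def) auto
        have bc: "\<zeta> \<in> cball 0 s" if "\<zeta> \<in> ball \<zeta>0 \<tau>" for \<zeta>
          using that \<tau>(2) norm_triangle_ineq2[of \<zeta> \<zeta>0] by (simp add: dist_norm norm_minus_commute)
        have uD: "u \<in> Dm" if "norm (u - \<eta> \<zeta>0) \<le> \<sigma>'" for u
          using that \<eta>_bd[OF z0c] \<sigma>' norm_triangle_ineq2[of u "\<eta> \<zeta>0"] s by (simp add: Dm_def)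
        have near: "norm (\<eta> \<zeta> - \<eta> \<zeta>0) \<le> \<sigma>' / 4" if "\<zeta> \<in> ball \<zeta>0 \<tau>" for \<zeta>
        proof -
          have "norm (\<eta> \<zeta> - \<eta> \<zeta>0) \<le> 3 * \<epsilon> * cmod (\<zeta> - \<zeta>0)" by (rule \<eta>_lip[OF bc[OF that] z0c])
          also have "\<dots> \<le> 1 * \<tau>" using \<epsilon>' that by (intro mult_mono) (auto simp: dist_norm norm_minus_commute)
          finally show ?thesis using \<tau> by simp
        qed
        have ins: "\<zeta> + \<i> * fst u \<in> ball \<xi>0 \<sigma>" if "\<zeta> \<in> ball \<zeta>0 \<tau>" "norm (u - \<eta> \<zeta>0) \<le> \<sigma>'" for \<zeta> u
        proof -
          have "\<zeta> + \<i> * fst u - \<xi>0 = (\<zeta> - \<zeta>0) + \<i> * fst (u - \<eta> \<zeta>0)" by (simp add: \<xi>0_def W_def algebra_simps)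
          then have "cmod (\<zeta> + \<i> * fst u - \<xi>0) \<le> cmod (\<zeta> - \<zeta>0) + norm (u - \<eta> \<zeta>0)"
            using norm_triangle_ineq[of "\<zeta> - \<zeta>0" "\<i> * fst (u - \<eta> \<zeta>0)"] fs(1)[of "u - \<eta> \<zeta>0"] by (simp only: norm_mult norm_ii mult_1_left)
          moreover have "cmod (\<zeta> - \<zeta>0) < \<tau>" using that by (simp add: dist_norm norm_minus_commute)
          ultimately have "cmod (\<zeta> + \<i> * fst u - \<xi>0) < \<sigma>" using that(2) \<tau>(3) \<sigma>' by linarith
          then show ?thesis by (simp add: dist_norm norm_minus_commute)
        qed
        have khol: "(\<lambda>\<zeta>. k \<zeta> (f \<zeta>)) holomorphic_on ball \<zeta>0 \<tau>"
          if "(\<lambda>\<zeta>. fst (f \<zeta>)) holomorphic_on ball \<zeta>0 \<tau>" "(\<lambda>\<zeta>. snd (f \<zeta>)) holomorphic_on ball \<zeta>0 \<tau>"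
            "\<And>\<zeta>. \<zeta> \<in> ball \<zeta>0 \<tau> \<Longrightarrow> norm (f \<zeta> - \<eta> \<zeta>0) \<le> \<sigma>'" for f
        proof -
          have "(\<gamma> \<circ> (\<lambda>\<zeta>. \<zeta> + \<i> * fst (f \<zeta>))) holomorphic_on ball \<zeta>0 \<tau>"
          proof (rule holomorphic_on_compose_gen[OF _ \<gamma>hol])
            show "(\<lambda>\<zeta>. \<zeta> + \<i> * fst (f \<zeta>)) holomorphic_on ball \<zeta>0 \<tau>" by (intro holomorphic_intros that)
            show "(\<lambda>\<zeta>. \<zeta> + \<i> * fst (f \<zeta>)) ` ball \<zeta>0 \<tau> \<subseteq> ball \<xi>0 \<sigma>" using ins that(3) by blast
          qed
          then show ?thesis unfolding k_def o_def by (intro holomorphic_intros that)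
        qed
        have hol\<Psi>: "(\<lambda>\<zeta>. fst (\<Psi> \<zeta> (f \<zeta>))) holomorphic_on ball \<zeta>0 \<tau> \<and> (\<lambda>\<zeta>. snd (\<Psi> \<zeta> (f \<zeta>))) holomorphic_on ball \<zeta>0 \<tau>"
          if f: "(\<lambda>\<zeta>. fst (f \<zeta>)) holomorphic_on ball \<zeta>0 \<tau>" "(\<lambda>\<zeta>. snd (f \<zeta>)) holomorphic_on ball \<zeta>0 \<tau>"
            "\<And>\<zeta>. \<zeta> \<in> ball \<zeta>0 \<tau> \<Longrightarrow> norm (f \<zeta> - \<eta> \<zeta>0) \<le> \<sigma>'" for f :: "complex \<Rightarrow> complex \<times> complex"
        proof -
          have "(\<lambda>\<zeta>. fst (F q \<zeta> (k \<zeta> (f \<zeta>)) (f \<zeta>))) holomorphic_on ball \<zeta>0 \<tau> \<and>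
             (\<lambda>\<zeta>. snd (F q \<zeta> (k \<zeta> (f \<zeta>)) (f \<zeta>))) holomorphic_on ball \<zeta>0 \<tau>"
          proof (rule F_hol[OF qR' _ khol[OF f] f(1,2) open_ball])
            fix \<zeta> assume z: "\<zeta> \<in> ball \<zeta>0 \<tau>"
            show "cmod \<zeta> < R' \<and> cmod (k \<zeta> (f \<zeta>)) < R' \<and> norm (f \<zeta>) < R'"
              using bc[OF z] uD[OF f(3)[OF z]] k_bd[OF bc[OF z] uD[OF f(3)[OF z]]] s by (auto simp: Dm_def)
          qed (intro holomorphic_intros)
          then show ?thesis
            unfolding \<Psi>_def fst_diff snd_diff using f by (auto intro: holomorphic_on_diff)
        qed
        have fp: "\<Psi> \<zeta> (\<eta> \<zeta>) = \<eta> \<zeta>" if "\<zeta> \<in> ball \<zeta>0 \<tau>" for \<zeta> by (rule \<eta>(2)[OF bc[OF that]])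
        have ct: "norm (\<Psi> \<zeta> u - \<Psi> \<zeta> u') \<le> norm (u - u') / 2"
          if "\<zeta> \<in> ball \<zeta>0 \<tau>" "norm (u - \<eta> \<zeta>0) \<le> \<sigma>'" "norm (u' - \<eta> \<zeta>0) \<le> \<sigma>'" for \<zeta> u u'
          by (rule \<Psi>_contr[OF bc[OF that(1)] uD[OF that(2)] uD[OF that(3)]])
        note h\<eta> = holomorphic_fixpoint[where \<Psi>=\<Psi> and c="\<eta> \<zeta>0" and \<sigma>=\<sigma>', OF fp near \<sigma>'(1) ct hol\<Psi>]
        have "\<kappa> holomorphic_on ball \<zeta>0 \<tau>"
          unfolding \<kappa>_def
        proof (rule khol[OF h\<eta>])
          show "norm (\<eta> \<zeta> - \<eta> \<zeta>0) \<le> \<sigma>'" if "\<zeta> \<in> ball \<zeta>0 \<tau>" for \<zeta>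
            using near[OF that] \<sigma>'(1) by linarith
        qed
        with h\<eta> \<tau>(1) show ?thesis by blast
      qed
      have glue: "f holomorphic_on (ball 0 s \<inter> {z. 0 < Im z})"
        if g: "\<And>\<zeta>0. \<zeta>0 \<in> ball 0 s \<Longrightarrow> 0 < Im \<zeta>0 \<Longrightarrow> \<exists>\<tau>>0. f holomorphic_on ball \<zeta>0 \<tau>" for f
        unfolding holomorphic_on_def
      proof
        fix x assume "x \<in> ball 0 s \<inter> {z. 0 < Im z}"
        then obtain \<tau> where "\<tau> > 0" "f holomorphic_on ball x \<tau>" using g by blast
        then have "f field_differentiable at x"
          by (intro holomorphic_on_imp_differentiable_at[OF _ open_ball]) auto
        then show "f field_differentiable at x within ball 0 s \<inter> {z. 0 < Im z}"
          by (rule field_differentiable_at_within)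
      qed
      show ?thesis by (intro conjI glue) (use loc in blast)+
    qed
    show "\<exists>h. h holomorphic_on ball 0 (s/4) \<and> (\<forall>\<xi>\<in>ball 0 (s/4). cmod (h \<xi>) \<le> 4 * s) \<and>
         (\<forall>\<xi>\<in>ball 0 (s/4). \<rho> (q + \<xi> *s a + g (q + \<xi> *s a) *s b) \<ge> 0 \<longrightarrow> h \<xi> = g (q + \<xi> *s a)) \<and>
         (q \<in> M \<and> Re (h 0) = 0 \<longrightarrow> h 0 = 0 \<and> g q = 0)"
    proof -
      define a1 where "a1 = schwarz_refl (\<lambda>\<zeta>. fst (\<eta> \<zeta>))"
      define a2 where "a2 = schwarz_refl (\<lambda>\<zeta>. snd (\<eta> \<zeta>))"
      define a3 where "a3 = schwarz_refl \<kappa>"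
      have re: "fst (\<eta> (of_real x)) \<in> \<real>" "snd (\<eta> (of_real x)) \<in> \<real>" "\<kappa> (of_real x) \<in> \<real>"
        if "complex_of_real x \<in> ball 0 s" for x
        using real[of x] that by auto
      have cb: "\<zeta> \<in> cball 0 s" if "\<zeta> \<in> ball 0 s" for \<zeta> :: complex using that by simp
      have a1h: "a1 holomorphic_on ball 0 s" unfolding a1_def
        by (rule schwarz_refl_holomorphic[where c="3 * \<epsilon>"]) (use hol_\<eta> \<eta>1_lip cb re \<epsilon>' in auto)
      have a2h: "a2 holomorphic_on ball 0 s" unfolding a2_def
        by (rule schwarz_refl_holomorphic[where c="3 * \<epsilon>"]) (use hol_\<eta> \<eta>2_lip cb re \<epsilon>' in auto)
      have a3h: "a3 holomorphic_on ball 0 s" unfolding a3_def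
        by (rule schwarz_refl_holomorphic[where c="11 * \<epsilon>"]) (use hol_\<eta> \<kappa>_lip cb re \<epsilon>' in auto)
      have a1l: "cmod (a1 \<zeta> - a1 \<zeta>') \<le> 3 * (3 * \<epsilon>) * cmod (\<zeta> - \<zeta>')" if "\<zeta> \<in> ball 0 s" "\<zeta>' \<in> ball 0 s" for \<zeta> \<zeta>'
        unfolding a1_def by (rule schwarz_refl_Lipschitz[OF _ _ _ that]) (use \<eta>1_lip cb re \<epsilon>' in auto)
      have a2l: "cmod (a2 \<zeta> - a2 \<zeta>') \<le> 3 * (3 * \<epsilon>) * cmod (\<zeta> - \<zeta>')" if "\<zeta> \<in> ball 0 s" "\<zeta>' \<in> ball 0 s" for \<zeta> \<zeta>'
        unfolding a2_def by (rule schwarz_refl_Lipschitz[OF _ _ _ that]) (use \<eta>2_lip cb re \<epsilon>' in auto)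
      have a3l: "cmod (a3 \<zeta> - a3 \<zeta>') \<le> 3 * (11 * \<epsilon>) * cmod (\<zeta> - \<zeta>')" if "\<zeta> \<in> ball 0 s" "\<zeta>' \<in> ball 0 s" for \<zeta> \<zeta>'
        unfolding a3_def by (rule schwarz_refl_Lipschitz[OF _ _ _ that]) (use \<kappa>_lip cb re \<epsilon>' in auto)
      have refl_bd: "cmod (schwarz_refl f \<zeta>) \<le> A" if "\<zeta> \<in> ball 0 s" "\<And>\<zeta>. \<zeta> \<in> cball 0 s \<Longrightarrow> cmod (f \<zeta>) \<le> A" for f \<zeta> A
        using that(2)[of \<zeta>] that(2)[of "cnj \<zeta>"] that(1) by (simp add: schwarz_refl_def)
      have a1b: "cmod (a1 \<zeta>) \<le> s / 8" if "\<zeta> \<in> ball 0 s" for \<zeta>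
        unfolding a1_def by (rule refl_bd[OF that]) (meson \<eta>_bd fs(1) order_trans)
      have a2b: "cmod (a2 \<zeta>) \<le> s / 8" if "\<zeta> \<in> ball 0 s" for \<zeta>
        unfolding a2_def by (rule refl_bd[OF that]) (meson \<eta>_bd fs(2) order_trans)
      have a3b: "cmod (a3 \<zeta>) \<le> 2 * s" if "\<zeta> \<in> ball 0 s" for \<zeta>
        unfolding a3_def by (rule refl_bd[OF that]) (simp add: \<kappa>_def k_bd \<eta>(1))
      \<comment> \<open>The two coordinates of the extended leaf: for Im \<zeta> \<ge> 0 they are
        \<open>W\<close> and \<gamma> \<circ> W, and \<open>W'\<close> is invertible as a small
        perturbation of the identity.\<close>
      define W' where "W' \<zeta> = \<zeta> + \<i> * a1 \<zeta>" for \<zeta>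
      define w' where "w' \<zeta> = a3 \<zeta> + \<i> * a2 \<zeta>" for \<zeta>
      have W'h: "W' holomorphic_on ball 0 s" unfolding W'_def by (intro holomorphic_intros a1h)
      have w'h: "w' holomorphic_on ball 0 s" unfolding w'_def by (intro holomorphic_intros a2h a3h)
      have lip9: "cmod (\<i> * a1 \<zeta> - \<i> * a1 \<zeta>') \<le> 1/2 * cmod (\<zeta> - \<zeta>')" if "\<zeta> \<in> ball 0 s" "\<zeta>' \<in> ball 0 s" for \<zeta> \<zeta>'
      proof -
        have "cmod (\<i> * a1 \<zeta> - \<i> * a1 \<zeta>') = cmod (a1 \<zeta> - a1 \<zeta>')"
          unfolding right_diff_distrib[symmetric] norm_mult by simp
        also have "\<dots> \<le> 3 * (3 * \<epsilon>) * cmod (\<zeta> - \<zeta>')" by (rule a1l[OF that])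
        also have "\<dots> \<le> 1/2 * cmod (\<zeta> - \<zeta>')" using \<epsilon>' by (intro mult_right_mono) auto
        finally show ?thesis .
      qed
      have inj: "inj_on W' (ball 0 s)"
      proof (rule inj_onI)
        fix x y assume xy: "x \<in> ball 0 s" "y \<in> ball 0 s" "W' x = W' y"
        then have "x - y = - (\<i> * a1 x - \<i> * a1 y)" by (simp add: W'_def algebra_simps)
        then have "cmod (x - y) \<le> 1/2 * cmod (x - y)" using lip9[OF xy(1,2)] by (metis norm_minus_cancel)
        then show "x = y" by simp
      qed
      obtain j where j: "j holomorphic_on W' ` ball 0 s" "\<And>z. z \<in> ball 0 s \<Longrightarrow> j (W' z) = z"
        using holomorphic_has_inverse[OF W'h open_ball inj] by metis
      have half: "\<zeta> \<in> ball 0 s" if "\<zeta> \<in> cball 0 (s/2)" for \<zeta> :: complex using that s by simp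
      have surj: "\<exists>\<zeta>. \<zeta> \<in> ball 0 s \<and> W' \<zeta> = \<xi>" if "\<xi> \<in> ball 0 (s/4)" for \<xi>
      proof -
        have "cmod \<xi> \<le> s / 2 / 2" using that by simp
        moreover have "cmod (\<i> * a1 \<zeta>) \<le> s / 2 / 2" if "\<zeta> \<in> cball 0 (s/2)" for \<zeta>
          using a1b[OF half[OF that]] s by (simp add: norm_mult)
        ultimately obtain \<zeta> where "\<zeta> \<in> cball 0 (s/2)" "\<zeta> + \<i> * a1 \<zeta> = \<xi>"
          using near_identity_surj[of "s/2" "\<lambda>\<zeta>. \<i> * a1 \<zeta>" \<xi>] lip9 half by metis
        then show ?thesis using half by (auto simp: W'_def)
      qed
      then have sub: "ball 0 (s/4) \<subseteq> W' ` ball 0 s" by blast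
      have jin: "j ` ball 0 (s/4) \<subseteq> ball 0 s" using surj j(2) by fastforce
      define h where "h = w' \<circ> j"
      have hh: "h holomorphic_on ball 0 (s/4)"
        unfolding h_def by (rule holomorphic_on_compose_gen[OF holomorphic_on_subset[OF j(1) sub] w'h jin])
      have hb: "cmod (h \<xi>) \<le> 4 * s" if "\<xi> \<in> ball 0 (s/4)" for \<xi>
      proof -
        have ji: "j \<xi> \<in> ball 0 s" using jin that by blast
        have "cmod (h \<xi>) \<le> cmod (a3 (j \<xi>)) + cmod (a2 (j \<xi>))"
          unfolding h_def w'_def o_def using norm_triangle_ineq[of "a3 (j \<xi>)" "\<i> * a2 (j \<xi>)"] by (simp add: norm_mult)
        then show ?thesis using a2b[OF ji] a3b[OF ji] s by linarith
      qed
      \<comment> \<open>The unreflected \<open>W\<close> also covers the disc, so \<xi> = W \<zeta>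
        for some \<zeta>. Then \<rho> \<ge> 0 forces Im \<zeta> \<ge> 0, where reflection changes
        nothing.\<close>
      have hg: "h \<xi> = \<gamma> \<xi>" if x: "\<xi> \<in> ball 0 (s/4)" and pos: "\<rho> (q + \<xi> *s a + \<gamma> \<xi> *s b) \<ge> 0" for \<xi>
      proof -
        have "cmod \<xi> \<le> s / 2 / 2" using x by simp
        moreover have "cmod (\<i> * fst (\<eta> \<zeta>)) \<le> s / 2 / 2" if "\<zeta> \<in> cball 0 (s/2)" for \<zeta>
          using \<eta>_bd[OF cb[OF half[OF that]]] fs(1)[of "\<eta> \<zeta>"] s by (simp add: norm_mult)
        moreover have "cmod (\<i> * fst (\<eta> \<zeta>) - \<i> * fst (\<eta> \<zeta>')) \<le> 1/2 * cmod (\<zeta> - \<zeta>')"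
          if "\<zeta> \<in> cball 0 (s/2)" "\<zeta>' \<in> cball 0 (s/2)" for \<zeta> \<zeta>'
        proof -
          have "cmod (\<i> * fst (\<eta> \<zeta>) - \<i> * fst (\<eta> \<zeta>')) = cmod (fst (\<eta> \<zeta>) - fst (\<eta> \<zeta>'))"
            unfolding right_diff_distrib[symmetric] norm_mult by simp
          also have "\<dots> \<le> 3 * \<epsilon> * cmod (\<zeta> - \<zeta>')" by (rule \<eta>1_lip) (use that half cb in blast)+
          also have "\<dots> \<le> 1/2 * cmod (\<zeta> - \<zeta>')" using \<epsilon>' by (intro mult_right_mono) auto
          finally show ?thesis .
        qed
        ultimately obtain \<zeta> where z: "\<zeta> \<in> cball 0 (s/2)" "\<zeta> + \<i> * fst (\<eta> \<zeta>) = \<xi>"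
          using near_identity_surj[of "s/2" "\<lambda>\<zeta>. \<i> * fst (\<eta> \<zeta>)" \<xi>] by metis
        have zs: "\<zeta> \<in> ball 0 s" by (rule half[OF z(1)])
        have Wz: "W \<zeta> = \<xi>" using z by (simp add: W_def)
        have "\<rho> (pt \<zeta>) \<ge> 0" using pos by (simp add: pt_def Wz)
        then have im: "Im \<zeta> \<ge> 0" using pt_\<rho>[OF cb[OF zs]] by linarith
        then have "W' \<zeta> = \<xi>" using Wz by (simp add: W'_def W_def a1_def schwarz_refl_def)
        then have "j \<xi> = \<zeta>" using j(2)[OF zs] by simp
        then show ?thesis using im Wz \<gamma>W[of \<zeta>] by (simp add: h_def w'_def a2_def a3_def schwarz_refl_def)
      qed
      \<comment> \<open>At a point \<open>q\<close> of \<open>M\<close> everything is controlled by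
        the real number \<kappa> 0: since \<open>F q 0 0 0 = 0\<close>, the pair
        \<open>\<eta> 0\<close> is a small fraction of it, and so is the preimage of 0 under
        \<open>W'\<close>. Hence \<open>Re (h 0)\<close> differs from \<kappa> 0 by a small fraction
        of its modulus, and its vanishing forces \<kappa> 0 = 0.\<close>
      have hM: "h 0 = 0 \<and> g q = 0" if "q \<in> M" "Re (h 0) = 0"
      proof -
        have z0: "(0::complex) \<in> ball 0 s" "(0::complex) \<in> cball 0 s" using s by auto
        have r0: "fst (\<eta> 0) \<in> \<real>" "snd (\<eta> 0) \<in> \<real>" "\<kappa> 0 \<in> \<real>" using real[of 0] s by auto
        have \<Psi>0: "F q 0 (\<kappa> 0) (\<eta> 0) = 0" using \<eta>(2)[OF z0(2)] by (simp add: \<Psi>_def \<kappa>_def)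
        have F00: "F q 0 0 0 = 0"
        proof -
          have "Complex 0 0 = 0" by (simp add: complex_eq_iff)
          then show ?thesis using F_real[OF qR', of 0 0 0 0] that(1) R' by (simp add: zero_prod_def)
        qed
        have D0: "0 \<in> Dm" using s by (simp add: Dm_def)
        have "norm (F q 0 (\<kappa> 0) (\<eta> 0) - F q 0 0 0 - (\<eta> 0 - 0)) \<le> \<epsilon> * (cmod (0 - 0) + cmod (\<kappa> 0 - 0) + norm (\<eta> 0 - 0))"
          by (rule Fd[OF z0(2) \<eta>(1)[OF z0(2)] z0(2) D0]) (use k_bd[OF z0(2) \<eta>(1)[OF z0(2)]] s in \<open>auto simp: \<kappa>_def\<close>)
        then have "norm (\<eta> 0) \<le> \<epsilon> * (cmod (\<kappa> 0) + norm (\<eta> 0))" by (simp add: \<Psi>0 F00)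
        also have "\<dots> \<le> 1/100 * (cmod (\<kappa> 0) + norm (\<eta> 0))" using \<epsilon>' by (intro mult_right_mono) auto
        finally have n\<eta>: "norm (\<eta> 0) \<le> cmod (\<kappa> 0) / 50" using norm_ge_zero[of "\<kappa> 0"] norm_ge_zero[of "\<eta> 0"] by argo
        have a10: "a1 0 = fst (\<eta> 0)" and w'0: "w' 0 = \<kappa> 0 + \<i> * snd (\<eta> 0)"
          by (simp_all add: a1_def w'_def a2_def a3_def schwarz_refl_def)
        define \<zeta> where "\<zeta> = j 0"
        have "0 \<in> ball (0::complex) (s/4)" using s by simp
        from surj[OF this] obtain \<zeta>1 where "\<zeta>1 \<in> ball 0 s" "W' \<zeta>1 = 0" by blast
        moreover from this have "\<zeta> = \<zeta>1" using j(2)[of \<zeta>1] by (simp add: \<zeta>_def)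
        ultimately have zb: "\<zeta> \<in> ball 0 s" "W' \<zeta> = 0" by simp_all
        then have "\<zeta> = - (\<i> * a1 \<zeta> - \<i> * a1 0) - \<i> * a1 0" by (simp add: W'_def eq_neg_iff_add_eq_0)
        then have "cmod \<zeta> \<le> cmod (\<i> * a1 \<zeta> - \<i> * a1 0) + cmod (a1 0)"
          using norm_triangle_ineq4[of "- (\<i> * a1 \<zeta> - \<i> * a1 0)" "\<i> * a1 0"]
          by (metis norm_minus_cancel norm_mult norm_ii mult_1_left)
        then have "cmod \<zeta> \<le> 2 * cmod (a1 0)" using lip9[OF zb(1) z0(1)] by simp
        also have "\<dots> \<le> 2 * (cmod (\<kappa> 0) / 50)" using n\<eta> fs(1)[of "\<eta> 0"] unfolding a10 by linarith
        finally have nz: "cmod \<zeta> \<le> cmod (\<kappa> 0) / 25" by simp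
        have "w' 0 - w' \<zeta> = (a3 0 - a3 \<zeta>) + \<i> * (a2 0 - a2 \<zeta>)" by (simp add: w'_def algebra_simps)
        then have "cmod (w' 0 - w' \<zeta>) \<le> cmod (a3 0 - a3 \<zeta>) + cmod (a2 0 - a2 \<zeta>)"
          using norm_triangle_ineq[of "a3 0 - a3 \<zeta>" "\<i> * (a2 0 - a2 \<zeta>)"] by (simp only: norm_mult norm_ii mult_1_left)
        also have "\<dots> \<le> 3 * (11 * \<epsilon>) * cmod (0 - \<zeta>) + 3 * (3 * \<epsilon>) * cmod (0 - \<zeta>)"
          by (intro add_mono a3l a2l z0 zb)
        also have "\<dots> = 42 * \<epsilon> * cmod \<zeta>" by simp
        also have "\<dots> \<le> 1 * cmod \<zeta>" using \<epsilon>' by (intro mult_right_mono) auto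
        finally have d: "cmod (w' 0 - w' \<zeta>) \<le> cmod (\<kappa> 0) / 25" using nz by simp
        have "Re (w' \<zeta>) = 0" using that(2) by (simp add: h_def \<zeta>_def)
        moreover have "Re (w' 0) = Re (\<kappa> 0)" using r0 by (simp add: w'0 complex_is_Real_iff)
        ultimately have "\<bar>Re (\<kappa> 0)\<bar> \<le> cmod (\<kappa> 0) / 25"
          using abs_Re_le_cmod[of "w' 0 - w' \<zeta>"] d by simp
        moreover have "cmod (\<kappa> 0) = \<bar>Re (\<kappa> 0)\<bar>" using r0(3) by (simp add: complex_is_Real_iff cmod_eq_Re)
        ultimately have "cmod (\<kappa> 0) = 0" by linarith
        then have k0: "\<kappa> 0 = 0" by simp
        then have e0: "\<eta> 0 = 0" using n\<eta> by simp
        have "\<zeta> = 0" using nz k0 by simp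
        then have "h 0 = 0" using k0 e0 w'0 by (simp add: h_def \<zeta>_def)
        moreover have "\<gamma> 0 = 0" using \<gamma>W[of 0] k0 e0 by (simp add: W_def)
        ultimately show ?thesis by (simp add: \<gamma>_def)
      qed
      show ?thesis
        using hh hb hg hM unfolding \<gamma>_def by (intro exI[of _ h]) blast
    qed
  qed
qed

end

section \<open>Hartogs' argument: Taylor series along a with coefficients holomorphic in all
  variables\<close>

lemma holomorphic_fun_on_translate:
  assumes "holomorphic_fun_on f U" "\<And>z. z \<in> V \<Longrightarrow> z + w \<in> U"
  shows "holomorphic_fun_on (\<lambda>z. f (z + w)) V"
  unfolding holomorphic_fun_on_def
proof (intro ballI exI conjI allI)
  fix z assume z: "z \<in> V"
  have "((\<lambda>z. z + w) has_derivative (\<lambda>h. h)) (at z)" by (auto intro!: derivative_eq_intros)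
  from has_derivative_compose[OF this holomorphic_fun_onD(1)[OF assms(1) assms(2)[OF z]]]
  show "((\<lambda>z. f (z + w)) has_derivative (\<lambda>h. frechet_derivative f (at (z + w)) h)) (at z)" .
  show "frechet_derivative f (at (z + w)) (c *s v) = c * frechet_derivative f (at (z + w)) v" for c v
    by (rule holomorphic_fun_onD(2)[OF assms(1) assms(2)[OF z]])
qed

lemma holomorphic_fun_on_iterated_derivative:
  assumes "open U" "holomorphic_fun_on f U"
  shows "holomorphic_fun_on (((\<lambda>f z. frechet_derivative f (at z) v) ^^ k) f) U"
  by (induction k) (auto intro: assms holomorphic_fun_on_derivative)

text \<open>Turns the Taylor coefficients of a slice into iterated directional derivatives, which
  depend holomorphically on the position of the slice.\<close>

lemma higher_deriv_line:
  assumes "open U" "holomorphic_fun_on f U" "z + \<xi> *s v \<in> U"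
  shows "(deriv ^^ k) (\<lambda>\<xi>. f (z + \<xi> *s v)) \<xi> = ((\<lambda>f z. frechet_derivative f (at z) v) ^^ k) f (z + \<xi> *s v)"
  using assms(3)
proof (induction k arbitrary: \<xi>)
  case (Suc k)
  have "open ((\<lambda>\<xi>. z + \<xi> *s v) -` U)"
    by (rule open_vimage[OF assms(1)])
       (intro continuous_on_add continuous_on_const linear_continuous_on bounded_linear_cvec_smult_left)
  then have "\<forall>\<^sub>F \<xi> in nhds \<xi>. \<xi> \<in> (\<lambda>\<xi>. z + \<xi> *s v) -` U"
    using Suc.prems by (intro eventually_nhds_in_open) auto
  then have "deriv ((deriv ^^ k) (\<lambda>\<xi>. f (z + \<xi> *s v))) \<xi> =
      deriv (\<lambda>\<xi>. ((\<lambda>f z. frechet_derivative f (at z) v) ^^ k) f (z + \<xi> *s v)) \<xi>"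
    by (intro deriv_cong_ev refl, elim eventually_mono) (simp add: Suc.IH)
  also have "\<dots> = frechet_derivative (((\<lambda>f z. frechet_derivative f (at z) v) ^^ k) f) (at (z + \<xi> *s v)) v"
    by (rule holomorphic_fun_on_deriv_line[OF holomorphic_fun_on_iterated_derivative[OF assms(1,2)] Suc.prems])
  finally show ?case by simp
qed simp

context leaf_extension
begin

text \<open>Hartogs' argument: the Taylor coefficients along \<open>a\<close> at points inside are holomorphic in all
  variables, and the slices extend to discs of a fixed radius with a common bound.\<close>
lemma leaf_extends:
  assumes "\<delta> > 0"
  obtains \<delta>' where "\<delta>' > 0" "\<delta>' \<le> \<delta>" "\<delta>' \<le> R / 2"
    "\<And>p g. p \<in> M \<Longrightarrow> p \<in> ball 0 \<delta>' \<Longrightarrow> leaf \<delta> p g \<Longrightarrow>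
       \<exists>G. holomorphic_fun_on G (ball 0 \<delta>') \<and> (\<forall>z\<in>ball 0 \<delta>'. \<rho> (z + g z *s b) \<ge> 0 \<longrightarrow> G z = g z) \<and>
         (\<forall>m\<in>M \<inter> ball 0 \<delta>'. Re (G m) = 0 \<longrightarrow> G m = 0 \<and> g m = 0)"
proof -
  obtain s \<delta>0 where s: "s > 0" and \<delta>0: "\<delta>0 > 0" "\<delta>0 \<le> \<delta>" and s4: "4 * s \<le> \<delta>" "4 * s \<le> R" and \<delta>0R: "\<delta>0 \<le> R / 2"
    and slice: "\<And>q p g. q \<in> ball 0 \<delta>0 \<Longrightarrow> p \<in> ball 0 \<delta>0 \<Longrightarrow> leaf \<delta> p g \<Longrightarrow>
       \<exists>h. h holomorphic_on ball 0 (s/4) \<and> (\<forall>\<xi>\<in>ball 0 (s/4). cmod (h \<xi>) \<le> 4 * s) \<and>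
         (\<forall>\<xi>\<in>ball 0 (s/4). \<rho> (q + \<xi> *s a + g (q + \<xi> *s a) *s b) \<ge> 0 \<longrightarrow> h \<xi> = g (q + \<xi> *s a)) \<and>
         (q \<in> M \<and> Re (h 0) = 0 \<longrightarrow> h 0 = 0 \<and> g q = 0)"
    using slice_extension[OF assms] by metis
  \<comment> \<open>The expansion point c = i \<delta>9 of the slices lies on the side \<rho> > 0,
    and the disc of radius 3 * s / 16 about it is contained in the disc of radius s / 4 to which the
    slices extend.\<close>
  define \<delta>9 where "\<delta>9 = s / 16"
  have \<delta>9: "\<delta>9 > 0" using s by (simp add: \<delta>9_def)
  define E where "E = C1 * C"
  have E: "E \<ge> C1" "E \<ge> C" "E \<ge> 1"
  proof -
    show 1: "E \<ge> C1" using mult_left_mono[OF C, of C1] C1 by (simp add: E_def)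
    show "E \<ge> C" using mult_right_mono[OF C1, of C] C by (simp add: E_def)
    show "E \<ge> 1" using 1 C1 by simp
  qed
  \<comment> \<open>So small that C * x, C1 * x and C1 * C * x are a small fraction of \<delta>9.
    Then \<rho> > 0 on the leaf over the whole ball \<open>Q\<close>, for every leaf through a point
    of \<open>M\<close> within \<open>x\<close> of 0.\<close>
  define x where "x = min \<delta>0 (\<delta>9 / (42 * E))"
  have x: "x > 0" "x \<le> \<delta>0" using \<delta>0 \<delta>9 E by (auto simp: x_def)
  have "x \<le> \<delta>9 / (42 * E)" by (simp add: x_def)
  then have xE: "42 * (E * x) \<le> \<delta>9" using E by (simp add: field_simps)
  have mono: "C1 * x \<le> E * x" "C * x \<le> E * x" "x \<le> E * x"
    using mult_right_mono[OF E(1), of x] mult_right_mono[OF E(2), of x] mult_right_mono[OF E(3), of x] x by auto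
  then have x9: "42 * x \<le> \<delta>9" using xE by linarith
  define c where "c = \<i> * of_real \<delta>9"
  have nc: "cmod c = \<delta>9" using \<delta>9 by (simp add: c_def norm_mult)
  define Q where "Q = ball (c *s a) (3 * x)"
  note \<epsilon>' = \<epsilon>(1) \<epsilon>_small
  show ?thesis
  proof (rule that[of x])
    show "x > 0" "x \<le> \<delta>" "x \<le> R / 2" using x \<delta>0 \<delta>0R by auto
    fix p g assume pM: "p \<in> M" and p: "p \<in> ball 0 x" and L: "leaf \<delta> p g"
    have pR: "p \<in> ball 0 R" using p x \<delta>0R R by auto
    have pd: "p \<in> ball 0 \<delta>" "p \<in> ball 0 \<delta>0" using p x \<delta>0 by auto
    have Q\<delta>: "w \<in> ball 0 \<delta>" if "w \<in> Q" for w
    proof -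
      have "norm w \<le> norm (c *s a) + 3 * x"
        using that norm_triangle_ineq2[of w "c *s a"] by (simp add: Q_def dist_norm norm_minus_commute)
      then show ?thesis using x9 s s4 by (simp add: norm_cvec_smult a nc \<delta>9_def)
    qed
    have inner: "\<rho> (w + g w *s b) > 0" if w: "w \<in> Q" for w
    proof -
      have wd: "w \<in> ball 0 \<delta>" by (rule Q\<delta>[OF w])
      have cd: "c *s a \<in> ball 0 \<delta>" by (rule Q\<delta>) (use x in \<open>simp add: Q_def\<close>)
      have od: "0 \<in> ball 0 \<delta>" using assms by simp
      have "cmod (g w - g (c *s a)) \<le> 4 * C * norm (w - c *s a)" using L wd cd by (simp add: leaf_def)
      also have "\<dots> \<le> 4 * C * (3 * x)" using w C by (intro mult_left_mono) (auto simp: Q_def dist_norm norm_minus_commute)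
      finally have g1: "cmod (g w - g (c *s a)) \<le> 12 * (C * x)" by simp
      have "cmod (g (0 + c *s a) - g 0) \<le> 4 * \<epsilon> * cmod c" using L od cd unfolding leaf_def by (metis add_0)
      then have g2: "cmod (g (c *s a) - g 0) \<le> 4 * \<epsilon> * \<delta>9" by (simp add: nc)
      have "cmod (g 0 - g p) \<le> 4 * C * norm (0 - p)" using L od pd unfolding leaf_def by blast
      also have "\<dots> \<le> 4 * C * x" using p C by (intro mult_left_mono) auto
      finally have g3: "cmod (g 0) \<le> 4 * (C * x)" using L by (simp add: leaf_def)
      have gw: "cmod (g w) \<le> 16 * (C * x) + 4 * \<epsilon> * \<delta>9"
        using g1 g2 g3 norm_triangle_ineq2[of "g w" "g (c *s a)"] norm_triangle_ineq2[of "g (c *s a)" "g 0"] by linarith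
      define e where "e = w + g w *s b - p"
      define f where "f = (w - c *s a) - p"
      have ef: "e = \<delta>9 *\<^sub>R (\<i> *s a) + f + g w *s b"
        by (simp add: e_def f_def c_def of_real_cvec_smult[symmetric] vector_smult_assoc mult.commute)
      have nf: "norm f \<le> 4 * x"
        using norm_triangle_ineq4[of "w - c *s a" p] w p by (simp add: f_def Q_def dist_norm norm_minus_commute)
      have lf: "\<bar>l f\<bar> \<le> 4 * (C1 * x)" using l_bound[of f] mult_left_mono[OF nf, of C1] C1 by linarith
      have "\<bar>l (g w *s b)\<bar> \<le> C1 * cmod (g w)" using l_bound[of "g w *s b"] by (simp add: norm_cvec_smult b)
      also have "\<dots> \<le> C1 * (16 * (C * x) + 4 * \<epsilon> * \<delta>9)" using gw C1 by (intro mult_left_mono) auto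
      also have "\<dots> = 16 * (E * x) + 4 * ((\<epsilon> * C1) * \<delta>9)" by (simp add: E_def algebra_simps)
      also have "\<dots> \<le> 16 * (E * x) + 4 * (1/100 * \<delta>9)"
        using \<epsilon>(2) \<delta>9 by (intro add_left_mono mult_left_mono mult_right_mono) auto
      finally have lg: "\<bar>l (g w *s b)\<bar> \<le> 16 * (E * x) + \<delta>9 / 25" by simp
      have le: "l e = \<delta>9 + l f + l (g w *s b)"
        unfolding ef by (simp add: linear_add[OF l_lin] linear_cmul[OF l_lin] l_ia)
      have "4 * \<epsilon> * \<delta>9 \<le> 1 * \<delta>9" using \<epsilon>' \<delta>9 by (intro mult_right_mono) auto
      then have "cmod (g w) \<le> 16 * (E * x) + \<delta>9" using gw mono by linarith
      moreover have "norm (\<delta>9 *\<^sub>R (\<i> *s a)) = \<delta>9" using \<delta>9 by (simp add: norm_cvec_smult a)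
      moreover have "norm (g w *s b) = cmod (g w)" by (simp add: norm_cvec_smult b)
      ultimately have "norm e \<le> 2 * \<delta>9 + 4 * x + 16 * (E * x)"
        unfolding ef using norm_triangle_ineq[of "\<delta>9 *\<^sub>R (\<i> *s a) + f" "g w *s b"]
          norm_triangle_ineq[of "\<delta>9 *\<^sub>R (\<i> *s a)" f] nf by linarith
      then have ne: "norm e \<le> 3 * \<delta>9" using mono xE \<delta>9 by linarith
      have ee: "\<epsilon> * norm e \<le> 1/100 * (3 * \<delta>9)" using \<epsilon>' ne by (intro mult_mono) auto
      have "w + g w *s b \<in> ball 0 R" using L wd by (simp add: leaf_def)
      then have "\<bar>\<rho> (w + g w *s b) - \<rho> p - l e\<bar> \<le> \<epsilon> * norm e"
        unfolding e_def using \<rho>_approx pR by blast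
      moreover have "\<rho> p = 0" using M_sub[OF pM pR] by simp
      ultimately show ?thesis using le lf lg ee mono xE \<delta>9 by linarith
    qed
    have holg: "holomorphic_fun_on g Q"
      unfolding holomorphic_fun_on_def
    proof (intro ballI exI conjI allI)
      fix w assume w: "w \<in> Q"
      show "(g has_derivative B (w + g w *s b)) (at w)"
        using L Q\<delta>[OF w] inner[OF w] by (simp add: leaf_def)
      have "w + g w *s b \<in> ball 0 R" using L Q\<delta>[OF w] by (simp add: leaf_def)
      then show "B (w + g w *s b) (c *s v) = c * B (w + g w *s b) v" for c v by (rule B_smult)
    qed
    define good where "good z h \<longleftrightarrow> h holomorphic_on ball 0 (s/4) \<and> (\<forall>\<xi>\<in>ball 0 (s/4). cmod (h \<xi>) \<le> 4 * s) \<and>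
         (\<forall>\<xi>\<in>ball 0 (s/4). \<rho> (z + \<xi> *s a + g (z + \<xi> *s a) *s b) \<ge> 0 \<longrightarrow> h \<xi> = g (z + \<xi> *s a)) \<and>
         (z \<in> M \<and> Re (h 0) = 0 \<longrightarrow> h 0 = 0 \<and> g z = 0)" for z h
    have "\<forall>z\<in>ball 0 x. \<exists>h. good z h"
      using slice pd(2) L x(2) unfolding good_def by (simp add: less_le_trans)
    from bchoice[OF this] obtain h where good: "\<forall>z\<in>ball 0 x. good z (h z)" by blast
    have h: "h z holomorphic_on ball 0 (s/4)"
      "\<And>\<xi>. \<xi> \<in> ball 0 (s/4) \<Longrightarrow> cmod (h z \<xi>) \<le> 4 * s"
      "\<And>\<xi>. \<xi> \<in> ball 0 (s/4) \<Longrightarrow> \<rho> (z + \<xi> *s a + g (z + \<xi> *s a) *s b) \<ge> 0 \<Longrightarrow> h z \<xi> = g (z + \<xi> *s a)"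
      "z \<in> M \<Longrightarrow> Re (h z 0) = 0 \<Longrightarrow> h z 0 = 0 \<and> g z = 0" if "z \<in> ball 0 x" for z
      using good that unfolding good_def by blast+
    define D where "D k = ((\<lambda>f z. frechet_derivative f (at z) a) ^^ k) g" for k
    have holD: "holomorphic_fun_on (D k) Q" for k
      unfolding D_def by (rule holomorphic_fun_on_iterated_derivative[OF _ holg]) (simp add: Q_def)
    have zQ: "z + \<xi> *s a \<in> Q" if "z \<in> ball 0 x" "\<xi> \<in> ball c x" for z \<xi>
    proof -
      have "z + \<xi> *s a - c *s a = z + (\<xi> - c) *s a" by (simp add: vector_sub_rdistrib)
      then have "norm (z + \<xi> *s a - c *s a) \<le> norm z + cmod (\<xi> - c)"
        using norm_triangle_ineq[of z "(\<xi> - c) *s a"] by (simp only: norm_cvec_smult a mult_1_right)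
      also have "\<dots> < 3 * x" using that x by (simp add: dist_norm norm_minus_commute)
      finally show ?thesis by (simp add: Q_def dist_norm norm_minus_commute)
    qed
    have cin: "c \<in> ball c x" using x by simp
    have csub: "ball c r \<subseteq> ball 0 (s/4)" if "r \<le> 3 * s / 16" for r
    proof
      fix \<xi> assume "\<xi> \<in> ball c r"
      then have "cmod \<xi> < \<delta>9 + r" using norm_triangle_ineq2[of \<xi> c] nc by (simp add: dist_norm norm_minus_commute)
      then show "\<xi> \<in> ball 0 (s/4)" using that by (simp add: \<delta>9_def)
    qed
    have hD: "(deriv ^^ k) (h z) c = D k (z + c *s a)" if z: "z \<in> ball 0 x" for z k
    proof -
      have "(deriv ^^ k) (h z) c = (deriv ^^ k) (\<lambda>\<xi>. g (z + \<xi> *s a)) c"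
      proof (rule higher_deriv_transform_within_open[of _ "ball c x"])
        have sub: "ball c x \<subseteq> ball 0 (s/4)" by (rule csub) (use x9 s in \<open>simp add: \<delta>9_def\<close>)
        show "h z holomorphic_on ball c x" by (rule holomorphic_on_subset[OF h(1)[OF z] sub])
        show "(\<lambda>\<xi>. g (z + \<xi> *s a)) holomorphic_on ball c x"
          by (rule holomorphic_fun_on_line[OF holg zQ[OF z]])
        show "h z \<xi> = g (z + \<xi> *s a)" if "\<xi> \<in> ball c x" for \<xi>
          by (rule h(3)[OF z]) (use that sub inner[OF zQ[OF z that]] in auto)
      qed (use cin in auto)
      also have "\<dots> = D k (z + c *s a)" unfolding D_def
        by (rule higher_deriv_line[OF _ holg zQ[OF z cin]]) (simp add: Q_def)
      finally show ?thesis .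
    qed
    \<comment> \<open>The k-th Taylor term about \<open>c\<close> of the slice through
      \<open>z\<close>, evaluated at \<open>z\<close> itself.\<close>
    define T where "T k z = D k (z + c *s a) * ((- c) ^ k / fact k)" for k z
    have Tb: "cmod (T k z) \<le> 4 * s * (2/3) ^ k" if z: "z \<in> ball 0 x" for k z
    proof -
      \<comment> \<open>Cauchy's inequality on radius 3 * s / 32; since cmod c = s / 16, the terms
        decay with ratio 2/3, uniformly in \<open>z\<close>.\<close>
      have "cmod ((deriv ^^ k) (h z) c) \<le> fact k * (4 * s) / (3 * s / 32) ^ k"
      proof (rule Cauchy_inequality)
        have cs: "cball c (3 * s / 32) \<subseteq> ball 0 (s/4)"
        proof -
          have "cball c (3 * s / 32) \<subseteq> ball c (3 * s / 16)" using s by auto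
          then show ?thesis using csub[of "3 * s / 16"] by blast
        qed
        show "h z holomorphic_on ball c (3 * s / 32)"
          by (rule holomorphic_on_subset[OF h(1)[OF z]]) (use cs ball_subset_cball in blast)
        show "continuous_on (cball c (3 * s / 32)) (h z)"
          by (rule continuous_on_subset[OF holomorphic_on_imp_continuous_on[OF h(1)[OF z]] cs])
        show "cmod (h z y) \<le> 4 * s" if "cmod (c - y) = 3 * s / 32" for y
        proof -
          have "y \<in> cball c (3 * s / 32)" using that by (simp add: dist_norm)
          then show ?thesis using cs by (intro h(2)[OF z]) blast
        qed
      qed (use s in simp)
      then have "cmod (D k (z + c *s a)) \<le> fact k * (4 * s) / (3 * s / 32) ^ k" by (simp add: hD[OF z])
      then have "cmod (T k z) \<le> fact k * (4 * s) / (3 * s / 32) ^ k * (\<delta>9 ^ k / fact k)"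
        unfolding T_def norm_mult norm_divide norm_power norm_minus_cancel nc norm_fact
        using \<delta>9 by (intro mult_right_mono) auto
      also have "\<dots> = 4 * s * (\<delta>9 / (3 * s / 32)) ^ k" by (simp add: power_divide)
      also have "\<delta>9 / (3 * s / 32) = 2/3" using s by (simp add: \<delta>9_def)
      finally show ?thesis .
    qed
    have sums: "(\<lambda>k. T k z) sums h z 0" if z: "z \<in> ball 0 x" for z
    proof -
      have "(\<lambda>n. (deriv ^^ n) (h z) c / fact n * (0 - c) ^ n) sums h z 0"
      proof (rule holomorphic_power_series)
        show "h z holomorphic_on ball c (s / 8)"
          by (rule holomorphic_on_subset[OF h(1)[OF z] csub]) (use s in simp)
        show "0 \<in> ball c (s / 8)" using s nc by (simp add: \<delta>9_def)
      qed
      then show ?thesis by (simp add: hD[OF z] T_def)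
    qed
    define G where "G z = (\<Sum>k. T k z)" for z
    have Gh: "G z = h z 0" if "z \<in> ball 0 x" for z using sums[OF that] by (simp add: G_def sums_iff)
    have "holomorphic_fun_on G (ball 0 x)"
    proof (rule holomorphic_fun_on_uniform_limit)
      show "uniform_limit (ball 0 x) (\<lambda>n z. \<Sum>k<n. T k z) G sequentially"
        unfolding G_def by (rule Weierstrass_m_test[OF Tb]) (auto intro!: summable_mult)
      show "holomorphic_fun_on (\<lambda>z. \<Sum>k<n. T k z) (ball 0 x)" for n
        unfolding T_def
        by (intro holomorphic_fun_on_sum holomorphic_fun_on_mult holomorphic_fun_on_const
            holomorphic_fun_on_translate[OF holD] zQ cin)
    qed auto
    moreover have "G z = g z" if "z \<in> ball 0 x" "\<rho> (z + g z *s b) \<ge> 0" for z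
      using h(3)[OF that(1), of 0] that s by (simp add: Gh)
    moreover have "G m = 0 \<and> g m = 0" if "m \<in> M \<inter> ball 0 x" "Re (G m) = 0" for m
      using h(4)[of m] that by (simp add: Gh)
    ultimately show "\<exists>G. holomorphic_fun_on G (ball 0 x) \<and> (\<forall>z\<in>ball 0 x. \<rho> (z + g z *s b) \<ge> 0 \<longrightarrow> G z = g z) \<and>
         (\<forall>m\<in>M \<inter> ball 0 x. Re (G m) = 0 \<longrightarrow> G m = 0 \<and> g m = 0)"
      by blast
  qed
qed

end

section \<open>Tangent spaces in charts\<close>

lemma Ck_1_deriv: "Ck_on 1 f U \<Longrightarrow> x \<in> U \<Longrightarrow> (f has_derivative frechet_derivative f (at x)) (at x)"
  using Ck_on_SucD[of 0 f U x] by simp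

lemma homeomorphism_derivative_inverse:
  assumes "open U" "homeomorphism U V \<phi> \<psi>" "p \<in> U"
    and "(\<phi> has_derivative D) (at p)" "(\<psi> has_derivative D') (at (\<phi> p))"
  shows "D' (D v) = v"
proof -
  have "((\<lambda>x. \<psi> (\<phi> x)) has_derivative (\<lambda>v. D' (D v))) (at p)"
    by (rule has_derivative_compose[OF assms(4,5)])
  moreover have "((\<lambda>x. \<psi> (\<phi> x)) has_derivative (\<lambda>v. v)) (at p)"
    by (rule has_derivative_transform_within_open[OF has_derivative_ident assms(1,3)])
       (use assms(2) in \<open>simp add: homeomorphism_apply1\<close>)
  ultimately have "(\<lambda>v. D' (D v)) = (\<lambda>v. v)" by (rule has_derivative_unique)
  then show ?thesis by (rule fun_cong)
qed

lemma tangent_space_vanishing: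
  fixes f :: "'a::euclidean_space \<Rightarrow> real"
  assumes "v \<in> tangent_space M p" "open U" "p \<in> U" "(f has_derivative D) (at p)"
    and "\<And>x. x \<in> M \<Longrightarrow> x \<in> U \<Longrightarrow> f x = c"
  shows "D v = 0"
proof -
  obtain \<gamma> :: "real \<Rightarrow> 'a" and \<epsilon> where g: "\<epsilon> > 0" "Ck_on 1 \<gamma> {-\<epsilon><..<\<epsilon>}" "\<gamma> ` {-\<epsilon><..<\<epsilon>} \<subseteq> M"
    "\<gamma> 0 = p" "(\<gamma> has_vector_derivative v) (at 0)"
    using assms(1) unfolding tangent_space_def by blast
  have d: "((\<lambda>s. f (\<gamma> s)) has_derivative (\<lambda>h. D (h *\<^sub>R v))) (at 0)"
    by (rule has_derivative_compose[OF g(5)[unfolded has_vector_derivative_def]]) (simp add: g(4) assms(4))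
  have "continuous_on {-\<epsilon><..<\<epsilon>} \<gamma>" by (rule Ck_on_imp_continuous_on[OF g(2)])
  then have "open ({-\<epsilon><..<\<epsilon>} \<inter> \<gamma> -` U)"
    by (rule continuous_open_preimage[OF _ _ assms(2)]) auto
  then have "((\<lambda>s. c) has_derivative (\<lambda>h. D (h *\<^sub>R v))) (at 0)"
  proof (rule has_derivative_transform_within_open[OF d])
    show "f (\<gamma> s) = c" if "s \<in> {-\<epsilon><..<\<epsilon>} \<inter> \<gamma> -` U" for s using g(3) that assms(5) by blast
  qed (use g(1,4) assms(3) in auto)
  then have "(\<lambda>h. D (h *\<^sub>R v)) = (\<lambda>h. 0)"
    using has_derivative_unique has_derivative_const by blast
  from fun_cong[OF this, of 1] show ?thesis by simp
qed

lemma tangent_spaceI: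
  fixes \<psi> :: "'a::euclidean_space \<Rightarrow> 'b::euclidean_space"
  assumes "open V" "y \<in> V" "Ck_on 1 \<psi> V" "\<psi> y = p"
    and "\<delta> > 0" "\<And>s. \<bar>s\<bar> < \<delta> \<Longrightarrow> y + s *\<^sub>R u \<in> V \<Longrightarrow> \<psi> (y + s *\<^sub>R u) \<in> M"
  shows "frechet_derivative \<psi> (at y) u \<in> tangent_space M p"
proof -
  obtain r where r: "r > 0" "ball y r \<subseteq> V" using assms(1,2) open_contains_ball by blast
  define \<epsilon> where "\<epsilon> = min \<delta> (r / (norm u + 1))"
  have \<epsilon>: "\<epsilon> > 0" using r assms(5) by (auto simp: \<epsilon>_def intro!: divide_pos_pos add_nonneg_pos)
  have inV: "y + s *\<^sub>R u \<in> V" if "s \<in> {-\<epsilon><..<\<epsilon>}" for s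
  proof -
    have "\<bar>s\<bar> < r / (norm u + 1)" using that by (auto simp: \<epsilon>_def)
    then have "\<bar>s\<bar> * (norm u + 1) < r"
      using norm_ge_zero[of u] by (simp add: pos_less_divide_eq add_nonneg_pos)
    then have "\<bar>s\<bar> * norm u < r" by (simp add: distrib_left)
    then show ?thesis by (intro subsetD[OF r(2)]) (simp add: dist_norm)
  qed
  have line: "Ck_on 1 (\<lambda>s::real. y + s *\<^sub>R u) {-\<epsilon><..<\<epsilon>}"
    by (rule Ck_on_add[OF _ Ck_on_const Ck_on_bounded_linear[OF _ bounded_linear_scaleR_left Ck_on_id]]) auto
  have c1: "Ck_on 1 (\<lambda>s. \<psi> (y + s *\<^sub>R u)) {-\<epsilon><..<\<epsilon>}"
    by (rule Ck_on_compose[OF _ assms(1,3) line]) (use inV in auto)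
  have c2: "(\<lambda>s. \<psi> (y + s *\<^sub>R u)) ` {-\<epsilon><..<\<epsilon>} \<subseteq> M"
  proof (rule image_subsetI)
    fix s assume s: "s \<in> {-\<epsilon><..<\<epsilon>}"
    then have "\<bar>s\<bar> < \<delta>" by (auto simp: \<epsilon>_def)
    then show "\<psi> (y + s *\<^sub>R u) \<in> M" by (rule assms(6)[OF _ inV[OF s]])
  qed
  have c3: "((\<lambda>s. \<psi> (y + s *\<^sub>R u)) has_vector_derivative frechet_derivative \<psi> (at y) u) (at 0)"
  proof -
    have 1: "((\<lambda>s. y + s *\<^sub>R u) has_derivative (\<lambda>s. s *\<^sub>R u)) (at 0)"
      by (auto intro!: derivative_eq_intros)
    have 2: "(\<psi> has_derivative frechet_derivative \<psi> (at y)) (at (y + 0 *\<^sub>R u))"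
      using Ck_1_deriv[OF assms(3,2)] by simp
    have "((\<lambda>s. \<psi> (y + s *\<^sub>R u)) has_derivative (\<lambda>s. frechet_derivative \<psi> (at y) (s *\<^sub>R u))) (at 0)"
      by (rule has_derivative_compose[OF 1 2])
    then show ?thesis
      unfolding has_vector_derivative_def using linear_cmul[OF has_derivative_linear[OF 2]] by simp
  qed
  show ?thesis unfolding tangent_space_def mem_Collect_eq
  proof (rule exI[of _ "\<lambda>s. \<psi> (y + s *\<^sub>R u)"], rule exI[of _ \<epsilon>], intro conjI)
    show "\<psi> (y + 0 *\<^sub>R u) = p" using assms(4) by simp
  qed (rule \<epsilon> c1 c2 c3)+
qed

text \<open>Membership in \<open>S\<close> is reduced to the vanishing of functionals that vanish on
  \<open>S\<close>; composed with a chart, these are functions to which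
  \<open>tangent_space_vanishing\<close> applies.\<close>

lemma in_subspace_orthogonal:
  fixes S :: "'a::euclidean_space set"
  assumes "subspace S" "\<And>w. (\<And>y. y \<in> S \<Longrightarrow> y \<bullet> w = 0) \<Longrightarrow> x \<bullet> w = 0"
  shows "x \<in> S"
proof -
  have "x \<in> orthogonal_comp (orthogonal_comp S)"
    unfolding orthogonal_comp_def orthogonal_def
    using assms(2) by (auto simp: inner_commute)
  then show ?thesis using orthogonal_comp_self[OF assms(1)] by simp
qed

text \<open>Functionals of the chart that vanish on \<open>M\<close> give one inclusion, straight
  lines in \<open>S\<close> carried back by the chart give the other. The two descriptions agree
  because the derivatives of the chart and of its inverse are inverse to each other.\<close>

lemma chart_tangent_space:
  fixes M :: "'a::euclidean_space set"
  assumes "open U" "open V" "homeomorphism U V \<phi> \<psi>" "Ck_on 1 \<phi> U" "Ck_on 1 \<psi> V"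
    and "subspace S" "\<phi> ` (M \<inter> U) = S \<inter> V" "p \<in> M" "p \<in> U"
  shows "tangent_space M p = {v. frechet_derivative \<phi> (at p) v \<in> S}"
    and "tangent_space M p = frechet_derivative \<psi> (at (\<phi> p)) ` S"
proof -
  define D where "D = frechet_derivative \<phi> (at p)"
  define D' where "D' = frechet_derivative \<psi> (at (\<phi> p))"
  have pV: "\<phi> p \<in> V" using assms(3,9) by (auto simp: homeomorphism_def)
  have D: "(\<phi> has_derivative D) (at p)" unfolding D_def by (rule Ck_1_deriv[OF assms(4,9)])
  have D': "(\<psi> has_derivative D') (at (\<phi> p))" unfolding D'_def by (rule Ck_1_deriv[OF assms(5) pV])
  have \<psi>p: "\<psi> (\<phi> p) = p" using assms(3,9) by (simp add: homeomorphism_apply1)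
  have 1: "D' (D v) = v" for v by (rule homeomorphism_derivative_inverse[OF assms(1,3,9) D D'])
  have 2: "D (D' w) = w" for w
    by (rule homeomorphism_derivative_inverse[OF assms(2) homeomorphism_symD[OF assms(3)] pV D'])
       (simp add: \<psi>p D)
  have A: "D v \<in> S" if v: "v \<in> tangent_space M p" for v
  proof (rule in_subspace_orthogonal[OF assms(6)])
    fix w assume w: "\<And>y. y \<in> S \<Longrightarrow> y \<bullet> w = 0"
    show "D v \<bullet> w = 0"
    proof (rule tangent_space_vanishing[OF v assms(1,9), where f="\<lambda>x. \<phi> x \<bullet> w" and c=0])
      show "((\<lambda>x. \<phi> x \<bullet> w) has_derivative (\<lambda>v. D v \<bullet> w)) (at p)" by (rule has_derivative_inner_left[OF D])
      show "\<phi> x \<bullet> w = 0" if "x \<in> M" "x \<in> U" for x using w assms(7) that by blast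
    qed
  qed
  have B: "D' u \<in> tangent_space M p" if u: "u \<in> S" for u
    unfolding D'_def
  proof (rule tangent_spaceI[OF assms(2) pV assms(5) \<psi>p zero_less_one])
    fix s :: real assume V: "\<phi> p + s *\<^sub>R u \<in> V"
    have "\<phi> p \<in> S" using assms(7,8,9) by blast
    then have "\<phi> p + s *\<^sub>R u \<in> S" using u assms(6) by (simp add: subspace_add subspace_scale)
    then obtain x where "x \<in> M \<inter> U" "\<phi> x = \<phi> p + s *\<^sub>R u" using V assms(7) by (metis IntI imageE)
    then show "\<psi> (\<phi> p + s *\<^sub>R u) \<in> M" using assms(3) by (metis IntE homeomorphism_apply1)
  qed
  show "tangent_space M p = {v. frechet_derivative \<phi> (at p) v \<in> S}"
    using A B 1 unfolding D_def[symmetric] by (metis (mono_tags, lifting) Collect_cong Collect_mem_eq)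
  show "tangent_space M p = frechet_derivative \<psi> (at (\<phi> p)) ` S"
    unfolding D'_def[symmetric] using A B 1 by (auto simp: image_iff) metis
qed

lemma chart_tangent_space_dim:
  fixes M :: "'a::euclidean_space set"
  assumes "open U" "open V" "homeomorphism U V \<phi> \<psi>" "Ck_on 1 \<phi> U" "Ck_on 1 \<psi> V"
    and "subspace S" "\<phi> ` (M \<inter> U) = S \<inter> V" "p \<in> M" "p \<in> U"
  shows "subspace (tangent_space M p)" "dim (tangent_space M p) = dim S"
proof -
  have pV: "\<phi> p \<in> V" using assms(3,9) by (auto simp: homeomorphism_def)
  have D: "(\<phi> has_derivative frechet_derivative \<phi> (at p)) (at p)" by (rule Ck_1_deriv[OF assms(4,9)])
  have D': "(\<psi> has_derivative frechet_derivative \<psi> (at (\<phi> p))) (at (\<phi> p))"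
    by (rule Ck_1_deriv[OF assms(5) pV])
  have lin: "linear (frechet_derivative \<psi> (at (\<phi> p)))" by (rule has_derivative_linear[OF D'])
  have \<psi>p: "\<psi> (\<phi> p) = p" using assms(3,9) by (simp add: homeomorphism_apply1)
  have "frechet_derivative \<phi> (at p) (frechet_derivative \<psi> (at (\<phi> p)) w) = w" for w
    by (rule homeomorphism_derivative_inverse[OF assms(2) homeomorphism_symD[OF assms(3)] pV D'])
       (simp add: \<psi>p D)
  then have inj: "inj (frechet_derivative \<psi> (at (\<phi> p)))" by (metis injI)
  note T = chart_tangent_space(2)[OF assms]
  show "subspace (tangent_space M p)" unfolding T by (rule linear_subspace_image[OF lin assms(6)])
  show "dim (tangent_space M p) = dim S" unfolding T
    by (rule dim_image_eq[OF lin inj_on_subset[OF inj]]) simp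
qed

text \<open>The regularity class is kept as a parameter so that smooth and real analytic
  submanifolds are both covered.\<close>

lemma submanifold_tangent_space:
  assumes "submanifold Rc d M" "p \<in> M" "\<And>f U. open U \<Longrightarrow> Rc f U \<Longrightarrow> Ck_on 1 f U"
  shows "subspace (tangent_space M p)" "dim (tangent_space M p) = d"
proof -
  obtain U V \<phi> S where 1: "p \<in> U" "diffeo Rc U V \<phi>" "subspace S" "dim S = d" "\<phi> ` (M \<inter> U) = S \<inter> V"
    using assms(1,2) unfolding submanifold_def by blast
  then obtain \<psi> where 2: "open U" "open V" "homeomorphism U V \<phi> \<psi>" "Rc \<phi> U" "Rc \<psi> V"
    unfolding diffeo_def by blast
  note T = chart_tangent_space_dim[OF 2(1-3) assms(3)[OF 2(1,4)] assms(3)[OF 2(2,5)] 1(3,5) assms(2) 1(1)]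
  show "subspace (tangent_space M p)" "dim (tangent_space M p) = d" using T 1(4) by auto
qed

lemma smooth_on_imp_Ck: "smooth_on f U \<Longrightarrow> Ck_on k f U"
  by (simp add: smooth_on_def)

section \<open>Complex tangent spaces\<close>

lemma linear_cJ: "linear cJ"
  by (rule linearI) (simp_all add: cJ_def vec_eq_iff algebra_simps)

lemma cJ_cJ: "cJ (cJ v) = - v"
  by (simp add: cJ_def vec_eq_iff)

lemma inj_cJ: "inj cJ"
  by (rule injI) (simp add: cJ_def)

text \<open>J squared is -1 and a subspace is closed under negation, so lying in the image under J
  is tested by applying J.\<close>

lemma complex_tangent_space_iff:
  assumes "subspace (tangent_space M p)"
  shows "v \<in> complex_tangent_space M p \<longleftrightarrow> v \<in> tangent_space M p \<and> cJ v \<in> tangent_space M p"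
proof
  assume "v \<in> complex_tangent_space M p"
  then obtain w where w: "w \<in> tangent_space M p" "v = cJ w" "v \<in> tangent_space M p"
    by (auto simp: complex_tangent_space_def)
  then show "v \<in> tangent_space M p \<and> cJ v \<in> tangent_space M p"
    using subspace_neg[OF assms w(1)] by (simp add: cJ_cJ)
next
  assume v: "v \<in> tangent_space M p \<and> cJ v \<in> tangent_space M p"
  have "v = cJ (- cJ v)" using linear_neg[OF linear_cJ, of "cJ v"] by (simp add: cJ_cJ)
  then show "v \<in> complex_tangent_space M p"
    unfolding complex_tangent_space_def using v subspace_neg[OF assms] by blast
qed

lemma subspace_complex_tangent_space:
  "subspace (tangent_space M p) \<Longrightarrow> subspace (complex_tangent_space M p)"
  unfolding complex_tangent_space_def
  by (intro subspace_inter linear_subspace_image[OF linear_cJ])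

text \<open>The dimension formula for T + J T, which is the whole space by genericity. The form with
  + 4 avoids truncated subtraction.\<close>

lemma dim_complex_tangent_space_generic:
  fixes M :: "(complex ^ 'n) set"
  assumes "generic M" "p \<in> M" "subspace (tangent_space M p)" "dim (tangent_space M p) = DIM(complex ^ 'n) - 2"
  shows "dim (complex_tangent_space M p) + 4 = DIM(complex ^ 'n)"
proof -
  let ?T = "tangent_space M p"
  have sJ: "subspace (cJ ` ?T)" by (rule linear_subspace_image[OF linear_cJ assms(3)])
  have dJ: "dim (cJ ` ?T) = dim ?T"
    by (rule dim_image_eq[OF linear_cJ inj_on_subset[OF inj_cJ]]) simp
  have U: "{x + y |x y. x \<in> ?T \<and> y \<in> cJ ` ?T} = UNIV"
  proof -
    have "{v + cJ w | v w. v \<in> ?T \<and> w \<in> ?T} = UNIV" using assms(1,2) by (simp add: generic_def)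
    moreover have "{v + cJ w | v w. v \<in> ?T \<and> w \<in> ?T} \<subseteq> {x + y |x y. x \<in> ?T \<and> y \<in> cJ ` ?T}" by blast
    ultimately show ?thesis by auto
  qed
  have "dim {x + y |x y. x \<in> ?T \<and> y \<in> cJ ` ?T} + dim (?T \<inter> cJ ` ?T) = dim ?T + dim (cJ ` ?T)"
    by (rule dim_sums_Int[OF assms(3) sJ])
  then have "DIM(complex ^ 'n) + dim (complex_tangent_space M p) = 2 * (DIM(complex ^ 'n) - 2)"
    unfolding U by (simp add: dJ assms(4) complex_tangent_space_def Int_commute dim_UNIV)
  moreover have "DIM(complex ^ 'n) > 0" by simp
  ultimately show ?thesis by arith
qed

section \<open>The field of complex hyperplanes of a real hypersurface\<close>

text \<open>\<open>cdiff r q\<close> is \<open>2 \<partial>r\<close> at \<open>q\<close>.\<close>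

definition cdiff :: "(complex ^ 'n \<Rightarrow> real) \<Rightarrow> complex ^ 'n \<Rightarrow> complex ^ 'n \<Rightarrow> complex" where
  "cdiff r q v = Complex (frechet_derivative r (at q) v) (- frechet_derivative r (at q) (cJ v))"

text \<open>The coefficient for which \<open>v + hproj r b q v *s b\<close> is the projection of
  \<open>v\<close> along \<open>b\<close> to the kernel of \<open>cdiff r q\<close>. It plays the
  part of \<open>B\<close> in \<open>hyperplane_field\<close>.\<close>

definition hproj :: "(complex ^ 'n \<Rightarrow> real) \<Rightarrow> complex ^ 'n \<Rightarrow> complex ^ 'n \<Rightarrow> complex ^ 'n \<Rightarrow> complex" where
  "hproj r b q v = - cdiff r q v / cdiff r q b"

lemma cdiff_linear:
  assumes "r differentiable (at q)"
  shows "cdiff r q (u + v) = cdiff r q u + cdiff r q v" "cdiff r q (c *s v) = c * cdiff r q v"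
proof -
  have lin: "linear (frechet_derivative r (at q))" by (rule linear_frechet_derivative[OF assms])
  note l = linear_add[OF lin] linear_cmul[OF lin] linear_add[OF linear_cJ] linear_neg[OF lin]
  show "cdiff r q (u + v) = cdiff r q u + cdiff r q v" by (simp add: cdiff_def l complex_eq_iff)
  have c: "c *s v = Re c *\<^sub>R v + Im c *\<^sub>R cJ v"
    by (simp add: vec_eq_iff cJ_def scaleR_conv_of_real[where 'a=complex] complex_eq_iff)
  have cJc: "cJ (c *s v) = Re c *\<^sub>R cJ v - Im c *\<^sub>R v"
    by (simp add: vec_eq_iff cJ_def scaleR_conv_of_real[where 'a=complex] complex_eq_iff)
  show "cdiff r q (c *s v) = c * cdiff r q v"
    unfolding cdiff_def cJc unfolding c by (simp add: l linear_diff[OF lin] complex_eq_iff)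
qed

lemma hproj_linear:
  assumes "r differentiable (at q)"
  shows "hproj r b q (u + v) = hproj r b q u + hproj r b q v" "hproj r b q (c *s v) = c * hproj r b q v"
  by (simp_all add: hproj_def cdiff_linear[OF assms] add_divide_distrib diff_divide_distrib)

lemma hproj_tangent:
  assumes "r differentiable (at q)" "cdiff r q b \<noteq> 0"
  shows "cdiff r q (v + hproj r b q v *s b) = 0"
  using assms(2) by (simp only: cdiff_linear[OF assms(1)] hproj_def) simp

lemma Re_cdiff: "Re (cdiff r q v) = frechet_derivative r (at q) v"
  by (simp add: cdiff_def)

lemma Ck_on_cdiff:
  assumes "open U" "Ck_on 2 r U"
  shows "Ck_on 1 (\<lambda>q. cdiff r q v) U"
proof -
  have 1: "Ck_on 1 (\<lambda>q. frechet_derivative r (at q) w) U" for w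
    using assms(2) by (simp add: numeral_2_eq_2)
  have "Ck_on 1 (\<lambda>q. frechet_derivative r (at q) v *\<^sub>R (1::complex) + frechet_derivative r (at q) (cJ v) *\<^sub>R (- \<i>)) U"
    by (rule Ck_on_add[OF assms(1) Ck_on_bounded_linear[OF assms(1) bounded_linear_scaleR_left 1]
          Ck_on_bounded_linear[OF assms(1) bounded_linear_scaleR_left 1]])
  then show ?thesis
    by (rule Ck_on_cong[OF assms(1), rotated]) (simp add: cdiff_def complex_eq_iff)
qed

lemma Ck_on_hproj:
  assumes "open U" "Ck_on 2 r U" "\<And>q. q \<in> U \<Longrightarrow> cdiff r q b \<noteq> 0"
  shows "Ck_on 1 (\<lambda>q. hproj r b q v) U"
  unfolding hproj_def
  by (rule Ck_on_divide[OF assms(1) Ck_on_minus[OF assms(1)]]) (use Ck_on_cdiff[OF assms(1,2)] assms(3) in auto)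

text \<open>Projecting the constant fields \<open>u\<close> and \<open>v\<close> along
  \<open>b\<close> gives fields that are complex tangent on \<open>H\<close>. The constants drop out
  of their bracket, which is therefore a multiple of \<open>b\<close>; it is complex tangent while
  \<open>b\<close> is not, so the coefficient vanishes.\<close>

lemma levi_flat_integrable:
  fixes H :: "(complex ^ 'n) set"
  assumes "levi_flat H" "open U" "Ck_on 2 r U" "\<And>q. q \<in> U \<Longrightarrow> cdiff r q b \<noteq> 0"
    and tan: "\<And>q. q \<in> U \<inter> H \<Longrightarrow> tangent_space H q = {v. frechet_derivative r (at q) v = 0}"
    and q: "q \<in> U \<inter> H"
  shows "frechet_derivative (\<lambda>q. hproj r b q v) (at q) (u + hproj r b q u *s b) =
         frechet_derivative (\<lambda>q. hproj r b q u) (at q) (v + hproj r b q v *s b)"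
proof -
  have rd: "r differentiable (at q)" if "q \<in> U" for q using assms(3) that by (simp add: numeral_2_eq_2)
  have sub: "subspace (tangent_space H q)" if "q \<in> U \<inter> H" for q
    unfolding tan[OF that] using linear_subspace_kernel[OF linear_frechet_derivative[OF rd]] that by simp
  have ctan: "w \<in> complex_tangent_space H q \<longleftrightarrow> cdiff r q w = 0" if "q \<in> U \<inter> H" for q w
    unfolding complex_tangent_space_iff[OF sub[OF that]] tan[OF that] cdiff_def by (simp add: complex_eq_iff)
  define X where "X w q = w + hproj r b q w *s b" for w q
  note h = Ck_on_hproj[OF assms(2-4)]
  have X: "Ck_on 1 (X w) U" for w
    unfolding X_def
    by (rule Ck_on_add[OF assms(2) Ck_on_const Ck_on_bounded_linear[OF assms(2) bounded_linear_cvec_smult_left h]])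
  have Xd: "frechet_derivative (X w) (at q) z = frechet_derivative (\<lambda>q. hproj r b q w) (at q) z *s b" if "q \<in> U" for w q z
  proof -
    have "((\<lambda>q. hproj r b q w) has_derivative frechet_derivative (\<lambda>q. hproj r b q w) (at q)) (at q)"
      by (rule Ck_1_deriv[OF h that])
    from has_derivative_add[OF has_derivative_const bounded_linear.has_derivative[OF bounded_linear_cvec_smult_left this], of w b]
    have "(X w has_derivative (\<lambda>z. 0 + frechet_derivative (\<lambda>q. hproj r b q w) (at q) z *s b)) (at q)"
      unfolding X_def .
    from fun_cong[OF frechet_derivative_at[OF this], of z] show ?thesis by simp
  qed
  have Xt: "X w q \<in> complex_tangent_space H q" if "q \<in> H \<inter> U" for w q
    using ctan[of q] hproj_tangent[OF rd assms(4)] that by (simp add: X_def)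
  have "lie_bracket (X u) (X v) q \<in> complex_tangent_space H q"
    using assms(1) X Xt q assms(2) unfolding levi_flat_def by blast
  then have c0: "cdiff r q (lie_bracket (X u) (X v) q) = 0" using ctan[OF q] by simp
  have qU: "q \<in> U" using q by simp
  have "lie_bracket (X u) (X v) q = (frechet_derivative (\<lambda>q. hproj r b q v) (at q) (X u q) -
      frechet_derivative (\<lambda>q. hproj r b q u) (at q) (X v q)) *s b"
    by (simp add: lie_bracket_def Xd[OF qU] vector_sub_rdistrib)
  then have "(frechet_derivative (\<lambda>q. hproj r b q v) (at q) (X u q) -
      frechet_derivative (\<lambda>q. hproj r b q u) (at q) (X v q)) * cdiff r q b = 0"
    using c0 cdiff_linear(2)[OF rd[OF qU]] by metis
  then show ?thesis using assms(4)[OF qU] by (simp add: X_def)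
qed

text \<open>The constants required by \<open>hyperplane_field\<close>. Compactness bounds the values
  on each basis vector, and real linearity in \<open>v\<close> turns the sum over
  \<open>Basis\<close> into bounds proportional to \<open>norm v\<close>.\<close>

lemma hproj_field:
  fixes r :: "complex ^ 'n \<Rightarrow> real"
  assumes "open U" "Ck_on 2 r U" "\<And>q. q \<in> U \<Longrightarrow> cdiff r q b \<noteq> 0" "cball 0 R \<subseteq> U"
  defines "B \<equiv> hproj r b" and "DB \<equiv> \<lambda>q u v. frechet_derivative (\<lambda>q. hproj r b q v) (at q) u"
  obtains C K :: real where "C \<ge> 1" "K \<ge> 0"
    "\<And>q v. q \<in> ball 0 R \<Longrightarrow> cmod (B q v) \<le> C * norm v"
    "\<And>q q' v. q \<in> ball 0 R \<Longrightarrow> q' \<in> ball 0 R \<Longrightarrow> cmod (B q v - B q' v) \<le> K * norm (q - q') * norm v"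
    "\<And>q v. q \<in> ball 0 R \<Longrightarrow> ((\<lambda>q. B q v) has_derivative (\<lambda>u. DB q u v)) (at q)"
    "\<And>v e. e > 0 \<Longrightarrow> \<exists>d>0. \<forall>q\<in>ball 0 R. \<forall>q'\<in>ball 0 R. dist q q' < d \<longrightarrow>
        cmod (B q' v - B q v - DB q (q' - q) v) \<le> e * norm (q' - q)"
proof -
  note h = Ck_on_hproj[OF assms(1-3)]
  have rd: "r differentiable (at q)" if "q \<in> U" for q using assms(2) that by (simp add: numeral_2_eq_2)
  have inU: "q \<in> U" if "q \<in> ball 0 R" for q using assms(4) that by auto
  have linB: "linear (B q)" if "q \<in> U" for q
  proof (rule linearI)
    show "B q (x + y) = B q x + B q y" for x y by (simp add: B_def hproj_linear[OF rd[OF that]])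
    show "B q (c *\<^sub>R x) = c *\<^sub>R B q x" for c x
      unfolding B_def of_real_cvec_smult[symmetric] hproj_linear[OF rd[OF that]] by (simp add: scaleR_conv_of_real)
  qed
  have "\<exists>k\<ge>0. \<forall>q\<in>cball 0 R. cmod (B q v) \<le> k" for v
  proof -
    have "continuous_on U (\<lambda>q. B q v)" unfolding B_def by (rule Ck_on_imp_continuous_on[OF h])
    then have "compact ((\<lambda>q. B q v) ` cball 0 R)"
      using assms(4) by (meson compact_continuous_image continuous_on_subset compact_cball)
    from compact_imp_bounded[OF this] obtain k where "\<forall>y\<in>(\<lambda>q. B q v) ` cball 0 R. norm y \<le> k"
      unfolding bounded_iff by blast
    then show ?thesis by (intro exI[of _ "\<bar>k\<bar>"]) force
  qed
  then obtain k where k: "\<And>v. k v \<ge> 0" "\<And>v q. q \<in> cball 0 R \<Longrightarrow> cmod (B q v) \<le> k v" by metis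
  have "\<exists>k\<ge>0. \<forall>q\<in>cball 0 R. \<forall>q'\<in>cball 0 R. cmod (B q v - B q' v) \<le> k * norm (q - q')" for v
    using Ck_1_Lipschitz[OF assms(1,4) h, of v] unfolding B_def by metis
  then obtain k' where k': "\<And>v. k' v \<ge> 0"
    "\<And>v q q'. q \<in> cball 0 R \<Longrightarrow> q' \<in> cball 0 R \<Longrightarrow> cmod (B q v - B q' v) \<le> k' v * norm (q - q')" by metis
  define C where "C = 1 + (\<Sum>i\<in>Basis. k i)"
  define K where "K = (\<Sum>i\<in>Basis. k' i)"
  show ?thesis
  proof (rule that[of C K])
    show "C \<ge> 1" using k(1) by (simp add: C_def sum_nonneg)
    show "K \<ge> 0" using k'(1) by (simp add: K_def sum_nonneg)
    fix q v :: "complex ^ 'n" assume q: "q \<in> ball 0 R"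
    have "cmod (B q v) \<le> (\<Sum>i\<in>Basis. norm v * k i)"
      unfolding linear_eq_sum_Basis[OF linB[OF inU[OF q]], of v]
    proof (rule sum_norm_le)
      fix i :: "complex ^ 'n" assume i: "i \<in> Basis"
      have "q \<in> cball 0 R" using q by simp
      from mult_mono[OF Basis_le_norm[OF i, of v] k(2)[OF this, of i] norm_ge_zero norm_ge_zero]
      show "cmod ((v \<bullet> i) *\<^sub>R B q i) \<le> norm v * k i" by simp
    qed
    also have "\<dots> \<le> C * norm v" by (simp add: C_def sum_distrib_left[symmetric] algebra_simps)
    finally show "cmod (B q v) \<le> C * norm v" .
    show "((\<lambda>q. B q v) has_derivative (\<lambda>u. DB q u v)) (at q)"
      unfolding B_def DB_def by (rule Ck_1_deriv[OF h inU[OF q]])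
  next
    fix q q' v :: "complex ^ 'n" assume q: "q \<in> ball 0 R" "q' \<in> ball 0 R"
    then have qc: "q \<in> cball 0 R" "q' \<in> cball 0 R" by auto
    have eq: "B q v - B q' v = (\<Sum>i\<in>Basis. (v \<bullet> i) *\<^sub>R (B q i - B q' i))"
      using linear_eq_sum_Basis[OF linB[OF inU[OF q(1)]], of v] linear_eq_sum_Basis[OF linB[OF inU[OF q(2)]], of v]
      by (simp add: sum_subtractf scaleR_diff_right)
    have "cmod (B q v - B q' v) \<le> (\<Sum>i\<in>Basis. norm v * (k' i * norm (q - q')))"
      unfolding eq
    proof (rule sum_norm_le)
      fix i :: "complex ^ 'n" assume i: "i \<in> Basis"
      from mult_mono[OF Basis_le_norm[OF i, of v] k'(2)[OF qc, of i] norm_ge_zero norm_ge_zero]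
      show "cmod ((v \<bullet> i) *\<^sub>R (B q i - B q' i)) \<le> norm v * (k' i * norm (q - q'))" by (simp only: norm_scaleR)
    qed
    also have "\<dots> = K * norm (q - q') * norm v"
      by (simp add: K_def sum_distrib_left sum_distrib_right algebra_simps)
    finally show "cmod (B q v - B q' v) \<le> K * norm (q - q') * norm v" .
  next
    fix v :: "complex ^ 'n" and e :: real assume "e > 0"
    show "\<exists>d>0. \<forall>q\<in>ball 0 R. \<forall>q'\<in>ball 0 R. dist q q' < d \<longrightarrow>
        cmod (B q' v - B q v - DB q (q' - q) v) \<le> e * norm (q' - q)"
    proof (rule Ck_1_uniform[OF assms(1,4) h[of v] \<open>e > 0\<close>])
      fix d :: real
      assume d: "d > 0" and d2: "\<And>x y. x \<in> cball 0 R \<Longrightarrow> y \<in> cball 0 R \<Longrightarrow> dist x y < d \<Longrightarrow>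
        norm (hproj r b y v - hproj r b x v - frechet_derivative (\<lambda>q. hproj r b q v) (at x) (y - x)) \<le> e * norm (y - x)"
      show ?thesis
        unfolding B_def DB_def
      proof (intro exI[of _ d] conjI d ballI impI)
        fix q q' :: "complex ^ 'n" assume "q \<in> ball 0 R" "q' \<in> ball 0 R" "dist q q' < d"
        then show "cmod (hproj r b q' v - hproj r b q v - frechet_derivative (\<lambda>q. hproj r b q v) (at q) (q' - q)) \<le> e * norm (q' - q)"
          by (intro d2) auto
      qed
    qed
  qed
qed

section \<open>Cutting a linear subspace by a smooth function\<close>

text \<open>An implicit function theorem in ambient form. The map \<Theta> replaces the component of
  \<open>y\<close> along \<open>e\<close> by - h y; as \<open>e\<close> lies in \<open>S\<close> it
  respects \<open>S\<close>, and h = 0 becomes orthogonality to \<open>e\<close>. The inverse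
  function theorem gives a differentiable inverse, whose explicit derivative is used to reach all
  orders.\<close>

lemma smooth_level_subspace:
  fixes h :: "'a::euclidean_space \<Rightarrow> real"
  assumes "open V" "subspace S" "e \<in> S" "smooth_on h V" "y0 \<in> V" "frechet_derivative h (at y0) e \<noteq> 0"
  obtains V' W \<Theta> S' where "y0 \<in> V'" "V' \<subseteq> V" "diffeo smooth_on V' W \<Theta>" "subspace S'" "dim S' + 1 = dim S"
    "\<Theta> ` ({y \<in> S. h y = 0} \<inter> V') = S' \<inter> W" "\<And>y. y \<in> V' \<Longrightarrow> frechet_derivative h (at y) e \<noteq> 0"
proof -
  define D where "D y = frechet_derivative h (at y)" for y
  have hk: "Ck_on k h V" for k using assms(4) by (simp add: smooth_on_def)
  have h1: "Ck_on 1 h V" by (rule hk)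
  have D: "(h has_derivative D y) (at y)" if "y \<in> V" for y
    unfolding D_def by (rule Ck_1_deriv[OF h1 that])
  have linD: "linear (D y)" if "y \<in> V" for y by (rule has_derivative_linear[OF D[OF that]])
  have DC: "Ck_on k (\<lambda>y. D y v) V" for k v using hk[of "Suc k"] by (simp add: D_def)
  have "e \<noteq> 0" using assms(6) linear_0[OF linD[OF assms(5)]] by (auto simp: D_def)
  then have ee: "e \<bullet> e \<noteq> 0" by simp
  define V1 where "V1 = V \<inter> (\<lambda>y. D y e) -` (- {0})"
  have "open V1" unfolding V1_def
    by (rule continuous_open_preimage[OF Ck_on_imp_continuous_on[OF DC[of 0 e]] assms(1)]) auto
  have y0V1: "y0 \<in> V1" using assms(5,6) by (simp add: V1_def D_def)
  define \<Theta> where "\<Theta> y = y - ((y \<bullet> e) / (e \<bullet> e)) *\<^sub>R e - h y *\<^sub>R e" for y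
  define D\<Theta> where "D\<Theta> y v = v - ((v \<bullet> e) / (e \<bullet> e)) *\<^sub>R e - D y v *\<^sub>R e" for y v
  \<comment> \<open>The inverse of \<open>D\<Theta> y\<close> in closed form: only the component
    along \<open>e\<close> has to be corrected.\<close>
  define I\<Theta> where "I\<Theta> y w = w - (((w \<bullet> e) / (e \<bullet> e) + D y w) / D y e) *\<^sub>R e" for y w
  have P: "bounded_linear (\<lambda>y. y - ((y \<bullet> e) / (e \<bullet> e)) *\<^sub>R e)"
  proof -
    have "linear (\<lambda>y. y - ((y \<bullet> e) / (e \<bullet> e)) *\<^sub>R e)"
      by (rule linearI) (simp_all add: inner_add_left add_divide_distrib algebra_simps)
    then show ?thesis by (simp add: linear_conv_bounded_linear)
  qed
  have \<Theta>d: "(\<Theta> has_derivative D\<Theta> y) (at y)" if "y \<in> V" for y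
    unfolding \<Theta>_def D\<Theta>_def
    by (rule has_derivative_diff[OF bounded_linear_imp_has_derivative[OF P] has_derivative_scaleR_left[OF D[OF that]]])
  have inv1: "I\<Theta> y (D\<Theta> y v) = v" if "y \<in> V1" for y v
  proof -
    have y: "y \<in> V" "D y e \<noteq> 0" using that by (auto simp: V1_def)
    have "D\<Theta> y v \<bullet> e = - D y v * (e \<bullet> e)" using ee by (simp add: D\<Theta>_def inner_diff_left)
    moreover have "D y (D\<Theta> y v) = D y v - ((v \<bullet> e) / (e \<bullet> e)) * D y e - D y v * D y e"
      by (simp add: D\<Theta>_def linear_diff[OF linD[OF y(1)]] linear_cmul[OF linD[OF y(1)]])
    ultimately have eq: "((D\<Theta> y v \<bullet> e) / (e \<bullet> e) + D y (D\<Theta> y v)) / D y e = - ((v \<bullet> e) / (e \<bullet> e)) - D y v"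
      using ee y(2) by (simp add: field_simps)
    show ?thesis unfolding I\<Theta>_def eq by (simp add: D\<Theta>_def algebra_simps)
  qed
  have inv2: "D\<Theta> y (I\<Theta> y w) = w" if "y \<in> V1" for y w
  proof -
    have y: "y \<in> V" "D y e \<noteq> 0" using that by (auto simp: V1_def)
    define c0 where "c0 = ((w \<bullet> e) / (e \<bullet> e) + D y w) / D y e"
    have l: "c0 * D y e = (w \<bullet> e) / (e \<bullet> e) + D y w" using y(2) by (simp add: c0_def)
    have I0: "I\<Theta> y w = w - c0 *\<^sub>R e" by (simp add: I\<Theta>_def c0_def)
    have e1: "(I\<Theta> y w \<bullet> e) / (e \<bullet> e) = (w \<bullet> e) / (e \<bullet> e) - c0"
      using ee by (simp add: I0 inner_diff_left diff_divide_distrib)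
    have e2: "D y (I\<Theta> y w) = D y w - c0 * D y e"
      by (simp add: I0 linear_diff[OF linD[OF y(1)]] linear_cmul[OF linD[OF y(1)]])
    show ?thesis unfolding D\<Theta>_def e1 e2 l unfolding I0 by (simp add: algebra_simps)
  qed
  have blD: "bounded_linear (D\<Theta> y)" if "y \<in> V" for y using \<Theta>d[OF that] has_derivative_bounded_linear by blast
  define F where "F y = Blinfun (D\<Theta> y)" for y
  have F: "blinfun_apply (F y) = D\<Theta> y" if "y \<in> V" for y
    unfolding F_def by (rule bounded_linear_Blinfun_apply[OF blD[OF that]])
  have blI: "bounded_linear (I\<Theta> y0)"
  proof -
    have "linear (I\<Theta> y0)"
      unfolding I\<Theta>_def
      by (rule linearI) (simp_all add: inner_add_left linear_add[OF linD[OF assms(5)]] linear_cmul[OF linD[OF assms(5)]]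
          add_divide_distrib algebra_simps)
    then show ?thesis by (simp add: linear_conv_bounded_linear)
  qed
  have F_cont: "continuous_on V1 F"
  proof (rule continuous_on_blinfun_componentwise)
    fix i :: 'a assume "i \<in> Basis"
    have "continuous_on V1 (\<lambda>y. D y i)"
      by (rule continuous_on_subset[OF Ck_on_imp_continuous_on[OF DC[of 0 i]]]) (auto simp: V1_def)
    then have "continuous_on V1 (\<lambda>y. D\<Theta> y i)" unfolding D\<Theta>_def by (intro continuous_intros)
    then show "continuous_on V1 (\<lambda>y. blinfun_apply (F y) i)"
      by (rule continuous_on_eq) (simp add: F V1_def)
  qed
  obtain V' W g g' where IFT: "open V'" "V' \<subseteq> V1" "y0 \<in> V'" "open W" "\<Theta> y0 \<in> W" "homeomorphism V' W \<Theta> g"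
    "\<And>y. y \<in> W \<Longrightarrow> (g has_derivative (g' y)) (at y)"
    "\<And>y. y \<in> W \<Longrightarrow> g' y = inv (blinfun_apply (F (g y)))"
  proof (rule inverse_function_theorem[OF \<open>open V1\<close> _ F_cont y0V1])
    show "(\<Theta> has_derivative blinfun_apply (F x)) (at x)" if "x \<in> V1" for x
      using \<Theta>d[of x] F[of x] that by (auto simp: V1_def)
    show "Blinfun (I\<Theta> y0) o\<^sub>L F y0 = id_blinfun"
      by (rule blinfun_eqI) (simp add: F[OF assms(5)] bounded_linear_Blinfun_apply[OF blI] inv1[OF y0V1])
  qed blast
  have V'V: "V' \<subseteq> V" using IFT(2) by (auto simp: V1_def)
  have gV': "g w \<in> V'" if "w \<in> W" for w using IFT(6) that by (auto simp: homeomorphism_def)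
  have g'I: "g' w v = I\<Theta> (g w) v" if "w \<in> W" for w v
  proof -
    have y: "g w \<in> V1" using gV'[OF that] IFT(2) by blast
    have "inv (D\<Theta> (g w)) v = I\<Theta> (g w) v"
      by (rule inv_f_eq) (use inv1[OF y] inv2[OF y] in \<open>auto intro: injI dest: arg_cong[of _ _ "I\<Theta> (g w)"]\<close>, metis injI)
    then show ?thesis using IFT(8)[OF that] F[of "g w"] y by (simp add: V1_def)
  qed
  have \<Theta>C: "Ck_on k \<Theta> V'" for k
  proof -
    have "Ck_on k (\<lambda>y. y - (y \<bullet> e / (e \<bullet> e)) *\<^sub>R e) V" by (rule Ck_on_linear[OF P])
    then have "Ck_on k \<Theta> V" unfolding \<Theta>_def
      by (rule Ck_on_diff[OF assms(1) _ Ck_on_bounded_linear[OF assms(1) bounded_linear_scaleR_left hk]])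
    then show ?thesis by (rule Ck_on_subset[OF _ V'V])
  qed
  \<comment> \<open>Bootstrapping: the derivative of \<open>g\<close> is a rational expression in
    values of \<open>D (g w)\<close>, hence as regular as \<open>g\<close> itself.\<close>
  have gC: "Ck_on k g W" for k
  proof (induction k)
    case 0
    show ?case using IFT(6) by (simp add: homeomorphism_def)
  next
    case (Suc k)
    have gV: "g ` W \<subseteq> V" using gV' V'V by blast
    have Dg: "Ck_on k (\<lambda>w. D (g w) v) W" for v
      by (rule Ck_on_compose[OF IFT(4) assms(1) DC Suc gV])
    show ?case
    proof (rule Ck_on_SucI[OF IFT(4)])
      show "(g has_derivative I\<Theta> (g w)) (at w)" if "w \<in> W" for w
      proof -
        have "g' w = I\<Theta> (g w)" by (rule ext) (rule g'I[OF that])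
        then show ?thesis using IFT(7)[OF that] by simp
      qed
      show "Ck_on k (\<lambda>w. I\<Theta> (g w) v) W" for v
        unfolding I\<Theta>_def
        by (rule Ck_on_diff[OF IFT(4) Ck_on_const Ck_on_bounded_linear[OF IFT(4) bounded_linear_scaleR_left
                Ck_on_divide[OF IFT(4) Ck_on_add[OF IFT(4) Ck_on_const Dg] Dg]]])
           (use gV' IFT(2) in \<open>auto simp: V1_def\<close>)
    qed
  qed
  define S' where "S' = S \<inter> {x. e \<bullet> x = 0}"
  have sS': "subspace S'" unfolding S'_def by (intro subspace_inter assms(2) subspace_hyperplane)
  have dS': "dim S' + 1 = dim S"
  proof -
    have "{x + y |x y. x \<in> S' \<and> y \<in> span {e}} = S"
    proof (intro equalityI subsetI)
      fix z assume "z \<in> {x + y |x y. x \<in> S' \<and> y \<in> span {e}}"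
      then show "z \<in> S" using assms(2,3) by (auto simp: S'_def span_singleton intro: subspace_add subspace_scale)
    next
      fix z assume z: "z \<in> S"
      have "z = (z - ((z \<bullet> e) / (e \<bullet> e)) *\<^sub>R e) + ((z \<bullet> e) / (e \<bullet> e)) *\<^sub>R e" by simp
      moreover have "z - ((z \<bullet> e) / (e \<bullet> e)) *\<^sub>R e \<in> S'"
        using z assms(2,3) ee by (simp add: S'_def subspace_diff subspace_scale inner_diff_right inner_commute)
      moreover have "((z \<bullet> e) / (e \<bullet> e)) *\<^sub>R e \<in> span {e}" by (simp add: span_base span_scale)
      ultimately show "z \<in> {x + y |x y. x \<in> S' \<and> y \<in> span {e}}" by blast
    qed
    moreover have "S' \<inter> span {e} = {0}"
      using ee subspace_0[OF sS'] by (auto simp: S'_def span_singleton)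
    ultimately show ?thesis
      using dim_sums_Int[OF sS' subspace_span[of "{e}"]] \<open>e \<noteq> 0\<close> by simp
  qed
  have img: "\<Theta> ` ({y \<in> S. h y = 0} \<inter> V') = S' \<inter> W"
  proof (intro equalityI subsetI)
    fix w assume "w \<in> \<Theta> ` ({y \<in> S. h y = 0} \<inter> V')"
    then obtain y where y: "y \<in> S" "h y = 0" "y \<in> V'" "w = \<Theta> y" by blast
    then have "w \<in> S'" using assms(2,3) ee
      by (simp add: S'_def \<Theta>_def subspace_diff subspace_scale inner_diff_right inner_commute)
    then show "w \<in> S' \<inter> W" using y IFT(6) by (auto simp: homeomorphism_def)
  next
    fix w assume w: "w \<in> S' \<inter> W"
    define y where "y = g w"
    have y: "y \<in> V'" "\<Theta> y = w" using w gV' IFT(6) by (auto simp: y_def homeomorphism_apply2)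
    have "e \<bullet> \<Theta> y = 0" using w y by (simp add: S'_def)
    then have h0: "h y = 0" using ee by (simp add: \<Theta>_def inner_diff_right inner_commute)
    have "y = w + ((y \<bullet> e) / (e \<bullet> e)) *\<^sub>R e" using y(2) h0 by (auto simp: \<Theta>_def)
    then have "y \<in> S" using w assms(2,3) by (metis IntD1 S'_def subspace_add subspace_scale)
    then show "w \<in> \<Theta> ` ({y \<in> S. h y = 0} \<inter> V')" using y h0 by blast
  qed
  have diff: "diffeo smooth_on V' W \<Theta>"
    unfolding diffeo_def smooth_on_def using IFT(1,4,6) \<Theta>C gC by blast
  have ne: "frechet_derivative h (at y) e \<noteq> 0" if "y \<in> V'" for y
    using that IFT(2) by (auto simp: V1_def D_def)
  show ?thesis by (rule that[OF IFT(3) V'V diff sS' dS' img ne])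
qed

section \<open>Competitors for the local CR orbit\<close>

lemma tangent_space_mono: "N \<subseteq> M \<Longrightarrow> tangent_space N q \<subseteq> tangent_space M q"
  unfolding tangent_space_def by blast

lemma submanifold_Int_open:
  fixes N :: "'a::euclidean_space set"
  assumes "submanifold smooth_on d N" "open O'"
  shows "submanifold smooth_on d (N \<inter> O')"
  unfolding submanifold_def
proof
  fix p assume p: "p \<in> N \<inter> O'"
  then obtain U V \<phi> S where 1: "p \<in> U" "diffeo smooth_on U V \<phi>" "subspace S" "dim S = d" "\<phi> ` (N \<inter> U) = S \<inter> V"
    using assms(1) unfolding submanifold_def by blast
  then obtain \<psi> where 2: "open U" "open V" "homeomorphism U V \<phi> \<psi>" "smooth_on \<phi> U" "smooth_on \<psi> V"
    unfolding diffeo_def by blast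
  have c: "continuous_on V \<psi>" and im: "\<psi> ` V = U" "\<phi> ` U = V"
    and a: "\<And>x. x \<in> U \<Longrightarrow> \<psi> (\<phi> x) = x" "\<And>y. y \<in> V \<Longrightarrow> \<phi> (\<psi> y) = y"
    using 2(3) by (auto simp: homeomorphism_def)
  define V' where "V' = V \<inter> \<psi> -` O'"
  have oV': "open V'" unfolding V'_def by (rule continuous_open_preimage[OF c 2(2) assms(2)])
  have hom: "homeomorphism (U \<inter> O') V' \<phi> \<psi>"
  proof (rule homeomorphism_of_subsets[OF 2(3)])
    show "\<phi> ` (U \<inter> O') = V'"
    proof (intro equalityI subsetI)
      fix y assume "y \<in> V'"
      then show "y \<in> \<phi> ` (U \<inter> O')" using im a by (intro image_eqI[of _ _ "\<psi> y"]) (auto simp: V'_def)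
    qed (use im a in \<open>auto simp: V'_def\<close>)
  qed (auto simp: V'_def)
  have sm: "smooth_on \<phi> (U \<inter> O')" "smooth_on \<psi> V'"
    using 2(4,5) Ck_on_subset unfolding smooth_on_def V'_def by blast+
  have img: "\<phi> ` (N \<inter> O' \<inter> (U \<inter> O')) = S \<inter> V'"
  proof (intro equalityI subsetI)
    fix y assume "y \<in> \<phi> ` (N \<inter> O' \<inter> (U \<inter> O'))"
    then show "y \<in> S \<inter> V'" using 1(5) im a by (auto simp: V'_def)
  next
    fix y assume y: "y \<in> S \<inter> V'"
    then have "y \<in> \<phi> ` (N \<inter> U)" using 1(5) by (auto simp: V'_def)
    then obtain x where x: "x \<in> N" "x \<in> U" "y = \<phi> x" by blast
    then have "x \<in> O'" using y a by (auto simp: V'_def)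
    then show "y \<in> \<phi> ` (N \<inter> O' \<inter> (U \<inter> O'))" using x by blast
  qed
  have "diffeo smooth_on (U \<inter> O') V' \<phi>" unfolding diffeo_def using 2(1) assms(2) oV' hom sm by blast
  then show "\<exists>U V \<phi> S. p \<in> U \<and> diffeo smooth_on U V \<phi> \<and> subspace S \<and> dim S = d \<and> \<phi> ` (N \<inter> O' \<inter> U) = S \<inter> V"
    using p 1 img by blast
qed

lemma tangent_space_Int_open:
  assumes "open O'" "q \<in> O'"
  shows "tangent_space (N \<inter> O') q = tangent_space N q"
proof
  show "tangent_space (N \<inter> O') q \<subseteq> tangent_space N q" by (rule tangent_space_mono) simp
  show "tangent_space N q \<subseteq> tangent_space (N \<inter> O') q"
  proof
    fix v assume "v \<in> tangent_space N q"
    then obtain \<gamma> :: "real \<Rightarrow> 'a" and \<epsilon> where g: "\<epsilon> > 0" "Ck_on 1 \<gamma> {-\<epsilon><..<\<epsilon>}" "\<gamma> ` {-\<epsilon><..<\<epsilon>} \<subseteq> N"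
      "\<gamma> 0 = q" "(\<gamma> has_vector_derivative v) (at 0)"
      unfolding tangent_space_def by blast
    have "open ({-\<epsilon><..<\<epsilon>} \<inter> \<gamma> -` O')"
      by (rule continuous_open_preimage[OF Ck_on_imp_continuous_on[OF g(2)] _ assms(1)]) simp
    moreover have "0 \<in> {-\<epsilon><..<\<epsilon>} \<inter> \<gamma> -` O'" using g assms(2) by simp
    ultimately obtain d where d: "d > 0" "ball 0 d \<subseteq> {-\<epsilon><..<\<epsilon>} \<inter> \<gamma> -` O'" using open_contains_ball by metis
    have bd: "ball 0 d = {-d<..<d}" by (auto simp: dist_norm)
    have "Ck_on 1 \<gamma> {-d<..<d}" by (rule Ck_on_subset[OF g(2)]) (use d bd in blast)
    moreover have "\<gamma> ` {-d<..<d} \<subseteq> N \<inter> O'" using g(3) d(2) unfolding bd by blast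
    ultimately show "v \<in> tangent_space (N \<inter> O') q"
      unfolding tangent_space_def mem_Collect_eq using d(1) g(4,5) by blast
  qed
qed

text \<open>The orbit is a germ: representatives may be cut down to any neighbourhood of
  \<open>p\<close> without changing the dimension.\<close>

lemma CR_orbit_candidate_Int_open:
  assumes "CR_orbit_candidate M p d N" "open O'" "p \<in> O'"
  shows "CR_orbit_candidate M p d (N \<inter> O')"
proof -
  have c: "complex_tangent_space (N \<inter> O') q = complex_tangent_space N q" if "q \<in> O'" for q
    by (simp add: complex_tangent_space_def tangent_space_Int_open[OF assms(2) that])
  have "CR (N \<inter> O')" using assms(1) c unfolding CR_orbit_candidate_def CR_def by (metis IntE)
  then show ?thesis
    using assms submanifold_Int_open[OF _ assms(2)] c unfolding CR_orbit_candidate_def by auto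
qed

section \<open>Orbits are contained in the extended leaves\<close>

context leaf_extension
begin

text \<open>A point of \<open>M\<close> on the leaf is its own projection and has \<rho> = 0, so it
  is among the points where \<open>leaf\<close> grants a derivative.\<close>

lemma leaf_at_zero:
  assumes L: "leaf \<delta> p g" and m: "m \<in> M" "m \<in> ball 0 \<delta>" "m \<in> ball 0 R" "g m = 0"
  shows "(g has_derivative B m) (at m)"
proof -
  have e: "m + g m *s b = m" using m(4) by simp
  have "\<rho> (m + g m *s b) \<ge> 0" using M_sub[OF m(1,3)] unfolding e by simp
  then have "(g has_derivative B (m + g m *s b)) (at m)" using L m(2) unfolding leaf_def by blast
  then show ?thesis unfolding e .
qed

text \<open>Both functions are differentiable at the boundary point \<open>m\<close>, and they agree in an open cone with
  vertex \<open>m\<close>.\<close>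
lemma extended_leaf_derivative:
  assumes L: "leaf \<delta> p g" and m: "m \<in> M" "m \<in> ball 0 \<delta>" "m \<in> ball 0 R" "g m = 0"
    and \<delta>': "\<delta>' \<le> \<delta>" "m \<in> ball 0 \<delta>'"
    and G: "(G has_derivative D) (at m)" "\<And>z. z \<in> ball 0 \<delta>' \<Longrightarrow> \<rho> (z + g z *s b) \<ge> 0 \<Longrightarrow> G z = g z"
  shows "D v = B m v"
proof -
  have gd: "(g has_derivative B m) (at m)" by (rule leaf_at_zero[OF L m])
  define \<Delta> where "\<Delta> z = G z - g z" for z
  define \<Lambda> where "\<Lambda> v = D v - B m v" for v
  have \<Delta>d: "(\<Delta> has_derivative \<Lambda>) (at m)" unfolding \<Delta>_def \<Lambda>_def by (rule has_derivative_diff[OF G(1) gd])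
  have lin: "linear \<Lambda>" by (rule has_derivative_linear[OF \<Delta>d])
  \<comment> \<open>Half-opening of the cone about i a: perturbing the direction by \<eta> alters
    \<open>g\<close> and \<open>l\<close> by small fractions of the step length.\<close>
  define \<eta> where "\<eta> = 1 / (100 * (C1 * C))"
  have C1C: "C1 * C \<ge> 1" using mult_mono[OF C1 C] C1 by simp
  have \<eta>: "\<eta> > 0" "C1 * C * \<eta> = 1/100" using C1C by (auto simp: \<eta>_def)
  have \<eta>2: "C * \<eta> \<le> 1/100" "C1 * \<eta> \<le> 1/100" "\<eta> \<le> 1/100"
  proof -
    have "0 \<le> C * \<eta>" "0 \<le> C1 * \<eta>" using C C1 \<eta> by auto
    from mult_right_mono[OF C1 this(1)] mult_right_mono[OF C this(2)]
    show 1: "C * \<eta> \<le> 1/100" "C1 * \<eta> \<le> 1/100" using \<eta>(2) by (auto simp: mult.commute mult.left_commute)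
    have "0 \<le> \<eta>" using \<eta> by simp
    from mult_right_mono[OF C this] show "\<eta> \<le> 1/100" using 1 by simp
  qed
  note \<epsilon>' = \<epsilon>(1) \<epsilon>_small
  have cone: "\<Lambda> (\<i> *s a + k) = 0" if k: "norm k \<le> \<eta>" for k
  proof -
    define h where "h = \<i> *s a + k"
    have nh: "norm h \<le> 2" using norm_triangle_ineq[of "\<i> *s a" k] k \<eta>2 by (simp add: h_def norm_cvec_smult a)
    define s0 where "s0 = (\<delta>' - norm m) / 4"
    have s0: "s0 > 0" using \<delta>'(2) by (simp add: s0_def)
    \<comment> \<open>Along a ray of the cone \<rho> at the projection to the leaf grows like
      \<open>s\<close>, since i a points inwards. So \<open>G\<close> and \<open>g\<close> agree
      there.\<close>
    have zero: "\<Delta> (m + s *\<^sub>R h) = 0" if s: "0 \<le> s" "s < s0" for s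
    proof (cases "s = 0")
      case True
      then show ?thesis using G(2)[OF \<delta>'(2)] M_sub[OF m(1,3)] m(4) by (simp add: \<Delta>_def)
    next
      case False
      then have sp: "s > 0" using s by simp
      have inb: "m + u \<in> ball 0 \<delta>'" if "norm u \<le> 3 * s" for u
        using norm_triangle_ineq[of m u] that s by (simp add: s0_def)
      have sh: "norm (s *\<^sub>R h) \<le> 2 * s" using mult_left_mono[OF nh, of s] sp by simp
      have sk: "norm (s *\<^sub>R k) \<le> s * \<eta>" using mult_left_mono[OF k, of s] sp by simp
      have sk3: "norm (s *\<^sub>R k) \<le> 3 * s" using sk mult_left_mono[OF \<eta>2(3), of s] sp by simp
      have z: "m + s *\<^sub>R h \<in> ball 0 \<delta>'" by (rule inb) (use sh sp in simp)
      have z1: "m + s *\<^sub>R k \<in> ball 0 \<delta>'" by (rule inb[OF sk3])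
      have z\<delta>: "m + s *\<^sub>R h \<in> ball 0 \<delta>" "m + s *\<^sub>R k \<in> ball 0 \<delta>" using z z1 \<delta>'(1) by auto
      have eq: "m + s *\<^sub>R k + (\<i> * of_real s) *s a = m + s *\<^sub>R h"
        by (simp add: h_def vec_eq_iff scaleR_conv_of_real[where 'a=complex] algebra_simps)
      have "cmod (g (m + s *\<^sub>R k + (\<i> * of_real s) *s a) - g (m + s *\<^sub>R k)) \<le> 4 * \<epsilon> * cmod (\<i> * of_real s)"
        using L z\<delta> eq unfolding leaf_def by metis
      then have g1: "cmod (g (m + s *\<^sub>R h) - g (m + s *\<^sub>R k)) \<le> 4 * \<epsilon> * s" unfolding eq using sp by (simp add: norm_mult)
      have "cmod (g (m + s *\<^sub>R k) - g m) \<le> 4 * C * norm (m + s *\<^sub>R k - m)" using L z\<delta> m(2) unfolding leaf_def by blast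
      also have "norm (m + s *\<^sub>R k - m) = norm (s *\<^sub>R k)" by simp
      also have "4 * C * norm (s *\<^sub>R k) \<le> 4 * C * (s * \<eta>)" using sk C by (intro mult_left_mono) auto
      finally have g2: "cmod (g (m + s *\<^sub>R k)) \<le> 4 * (C * \<eta>) * s" using m(4) by (simp add: algebra_simps)
      define w where "w = g (m + s *\<^sub>R h)"
      have w: "cmod w \<le> 4 * \<epsilon> * s + 4 * (C * \<eta>) * s"
        unfolding w_def using g1 g2 norm_triangle_ineq2[of "g (m + s *\<^sub>R h)" "g (m + s *\<^sub>R k)"] by linarith
      define e where "e = s *\<^sub>R h + w *s b"
      have "C1 * cmod w \<le> C1 * (4 * \<epsilon> * s + 4 * (C * \<eta>) * s)" using w C1 by (intro mult_left_mono) auto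
      also have "\<dots> = 4 * (\<epsilon> * C1) * s + 4 * (C1 * C * \<eta>) * s" by (simp add: algebra_simps)
      also have "\<dots> \<le> 4 * (1/100) * s + 4 * (1/100) * s"
        using \<epsilon>(2) \<eta>(2) sp by (intro add_mono mult_right_mono mult_left_mono) auto
      finally have C1w: "C1 * cmod w \<le> 8/100 * s" by simp
      then have w1: "cmod w \<le> 8/100 * s" using mult_right_mono[OF C1 norm_ge_zero[of w]] by simp
      have le: "l e = s + s * l k + l (w *s b)"
        by (simp add: e_def h_def linear_add[OF l_lin] linear_cmul[OF l_lin] l_ia algebra_simps)
      have "\<bar>l (w *s b)\<bar> \<le> 8/100 * s" using l_bound[of "w *s b"] C1w by (simp add: norm_cvec_smult b)
      moreover have "\<bar>s * l k\<bar> \<le> s * (1/100)"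
      proof -
        have "\<bar>l k\<bar> \<le> 1/100" using l_bound[of k] mult_left_mono[OF k, of C1] C1 \<eta>2(2) by linarith
        then have "s * \<bar>l k\<bar> \<le> s * (1/100)" using sp by (intro mult_left_mono) auto
        then show ?thesis using sp by (simp add: abs_mult)
      qed
      moreover have "norm e \<le> 3 * s"
        unfolding e_def using norm_triangle_ineq[of "s *\<^sub>R h" "w *s b"] sh w1 sp norm_cvec_smult[of w b] unfolding b by linarith
      then have "\<epsilon> * norm e \<le> 1/100 * (3 * s)" using \<epsilon>' by (intro mult_mono) auto
      moreover have "\<bar>\<rho> (m + s *\<^sub>R h + w *s b) - \<rho> m - l e\<bar> \<le> \<epsilon> * norm e"
      proof -
        have "m + s *\<^sub>R h + w *s b \<in> ball 0 R" using L z\<delta>(1) unfolding leaf_def w_def by blast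
        from \<rho>_approx[OF this m(3)] show ?thesis by (simp add: e_def add.assoc)
      qed
      ultimately have "\<rho> (m + s *\<^sub>R h + w *s b) \<ge> 0" using le sp M_sub[OF m(1,3)] by linarith
      then show ?thesis using G(2)[OF z] by (simp add: \<Delta>_def w_def)
    qed
    have "((\<lambda>s. m + s *\<^sub>R h) has_derivative (\<lambda>s. s *\<^sub>R h)) (at 0 within {0..<s0})"
      by (auto intro!: derivative_eq_intros)
    from has_derivative_compose[OF this, of \<Delta> \<Lambda>] \<Delta>d
    have "((\<lambda>s. \<Delta> (m + s *\<^sub>R h)) has_derivative (\<lambda>s. \<Lambda> (s *\<^sub>R h))) (at 0 within {0..<s0})" by simp
    then have 1: "((\<lambda>s. \<Delta> (m + s *\<^sub>R h)) has_vector_derivative \<Lambda> h) (at 0 within {0..<s0})"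
      by (simp add: has_vector_derivative_def linear_cmul[OF lin])
    have 2: "((\<lambda>s. \<Delta> (m + s *\<^sub>R h)) has_vector_derivative 0) (at 0 within {0..<s0})"
      by (rule has_vector_derivative_transform[OF _ _ has_vector_derivative_const[of 0]]) (use s0 zero in auto)
    have "at 0 within {0..<s0} \<noteq> bot"
      using s0 by (simp add: trivial_limit_within islimpt_Ico)
    from vector_derivative_unique_within[OF this 1 2] show ?thesis by (simp add: h_def)
  qed
  \<comment> \<open>A linear map that vanishes on a ball about i a also vanishes on differences,
    hence on a ball about 0.\<close>
  have small: "\<Lambda> k = 0" if "norm k \<le> \<eta>" for k
    using cone[OF that] cone[of 0] \<eta> linear_add[OF lin, of "\<i> *s a" k] by simp
  have "\<Lambda> v = 0"
  proof (cases "v = 0")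
    case False
    have "\<Lambda> ((\<eta> / norm v) *\<^sub>R v) = 0" by (rule small) (use \<eta> in simp)
    then show ?thesis using False \<eta> by (simp add: linear_cmul[OF lin])
  qed (simp add: linear_0[OF lin])
  then show ?thesis by (simp add: \<Lambda>_def)
qed

end

section \<open>Orbits inside an extended leaf\<close>

context leaf_extension
begin

text \<open>As \<open>b\<close> is tangent to \<open>M\<close> at 0 and \<open>B q b = -1\<close>,
  the derivative of \<open>Re Ge\<close> is nonzero along \<open>M\<close> near 0 at points of the
  leaf. So its zero set in \<open>M\<close> is a submanifold near \<open>p\<close>, and
  \<open>Ge\<close> does not vanish identically. For dimensions: with N = CARD('n), the complex
  tangent spaces of \<open>M\<close> have dimension 2N - 4 and the competitor has dimension 2N - 3,
  which leaves the orbit only two possibilities.\<close>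

lemma not_almost_minimal:
  assumes an: "submanifold real_analytic_on (DIM(complex ^ 'n) - 2) M" and gen: "generic M" and M0: "0 \<in> M"
    and tanM: "\<And>m v. m \<in> M \<Longrightarrow> m \<in> ball 0 R \<Longrightarrow> v \<in> tangent_space M m \<Longrightarrow> Dr m v = 0"
    and kerB: "\<And>q v. q \<in> ball 0 R \<Longrightarrow> Dr q v = 0 \<Longrightarrow> Dr q (cJ v) = 0 \<Longrightarrow> B q v = 0"
    and bT: "b \<in> tangent_space M 0"
  shows "\<not> almost_minimal_at_origin M"
proof
  assume am: "almost_minimal_at_origin M"
  have ana: "Ck_on k f U" if "open U" "real_analytic_on f U" for k and f :: "complex ^ 'n \<Rightarrow> complex ^ 'n" and U
    using real_analytic_imp_smooth[OF that] by (simp add: smooth_on_def)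
  obtain U1 V1 \<phi> S where U1: "0 \<in> U1" and df: "diffeo real_analytic_on U1 V1 \<phi>" and S: "subspace S" "dim S = DIM(complex ^ 'n) - 2"
    and im1: "\<phi> ` (M \<inter> U1) = S \<inter> V1"
    using an M0 unfolding submanifold_def by blast
  obtain \<psi> where o1: "open U1" "open V1" and hom: "homeomorphism U1 V1 \<phi> \<psi>" and anf: "real_analytic_on \<phi> U1" "real_analytic_on \<psi> V1"
    using df unfolding diffeo_def by blast
  have Ck: "Ck_on k \<phi> U1" "Ck_on k \<psi> V1" for k using ana o1 anf by blast+
  have a1: "\<psi> (\<phi> x) = x" "\<phi> x \<in> V1" if "x \<in> U1" for x using hom that by (auto simp: homeomorphism_def)
  have a2: "\<phi> (\<psi> y) = y" "\<psi> y \<in> U1" if "y \<in> V1" for y using hom that by (auto simp: homeomorphism_def)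
  have M\<psi>: "\<psi> y \<in> M" if "y \<in> S" "y \<in> V1" for y
  proof -
    have "y \<in> \<phi> ` (M \<inter> U1)" unfolding im1 using that by simp
    then obtain x where x: "x \<in> M" "x \<in> U1" "y = \<phi> x" by blast
    show ?thesis unfolding x(3) a1(1)[OF x(2)] by (rule x(1))
  qed
  have M\<phi>: "\<phi> x \<in> S" if "x \<in> M" "x \<in> U1" for x using im1 that by blast
  note TM = chart_tangent_space[OF o1 hom Ck S(1) im1]
  have tsM: "subspace (tangent_space M m)" "dim (tangent_space M m) = DIM(complex ^ 'n) - 2" if "m \<in> M" for m
    using submanifold_tangent_space[OF an that ana] by auto
  have dimTc: "dim (complex_tangent_space M m) + 4 = DIM(complex ^ 'n)" if "m \<in> M" for m
    by (rule dim_complex_tangent_space_generic[OF gen that tsM[OF that]])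
  have TcB: "B m v = 0" if "m \<in> M" "m \<in> ball 0 R" "v \<in> complex_tangent_space M m" for m v
    using that(3) unfolding complex_tangent_space_iff[OF tsM(1)[OF that(1)]]
    by (intro kerB[OF that(2)] tanM[OF that(1,2)]) auto
  \<comment> \<open>\<open>b\<close> read in the chart of \<open>M\<close>. The field
    \<open>vf\<close> carries this constant vector to nearby points of \<open>M\<close> as a tangent
    vector close to \<open>b\<close>.\<close>
  define e where "e = frechet_derivative \<phi> (at 0) b"
  have eS: "e \<in> S" using bT TM(1)[OF M0 U1] by (simp add: e_def)
  define vf where "vf x = frechet_derivative \<psi> (at (\<phi> x)) e" for x
  have vf0: "vf 0 = b"
    unfolding vf_def e_def
    by (rule homeomorphism_derivative_inverse[OF o1(1) hom U1 Ck_1_deriv[OF Ck(1) U1] Ck_1_deriv[OF Ck(2) a1(2)[OF U1]]])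
  have vfT: "vf x \<in> tangent_space M x" if "x \<in> M" "x \<in> U1" for x
    using TM(2)[OF that] eS by (simp add: vf_def)
  have "continuous_on V1 (\<lambda>y. frechet_derivative \<psi> (at y) e)"
    using Ck(2)[of 1] by simp
  moreover have "continuous_on U1 \<phi>" by (rule Ck_on_imp_continuous_on[OF Ck(1)[of 0]])
  ultimately have "continuous_on U1 vf" unfolding vf_def
    by (rule continuous_on_compose2) (use a1 in auto)
  then have "isCont vf 0" using o1(1) U1 by (simp add: continuous_on_eq_continuous_at)
  \<comment> \<open>This tolerance keeps \<open>B p (vf p)\<close> within 1/2 of
    \<open>B p b\<close>, which is -1.\<close>
  moreover have "1 / (2 * C) > 0" using C by simp
  ultimately obtain d1 where d1: "d1 > 0" "\<And>x. dist x 0 < d1 \<Longrightarrow> dist (vf x) (vf 0) < 1 / (2 * C)"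
    unfolding continuous_at_eps_delta by blast
  obtain d2 where d2: "d2 > 0" "ball 0 d2 \<subseteq> U1" using o1(1) U1 open_contains_ball by blast
  obtain \<delta> :: real and t :: "complex ^ 'n \<Rightarrow> complex" and G :: "complex \<Rightarrow> complex ^ 'n \<Rightarrow> complex" where \<delta>: "\<delta> > 0"
    and G1: "\<And>m. m \<in> ball 0 \<delta> \<Longrightarrow> G (t m) m = 0"
    and G2: "\<And>m z z'. m \<in> ball 0 \<delta> \<Longrightarrow> z \<in> ball 0 \<delta> \<Longrightarrow> z' \<in> ball 0 \<delta> \<Longrightarrow>
        cmod (G (t m) z - G (t m) z') \<le> 4 * C * norm (z - z')"
    and G3: "\<And>m z \<xi>. m \<in> ball 0 \<delta> \<Longrightarrow> z \<in> ball 0 \<delta> \<Longrightarrow> z + \<xi> *s a \<in> ball 0 \<delta> \<Longrightarrow>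
        cmod (G (t m) (z + \<xi> *s a) - G (t m) z) \<le> 4 * \<epsilon> * cmod \<xi>"
    and G4: "\<And>m z c. m \<in> ball 0 \<delta> \<Longrightarrow> z \<in> ball 0 \<delta> \<Longrightarrow> z + c *s b \<in> ball 0 \<delta> \<Longrightarrow>
        G (t m) (z + c *s b) = G (t m) z - c"
    and G5: "\<And>m z. m \<in> ball 0 \<delta> \<Longrightarrow> z \<in> ball 0 \<delta> \<Longrightarrow> z + G (t m) z *s b \<in> ball 0 R"
    and G6: "\<And>m z. m \<in> ball 0 \<delta> \<Longrightarrow> z \<in> ball 0 \<delta> \<Longrightarrow> r (z + G (t m) z *s b) = r m"
    and G7: "\<And>m z. m \<in> ball 0 \<delta> \<Longrightarrow> z \<in> ball 0 \<delta> \<Longrightarrow> r m = 0 \<Longrightarrow> \<rho> (z + G (t m) z *s b) \<ge> 0 \<Longrightarrow>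
        (G (t m) has_derivative B (z + G (t m) z *s b)) (at z)"
    and G8: "\<And>m m'. m \<in> ball 0 \<delta> \<Longrightarrow> m' \<in> ball 0 \<delta> \<Longrightarrow> cmod (t m - t m') \<le> 2 * cmod (G (t m) m')"
  proof (rule leaf_family, goal_cases)
    case (1 \<delta> t G)
    show thesis by (rule 1(1)[of \<delta> G t, OF 1(2-)])
  qed
  have leafG: "leaf \<delta> m (G (t m))" if "m \<in> ball 0 \<delta>" "r m = 0" for m
    unfolding leaf_def using G1 G2 G3 G4 G5 G6 G7 that by auto
  obtain \<delta>' where \<delta>': "\<delta>' > 0" "\<delta>' \<le> \<delta>" "\<delta>' \<le> R / 2"
    and ext: "\<And>p g. p \<in> M \<Longrightarrow> p \<in> ball 0 \<delta>' \<Longrightarrow> leaf \<delta> p g \<Longrightarrow>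
       \<exists>G. holomorphic_fun_on G (ball 0 \<delta>') \<and> (\<forall>z\<in>ball 0 \<delta>'. \<rho> (z + g z *s b) \<ge> 0 \<longrightarrow> G z = g z) \<and>
         (\<forall>m\<in>M \<inter> ball 0 \<delta>'. Re (G m) = 0 \<longrightarrow> G m = 0 \<and> g m = 0)"
  proof (rule leaf_extends[OF \<delta>], goal_cases)
    case (1 \<delta>')
    show thesis by (rule 1(1)[of \<delta>', OF 1(2-)])
  qed
  define x where "x = min \<delta>' (min d1 d2)"
  have x: "x > 0" "x \<le> \<delta>'" "x \<le> d1" "x \<le> d2" using \<delta>' d1 d2 by (auto simp: x_def)
  define U where "U = ball (0 :: complex ^ 'n) x"
  have Ub: "z \<in> ball 0 \<delta>'" "z \<in> ball 0 \<delta>" "z \<in> ball 0 R" "z \<in> U1" if "z \<in> U" for z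
    using that x \<delta>' d2 R by (auto simp: U_def)
  have "open U" "connected U" "0 \<in> U" using x by (auto simp: U_def)
  then have "\<exists>p\<in>U \<inter> M. \<forall>N. local_CR_orbit M p N \<longrightarrow> (\<forall>V. analytic_subvariety U V \<and> V \<noteq> U \<longrightarrow> \<not> N \<subseteq> V)"
    using spec[OF am[unfolded almost_minimal_at_origin_def], of U] by simp
  then obtain p where p: "p \<in> U" "p \<in> M"
    and orb0: "\<forall>N. local_CR_orbit M p N \<longrightarrow> (\<forall>V. analytic_subvariety U V \<and> V \<noteq> U \<longrightarrow> \<not> N \<subseteq> V)"
    by auto
  have orb: "\<not> N \<subseteq> V" if "local_CR_orbit M p N" "analytic_subvariety U V" "V \<noteq> U" for N V
    using orb0 that by simp
  have Mr: "r m = 0" "\<rho> m = 0" if "m \<in> M" "m \<in> U" for m using M_sub[OF that(1) Ub(3)[OF that(2)]] by auto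
  define g where "g = G (t p)"
  have L: "leaf \<delta> p g" unfolding g_def by (rule leafG[OF Ub(2)[OF p(1)] Mr(1)[OF p(2,1)]])
  obtain Ge where Ge: "holomorphic_fun_on Ge (ball 0 \<delta>')"
    "\<And>z. z \<in> ball 0 \<delta>' \<Longrightarrow> \<rho> (z + g z *s b) \<ge> 0 \<Longrightarrow> Ge z = g z"
    "\<And>m. m \<in> M \<Longrightarrow> m \<in> ball 0 \<delta>' \<Longrightarrow> Re (Ge m) = 0 \<Longrightarrow> Ge m = 0 \<and> g m = 0"
    using ext[OF p(2) Ub(1)[OF p(1)] L] by blast
  have gp: "g p = 0" using L by (simp add: leaf_def)
  have GeM: "Ge m = 0" if "m \<in> M" "m \<in> U" "g m = 0" for m
    using Ge(2)[OF Ub(1)[OF that(2)]] Mr[OF that(1,2)] that(3) by simp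
  have GeD: "frechet_derivative Ge (at m) v = B m v" if "m \<in> M" "m \<in> U" "g m = 0" for m v
    by (rule extended_leaf_derivative[OF L that(1) Ub(2)[OF that(2)] Ub(3)[OF that(2)] that(3) \<delta>'(2) Ub(1)[OF that(2)]
          holomorphic_fun_onD(1)[OF Ge(1) Ub(1)[OF that(2)]] Ge(2)])
  define Vr where "Vr = {z \<in> U. Ge z = 0}"
  have Vr: "analytic_subvariety U Vr"
    unfolding analytic_subvariety_def
  proof (intro conjI ballI)
    fix q assume "q \<in> U"
    have "holomorphic_fun_on Ge U" by (rule holomorphic_fun_on_subset[OF Ge(1)]) (use Ub in blast)
    then show "\<exists>W F. open W \<and> q \<in> W \<and> W \<subseteq> U \<and> finite F \<and> (\<forall>f\<in>F. holomorphic_fun_on f W) \<and> Vr \<inter> W = {z \<in> W. \<forall>f\<in>F. f z = 0}"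
      using \<open>open U\<close> \<open>q \<in> U\<close> by (intro exI[of _ U] exI[of _ "{Ge}"]) (auto simp: Vr_def)
  qed (auto simp: Vr_def)
  have VrU: "Vr \<noteq> U"
  proof
    assume "Vr = U"
    then have z: "Ge z = 0" if "z \<in> U" for z using that by (auto simp: Vr_def)
    have "(Ge has_derivative (\<lambda>v. 0)) (at p)"
      by (rule has_derivative_transform_within_open[OF has_derivative_const \<open>open U\<close> p(1)]) (use z in auto)
    from fun_cong[OF frechet_derivative_at[OF this], of b] GeD[OF p(2,1) gp, of b] B_b[OF Ub(3)[OF p(1)]]
    show False by simp
  qed
  define h where "h y = Re (Ge (\<psi> y))" for y
  define V2 where "V2 = V1 \<inter> \<psi> -` U"
  have oV2: "open V2" unfolding V2_def
    by (rule continuous_open_preimage[OF Ck_on_imp_continuous_on[OF Ck(2)[of 0]] o1(2) \<open>open U\<close>])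
  have pV2: "\<phi> p \<in> V2" using a1[OF Ub(4)[OF p(1)]] p(1) by (simp add: V2_def)
  have hs: "smooth_on h V2"
    unfolding smooth_on_def h_def
  proof
    fix k
    have "Ck_on k (\<lambda>y. Ge (\<psi> y)) V2"
      by (rule Ck_on_compose[OF oV2 open_ball holomorphic_fun_on_imp_Ck[OF open_ball Ge(1)] Ck_on_subset[OF Ck(2)]])
         (use Ub in \<open>auto simp: V2_def\<close>)
    then show "Ck_on k (\<lambda>y. Re (Ge (\<psi> y))) V2" by (rule Ck_on_bounded_linear[OF oV2 bounded_linear_Re])
  qed
  have hd: "frechet_derivative h (at y) v = Re (frechet_derivative Ge (at (\<psi> y)) (frechet_derivative \<psi> (at y) v))"
    if "y \<in> V2" for y v
  proof -
    have y: "y \<in> V1" "\<psi> y \<in> ball 0 \<delta>'" using that Ub by (auto simp: V2_def)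
    have "(h has_derivative (\<lambda>v. Re (frechet_derivative Ge (at (\<psi> y)) (frechet_derivative \<psi> (at y) v)))) (at y)"
      unfolding h_def
      by (rule bounded_linear.has_derivative[OF bounded_linear_Re
            has_derivative_compose[OF Ck_1_deriv[OF Ck(2) y(1)] holomorphic_fun_onD(1)[OF Ge(1) y(2)]]])
    from fun_cong[OF frechet_derivative_at[OF this], of v] show ?thesis by simp
  qed
  have hne: "frechet_derivative h (at (\<phi> p)) e \<noteq> 0"
  proof -
    have "frechet_derivative h (at (\<phi> p)) e = Re (B p (vf p))"
      unfolding hd[OF pV2] using a1(1)[OF Ub(4)[OF p(1)]] GeD[OF p(2,1) gp] by (simp add: vf_def)
    moreover have "Re (B p (vf p)) = Re (B p (vf p - b)) - 1"
      using B_diff[OF Ub(3)[OF p(1)], of "vf p" b] B_b[OF Ub(3)[OF p(1)]] by simp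
    moreover have "cmod (B p (vf p - b)) < 1"
    proof -
      have "norm (vf p - b) < 1 / (2 * C)" using d1(2)[of p] p(1) x vf0 by (simp add: U_def dist_norm)
      then have "C * norm (vf p - b) < 1 / 2" using C by (simp add: field_simps)
      then show ?thesis using B_bound[OF Ub(3)[OF p(1)], of "vf p - b"] by linarith
    qed
    ultimately show ?thesis using abs_Re_le_cmod[of "B p (vf p - b)"] by linarith
  qed
  obtain V' W \<Theta> S' where cut: "\<phi> p \<in> V'" "V' \<subseteq> V2" "diffeo smooth_on V' W \<Theta>" "subspace S'" "dim S' + 1 = dim S"
    "\<Theta> ` ({y \<in> S. h y = 0} \<inter> V') = S' \<inter> W" "\<And>y. y \<in> V' \<Longrightarrow> frechet_derivative h (at y) e \<noteq> 0"
  proof (rule smooth_level_subspace[OF oV2 S(1) eS hs pV2 hne], goal_cases)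
    case (1 V' W \<Theta> S')
    show thesis by (rule 1(1)[OF 1(2-)])
  qed
  obtain \<Theta>i where o2: "open V'" "open W" and hom2: "homeomorphism V' W \<Theta> \<Theta>i" and sm2: "smooth_on \<Theta> V'" "smooth_on \<Theta>i W"
    using cut(3) unfolding diffeo_def by blast
  define U' where "U' = U1 \<inter> \<phi> -` V'"
  have oU': "open U'" unfolding U'_def
    by (rule continuous_open_preimage[OF Ck_on_imp_continuous_on[OF Ck(1)[of 0]] o1(1) o2(1)])
  have V'V1: "V' \<subseteq> V1" using cut(2) by (auto simp: V2_def)
  have U'U: "z \<in> U" if "z \<in> U'" for z using that cut(2) a1 by (fastforce simp: U'_def V2_def)
  have hom1: "homeomorphism U' V' \<phi> \<psi>"
  proof (rule homeomorphism_of_subsets[OF hom])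
    show "\<phi> ` U' = V'"
    proof (intro equalityI subsetI)
      fix y assume "y \<in> V'"
      then show "y \<in> \<phi> ` U'" using V'V1 a2 by (intro image_eqI[of _ _ "\<psi> y"]) (auto simp: U'_def)
    qed (auto simp: U'_def)
  qed (use V'V1 in \<open>auto simp: U'_def\<close>)
  define N where "N = {m \<in> M \<inter> U'. Ge m = 0}"
  \<comment> \<open>The complex equation for \<open>N\<close> may be replaced by a single real one,
    so that \<open>N\<close> has codimension 1 in \<open>M\<close>.\<close>
  have Nre: "N = {m \<in> M \<inter> U'. Re (Ge m) = 0}"
    using Ge(3) Ub(1)[OF U'U] unfolding N_def by auto
  have pN: "p \<in> N" using p Ub(4)[OF p(1)] cut(1) GeM[OF p(2,1) gp] by (simp add: N_def U'_def)
  have Nprop: "m \<in> M" "m \<in> U" "g m = 0" "Ge m = 0" "m \<in> U'" "m \<in> U1" if "m \<in> N" for m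
    using that U'U Ge(3)[of m] Ub(1)[of m] by (auto simp: N_def U'_def)
  define \<kappa> where "\<kappa> z = \<Theta> (\<phi> z)" for z
  define \<kappa>i where "\<kappa>i w = \<psi> (\<Theta>i w)" for w
  have hom3: "homeomorphism U' W \<kappa> \<kappa>i"
    using homeomorphism_compose[OF hom1 hom2] by (simp add: o_def \<kappa>_def[abs_def] \<kappa>i_def[abs_def])
  have sm3: "Ck_on k \<kappa> U'" "Ck_on k \<kappa>i W" for k
  proof -
    have i1: "\<phi> ` U' \<subseteq> V'" by (auto simp: U'_def)
    have i2: "\<Theta>i ` W \<subseteq> V'" using hom2 by (auto simp: homeomorphism_def)
    have "Ck_on k \<phi> U'" by (rule Ck_on_subset[OF Ck(1)]) (auto simp: U'_def)
    then show "Ck_on k \<kappa> U'" unfolding \<kappa>_def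
      by (rule Ck_on_compose[OF oU' o2(1) smooth_on_imp_Ck[OF sm2(1)] _ i1])
    show "Ck_on k \<kappa>i W" unfolding \<kappa>i_def
      by (rule Ck_on_compose[OF o2(2) o2(1) Ck_on_subset[OF Ck(2) V'V1] smooth_on_imp_Ck[OF sm2(2)] i2])
  qed
  have im3: "\<kappa> ` (N \<inter> U') = S' \<inter> W"
  proof -
    have "\<phi> ` (N \<inter> U') = {y \<in> S. h y = 0} \<inter> V'"
    proof (intro equalityI subsetI)
      fix y assume "y \<in> \<phi> ` (N \<inter> U')"
      then obtain m where m: "m \<in> N" "y = \<phi> m" by blast
      then show "y \<in> {y \<in> S. h y = 0} \<inter> V'"
        using Nprop[OF m(1)] M\<phi>[of m] a1(1)[of m] by (auto simp: h_def U'_def)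
    next
      fix y assume y: "y \<in> {y \<in> S. h y = 0} \<inter> V'"
      then have yV1: "y \<in> V1" using V'V1 by blast
      have "\<psi> y \<in> N" unfolding Nre using y M\<psi>[of y] a2[OF yV1] yV1 by (auto simp: h_def U'_def)
      moreover have "\<psi> y \<in> U'" using y a2[OF yV1] by (auto simp: U'_def)
      ultimately show "y \<in> \<phi> ` (N \<inter> U')" using a2(1)[OF yV1] by (intro image_eqI[of _ _ "\<psi> y"]) auto
    qed
    then show ?thesis using cut(6) by (simp add: \<kappa>_def[abs_def] image_image[symmetric])
  qed
  note TN = chart_tangent_space_dim[OF oU' o2(2) hom3 sm3(1) sm3(2) cut(4) im3]
  have NM: "N \<subseteq> M" by (auto simp: N_def)
  have TNeq: "complex_tangent_space N q = complex_tangent_space M q" if q: "q \<in> N" for q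
  proof -
    note qp = Nprop[OF q]
    have y: "\<phi> q \<in> V'" "\<phi> q \<in> V2" "\<psi> (\<phi> q) = q" using qp cut(2) a1 by (auto simp: U'_def)
    \<comment> \<open>The expected tangent space of \<open>N\<close>. The vector \<open>vf q\<close>
      shows that it is smaller than that of \<open>M\<close>, so the inclusion of the tangent space
      of \<open>N\<close> is an equality by dimension. It contains the complex tangent space of
      \<open>M\<close>, because \<open>B q\<close> vanishes there.\<close>
    define K where "K = {v \<in> tangent_space M q. Re (B q v) = 0}"
    have linB: "linear (\<lambda>v. Re (B q v))"
      by (rule linearI) (simp_all add: B_add[OF Ub(3)[OF qp(2)]] B_scaleR[OF Ub(3)[OF qp(2)]])
    have K: "subspace K"
    proof -
      have "K = tangent_space M q \<inter> {v. Re (B q v) = 0}" by (auto simp: K_def)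
      then show ?thesis using subspace_inter[OF tsM(1)[OF qp(1)] linear_subspace_kernel[OF linB]] by simp
    qed
    have sub: "tangent_space N q \<subseteq> K"
    proof
      fix v assume v: "v \<in> tangent_space N q"
      have "Re (frechet_derivative Ge (at q) v) = 0"
      proof (rule tangent_space_vanishing[OF v oU' qp(5), where f="\<lambda>z. Re (Ge z)" and c=0])
        show "((\<lambda>z. Re (Ge z)) has_derivative (\<lambda>v. Re (frechet_derivative Ge (at q) v))) (at q)"
          by (rule bounded_linear.has_derivative[OF bounded_linear_Re holomorphic_fun_onD(1)[OF Ge(1) Ub(1)[OF qp(2)]]])
      qed (auto simp: N_def)
      then show "v \<in> K" using tangent_space_mono[OF NM] v GeD[OF qp(1,2,3)] by (auto simp: K_def)
    qed
    have vfq: "vf q \<in> tangent_space M q" "vf q \<notin> K"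
    proof -
      show "vf q \<in> tangent_space M q" by (rule vfT[OF qp(1,6)])
      have "Re (B q (vf q)) \<noteq> 0"
        using cut(7)[OF y(1)] unfolding hd[OF y(2)] y(3) GeD[OF qp(1,2,3)] vf_def .
      then show "vf q \<notin> K" by (simp add: K_def)
    qed
    have "dim K < dim (tangent_space M q)"
    proof (rule ccontr)
      assume "\<not> dim K < dim (tangent_space M q)"
      then have "K = tangent_space M q"
        by (intro subspace_dim_equal[OF K tsM(1)[OF qp(1)]]) (auto simp: K_def)
      then show False using vfq by blast
    qed
    then have "dim K \<le> dim (tangent_space N q)"
      using TN(2)[OF q qp(5)] cut(5) S(2) tsM(2)[OF qp(1)] by simp
    then have eqK: "tangent_space N q = K" by (rule subspace_dim_equal[OF TN(1)[OF q qp(5)] K sub])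
    show ?thesis
    proof (intro equalityI subsetI)
      fix v assume "v \<in> complex_tangent_space N q"
      then show "v \<in> complex_tangent_space M q"
        using tangent_space_mono[OF NM] unfolding complex_tangent_space_def by blast
    next
      fix v assume v: "v \<in> complex_tangent_space M q"
      have B0: "B q v = 0" by (rule TcB[OF qp(1) Ub(3)[OF qp(2)] v])
      have "B q (cJ v) = 0" using B_smult[OF Ub(3)[OF qp(2)], of \<i> v] B0 by (simp add: cJ_def)
      then show "v \<in> complex_tangent_space N q"
        using v B0 unfolding complex_tangent_space_iff[OF TN(1)[OF q qp(5)]] complex_tangent_space_iff[OF tsM(1)[OF qp(1)]] eqK
        by (simp add: K_def)
    qed
  qed
  have candN: "CR_orbit_candidate M p (dim S') N"
    unfolding CR_orbit_candidate_def
  proof (intro conjI ballI)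
    show "submanifold smooth_on (dim S') N"
      unfolding submanifold_def
    proof
      fix q assume "q \<in> N"
      then have "q \<in> U'" by (rule Nprop(5))
      moreover have "diffeo smooth_on U' W \<kappa>"
        unfolding diffeo_def smooth_on_def using oU' o2(2) hom3 sm3 by blast
      ultimately show "\<exists>U V \<phi> S. q \<in> U \<and> diffeo smooth_on U V \<phi> \<and> subspace S \<and> dim S = dim S' \<and> \<phi> ` (N \<inter> U) = S \<inter> V"
        using cut(4) im3 by blast
    qed
    show "CR N"
      unfolding CR_def
    proof (intro ballI)
      fix q q' assume q: "q \<in> N" "q' \<in> N"
      show "dim (complex_tangent_space N q) = dim (complex_tangent_space N q')"
        using dimTc[OF Nprop(1)[OF q(1)]] dimTc[OF Nprop(1)[OF q(2)]] by (simp add: TNeq q)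
    qed
  qed (use NM pN TNeq in auto)
  have NV: "N \<subseteq> Vr" using Nprop unfolding Vr_def by blast
  \<comment> \<open>The least dimension of a competitor; any competitor of this dimension represents
    the orbit.\<close>
  define d0 where "d0 = (LEAST d. \<exists>N. CR_orbit_candidate M p d N)"
  have d0: "\<exists>N. CR_orbit_candidate M p d0 N" unfolding d0_def by (rule LeastI_ex) (use candN in blast)
  have d0_le: "d0 \<le> d" if "CR_orbit_candidate M p d N" for d N unfolding d0_def by (rule Least_le) (use that in blast)
  have orbI: "local_CR_orbit M p N'" if "CR_orbit_candidate M p d0 N'" for N'
    unfolding local_CR_orbit_def using that d0_le by blast
  show False
  proof (cases "d0 = dim S'")
    case True
    then show False using orb[OF orbI Vr VrU] candN NV by blast
  next
    case False
    then have lt: "d0 < dim S'" using d0_le[OF candN] by simp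
    obtain N1 where c1: "CR_orbit_candidate M p d0 N1" using d0 by blast
    have sub1: "submanifold smooth_on d0 N1" and N1M: "N1 \<subseteq> M" and pN1: "p \<in> N1"
      and T1: "\<And>q. q \<in> N1 \<Longrightarrow> complex_tangent_space N1 q = complex_tangent_space M q"
      using c1 by (auto simp: CR_orbit_candidate_def)
    have TN1: "tangent_space N1 q \<subseteq> complex_tangent_space M q" if q: "q \<in> N1" for q
    proof -
      note s = submanifold_tangent_space[OF sub1 q smooth_on_imp_Ck]
      \<comment> \<open>Below 2N - 3 there is no room: the tangent space contains a complex tangent
        space of dimension 2N - 4 and must coincide with it.\<close>
      have "dim (tangent_space N1 q) \<le> dim (complex_tangent_space N1 q)"
        using s(2) lt cut(5) S(2) dimTc[of q] N1M q T1[OF q] by auto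
      then have "complex_tangent_space N1 q = tangent_space N1 q"
        by (intro subspace_dim_equal[OF subspace_complex_tangent_space[OF s(1)] s(1)])
           (auto simp: complex_tangent_space_def)
      then show ?thesis using T1[OF q] by simp
    qed
    obtain U2 V3 \<phi>2 S2 where ch2: "p \<in> U2" "diffeo smooth_on U2 V3 \<phi>2" "subspace S2" "\<phi>2 ` (N1 \<inter> U2) = S2 \<inter> V3"
      using bspec[OF sub1[unfolded submanifold_def] pN1] by (elim exE conjE) (rule that)
    obtain \<psi>2 where o3: "open U2" "open V3" and hom4: "homeomorphism U2 V3 \<phi>2 \<psi>2" and sm4: "smooth_on \<phi>2 U2" "smooth_on \<psi>2 V3"
      using ch2(2) unfolding diffeo_def by blast
    have b1: "\<psi>2 (\<phi>2 z) = z" "\<phi>2 z \<in> V3" if "z \<in> U2" for z using hom4 that by (auto simp: homeomorphism_def)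
    have "open (V3 \<inter> \<psi>2 -` U)"
      by (rule continuous_open_preimage[OF Ck_on_imp_continuous_on[OF smooth_on_imp_Ck[OF sm4(2), of 0]] o3(2) \<open>open U\<close>])
    moreover have "\<phi>2 p \<in> V3 \<inter> \<psi>2 -` U" using b1[OF ch2(1)] p(1) by simp
    ultimately obtain s where s: "s > 0" "ball (\<phi>2 p) s \<subseteq> V3 \<inter> \<psi>2 -` U" using open_contains_ball by metis
    \<comment> \<open>A ball in the chart of \<open>N1\<close> makes the representative star-shaped
      about \<open>p\<close>, so that each of its points is joined to \<open>p\<close> by a curve in
      \<open>N1\<close> within \<open>U\<close>.\<close>
    define O2 where "O2 = U2 \<inter> \<phi>2 -` ball (\<phi>2 p) s"
    have oO2: "open O2" unfolding O2_def
      by (rule continuous_open_preimage[OF Ck_on_imp_continuous_on[OF smooth_on_imp_Ck[OF sm4(1), of 0]] o3(1) open_ball])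
    have pO2: "p \<in> O2" using ch2(1) s by (simp add: O2_def)
    have c2: "CR_orbit_candidate M p d0 (N1 \<inter> O2)" by (rule CR_orbit_candidate_Int_open[OF c1 oO2 pO2])
    have "N1 \<inter> O2 \<subseteq> Vr"
    proof
      fix q assume q: "q \<in> N1 \<inter> O2"
      define u where "u = \<phi>2 q - \<phi>2 p"
      define \<gamma> where "\<gamma> \<sigma> = \<psi>2 (\<phi>2 p + \<sigma> *\<^sub>R u)" for \<sigma> :: real
      have qU2: "q \<in> U2" using q by (simp add: O2_def)
      have pS: "\<phi>2 p \<in> S2" "\<phi>2 q \<in> S2" using ch2(1,4) pN1 q qU2 by blast+
      have uS: "u \<in> S2" unfolding u_def by (rule subspace_diff[OF ch2(3) pS(2,1)])
      have nu: "norm u < s" using q by (simp add: O2_def u_def dist_norm norm_minus_commute)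
      have ball: "\<phi>2 p + \<sigma> *\<^sub>R u \<in> ball (\<phi>2 p) s" if "\<sigma> \<in> {0..1}" for \<sigma>
      proof -
        have "\<bar>\<sigma>\<bar> * norm u \<le> 1 * norm u" using that by (intro mult_right_mono) auto
        then show ?thesis using nu by (simp add: dist_norm)
      qed
      have V3: "\<phi>2 p + \<sigma> *\<^sub>R u \<in> V3" and \<gamma>U: "\<gamma> \<sigma> \<in> U" if "\<sigma> \<in> {0..1}" for \<sigma>
        using ball[OF that] s(2) by (auto simp: \<gamma>_def)
      have \<gamma>N: "\<gamma> \<sigma> \<in> N1" "\<gamma> \<sigma> \<in> U2" "\<phi>2 (\<gamma> \<sigma>) = \<phi>2 p + \<sigma> *\<^sub>R u" if \<sigma>: "\<sigma> \<in> {0..1}" for \<sigma>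
      proof -
        have "\<phi>2 p + \<sigma> *\<^sub>R u \<in> S2 \<inter> V3"
          using V3[OF \<sigma>] pS(1) uS ch2(3) by (simp add: subspace_add subspace_scale)
        then have "\<phi>2 p + \<sigma> *\<^sub>R u \<in> \<phi>2 ` (N1 \<inter> U2)" unfolding ch2(4) .
        then obtain z where "z \<in> N1 \<inter> U2" "\<phi>2 z = \<phi>2 p + \<sigma> *\<^sub>R u" by auto
        moreover then have "\<gamma> \<sigma> = z" using b1(1)[of z] by (simp add: \<gamma>_def)
        ultimately show "\<gamma> \<sigma> \<in> N1" "\<gamma> \<sigma> \<in> U2" "\<phi>2 (\<gamma> \<sigma>) = \<phi>2 p + \<sigma> *\<^sub>R u"
          by auto
      qed
      have \<gamma>M: "\<gamma> \<sigma> \<in> M" if "\<sigma> \<in> {0..1}" for \<sigma> using \<gamma>N(1)[OF that] N1M by blast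
      \<comment> \<open>The parameter \<open>t\<close> is controlled only by \<open>G8\<close>: from
        \<open>m\<close> to a nearby point it changes by at most twice the value there of the leaf
        function of \<open>m\<close>. That function vanishes at \<open>m\<close> and has derivative
        0 along the curve, whose velocity is complex tangent; so \<open>t\<close> has derivative 0
        along the curve too.\<close>
      have tder: "((\<lambda>\<sigma>. t (\<gamma> \<sigma>)) has_derivative (\<lambda>h. 0)) (at \<sigma> within {0..1})" if \<sigma>: "\<sigma> \<in> {0..1}" for \<sigma>
      proof -
        define m where "m = \<gamma> \<sigma>"
        have m: "m \<in> M" "m \<in> U" using \<gamma>M[OF \<sigma>] \<gamma>U[OF \<sigma>] by (auto simp: m_def)
        define v where "v = frechet_derivative \<psi>2 (at (\<phi>2 p + \<sigma> *\<^sub>R u)) u"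
        have "((\<lambda>\<sigma>. \<phi>2 p + \<sigma> *\<^sub>R u) has_derivative (\<lambda>h. h *\<^sub>R u)) (at \<sigma> within {0..1})"
          by (auto intro!: derivative_eq_intros)
        from has_derivative_compose[OF this Ck_1_deriv[OF smooth_on_imp_Ck[OF sm4(2)] V3[OF \<sigma>]]]
        have \<gamma>d: "(\<gamma> has_derivative (\<lambda>h. h *\<^sub>R v)) (at \<sigma> within {0..1})"
          unfolding \<gamma>_def v_def
          using linear_cmul[OF has_derivative_linear[OF Ck_1_deriv[OF smooth_on_imp_Ck[OF sm4(2)] V3[OF \<sigma>]]]] by simp
        have "v \<in> tangent_space N1 m"
          using chart_tangent_space(2)[OF o3 hom4 smooth_on_imp_Ck[OF sm4(1)] smooth_on_imp_Ck[OF sm4(2)] ch2(3,4) \<gamma>N(1)[OF \<sigma>] \<gamma>N(2)[OF \<sigma>]]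
            uS \<gamma>N(3)[OF \<sigma>] by (simp add: v_def m_def)
        then have "B m v = 0" using TcB[OF m(1) Ub(3)[OF m(2)]] TN1[OF \<gamma>N(1)[OF \<sigma>]] by (auto simp: m_def)
        define gm where "gm = G (t m)"
        have Lm: "leaf \<delta> m gm" unfolding gm_def by (rule leafG[OF Ub(2)[OF m(2)] Mr(1)[OF m]])
        have gm0: "gm m = 0" using Lm by (simp add: leaf_def)
        have gmd: "(gm has_derivative B m) (at m)" by (rule leaf_at_zero[OF Lm m(1) Ub(2)[OF m(2)] Ub(3)[OF m(2)] gm0])
        have "((\<lambda>\<sigma>. gm (\<gamma> \<sigma>)) has_derivative (\<lambda>h. B m (h *\<^sub>R v))) (at \<sigma> within {0..1})"
          by (rule has_derivative_compose[OF \<gamma>d]) (use gmd in \<open>simp add: m_def\<close>)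
        then have gd: "((\<lambda>\<sigma>. gm (\<gamma> \<sigma>)) has_derivative (\<lambda>h. 0)) (at \<sigma> within {0..1})"
          using B_scaleR[OF Ub(3)[OF m(2)]] \<open>B m v = 0\<close> by simp
        show ?thesis
          unfolding has_derivative_within_alt
        proof (intro conjI bounded_linear_zero allI impI)
          fix \<epsilon>0 :: real assume "\<epsilon>0 > 0"
          then have "\<epsilon>0 / 2 > 0" by simp
          then obtain d where d: "d > 0" "\<And>y. y \<in> {0..1} \<Longrightarrow> norm (y - \<sigma>) < d \<Longrightarrow>
              norm (gm (\<gamma> y) - gm (\<gamma> \<sigma>) - 0) \<le> \<epsilon>0 / 2 * norm (y - \<sigma>)"
            using gd unfolding has_derivative_within_alt by blast
          have "norm (t (\<gamma> y) - t (\<gamma> \<sigma>) - 0) \<le> \<epsilon>0 * norm (y - \<sigma>)" if y: "y \<in> {0..1}" "norm (y - \<sigma>) < d" for y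
          proof -
            have "cmod (t m - t (\<gamma> y)) \<le> 2 * cmod (gm (\<gamma> y))"
              unfolding gm_def by (rule G8[OF Ub(2)[OF m(2)] Ub(2)[OF \<gamma>U[OF y(1)]]])
            also have "\<dots> \<le> 2 * (\<epsilon>0 / 2 * norm (y - \<sigma>))"
              using d(2)[OF y] gm0 by (simp add: m_def)
            finally show ?thesis by (simp add: m_def norm_minus_commute)
          qed
          with d(1) show "\<exists>d>0. \<forall>y\<in>{0..1}. norm (y - \<sigma>) < d \<longrightarrow> norm (t (\<gamma> y) - t (\<gamma> \<sigma>) - 0) \<le> \<epsilon>0 * norm (y - \<sigma>)"
            by blast
        qed
      qed
      have "\<exists>c. \<forall>\<sigma>\<in>{0..1}. t (\<gamma> \<sigma>) = c"
        by (rule has_derivative_zero_constant[OF _ tder]) simp_all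
      then obtain c where c: "\<And>\<sigma>. \<sigma> \<in> {0..1} \<Longrightarrow> t (\<gamma> \<sigma>) = c" by blast
      have "\<gamma> 0 = p" "\<gamma> 1 = q" using b1 ch2(1) qU2 by (simp_all add: \<gamma>_def u_def)
      then have tq: "t q = t p" using c[of 0] c[of 1] by simp
      have qMU: "q \<in> M" "q \<in> U" using \<gamma>M[of 1] \<gamma>U[of 1] \<open>\<gamma> 1 = q\<close> by auto
      have "g q = 0" unfolding g_def tq[symmetric] by (rule G1[OF Ub(2)[OF qMU(2)]])
      then show "q \<in> Vr" using GeM[OF qMU] qMU(2) by (simp add: Vr_def)
    qed
    then show False using orb[OF orbI[OF c2] Vr VrU] by blast
  qed
qed

end

section \<open>Complexified defining equations\<close>

lemma norm_cJ: "norm (cJ v) = norm v"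
  by (simp add: cJ_def norm_cvec_smult)

lemma Complex_cvec_smult: "Complex x y *s v = x *\<^sub>R v + y *\<^sub>R cJ v"
  by (simp add: cJ_def vec_eq_iff scaleR_conv_of_real[where 'a=complex] complex_eq_iff)

text \<open>On the real points \<open>F\<close> restricts to \<open>f\<close>; the two sides are the
  derivatives of this common restriction.\<close>

lemma complexify_derivative:
  fixes f :: "complex ^ 'n \<Rightarrow> real"
  assumes "R0 > 0" "holomorphic_fun_on F (ball 0 R0)" "\<And>y. norm y < R0 \<Longrightarrow> F (cplx_embed y) = of_real (f y)"
    and "(f has_derivative D) (at 0)"
  shows "frechet_derivative F (at 0) (cplx_embed v) = of_real (D v)"
proof -
  have e0: "cplx_embed (0 :: complex ^ 'n) = 0" by (simp add: linear_0 bounded_linear.linear[OF bounded_linear_cplx_embed])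
  have "(F has_derivative frechet_derivative F (at 0)) (at (cplx_embed (0 :: complex ^ 'n)))"
    unfolding e0 by (rule holomorphic_fun_onD(1)[OF assms(2)]) (use assms(1) in simp)
  from has_derivative_compose[OF bounded_linear_imp_has_derivative[OF bounded_linear_cplx_embed] this]
  have 1: "((\<lambda>y. F (cplx_embed y)) has_derivative (\<lambda>v. frechet_derivative F (at 0) (cplx_embed v))) (at 0)" .
  have "((\<lambda>y. F (cplx_embed y)) has_derivative (\<lambda>v. of_real (D v))) (at 0)"
    by (rule has_derivative_transform_within_open[OF has_derivative_of_real[OF assms(4)], of "ball 0 R0"])
       (use assms(1,3) in auto)
  from fun_cong[OF has_derivative_unique[OF 1 this], of v] show ?thesis .
qed

text \<open>A point q + (x1 + i y1) a + (x2 + i y2) b depends linearly on four real coordinates,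
  with directions a, J a, b and J b. In the doubled space these directions may be given complex
  coefficients, which defines \<open>arg\<close>. The normalisation of \<open>D1\<close> and
  \<open>D2\<close> makes \<open>y\<close> the linear part of F in the slice directions at 0, so
  \<open>F - y\<close> has a small Lipschitz constant nearby.\<close>

lemma complexified_equations:
  fixes f1 f2 :: "complex ^ 'n \<Rightarrow> real" and F1 F2 :: "complex ^ ('n + 'n) \<Rightarrow> complex" and a b :: "complex ^ 'n"
  assumes R0: "R0 > 0" and hol: "holomorphic_fun_on F1 (ball 0 R0)" "holomorphic_fun_on F2 (ball 0 R0)"
    and emb: "\<And>y. norm y < R0 \<Longrightarrow> F1 (cplx_embed y) = of_real (f1 y)" "\<And>y. norm y < R0 \<Longrightarrow> F2 (cplx_embed y) = of_real (f2 y)"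
    and zero: "f1 0 = 0" "f2 0 = 0" and der: "(f1 has_derivative D1) (at 0)" "(f2 has_derivative D2) (at 0)"
    and D1: "D1 a = 0" "D1 b = 0" "D1 (cJ a) = 1" "D1 (cJ b) = 0"
    and D2: "D2 a = 0" "D2 b = 0" "D2 (cJ a) = 0" "D2 (cJ b) = 1"
    and ab: "norm a = 1" "norm b = 1" and "\<epsilon> > 0"
  obtains R' CF and F :: "complex ^ 'n \<Rightarrow> complex \<Rightarrow> complex \<Rightarrow> complex \<times> complex \<Rightarrow> complex \<times> complex"
  where "R' > 0" "CF \<ge> 0"
    "\<And>q x1 x2 y x1' x2' y'. q \<in> ball 0 R' \<Longrightarrow> cmod x1 < R' \<Longrightarrow> cmod x2 < R' \<Longrightarrow> norm y < R' \<Longrightarrow>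
        cmod x1' < R' \<Longrightarrow> cmod x2' < R' \<Longrightarrow> norm y' < R' \<Longrightarrow>
        norm (F q x1 x2 y - F q x1' x2' y' - (y - y')) \<le> \<epsilon> * (cmod (x1 - x1') + cmod (x2 - x2') + norm (y - y'))"
    "\<And>q. q \<in> ball 0 R' \<Longrightarrow> norm (F q 0 0 0) \<le> CF * norm q"
    "\<And>q x1 x2 y1 y2. q \<in> ball 0 R' \<Longrightarrow> \<bar>x1\<bar> < R' \<Longrightarrow> \<bar>x2\<bar> < R' \<Longrightarrow> \<bar>y1\<bar> < R' \<Longrightarrow> \<bar>y2\<bar> < R' \<Longrightarrow>
        norm (q + Complex x1 y1 *s a + Complex x2 y2 *s b) < R0 \<and>
        F q (of_real x1) (of_real x2) (of_real y1, of_real y2) =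
          (of_real (f1 (q + Complex x1 y1 *s a + Complex x2 y2 *s b)), of_real (f2 (q + Complex x1 y1 *s a + Complex x2 y2 *s b)))"
    "\<And>q S h1 h2 g. q \<in> ball 0 R' \<Longrightarrow> h1 holomorphic_on S \<Longrightarrow> h2 holomorphic_on S \<Longrightarrow>
        (\<lambda>\<zeta>. fst (g \<zeta>)) holomorphic_on S \<Longrightarrow> (\<lambda>\<zeta>. snd (g \<zeta>)) holomorphic_on S \<Longrightarrow> open S \<Longrightarrow>
        (\<And>\<zeta>. \<zeta> \<in> S \<Longrightarrow> cmod (h1 \<zeta>) < R' \<and> cmod (h2 \<zeta>) < R' \<and> norm (g \<zeta>) < R') \<Longrightarrow>
        (\<lambda>\<zeta>. fst (F q (h1 \<zeta>) (h2 \<zeta>) (g \<zeta>))) holomorphic_on S \<and> (\<lambda>\<zeta>. snd (F q (h1 \<zeta>) (h2 \<zeta>) (g \<zeta>))) holomorphic_on S"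
proof -
  let ?E = "cplx_embed :: complex ^ 'n \<Rightarrow> complex ^ ('n + 'n)"
  have linE: "linear ?E" by (rule bounded_linear.linear[OF bounded_linear_cplx_embed])
  define arg where "arg q x1 x2 y = ?E q + x1 *s ?E a + fst y *s ?E (cJ a) + x2 *s ?E b + snd y *s ?E (cJ b)"
    for q x1 x2 and y :: "complex \<times> complex"
  define F where "F q x1 x2 y = (F1 (arg q x1 x2 y), F2 (arg q x1 x2 y))" for q x1 x2 y
  have fs: "cmod (fst y) \<le> norm y" "cmod (snd y) \<le> norm y" for y :: "complex \<times> complex"
    using norm_fst_le[of "fst y" "snd y"] norm_snd_le[of "snd y" "fst y"] by simp_all
  have nsum: "norm (w + x1 *s ?E a + y1 *s ?E (cJ a) + x2 *s ?E b + y2 *s ?E (cJ b))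
      \<le> norm w + cmod x1 + cmod y1 + cmod x2 + cmod y2" for w x1 x2 y1 y2
  proof -
    have "norm (x1 *s ?E a) = cmod x1" "norm (y1 *s ?E (cJ a)) = cmod y1"
      "norm (x2 *s ?E b) = cmod x2" "norm (y2 *s ?E (cJ b)) = cmod y2"
      by (simp_all add: norm_cvec_smult norm_cplx_embed norm_cJ ab)
    then show ?thesis
      using norm_triangle_ineq[of "w + x1 *s ?E a + y1 *s ?E (cJ a) + x2 *s ?E b" "y2 *s ?E (cJ b)"]
        norm_triangle_ineq[of "w + x1 *s ?E a + y1 *s ?E (cJ a)" "x2 *s ?E b"]
        norm_triangle_ineq[of "w + x1 *s ?E a" "y1 *s ?E (cJ a)"] norm_triangle_ineq[of w "x1 *s ?E a"] by linarith
  qed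
  \<comment> \<open>A quarter of \<epsilon>: the errors of the two components add up, and
    \<open>arg\<close> moves by at most twice the sum of the coordinate differences.\<close>
  have "\<epsilon> / 4 > 0" "0 \<in> ball (0 :: complex ^ ('n + 'n)) R0" using \<open>\<epsilon> > 0\<close> R0 by auto
  obtain d1 where d1: "d1 > 0" "\<And>x y. x \<in> ball 0 d1 \<Longrightarrow> y \<in> ball 0 d1 \<Longrightarrow>
       norm (F1 y - F1 x - frechet_derivative F1 (at 0) (y - x)) \<le> \<epsilon> / 4 * norm (y - x)"
    by (rule Ck_1_strict[OF open_ball \<open>0 \<in> ball 0 R0\<close> holomorphic_fun_on_imp_Ck[OF open_ball hol(1)] \<open>\<epsilon> / 4 > 0\<close>]) blast
  obtain d2 where d2: "d2 > 0" "\<And>x y. x \<in> ball 0 d2 \<Longrightarrow> y \<in> ball 0 d2 \<Longrightarrow>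
       norm (F2 y - F2 x - frechet_derivative F2 (at 0) (y - x)) \<le> \<epsilon> / 4 * norm (y - x)"
    by (rule Ck_1_strict[OF open_ball \<open>0 \<in> ball 0 R0\<close> holomorphic_fun_on_imp_Ck[OF open_ball hol(2)] \<open>\<epsilon> / 4 > 0\<close>]) blast
  \<comment> \<open>The five summands of \<open>arg\<close> have norm below \<open>R'\<close> each,
    so \<open>arg\<close> stays in all three balls.\<close>
  define R' where "R' = min R0 (min d1 d2) / 6"
  have R': "R' > 0" "6 * R' \<le> R0" "6 * R' \<le> d1" "6 * R' \<le> d2" using R0 d1(1) d2(1) by (auto simp: R'_def)
  have narg: "norm (arg q x1 x2 y) < 6 * R'" if "q \<in> ball 0 R'" "cmod x1 < R'" "cmod x2 < R'" "norm y < R'" for q x1 x2 y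
  proof -
    have "norm q < R'" using that(1) by simp
    then show ?thesis
      using nsum[of "?E q" x1 "fst y" x2 "snd y"] fs[of y] that(2-) R'(1) unfolding arg_def norm_cplx_embed by linarith
  qed
  have DF: "frechet_derivative F1 (at 0) (?E v) = of_real (D1 v)" "frechet_derivative F2 (at 0) (?E v) = of_real (D2 v)" for v
    using complexify_derivative[OF R0 hol(1) emb(1) der(1)] complexify_derivative[OF R0 hol(2) emb(2) der(2)] by auto
  have z0: "0 \<in> ball (0 :: complex ^ ('n + 'n)) R0" using R0 by simp
  have lin: "linear (frechet_derivative F1 (at 0))" "linear (frechet_derivative F2 (at 0))"
    using has_derivative_linear[OF holomorphic_fun_onD(1)[OF hol(1) z0]] has_derivative_linear[OF holomorphic_fun_onD(1)[OF hol(2) z0]] by blast+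
  have dif: "arg q x1 x2 y - arg q x1' x2' y' = 0 + (x1 - x1') *s ?E a + fst (y - y') *s ?E (cJ a) + (x2 - x2') *s ?E b + snd (y - y') *s ?E (cJ b)"
    for q x1 x2 y x1' x2' y' by (simp add: arg_def vec_eq_iff algebra_simps)
  have DFd: "frechet_derivative F1 (at 0) (arg q x1 x2 y - arg q x1' x2' y') = fst (y - y')"
      "frechet_derivative F2 (at 0) (arg q x1 x2 y - arg q x1' x2' y') = snd (y - y')" for q x1 x2 y x1' x2' y'
    unfolding dif using D1 D2
    by (simp_all only: linear_add[OF lin(1)] linear_add[OF lin(2)] linear_0[OF lin(1)] linear_0[OF lin(2)]
        holomorphic_fun_onD(2)[OF hol(1) z0] holomorphic_fun_onD(2)[OF hol(2) z0] DF) simp_all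
  have real_arg: "arg q (of_real x1) (of_real x2) (of_real y1, of_real y2) = ?E (q + Complex x1 y1 *s a + Complex x2 y2 *s b)" for q x1 x2 y1 y2
    by (simp add: arg_def Complex_cvec_smult of_real_cvec_smult linear_add[OF linE] linear_cmul[OF linE])
  obtain K1 where K1: "K1 \<ge> 0" "\<And>x. \<bar>D1 x\<bar> \<le> norm x * K1"
    using bounded_linear.nonneg_bounded[OF has_derivative_bounded_linear[OF der(1)]] by auto
  obtain K2 where K2: "K2 \<ge> 0" "\<And>x. \<bar>D2 x\<bar> \<le> norm x * K2"
    using bounded_linear.nonneg_bounded[OF has_derivative_bounded_linear[OF der(2)]] by auto
  have E0: "?E 0 = 0" by (rule linear_0[OF linE])
  show ?thesis
  proof (rule that[of R' "K1 + K2 + \<epsilon>" F])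
    show "R' > 0" by fact
    show "K1 + K2 + \<epsilon> \<ge> 0" using K1 K2 \<open>\<epsilon> > 0\<close> by simp
  next
    fix q :: "complex ^ 'n" and x1 x2 x1' x2' :: complex and y y' :: "complex \<times> complex"
    assume as: "q \<in> ball 0 R'" "cmod x1 < R'" "cmod x2 < R'" "norm y < R'" "cmod x1' < R'" "cmod x2' < R'" "norm y' < R'"
    let ?z = "arg q x1 x2 y" and ?z' = "arg q x1' x2' y'"
    note n = narg[OF as(1-4)] narg[OF as(1,5-7)]
    have nd: "norm (?z - ?z') \<le> cmod (x1 - x1') + cmod (x2 - x2') + 2 * norm (y - y')"
      unfolding dif using nsum[of 0 "x1 - x1'" "fst (y - y')" "x2 - x2'" "snd (y - y')"] fs[of "y - y'"]
      by (simp only: norm_zero)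
    have 1: "cmod (F1 ?z - F1 ?z' - fst (y - y')) \<le> \<epsilon> / 4 * norm (?z - ?z')"
      using d1(2)[of ?z' ?z] n R' DFd(1) by simp
    have 2: "cmod (F2 ?z - F2 ?z' - snd (y - y')) \<le> \<epsilon> / 4 * norm (?z - ?z')"
      using d2(2)[of ?z' ?z] n R' DFd(2) by simp
    have eq: "F q x1 x2 y - F q x1' x2' y' - (y - y') = (F1 ?z - F1 ?z' - fst (y - y'), F2 ?z - F2 ?z' - snd (y - y'))"
      by (simp add: F_def prod_eq_iff)
    have "norm (F q x1 x2 y - F q x1' x2' y' - (y - y')) \<le> \<epsilon> / 2 * norm (?z - ?z')"
      unfolding eq using norm_Pair_le[of "F1 ?z - F1 ?z' - fst (y - y')" "F2 ?z - F2 ?z' - snd (y - y')"] 1 2 by linarith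
    also have "\<dots> \<le> \<epsilon> / 2 * (2 * (cmod (x1 - x1') + cmod (x2 - x2') + norm (y - y')))"
    proof (rule mult_left_mono)
      show "norm (?z - ?z') \<le> 2 * (cmod (x1 - x1') + cmod (x2 - x2') + norm (y - y'))"
        using nd norm_ge_zero[of "x1 - x1'"] norm_ge_zero[of "x2 - x2'"] unfolding distrib_left by linarith
    qed (use \<open>\<epsilon> > 0\<close> in simp)
    also have "\<dots> = \<epsilon> * (cmod (x1 - x1') + cmod (x2 - x2') + norm (y - y'))" by (simp add: algebra_simps)
    finally show "norm (F q x1 x2 y - F q x1' x2' y' - (y - y')) \<le> \<epsilon> * (cmod (x1 - x1') + cmod (x2 - x2') + norm (y - y'))" .
  next
    fix q :: "complex ^ 'n" assume q: "q \<in> ball 0 R'"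
    have a0: "arg q 0 0 0 = ?E q" by (simp add: arg_def)
    have q0: "norm q < R0" "?E q \<in> ball 0 d1" "?E q \<in> ball 0 d2" using q R' by (auto simp: norm_cplx_embed)
    have F0: "F1 0 = 0" "F2 0 = 0" using emb[of 0] R0 zero E0 by auto
    have "cmod (F1 (?E q) - F1 0 - frechet_derivative F1 (at 0) (?E q - 0)) \<le> \<epsilon> / 4 * norm (?E q - 0)"
      by (rule d1(2)) (use q0 d1 in auto)
    then have "cmod (F1 (?E q) - of_real (D1 q)) \<le> \<epsilon> / 4 * norm q" by (simp add: F0 DF norm_cplx_embed)
    then have 1: "cmod (F1 (?E q)) \<le> \<epsilon> / 4 * norm q + norm q * K1"
      using norm_triangle_ineq2[of "F1 (?E q)" "of_real (D1 q)"] K1(2)[of q] unfolding norm_of_real by linarith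
    have "cmod (F2 (?E q) - F2 0 - frechet_derivative F2 (at 0) (?E q - 0)) \<le> \<epsilon> / 4 * norm (?E q - 0)"
      by (rule d2(2)) (use q0 d2 in auto)
    then have "cmod (F2 (?E q) - of_real (D2 q)) \<le> \<epsilon> / 4 * norm q" by (simp add: F0 DF norm_cplx_embed)
    then have 2: "cmod (F2 (?E q)) \<le> \<epsilon> / 4 * norm q + norm q * K2"
      using norm_triangle_ineq2[of "F2 (?E q)" "of_real (D2 q)"] K2(2)[of q] unfolding norm_of_real by linarith
    have "norm (F q 0 0 0) \<le> cmod (F1 (?E q)) + cmod (F2 (?E q))" by (simp add: F_def a0 norm_Pair_le)
    also have "\<dots> \<le> \<epsilon> / 2 * norm q + norm q * K1 + norm q * K2" using 1 2 by linarith
    also have "\<dots> \<le> (K1 + K2 + \<epsilon>) * norm q" using \<open>\<epsilon> > 0\<close> by (simp add: algebra_simps)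
    finally show "norm (F q 0 0 0) \<le> (K1 + K2 + \<epsilon>) * norm q" .
  next
    fix q :: "complex ^ 'n" and x1 x2 y1 y2 :: real
    assume as: "q \<in> ball 0 R'" "\<bar>x1\<bar> < R'" "\<bar>x2\<bar> < R'" "\<bar>y1\<bar> < R'" "\<bar>y2\<bar> < R'"
    let ?p = "q + Complex x1 y1 *s a + Complex x2 y2 *s b"
    have "norm ?p = norm (arg q (of_real x1) (of_real x2) (of_real y1, of_real y2))"
      unfolding real_arg norm_cplx_embed ..
    also have "\<dots> < 6 * R'"
      using nsum[of "?E q" "of_real x1" "of_real y1" "of_real x2" "of_real y2"] as by (simp add: arg_def norm_cplx_embed)
    finally have "norm ?p < R0" using R' by simp
    then show "norm ?p < R0 \<and> F q (of_real x1) (of_real x2) (of_real y1, of_real y2) = (of_real (f1 ?p), of_real (f2 ?p))"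
      using emb by (simp add: F_def real_arg)
  next
    fix q :: "complex ^ 'n" and S and h1 h2 :: "complex \<Rightarrow> complex" and g :: "complex \<Rightarrow> complex \<times> complex"
    assume q: "q \<in> ball 0 R'" and h: "h1 holomorphic_on S" "h2 holomorphic_on S"
      "(\<lambda>\<zeta>. fst (g \<zeta>)) holomorphic_on S" "(\<lambda>\<zeta>. snd (g \<zeta>)) holomorphic_on S" and "open S"
      and bd: "\<And>\<zeta>. \<zeta> \<in> S \<Longrightarrow> cmod (h1 \<zeta>) < R' \<and> cmod (h2 \<zeta>) < R' \<and> norm (g \<zeta>) < R'"
    have sm: "((\<lambda>\<zeta>. k \<zeta> *s v) has_derivative (\<lambda>x. x *s (deriv k \<zeta> *s v))) (at \<zeta>)"
      if "k holomorphic_on S" "\<zeta> \<in> S" for k \<zeta> and v :: "complex ^ ('n + 'n)"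
    proof -
      have "(k has_derivative (*) (deriv k \<zeta>)) (at \<zeta>)"
        using holomorphic_derivI[OF that(1) \<open>open S\<close> that(2)] by (simp add: has_field_derivative_def)
      from bounded_linear.has_derivative[OF bounded_linear_cvec_smult_left this, of v]
      show ?thesis by (simp add: vector_smult_assoc mult.commute)
    qed
    have key: "(\<lambda>\<zeta>. P (arg q (h1 \<zeta>) (h2 \<zeta>) (g \<zeta>))) holomorphic_on S" if P: "holomorphic_fun_on P (ball 0 R0)" for P
      unfolding holomorphic_on_def field_differentiable_def
    proof
      fix \<zeta> assume z: "\<zeta> \<in> S"
      have m1: "arg q (h1 \<zeta>) (h2 \<zeta>) (g \<zeta>) \<in> ball 0 R0" using narg[OF q, of "h1 \<zeta>" "h2 \<zeta>" "g \<zeta>"] bd[OF z] R' by simp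
      define w where "w = 0 + deriv h1 \<zeta> *s ?E a + deriv (\<lambda>\<zeta>. fst (g \<zeta>)) \<zeta> *s ?E (cJ a) + deriv h2 \<zeta> *s ?E b
          + deriv (\<lambda>\<zeta>. snd (g \<zeta>)) \<zeta> *s ?E (cJ b)"
      have "((\<lambda>\<zeta>. arg q (h1 \<zeta>) (h2 \<zeta>) (g \<zeta>)) has_derivative (\<lambda>x. 0 + x *s (deriv h1 \<zeta> *s ?E a) + x *s (deriv (\<lambda>\<zeta>. fst (g \<zeta>)) \<zeta> *s ?E (cJ a))
          + x *s (deriv h2 \<zeta> *s ?E b) + x *s (deriv (\<lambda>\<zeta>. snd (g \<zeta>)) \<zeta> *s ?E (cJ b)))) (at \<zeta>)"
        unfolding arg_def
        by (rule has_derivative_add[OF has_derivative_add[OF has_derivative_add[OF has_derivative_add[OF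
                has_derivative_const sm[OF h(1) z]] sm[OF h(3) z]] sm[OF h(2) z]] sm[OF h(4) z]])
      then have m2: "((\<lambda>\<zeta>. arg q (h1 \<zeta>) (h2 \<zeta>) (g \<zeta>)) has_derivative (\<lambda>x. x *s w)) (at \<zeta>)"
        by (simp add: w_def vector_add_ldistrib)
      show "\<exists>f'. ((\<lambda>\<zeta>. P (arg q (h1 \<zeta>) (h2 \<zeta>) (g \<zeta>))) has_field_derivative f') (at \<zeta> within S)"
        by (rule exI, rule has_field_derivative_at_within,
            rule holomorphic_fun_on_curve[where g="\<lambda>\<zeta>. arg q (h1 \<zeta>) (h2 \<zeta>) (g \<zeta>)", OF P m1 m2])
    qed
    show "(\<lambda>\<zeta>. fst (F q (h1 \<zeta>) (h2 \<zeta>) (g \<zeta>))) holomorphic_on S \<and> (\<lambda>\<zeta>. snd (F q (h1 \<zeta>) (h2 \<zeta>) (g \<zeta>))) holomorphic_on S"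
      using key[OF hol(1)] key[OF hol(2)] by (simp add: F_def)
  qed
qed

section \<open>Straightening the boundary\<close>

text \<open>The vectors \<open>y\<close> and \<open>x\<close> show that first \<open>m\<close> and
  then \<open>l\<close> cuts the dimension down, so the joint kernel has at most the dimension of
  \<open>T\<close>, which it contains.\<close>

lemma joint_kernel_eq:
  fixes l m :: "'a::euclidean_space \<Rightarrow> real"
  assumes "linear l" "linear m" "subspace T" "dim T = DIM('a) - 2"
    and "\<And>v. v \<in> T \<Longrightarrow> l v = 0 \<and> m v = 0" "l x \<noteq> 0" "m x = 0" "m y \<noteq> 0"
  shows "T = {v. l v = 0 \<and> m v = 0}"
proof (rule subspace_dim_equal[OF assms(3)])
  let ?K = "{v. l v = 0 \<and> m v = 0}" and ?L = "{v. m v = 0}"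
  have K: "?K = {v. l v = 0} \<inter> ?L" by auto
  show s: "subspace ?K"
    unfolding K by (intro subspace_inter linear_subspace_kernel assms(1,2))
  have s': "subspace ?L" by (rule linear_subspace_kernel[OF assms(2)])
  show "T \<subseteq> ?K" using assms(5) by blast
  have e: "span ?K = ?K" "span ?L = ?L" using s s' by (simp_all only: span_eq_iff)
  have "x \<in> ?L" "x \<notin> ?K" using assms(6,7) by simp_all
  then have "span ?K \<subset> span ?L" unfolding e by blast
  then have 1: "dim ?K < dim ?L" by (rule dim_psubset)
  have "y \<notin> ?L" using assms(8) by simp
  then have "span ?L \<subset> span UNIV" unfolding e span_UNIV by blast
  from dim_psubset[OF this] have 2: "dim ?L < DIM('a)" by (simp add: dim_UNIV)
  show "dim ?K \<le> dim T" using 1 2 assms(4) by linarith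
qed

text \<open>The chart of \<open>M\<close> is composed with the linear map that turns its differential into \<open>(l, m)\<close>.\<close>
lemma submanifold_equations:
  fixes M :: "'a::euclidean_space set"
  assumes "submanifold Rc d M" "p \<in> M" "\<And>f U. open U \<Longrightarrow> Rc f U \<Longrightarrow> Ck_on 1 f U"
    and "linear l" "linear m" "tangent_space M p = {v. l v = (0::real) \<and> m v = (0::real)}"
  obtains \<phi> U w1 w2 where "open U" "p \<in> U" "Rc \<phi> U"
    "\<And>q. q \<in> U \<Longrightarrow> q \<in> M \<longleftrightarrow> \<phi> q \<bullet> w1 = 0 \<and> \<phi> q \<bullet> w2 = 0"
    "((\<lambda>q. \<phi> q \<bullet> w1) has_derivative l) (at p)" "((\<lambda>q. \<phi> q \<bullet> w2) has_derivative m) (at p)"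
proof -
  obtain U V \<phi> S where 1: "p \<in> U" "diffeo Rc U V \<phi>" "subspace S" "\<phi> ` (M \<inter> U) = S \<inter> V"
    using bspec[OF assms(1)[unfolded submanifold_def] assms(2)] by (elim exE conjE) (rule that)
  obtain \<psi> where 2: "open U" "open V" "homeomorphism U V \<phi> \<psi>" "Rc \<phi> U" "Rc \<psi> V"
    using 1(2) unfolding diffeo_def by blast
  have Ck: "Ck_on 1 \<phi> U" "Ck_on 1 \<psi> V" using assms(3)[OF 2(1,4)] assms(3)[OF 2(2,5)] by simp_all
  have inv: "\<psi> (\<phi> x) = x" "\<phi> x \<in> V" if "x \<in> U" for x using 2(3) that by (auto simp: homeomorphism_def)
  define D where "D = frechet_derivative \<phi> (at p)"
  define D' where "D' = frechet_derivative \<psi> (at (\<phi> p))"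
  have D: "(\<phi> has_derivative D) (at p)" unfolding D_def by (rule Ck_1_deriv[OF Ck(1) 1(1)])
  have D': "(\<psi> has_derivative D') (at (\<phi> p))" unfolding D'_def by (rule Ck_1_deriv[OF Ck(2) inv(2)[OF 1(1)]])
  have DD: "D' (D v) = v" for v by (rule homeomorphism_derivative_inverse[OF 2(1,3) 1(1) D D'])
  have DD': "D (D' v) = v" for v
    by (rule homeomorphism_derivative_inverse[OF 2(2) homeomorphism_symD[OF 2(3)] inv(2)[OF 1(1)] D'])
       (simp add: inv(1)[OF 1(1)] D)
  have T: "tangent_space M p = {v. D v \<in> S}"
    unfolding D_def by (rule chart_tangent_space(1)[OF 2(1-3) Ck 1(3,4) assms(2) 1(1)])
  \<comment> \<open>The vector that represents the functional \<open>k\<close>, transported to the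
    chart by \<open>D'\<close>, as an inner product.\<close>
  define w where "w k = (\<Sum>i\<in>Basis. k (D' i) *\<^sub>R i)" for k :: "'a \<Rightarrow> real"
  have w: "y \<bullet> w k = k (D' y)" if "linear k" for k y
    using linear_eq_sum_Basis[OF linear_compose[OF has_derivative_linear[OF D'] that], of y]
    by (simp add: w_def inner_sum_right o_def mult.commute)
  have S: "y \<in> S \<longleftrightarrow> y \<bullet> w l = 0 \<and> y \<bullet> w m = 0" for y
  proof -
    have "y \<in> S \<longleftrightarrow> D' y \<in> tangent_space M p" unfolding T by (simp add: DD')
    then show ?thesis unfolding assms(6) by (simp add: w assms(4,5))
  qed
  show ?thesis
  proof (rule that[OF 2(1) 1(1) 2(4), of "w l" "w m"])
    fix q assume q: "q \<in> U"
    have "q \<in> M \<longleftrightarrow> \<phi> q \<in> S"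
    proof
      assume "\<phi> q \<in> S"
      then have "\<phi> q \<in> \<phi> ` (M \<inter> U)" unfolding 1(4) using inv(2)[OF q] by simp
      then obtain x where x: "x \<in> M" "x \<in> U" "\<phi> q = \<phi> x" by auto
      have "q = x" using arg_cong[OF x(3), of \<psi>] unfolding inv(1)[OF q] inv(1)[OF x(2)] .
      then show "q \<in> M" by (simp only: x(1))
    next
      assume "q \<in> M"
      then have "\<phi> q \<in> \<phi> ` (M \<inter> U)" using q by (intro imageI IntI)
      then show "\<phi> q \<in> S" unfolding 1(4) by (rule IntD1)
    qed
    then show "q \<in> M \<longleftrightarrow> \<phi> q \<bullet> w l = 0 \<and> \<phi> q \<bullet> w m = 0" using S by simp
  next
    show "((\<lambda>q. \<phi> q \<bullet> w l) has_derivative l) (at p)" "((\<lambda>q. \<phi> q \<bullet> w m) has_derivative m) (at p)"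
      using has_derivative_inner_left[OF D, of "w l"] has_derivative_inner_left[OF D, of "w m"]
      by (simp_all add: w assms(4,5) DD)
  qed
qed

text \<open>Near interior points \<open>H\<close> is an open part of the level set \<Phi> \<bullet>
  f = 0. The tangent space is computed in the boundary chart itself, so that one defining function
  serves up to the boundary.\<close>

lemma interior_tangent_space:
  fixes H :: "'a::euclidean_space set"
  assumes "open U" "homeomorphism U UNIV \<Phi> \<Psi>" "Ck_on 1 \<Phi> U" "Ck_on 1 \<Psi> UNIV"
    and H: "\<And>q. q \<in> U \<Longrightarrow> q \<in> H \<Longrightarrow> \<Phi> q \<bullet> f = 0" "\<And>q. q \<in> U \<Longrightarrow> \<Phi> q \<bullet> e > 0 \<Longrightarrow> \<Phi> q \<bullet> f = 0 \<Longrightarrow> q \<in> H"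
    and q: "q \<in> U" "\<Phi> q \<bullet> e > 0" "\<Phi> q \<bullet> f = 0"
  shows "tangent_space H q = {v. frechet_derivative \<Phi> (at q) v \<bullet> f = 0}"
proof -
  define D where "D = frechet_derivative \<Phi> (at q)"
  have D: "(\<Phi> has_derivative D) (at q)" unfolding D_def by (rule Ck_1_deriv[OF assms(3) q(1)])
  have inv: "\<Psi> (\<Phi> q) = q" "\<And>y. \<Phi> (\<Psi> y) = y" "\<And>y. \<Psi> y \<in> U"
    using assms(2) q(1) by (auto simp: homeomorphism_def)
  have D': "(\<Psi> has_derivative frechet_derivative \<Psi> (at (\<Phi> q))) (at (\<Phi> q))" by (rule Ck_1_deriv[OF assms(4)]) simp
  show ?thesis
    unfolding D_def[symmetric]
  proof (intro equalityI subsetI, unfold mem_Collect_eq)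
    fix v assume "v \<in> tangent_space H q"
    then show "D v \<bullet> f = 0"
      by (rule tangent_space_vanishing[OF _ assms(1) q(1) has_derivative_inner_left[OF D]]) (use H(1) in auto)
  next
    fix v assume v: "D v \<bullet> f = 0"
    \<comment> \<open>For times below \<delta> the coordinate along \<open>e\<close> of the straight
      line in the chart stays positive.\<close>
    define \<delta> where "\<delta> = \<Phi> q \<bullet> e / (\<bar>D v \<bullet> e\<bar> + 1)"
    have \<delta>: "\<delta> > 0" using q(2) by (auto simp: \<delta>_def intro!: divide_pos_pos)
    have "frechet_derivative \<Psi> (at (\<Phi> q)) (D v) \<in> tangent_space H q"
    proof (rule tangent_spaceI[OF open_UNIV _ assms(4) inv(1) \<delta>])
      fix s :: real assume s: "\<bar>s\<bar> < \<delta>"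
      have "\<bar>s\<bar> * (\<bar>D v \<bullet> e\<bar> + 1) < \<Phi> q \<bullet> e" using s by (simp add: \<delta>_def pos_less_divide_eq)
      moreover have "- (s * (D v \<bullet> e)) \<le> \<bar>s\<bar> * \<bar>D v \<bullet> e\<bar>" unfolding abs_mult[symmetric] by linarith
      moreover have "\<bar>s\<bar> \<ge> 0" by simp
      ultimately have "\<Phi> q \<bullet> e + s * (D v \<bullet> e) > 0" unfolding distrib_left by linarith
      then show "\<Psi> (\<Phi> q + s *\<^sub>R D v) \<in> H"
        by (intro H(2) inv(3)) (simp_all add: inv(2) inner_add_left v q(3))
    qed simp
    then show "v \<in> tangent_space H q"
      by (simp only: homeomorphism_derivative_inverse[OF assms(1,2) q(1) D D'])
  qed
qed

text \<open>A boundary point is a limit of interior points, obtained by moving along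
  \<open>e\<close> in the chart. This carries integrability of the hyperplane field to \<rho> =
  0.\<close>

lemma vanishing_at_boundary:
  fixes P :: "'a::euclidean_space \<Rightarrow> 'b::real_normed_vector"
  assumes "homeomorphism U UNIV \<Phi> \<Psi>" "open O'" "O' \<subseteq> U" "continuous_on O' P" "e \<bullet> e = 1" "e \<bullet> f = 0"
    and 0: "\<And>q. q \<in> O' \<Longrightarrow> \<Phi> q \<bullet> e > 0 \<Longrightarrow> \<Phi> q \<bullet> f = 0 \<Longrightarrow> P q = 0"
    and q: "q \<in> O'" "\<Phi> q \<bullet> e \<ge> 0" "\<Phi> q \<bullet> f = 0"
  shows "P q = 0"
proof -
  have inv: "\<Psi> (\<Phi> q) = q" "\<And>y. \<Phi> (\<Psi> y) = y" and cont: "continuous_on UNIV \<Psi>"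
    using assms(1,3) q(1) by (auto simp: homeomorphism_def)
  define x where "x n = \<Psi> (\<Phi> q + inverse (real (Suc n)) *\<^sub>R e)" for n
  have "(\<lambda>n. \<Phi> q + inverse (real (Suc n)) *\<^sub>R e) \<longlonglongrightarrow> \<Phi> q + 0 *\<^sub>R e"
    by (intro tendsto_intros LIMSEQ_inverse_real_of_nat)
  then have "(\<lambda>n. \<Phi> q + inverse (real (Suc n)) *\<^sub>R e) \<longlonglongrightarrow> \<Phi> q" by simp
  then have "x \<longlonglongrightarrow> \<Psi> (\<Phi> q)"
    unfolding x_def by (rule continuous_on_tendsto_compose[OF cont]) simp_all
  then have x: "x \<longlonglongrightarrow> q" using inv(1) by simp
  have ev: "eventually (\<lambda>n. x n \<in> O') sequentially" by (rule topological_tendstoD[OF x assms(2) q(1)])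
  have "(\<lambda>n. P (x n)) \<longlonglongrightarrow> P q"
    by (rule continuous_on_tendsto_compose[OF assms(4) x q(1) ev])
  moreover have "eventually (\<lambda>n. P (x n) = 0) sequentially"
    using ev
  proof eventually_elim
    case (elim n)
    have "inverse (real (Suc n)) > 0" by simp
    then show ?case
      by (intro 0[OF elim]) (use q(2) in \<open>simp_all add: x_def inv(2) inner_add_left assms(5,6) q(3) add_nonneg_pos\<close>)
  qed
  then have "(\<lambda>n. P (x n)) \<longlonglongrightarrow> 0" by (rule tendsto_eventually)
  ultimately show ?thesis by (rule LIMSEQ_unique)
qed

text \<open>The direction of differentiation itself depends on \<open>q\<close>. Real linearity
  splits off the varying coefficients along b and J b, leaving derivatives in fixed directions,
  which are continuous.\<close>

lemma continuous_on_hproj_derivative: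
  fixes r :: "complex ^ 'n \<Rightarrow> real"
  assumes "open U" "Ck_on 2 r U" "\<And>q. q \<in> U \<Longrightarrow> cdiff r q b \<noteq> 0"
  shows "continuous_on U (\<lambda>q. frechet_derivative (\<lambda>q. hproj r b q v) (at q) (u + hproj r b q u *s b))"
proof -
  note h = Ck_on_hproj[OF assms]
  define D where "D q = frechet_derivative (\<lambda>q. hproj r b q v) (at q)" for q
  have D: "continuous_on U (\<lambda>q. D q w)" for w using h[of v] by (simp add: D_def)
  have hc: "continuous_on U (\<lambda>q. hproj r b q u)" by (rule Ck_on_imp_continuous_on[OF h])
  have "continuous_on U (\<lambda>q. D q u + Re (hproj r b q u) *\<^sub>R D q b + Im (hproj r b q u) *\<^sub>R D q (cJ b))"
    by (intro continuous_intros D hc)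
  moreover have "D q (u + hproj r b q u *s b) = D q u + Re (hproj r b q u) *\<^sub>R D q b + Im (hproj r b q u) *\<^sub>R D q (cJ b)"
    if "q \<in> U" for q
  proof -
    have lin: "linear (D q)" unfolding D_def by (rule has_derivative_linear[OF Ck_1_deriv[OF h that]])
    have "hproj r b q u *s b = Re (hproj r b q u) *\<^sub>R b + Im (hproj r b q u) *\<^sub>R cJ b"
      by (simp only: Complex_cvec_smult[symmetric] complex_surj)
    then show ?thesis by (simp add: linear_add[OF lin] linear_cmul[OF lin] add.assoc)
  qed
  ultimately have "continuous_on U (\<lambda>q. D q (u + hproj r b q u *s b))"
    by (subst continuous_on_cong[OF refl]) auto
  then show ?thesis by (simp only: D_def)
qed

section \<open>Choice of the directions and of the defining functions, and conclusion\<close>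

theorem theorem1p4:
  fixes M H B :: "(complex ^ 'n) set"
  assumes "submanifold real_analytic_on (DIM(complex ^ 'n) - 2) M"
    and "connected M"
    and "generic M"
    and "0 \<in> M"
    and "almost_minimal_at_origin M"
    and "Ck_hypersurface_with_boundary 2 H B"
    and "connected H"
    and "M \<subseteq> B"
  shows "\<not> levi_flat_with_boundary H B"
proof
  assume flat: "levi_flat_with_boundary H B"
  have an1: "Ck_on 1 f U" if "open U" "real_analytic_on f U" for f :: "complex ^ 'n \<Rightarrow> complex ^ 'n" and U
    using real_analytic_imp_smooth[OF that] by (simp add: smooth_on_def)
  define T where "T = tangent_space M 0"
  have T: "subspace T" "dim T = DIM(complex ^ 'n) - 2"
    unfolding T_def using submanifold_tangent_space[OF assms(1,4) an1] by blast+
  have B0: "0 \<in> B" using assms(4,8) by blast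
  obtain UH \<Phi> e f where ef: "e \<in> Basis" "f \<in> Basis" "e \<noteq> f" and UH0: "0 \<in> UH"
    and \<Phi>: "diffeo (Ck_on 2) UH UNIV \<Phi>" and imH: "\<Phi> ` (H \<inter> UH) = {x. x \<bullet> e \<ge> 0 \<and> x \<bullet> f = 0}"
    and imB: "\<Phi> ` (B \<inter> UH) = {x. x \<bullet> e = 0 \<and> x \<bullet> f = 0}"
    using bspec[OF conjunct2[OF conjunct2[OF assms(6)[unfolded Ck_hypersurface_with_boundary_def]]] B0]
    by (elim exE bexE conjE) (rule that)
  obtain \<Psi> where UH: "open UH" and hom: "homeomorphism UH UNIV \<Phi> \<Psi>" and Ck2: "Ck_on 2 \<Phi> UH" "Ck_on 2 \<Psi> UNIV"
    using \<Phi> unfolding diffeo_def by blast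
  have Ck: "Ck_on 1 \<Phi> UH" "Ck_on 1 \<Psi> UNIV"
    using Ck_on_mono[OF _ Ck2(1), of 1] Ck_on_mono[OF _ Ck2(2), of 1] by simp_all
  have inv: "\<Psi> (\<Phi> q) = q" if "q \<in> UH" for q using hom that by (simp add: homeomorphism_apply1)
  have mem: "q \<in> X \<longleftrightarrow> \<Phi> q \<in> \<Phi> ` (X \<inter> UH)" if q: "q \<in> UH" for q X
  proof
    assume "\<Phi> q \<in> \<Phi> ` (X \<inter> UH)"
    then obtain x where x: "x \<in> X" "x \<in> UH" "\<Phi> q = \<Phi> x" by auto
    have "q = x" using arg_cong[OF x(3), of \<Psi>] unfolding inv[OF q] inv[OF x(2)] .
    then show "q \<in> X" by (simp only: x(1))
  qed (use q in \<open>intro imageI IntI\<close>)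
  have memH: "q \<in> H \<longleftrightarrow> \<Phi> q \<bullet> e \<ge> 0 \<and> \<Phi> q \<bullet> f = 0" and memB: "q \<in> B \<longleftrightarrow> \<Phi> q \<bullet> e = 0 \<and> \<Phi> q \<bullet> f = 0" if "q \<in> UH" for q
    using mem[OF that, of H] mem[OF that, of B] unfolding imH imB by simp_all
  have Me: "\<Phi> q \<bullet> e = 0" and Mf: "\<Phi> q \<bullet> f = 0" if "q \<in> M" "q \<in> UH" for q
    using memB[OF that(2)] subsetD[OF assms(8) that(1)] by simp_all
  have inn: "e \<bullet> e = 1" "f \<bullet> f = 1" "e \<bullet> f = 0" "f \<bullet> e = 0" using ef by (simp_all add: inner_Basis)
  define D where "D q = frechet_derivative \<Phi> (at q)" for q
  have D: "(\<Phi> has_derivative D q) (at q)" if "q \<in> UH" for q unfolding D_def by (rule Ck_1_deriv[OF Ck(1) that])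
  have linD: "linear (D q)" if "q \<in> UH" for q by (rule has_derivative_linear[OF D[OF that]])
  define D' where "D' = frechet_derivative \<Psi> (at (\<Phi> 0))"
  have D': "(\<Psi> has_derivative D') (at (\<Phi> 0))" unfolding D'_def by (rule Ck_1_deriv[OF Ck(2)]) simp
  have DD': "D 0 (D' v) = v" for v
    by (rule homeomorphism_derivative_inverse[OF open_UNIV homeomorphism_symD[OF hom] UNIV_I D'])
       (simp add: inv[OF UH0] D[OF UH0])
  have tanD: "D q v \<bullet> e = 0" "D q v \<bullet> f = 0" if "q \<in> M" "q \<in> UH" "v \<in> tangent_space M q" for q v
    by (rule tangent_space_vanishing[OF that(3) UH that(2) has_derivative_inner_left[OF D[OF that(2)]]], use Me Mf in blast)+
  have gen: "\<exists>v w. u = v + cJ w \<and> v \<in> T \<and> w \<in> T" for u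
  proof -
    have "u \<in> {v + cJ w | v w. v \<in> T \<and> w \<in> T}" using assms(3,4) by (simp add: generic_def T_def)
    then show ?thesis by blast
  qed
  \<comment> \<open>\<open>D' f\<close> and \<open>D' e\<close> are the two normal directions of the
    boundary chart. Genericity writes each as a tangent vector of \<open>M\<close> plus J of another
    one, \<open>w1\<close> or \<open>w2\<close>; normalised, these become \<open>b\<close> and
    \<open>a\<close>.\<close>
  obtain v1 w1 where w1: "D' f = v1 + cJ w1" "v1 \<in> T" "w1 \<in> T" using gen by blast
  obtain v2 w2 where w2: "D' e = v2 + cJ w2" "v2 \<in> T" "w2 \<in> T" using gen by blast
  note T0 = tanD[OF assms(4) UH0, folded T_def]
  note lin0 = linear_add[OF linD[OF UH0]] linear_cmul[OF linD[OF UH0]] linear_0[OF linD[OF UH0]]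
  have "D 0 (v1 + cJ w1) = f" "D 0 (v2 + cJ w2) = e" using DD' w1(1) w2(1) by metis+
  then have eqs: "D 0 (cJ w1) = f - D 0 v1" "D 0 (cJ w2) = e - D 0 v2" by (simp_all add: lin0 algebra_simps)
  have Dw: "D 0 (cJ w1) \<bullet> e = 0" "D 0 (cJ w1) \<bullet> f = 1" "D 0 (cJ w2) \<bullet> e = 1" "D 0 (cJ w2) \<bullet> f = 0"
    unfolding eqs by (simp_all add: inner_diff_left T0 w1 w2 inn)
  have w0: "w1 \<noteq> 0" "w2 \<noteq> 0" using Dw(2,3) by (auto simp: linear_0[OF linear_cJ] lin0)
  define a where "a = (1 / norm w2) *\<^sub>R w2"
  define b where "b = (1 / norm w1) *\<^sub>R w1"
  \<comment> \<open>The factors here and in \<rho> undo the normalisation of \<open>b\<close> and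
    \<open>a\<close>, so that r has slope exactly 1 along J b, and \<rho> along J a, at 0.\<close>
  define r where "r q = \<Phi> q \<bullet> (norm w1 *\<^sub>R f)" for q
  define \<rho> where "\<rho> q = \<Phi> q \<bullet> (norm w2 *\<^sub>R e)" for q
  define l where "l v = D 0 v \<bullet> (norm w2 *\<^sub>R e)" for v
  define m where "m v = D 0 v \<bullet> (norm w1 *\<^sub>R f)" for v
  have nab: "norm a = 1" "norm b = 1" using w0 by (simp_all add: a_def b_def)
  have abT: "a \<in> T" "b \<in> T" unfolding a_def b_def using w1 w2 T(1) by (simp_all add: subspace_scale)
  have la: "l a = 0" "l b = 0" "l (cJ a) = 1" "l (cJ b) = 0" and ma: "m a = 0" "m b = 0" "m (cJ a) = 0" "m (cJ b) = 1"
    using w0 by (simp_all add: l_def m_def a_def b_def linear_cmul[OF linear_cJ] lin0 T0 w1 w2 Dw)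
  have rd: "frechet_derivative r (at q) v = D q v \<bullet> (norm w1 *\<^sub>R f)" and rder: "(r has_derivative frechet_derivative r (at q)) (at q)"
    if "q \<in> UH" for q v
  proof -
    have d: "(r has_derivative (\<lambda>v. D q v \<bullet> (norm w1 *\<^sub>R f))) (at q)"
      unfolding r_def by (rule has_derivative_inner_left[OF D[OF that]])
    note e = frechet_derivative_at[OF d]
    show "frechet_derivative r (at q) v = D q v \<bullet> (norm w1 *\<^sub>R f)" using fun_cong[OF e, of v] by simp
    show "(r has_derivative frechet_derivative r (at q)) (at q)" using d unfolding e .
  qed
  have \<rho>der: "(\<rho> has_derivative l) (at 0)"
    unfolding \<rho>_def l_def by (rule has_derivative_inner_left[OF D[OF UH0]])
  have rm: "frechet_derivative r (at 0) = m" unfolding m_def using rd[OF UH0] by blast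
  have \<rho>l: "frechet_derivative \<rho> (at 0) = l" using frechet_derivative_at[OF \<rho>der] by simp
  have linl: "linear l" by (rule has_derivative_linear[OF \<rho>der])
  have linm: "linear m" using has_derivative_linear[OF rder[OF UH0]] unfolding rm .
  have r2: "Ck_on 2 r UH" unfolding r_def by (rule Ck_on_bounded_linear[OF UH bounded_linear_inner_left Ck2(1)])
  have r1: "Ck_on 1 r UH" unfolding r_def by (rule Ck_on_bounded_linear[OF UH bounded_linear_inner_left Ck(1)])
  have \<rho>1: "Ck_on 1 \<rho> UH" unfolding \<rho>_def by (rule Ck_on_bounded_linear[OF UH bounded_linear_inner_left Ck(1)])
  \<comment> \<open>The region where \<open>b\<close> is transverse to the complex hyperplanes; at 0
    the value of \<open>cdiff r 0 b\<close> is -i.\<close>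
  define O1 where "O1 = UH \<inter> (\<lambda>q. cdiff r q b) -` (- {0})"
  have O1: "open O1" unfolding O1_def
    by (rule continuous_open_preimage[OF Ck_on_imp_continuous_on[OF Ck_on_cdiff[OF UH r2]] UH]) auto
  have O1UH: "O1 \<subseteq> UH" and ne: "\<And>q. q \<in> O1 \<Longrightarrow> cdiff r q b \<noteq> 0" by (auto simp: O1_def)
  have c0: "cdiff r 0 a = 0" "cdiff r 0 b \<noteq> 0" unfolding cdiff_def rm by (simp_all add: ma complex_eq_iff)
  have O10: "0 \<in> O1" using c0(2) UH0 by (simp add: O1_def)
  have r2': "Ck_on 2 r O1" by (rule Ck_on_subset[OF r2 O1UH])
  obtain k where k: "\<And>v. \<bar>l v\<bar> \<le> norm v * k" "k \<ge> 0"
    using bounded_linear.nonneg_bounded[OF has_derivative_bounded_linear[OF \<rho>der]] by auto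
  define C1 where "C1 = k + 1"
  have C1: "C1 \<ge> 1" using k(2) by (simp add: C1_def)
  have lb: "\<bar>l v\<bar> \<le> C1 * norm v" for v
    using k(1)[of v] norm_ge_zero[of v] unfolding C1_def distrib_right mult.commute[of k] by linarith
  define \<epsilon> where "\<epsilon> = 1 / (100 * C1)"
  have \<epsilon>: "\<epsilon> > 0" "\<epsilon> * C1 \<le> 1 / 100" using C1 by (simp_all add: \<epsilon>_def)
  \<comment> \<open>Source of \<open>B_a\<close>: at 0 the vector \<open>a\<close> lies in the
    hyperplane, so its coefficient vanishes there and is at most \<epsilon> nearby.\<close>
  have "continuous_on O1 (\<lambda>q. hproj r b q a)" by (rule Ck_on_imp_continuous_on[OF Ck_on_hproj[OF O1 r2' ne]])
  then have "isCont (\<lambda>q. hproj r b q a) 0" using O1 O10 by (simp add: continuous_on_eq_continuous_at)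
  then obtain d0 where d0: "d0 > 0" "\<And>q. dist q 0 < d0 \<Longrightarrow> dist (hproj r b q a) (hproj r b 0 a) < \<epsilon>"
    using \<epsilon>(1) unfolding continuous_at_eps_delta by blast
  obtain d1 where d1: "d1 > 0" "ball 0 d1 \<subseteq> O1" using O1 O10 open_contains_ball by blast
  obtain d2 where d2: "d2 > 0" "\<And>x y. x \<in> ball 0 d2 \<Longrightarrow> y \<in> ball 0 d2 \<Longrightarrow>
       norm (\<rho> y - \<rho> x - frechet_derivative \<rho> (at 0) (y - x)) \<le> \<epsilon> * norm (y - x)"
    by (rule Ck_1_strict[OF UH UH0 \<rho>1 \<epsilon>(1)]) blast
  \<comment> \<open>Any tolerance below 1 gives \<open>r_ib\<close>, since \<open>r\<close> has
    slope 1 in the direction i b at 0.\<close>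
  have "(1/2 :: real) > 0" by simp
  obtain d3 where d3: "d3 > 0" "\<And>x y. x \<in> ball 0 d3 \<Longrightarrow> y \<in> ball 0 d3 \<Longrightarrow>
       norm (r y - r x - frechet_derivative r (at 0) (y - x)) \<le> 1/2 * norm (y - x)"
    by (rule Ck_1_strict[OF UH UH0 r1 \<open>(1/2 :: real) > 0\<close>]) blast
  define R where "R = min (min d0 d1) (min d2 d3) / 2"
  have R: "R > 0" "R < d0" "R < d1" "R < d2" "R < d3" using d0(1) d1(1) d2(1) d3(1) by (auto simp: R_def)
  have cR: "cball 0 R \<subseteq> O1" using d1(2) R(3) by (auto simp: subset_iff)
  have bR: "q \<in> O1" "q \<in> UH" if "q \<in> ball 0 R" for q
    using that cR O1UH by (auto simp: subset_iff)
  define BB where "BB = hproj r b"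
  define DB where "DB q u v = frechet_derivative (\<lambda>q. hproj r b q v) (at q) u" for q u v
  obtain C K where C: "C \<ge> 1" and K: "K \<ge> 0"
    and Bb: "\<And>q v. q \<in> ball 0 R \<Longrightarrow> cmod (hproj r b q v) \<le> C * norm v"
    and Bl: "\<And>q q' v. q \<in> ball 0 R \<Longrightarrow> q' \<in> ball 0 R \<Longrightarrow> cmod (hproj r b q v - hproj r b q' v) \<le> K * norm (q - q') * norm v"
    and Bd: "\<And>q v. q \<in> ball 0 R \<Longrightarrow> ((\<lambda>q. hproj r b q v) has_derivative (\<lambda>u. frechet_derivative (\<lambda>q. hproj r b q v) (at q) u)) (at q)"
    and Bu: "\<And>v e. e > 0 \<Longrightarrow> \<exists>d>0. \<forall>q\<in>ball 0 R. \<forall>q'\<in>ball 0 R. dist q q' < d \<longrightarrow>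
        cmod (hproj r b q' v - hproj r b q v - frechet_derivative (\<lambda>q. hproj r b q v) (at q) (q' - q)) \<le> e * norm (q' - q)"
  proof (rule hproj_field[OF O1 r2' ne cR], goal_cases)
    case (2 C K)
    show thesis by (rule 2(1)[OF 2(2-)])
  qed
  have integ: "DB q (u + BB q u *s b) v - DB q (v + BB q v *s b) u = 0" if q: "q \<in> ball 0 R" "r q = 0" "\<rho> q \<ge> 0" for q u v
  proof (rule vanishing_at_boundary[OF hom open_ball[of 0 R] _ _ inn(1,3), where P="\<lambda>q. DB q (u + BB q u *s b) v - DB q (v + BB q v *s b) u"])
    show "ball 0 R \<subseteq> UH" using bR(2) by blast
    have r2R: "Ck_on 2 r (ball 0 R)" by (rule Ck_on_subset[OF r2']) (use bR in blast)
    show "continuous_on (ball 0 R) (\<lambda>q. DB q (u + BB q u *s b) v - DB q (v + BB q v *s b) u)"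
      unfolding DB_def BB_def
      by (rule continuous_on_diff; rule continuous_on_hproj_derivative[OF open_ball r2R ne[OF bR(1)]])
    fix q assume q: "q \<in> ball 0 R" "\<Phi> q \<bullet> e > 0" "\<Phi> q \<bullet> f = 0"
    have tan: "tangent_space (H - B) x = {v. frechet_derivative r (at x) v = 0}" if "x \<in> ball 0 R \<inter> (H - B)" for x
    proof -
      have x: "x \<in> UH" "\<Phi> x \<bullet> e > 0" "\<Phi> x \<bullet> f = 0" using that bR(2)[of x] memH[of x] memB[of x] by auto
      have "tangent_space (H - B) x = {v. frechet_derivative \<Phi> (at x) v \<bullet> f = 0}"
        by (rule interior_tangent_space[OF UH hom Ck _ _ x]) (auto simp: memH memB)
      then show ?thesis using w0 by (simp add: rd[OF x(1)] D_def)
    qed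
    have "q \<in> ball 0 R \<inter> (H - B)" using q bR(2)[OF q(1)] memH[of q] memB[of q] by auto
    from levi_flat_integrable[OF flat[unfolded levi_flat_with_boundary_def] open_ball r2R ne[OF bR(1)] tan this]
    show "DB q (u + BB q u *s b) v - DB q (v + BB q v *s b) u = 0" unfolding DB_def BB_def by simp
  qed (use q w0 in \<open>auto simp: r_def \<rho>_def zero_le_mult_iff\<close>)
  have Teq: "T = {v. l v = 0 \<and> m v = 0}"
  proof (rule joint_kernel_eq[OF linl linm T, of "cJ a" "cJ b"])
    show "l v = 0 \<and> m v = 0" if "v \<in> T" for v using T0[OF that] by (simp add: l_def m_def)
  qed (simp_all add: la ma)
  obtain \<phi> :: "complex ^ 'n \<Rightarrow> complex ^ 'n" and U1 z1 z2 where U1: "open U1" "0 \<in> U1" and \<phi>: "real_analytic_on \<phi> U1"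
    and memM: "\<And>q. q \<in> U1 \<Longrightarrow> q \<in> M \<longleftrightarrow> \<phi> q \<bullet> z1 = 0 \<and> \<phi> q \<bullet> z2 = 0"
    and zd: "((\<lambda>q. \<phi> q \<bullet> z1) has_derivative l) (at 0)" "((\<lambda>q. \<phi> q \<bullet> z2) has_derivative m) (at 0)"
  proof (rule submanifold_equations[OF assms(1,4) an1 linl linm Teq[unfolded T_def]], goal_cases)
    case (3 \<phi> U w1 w2)
    show thesis by (rule 3(1)[of U \<phi> w1 w2, OF 3(2-)])
  qed auto
  obtain RA FA where FA: "RA > 0" "holomorphic_fun_on FA (ball 0 RA)"
    "\<And>y. norm y < RA \<Longrightarrow> FA (cplx_embed y) = of_real (\<phi> (0 + y) \<bullet> z1)"
    using real_analytic_complexify[OF \<phi> U1(2)] by blast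
  obtain RB FB where FB: "RB > 0" "holomorphic_fun_on FB (ball 0 RB)"
    "\<And>y. norm y < RB \<Longrightarrow> FB (cplx_embed y) = of_real (\<phi> (0 + y) \<bullet> z2)"
    using real_analytic_complexify[OF \<phi> U1(2)] by blast
  obtain d4 where d4: "d4 > 0" "ball 0 d4 \<subseteq> U1" using U1 open_contains_ball by blast
  define R0 where "R0 = min d4 (min RA RB)"
  have R0: "R0 > 0" "R0 \<le> d4" "R0 \<le> RA" "R0 \<le> RB" using d4(1) FA(1) FB(1) by (auto simp: R0_def)
  have hAB: "holomorphic_fun_on FA (ball 0 R0)" "holomorphic_fun_on FB (ball 0 R0)"
    using holomorphic_fun_on_subset[OF FA(2)] holomorphic_fun_on_subset[OF FB(2)] R0 by (meson subset_ball)+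
  have eAB: "FA (cplx_embed y) = of_real (\<phi> y \<bullet> z1)" "FB (cplx_embed y) = of_real (\<phi> y \<bullet> z2)" if "norm y < R0" for y
    using FA(3)[of y] FB(3)[of y] that R0 by auto
  have z0: "\<phi> 0 \<bullet> z1 = 0" "\<phi> 0 \<bullet> z2 = 0" using memM[OF U1(2)] assms(4) by auto
  obtain R' CF F where R': "R' > 0" and CF: "CF \<ge> 0"
    and Fl: "\<And>q x1 x2 y x1' x2' y'. q \<in> ball 0 R' \<Longrightarrow> cmod x1 < R' \<Longrightarrow> cmod x2 < R' \<Longrightarrow> norm y < R' \<Longrightarrow>
        cmod x1' < R' \<Longrightarrow> cmod x2' < R' \<Longrightarrow> norm y' < R' \<Longrightarrow>
        norm (F q x1 x2 y - F q x1' x2' y' - (y - y')) \<le> \<epsilon> * (cmod (x1 - x1') + cmod (x2 - x2') + norm (y - y'))"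
    and F0: "\<And>q. q \<in> ball 0 R' \<Longrightarrow> norm (F q 0 0 0) \<le> CF * norm q"
    and Fr: "\<And>q x1 x2 y1 y2. q \<in> ball 0 R' \<Longrightarrow> \<bar>x1\<bar> < R' \<Longrightarrow> \<bar>x2\<bar> < R' \<Longrightarrow> \<bar>y1\<bar> < R' \<Longrightarrow> \<bar>y2\<bar> < R' \<Longrightarrow>
        norm (q + Complex x1 y1 *s a + Complex x2 y2 *s b) < R0 \<and>
        F q (of_real x1) (of_real x2) (of_real y1, of_real y2) =
          (of_real (\<phi> (q + Complex x1 y1 *s a + Complex x2 y2 *s b) \<bullet> z1), of_real (\<phi> (q + Complex x1 y1 *s a + Complex x2 y2 *s b) \<bullet> z2))"
    and Fh: "\<And>q S h1 h2 g. q \<in> ball 0 R' \<Longrightarrow> h1 holomorphic_on S \<Longrightarrow> h2 holomorphic_on S \<Longrightarrow>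
        (\<lambda>\<zeta>. fst (g \<zeta>)) holomorphic_on S \<Longrightarrow> (\<lambda>\<zeta>. snd (g \<zeta>)) holomorphic_on S \<Longrightarrow> open S \<Longrightarrow>
        (\<And>\<zeta>. \<zeta> \<in> S \<Longrightarrow> cmod (h1 \<zeta>) < R' \<and> cmod (h2 \<zeta>) < R' \<and> norm (g \<zeta>) < R') \<Longrightarrow>
        (\<lambda>\<zeta>. fst (F q (h1 \<zeta>) (h2 \<zeta>) (g \<zeta>))) holomorphic_on S \<and> (\<lambda>\<zeta>. snd (F q (h1 \<zeta>) (h2 \<zeta>) (g \<zeta>))) holomorphic_on S"
  proof (rule complexified_equations[OF R0(1) hAB eAB z0 zd la(1,2,3,4) ma nab \<epsilon>(1)], goal_cases)
    case (3 R' CF F)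
    show thesis by (rule 3(1)[of R' CF F, OF 3(2-)])
  qed simp_all
  have rdiff: "r differentiable (at q)" if "q \<in> UH" for q using rder[OF that] by (auto simp: differentiable_def)
  have iJ: "\<i> *s v = cJ v" for v by (simp add: cJ_def)
  interpret leaf_extension b BB DB r \<rho> "\<lambda>q. frechet_derivative r (at q)" R C K a l C1 \<epsilon> M R' CF F
  proof unfold_locales
    fix q :: "complex ^ 'n" assume q: "q \<in> ball 0 R"
    note d = rdiff[OF bR(2)[OF q]] and n = ne[OF bR(1)[OF q]]
    show "BB q (u + v) = BB q u + BB q v" "BB q (c *s v) = c * BB q v" for u v c
      unfolding BB_def by (rule hproj_linear[OF d])+
    show "BB q b = -1" using n by (simp add: BB_def hproj_def)
    show "frechet_derivative r (at q) (v + BB q v *s b) = 0" for v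
      unfolding BB_def Re_cdiff[symmetric] by (simp only: hproj_tangent[OF d n] zero_complex.sel)
    show "(r has_derivative frechet_derivative r (at q)) (at q)" by (rule rder[OF bR(2)[OF q]])
    show "cmod (BB q a) \<le> \<epsilon>"
      using d0(2)[of q] q R(2) c0(1) by (simp add: BB_def hproj_def dist_norm)
  next
    show "DB q (u + BB q u *s b) v = DB q (v + BB q v *s b) u" if "q \<in> ball 0 R" "r q = 0" "\<rho> q \<ge> 0" for q u v
      using integ[OF that, of u v] by simp
    show "\<bar>\<rho> q - \<rho> q' - l (q - q')\<bar> \<le> \<epsilon> * norm (q - q')" if "q \<in> ball 0 R" "q' \<in> ball 0 R" for q q'
      using d2(2)[of q' q] that R(4) unfolding \<rho>l by simp
  next
    fix q y assume q: "q \<in> ball 0 R" "q + (\<i> * of_real y) *s b \<in> ball 0 R" "r q = 0" "r (q + (\<i> * of_real y) *s b) = 0"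
    have eq: "(\<i> * of_real y) *s b = y *\<^sub>R cJ b"
      by (simp add: cJ_def vec_eq_iff scaleR_conv_of_real[where 'a=complex])
    have "norm (r (q + y *\<^sub>R cJ b) - r q - m (q + y *\<^sub>R cJ b - q)) \<le> 1/2 * norm (q + y *\<^sub>R cJ b - q)"
      using d3(2)[of q "q + y *\<^sub>R cJ b"] q(1,2) R(5) unfolding rm eq by simp
    then show "y = 0" using q(3,4) nab by (simp add: eq linear_cmul[OF linm] ma norm_cJ)
  next
    fix q :: "complex ^ 'n" and x1 x2 y1 y2 :: real
    assume q: "q \<in> ball 0 R'" "\<bar>x1\<bar> < R'" "\<bar>x2\<bar> < R'" "\<bar>y1\<bar> < R'" "\<bar>y2\<bar> < R'"
    have "q + Complex x1 y1 *s a + Complex x2 y2 *s b \<in> U1"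
      using Fr[OF q] R0(2) by (intro subsetD[OF d4(2)]) simp
    then show "fst (F q (of_real x1) (of_real x2) (of_real y1, of_real y2)) \<in> \<real> \<and>
        snd (F q (of_real x1) (of_real x2) (of_real y1, of_real y2)) \<in> \<real> \<and>
        (F q (of_real x1) (of_real x2) (of_real y1, of_real y2) = 0 \<longleftrightarrow> q + Complex x1 y1 *s a + Complex x2 y2 *s b \<in> M)"
      using Fr[OF q] memM by (simp add: prod_eq_iff)
  next
    show "r x = 0 \<and> \<rho> x = 0" if "x \<in> M" "x \<in> ball 0 R" for x
      using Me[OF that(1) bR(2)[OF that(2)]] Mf[OF that(1) bR(2)[OF that(2)]] by (simp add: r_def \<rho>_def)
    show "((\<lambda>q. BB q v) has_derivative (\<lambda>u. DB q u v)) (at q)" if "q \<in> ball 0 R" for q v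
      unfolding BB_def DB_def by (rule Bd[OF that])
    show "\<exists>d>0. \<forall>q\<in>ball 0 R. \<forall>q'\<in>ball 0 R. dist q q' < d \<longrightarrow>
        cmod (BB q' v - BB q v - DB q (q' - q) v) \<le> e * norm (q' - q)" if "e > 0" for v e
      unfolding BB_def DB_def by (rule Bu[OF that])
    show "l (\<i> *s a) = 1" by (simp add: iJ la)
  qed (use R(1) C K nab \<epsilon> C1 lb linl R' CF in \<open>simp_all add: BB_def Bb Bl Fl F0 Fh linear_add[OF linl] linear_cmul[OF linl]\<close>)
  have "\<not> almost_minimal_at_origin M"
  proof (rule not_almost_minimal[OF assms(1,3,4)])
    show "frechet_derivative r (at x) v = 0" if "x \<in> M" "x \<in> ball 0 R" "v \<in> tangent_space M x" for x v
      using tanD(2)[OF that(1) bR(2)[OF that(2)] that(3)] by (simp add: rd[OF bR(2)[OF that(2)]])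
    show "BB q v = 0" if "frechet_derivative r (at q) v = 0" "frechet_derivative r (at q) (cJ v) = 0" for q v
    proof -
      have "cdiff r q v = 0" using that by (simp add: cdiff_def complex_eq_iff)
      then show ?thesis by (simp add: BB_def hproj_def)
    qed
    show "b \<in> tangent_space M 0" using abT(2) by (simp add: T_def)
  qed
  then show False using assms(5) by contradiction
qed

end
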